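(* Let $k$ be an algebraically closed field with $\operatorname{char}(k)\ne2$, let $A=A(\alpha,\beta,\gamma)$ be a 4-dimensional Sklyanin algebra over $k$ with associated elliptic curve $E$ and automorphism $\sigma$ of infinite order, and let $B^{G,\mu}$ be the cocycle twist of $B=A/(\Omega_1,\Omega_2)$ described in the context. Any irreducible object in $\mathrm{qgr}(B^{G,\mu})$ is isomorphic to $\pi(M_p^2)$ for some $p\in E$, where $M_p^2$ is a direct sum of two copies of the point module $M_p$ over $B$, regarded as a $B^{G,\mu}$-module. In particular, such modules $M_p^2$ are 1-critical and are therefore fat point modules of multiplicity 2 over $B^{G,\mu}$.
   Context: $\mathrm{qgr}(R)$ is the quotient of the category of finitely generated $\mathbb{N}$-graded right $R$-modules by the finite-dimensional ones, and $\pi$ is the quotient functor. Point module: cyclic $\mathbb{N}$-graded right module with Hilbert series $1/(1-t)$. A finitely generated graded module $M$ is 1-critical if $\operatorname{GKdim}M=1$ and $\operatorname{GKdim}(M/N)<1$ for every nonzero graded submodule $N$. Fat point module of multiplicity $e$: $\mathbb{N}$-graded right module with Hilbert series $e/(1-t)$, generated in degree 0, all of whose nonzero graded submodules have finite codimension. Algebra $A$: with $[x,y]=xy-yx$, $[x,y]_+=xy+yx$ and parameters satisfying $\alpha+\beta+\gamma+\alpha\beta\gamma=0$, $\{\alpha,\beta,\gamma\}\cap\{0,\pm1\}=\emptyset$, $A$ is generated by $x_0,\dots,x_3$ (degree 1) with relations $[x_0,x_1]-\alpha[x_2,x_3]_+$, $[x_0,x_1]_+-[x_2,x_3]$, $[x_0,x_2]-\beta[x_3,x_1]_+$,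 $[x_0,x_2]_+-[x_3,x_1]$, $[x_0,x_3]-\gamma[x_1,x_2]_+$, $[x_0,x_3]_+-[x_1,x_2]$. $E\subset\mathbb{P}^3_k$ is $y_0^2+y_1^2+y_2^2+y_3^2=0$, $y_3^2+\frac{1-\gamma}{1+\alpha}y_1^2+\frac{1+\gamma}{1-\beta}y_2^2=0$. $B=A/(\Omega_1,\Omega_2)$ with $\Omega_1=-x_0^2+x_1^2+x_2^2+x_3^2$, $\Omega_2=x_1^2+\frac{1+\alpha}{1-\beta}x_2^2+\frac{1-\alpha}{1+\gamma}x_3^2$; the point modules over $B$ are parameterised by $E$, $M_p$ being the point module with $m_0x_i=p_im_1$ for $p=(p_0,p_1,p_2,p_3)\in E$, and $\sigma$ is the translation of $E$ with $M_p[1]_{\ge0}\cong M_{\sigma(p)}$. $G=\langle g_1,g_2\rangle\cong(C_2)^2$ acts on $B$ by $x_0^{g_1}=x_0$, $x_1^{g_1}=x_1$, $x_2^{g_1}=-x_2$, $x_3^{g_1}=-x_3$, $x_i^{g_2}=(-1)^ix_i$, inducing a $G$-grading with $x_0,x_1,x_2,x_3$ in degrees $e,g_1,g_2,g_1g_2$; with $\mu(g_1^pg_2^q,g_1^rg_2^s)=(-1)^{ps}$, $B^{G,\mu}$ is $B$ with multiplication $a\ast_\mu b=\mu(g,h)ab$ for $a\in B_g,b\in B_h$. It embeds in $M_2(B)$ with generators (corresponding to $x_0,\dots,x_3$) $$\begin{pmatrix} x_0 & 0 \\ 0 & x_0 \end{pmatrix},\ \begin{pmatrix} x_1 & 0 \\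 0 & -x_1 \end{pmatrix},\ \begin{pmatrix} 0 & x_2 \\ x_2 & 0 \end{pmatrix},\ \begin{pmatrix} 0 & -x_3 \\ x_3 & 0 \end{pmatrix}.$$ $M_p^2$ (row vectors) is a right $M_2(B)$-module and is restricted to $B^{G,\mu}$. *)

theory Defs
  imports
    "Jordan_Normal_Form.VS_Connect"
    "HOL-Computational_Algebra.Computational_Algebra"
    "HOL-Algebra.QuotRing"
    "HOL-Library.Extended_Real"
    "HOL-Library.Liminf_Limsup"
    "HOL-Library.Z2"
begin

hide_const (open) Multiset.mult Polynomial.smult Modules.module

section \<open>Graded algebras and graded right modules\<close>

text \<open>
  The ground field enters as \<open>class_ring\<close>. Algebras are not assumed commutative, so they use the
  fields of the record \<open>module\<close> (which contain a ring multiplication) but not the locale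
  \<open>algebra\<close>. For modules, the ring multiplication and the unit in this record are junk.
\<close>

record ('k, 'm) graded_space = "('k, 'm) module" +
  piece :: "nat \<Rightarrow> 'm set"

record ('k, 'm, 'a) graded_rmodule = "('k, 'm) graded_space" +
  act :: "'m \<Rightarrow> 'a \<Rightarrow> 'm"

definition homog_decomp ::
  "('k::field, 'm, 'z) graded_space_scheme \<Rightarrow> (nat \<Rightarrow> 'm) \<Rightarrow> 'm \<Rightarrow> bool" where
  "homog_decomp V c v \<longleftrightarrow>
     (\<forall>n. c n \<in> piece V n) \<and> finite {n. c n \<noteq> \<zero>\<^bsub>V\<^esub>} \<and> v = finsum V c {n. c n \<noteq> \<zero>\<^bsub>V\<^esub>}"

definition graded_vector_space :: "('k::field, 'm, 'z) graded_space_scheme \<Rightarrow> bool" where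
  "graded_vector_space V \<longleftrightarrow>
     vectorspace class_ring V \<and>
     (\<forall>n. submodule class_ring (piece V n) V) \<and>
     (\<forall>v \<in> carrier V. \<exists>!c. homog_decomp V c v)"

definition graded_module ::
  "('k::field, 'a, 'y) graded_space_scheme \<Rightarrow> ('k, 'm, 'a, 'z) graded_rmodule_scheme \<Rightarrow> bool" where
  "graded_module R M \<longleftrightarrow>
     graded_vector_space M \<and>
     (\<forall>m \<in> carrier M. \<forall>r \<in> carrier R. act M m r \<in> carrier M) \<and>
     (\<forall>m \<in> carrier M. \<forall>m' \<in> carrier M. \<forall>r \<in> carrier R.
        act M (m \<oplus>\<^bsub>M\<^esub> m') r = act M m r \<oplus>\<^bsub>M\<^esub> act M m' r) \<and>
     (\<forall>m \<in> carrier M. \<forall>r \<in> carrier R. \<forall>s \<in> carrier R.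
        act M m (r \<oplus>\<^bsub>R\<^esub> s) = act M m r \<oplus>\<^bsub>M\<^esub> act M m s \<and>
        act M m (r \<otimes>\<^bsub>R\<^esub> s) = act M (act M m r) s) \<and>
     (\<forall>m \<in> carrier M. act M m \<one>\<^bsub>R\<^esub> = m) \<and>
     (\<forall>c. \<forall>m \<in> carrier M. \<forall>r \<in> carrier R.
        act M (c \<odot>\<^bsub>M\<^esub> m) r = c \<odot>\<^bsub>M\<^esub> act M m r \<and> act M m (c \<odot>\<^bsub>R\<^esub> r) = c \<odot>\<^bsub>M\<^esub> act M m r) \<and>
     (\<forall>i j. \<forall>m \<in> piece M i. \<forall>r \<in> piece R j. act M m r \<in> piece M (i + j))"

definition right_submodule ::
  "('k::field, 'a, 'y) graded_space_scheme \<Rightarrow> ('k, 'm, 'a, 'z) graded_rmodule_scheme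
   \<Rightarrow> 'm set \<Rightarrow> bool" where
  "right_submodule R M N \<longleftrightarrow>
     submodule class_ring N M \<and> (\<forall>m \<in> N. \<forall>r \<in> carrier R. act M m r \<in> N)"

definition graded_submodule ::
  "('k::field, 'a, 'y) graded_space_scheme \<Rightarrow> ('k, 'm, 'a, 'z) graded_rmodule_scheme
   \<Rightarrow> 'm set \<Rightarrow> bool" where
  "graded_submodule R M N \<longleftrightarrow>
     right_submodule R M N \<and> (\<forall>m \<in> N. \<exists>c. homog_decomp M c m \<and> (\<forall>n. c n \<in> N))"

definition sub_module ::
  "('k, 'm, 'a) graded_rmodule \<Rightarrow> 'm set \<Rightarrow> ('k, 'm, 'a) graded_rmodule" where
  "sub_module M N = M \<lparr>carrier := N, piece := (\<lambda>n. piece M n \<inter> N)\<rparr>"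

definition quot_module ::
  "('k, 'm, 'a) graded_rmodule \<Rightarrow> 'm set \<Rightarrow> ('k, 'm set, 'a) graded_rmodule" where
  "quot_module M N =
     \<lparr>carrier = a_rcosets\<^bsub>M\<^esub> N, mult = undefined, one = undefined, zero = N, add = set_add M,
      smult = (\<lambda>c X. \<Union>x\<in>X. N +>\<^bsub>M\<^esub> (c \<odot>\<^bsub>M\<^esub> x)),
      piece = (\<lambda>n. (\<lambda>x. N +>\<^bsub>M\<^esub> x) ` piece M n),
      act = (\<lambda>X r. \<Union>x\<in>X. N +>\<^bsub>M\<^esub> act M x r)\<rparr>"

definition quot_algebra ::
  "('k, 'a) graded_space \<Rightarrow> 'a set \<Rightarrow> ('k, 'a set) graded_space" where
  "quot_algebra R I =
     \<lparr>carrier = carrier (R Quot I), mult = mult (R Quot I), one = one (R Quot I),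
      zero = zero (R Quot I), add = add (R Quot I),
      smult = (\<lambda>c X. \<Union>x\<in>X. I +>\<^bsub>R\<^esub> (c \<odot>\<^bsub>R\<^esub> x)),
      piece = (\<lambda>n. (\<lambda>x. I +>\<^bsub>R\<^esub> x) ` piece R n)\<rparr>"

definition generates ::
  "('k::field, 'a, 'y) graded_space_scheme \<Rightarrow> ('k, 'm, 'a, 'z) graded_rmodule_scheme
   \<Rightarrow> 'm set \<Rightarrow> bool" where
  "generates R M S \<longleftrightarrow>
     S \<subseteq> carrier M \<and> (\<forall>N. right_submodule R M N \<and> S \<subseteq> N \<longrightarrow> N = carrier M)"

definition finitely_generated ::
  "('k::field, 'a, 'y) graded_space_scheme \<Rightarrow> ('k, 'm, 'a, 'z) graded_rmodule_scheme \<Rightarrow> bool" where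
  "finitely_generated R M \<longleftrightarrow> (\<exists>S. finite S \<and> generates R M S)"

definition graded_hom ::
  "('k::field, 'a) graded_space \<Rightarrow> ('k, 'm, 'a) graded_rmodule \<Rightarrow> ('k, 'n, 'a) graded_rmodule
   \<Rightarrow> ('m \<Rightarrow> 'n) set" where
  "graded_hom R M N =
     {f \<in> LinearCombinations.module_hom class_ring M N.
        (\<forall>m \<in> carrier M. \<forall>r \<in> carrier R. f (act M m r) = act N (f m) r) \<and>
        (\<forall>n. f ` piece M n \<subseteq> piece N n)}"

definition graded_isomorphic ::
  "('k::field, 'a) graded_space \<Rightarrow> ('k, 'm, 'a) graded_rmodule \<Rightarrow> ('k, 'n, 'a) graded_rmodule
   \<Rightarrow> bool" where
  "graded_isomorphic R M N \<longleftrightarrow> (\<exists>f \<in> graded_hom R M N. bij_betw f (carrier M) (carrier N))"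

text \<open>\<open>truncated_shift M\<close> is the module $M[1]_{\ge 0}$, where $M[1]_n = M_{n+1}$.\<close>

definition truncated_shift ::
  "('k::field, 'm, 'a) graded_rmodule \<Rightarrow> ('k, 'm, 'a) graded_rmodule" where
  "truncated_shift M =
     M \<lparr>carrier := {m \<in> carrier M. \<exists>c. homog_decomp M c m \<and> c 0 = \<zero>\<^bsub>M\<^esub>},
        piece := (\<lambda>n. piece M (Suc n))\<rparr>"

abbreviation fin_dim :: "('k::field, 'm, 'z) module_scheme \<Rightarrow> bool" where
  "fin_dim V \<equiv> vectorspace.fin_dim class_ring V"

abbreviation dimension :: "('k::field, 'm, 'z) module_scheme \<Rightarrow> nat" where
  "dimension V \<equiv> vectorspace.dim class_ring V"


section \<open>The quotient category qgr\<close>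

definition qgr_object ::
  "('k::field, 'a) graded_space \<Rightarrow> ('k, 'm, 'a) graded_rmodule \<Rightarrow> bool" where
  "qgr_object R M \<longleftrightarrow> graded_module R M \<and> finitely_generated R M"

text \<open>
  $\mathrm{Hom}(\pi M, \pi N)$ is the direct limit of the spaces $\mathrm{Hom}(M', N/N')$ of graded
  homomorphisms of degree 0, over the graded submodules $M' \subseteq M$ of finite codimension and
  the finite-dimensional graded submodules $N' \subseteq N$. A morphism is represented by a triple
  $(M', N', f)$; two triples represent the same morphism when they become equal for some smaller
  $M'$ and larger $N'$. The morphisms of the category are the classes of triples modulo \<open>qgr_eq\<close>.
\<close>

type_synonym ('m, 'n) qgr_rep = "'m set \<times> 'n set \<times> ('m \<Rightarrow> 'n set)"

definition cofinite_sub ::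
  "('k::field, 'a) graded_space \<Rightarrow> ('k, 'm, 'a) graded_rmodule \<Rightarrow> 'm set \<Rightarrow> bool" where
  "cofinite_sub R M M' \<longleftrightarrow> graded_submodule R M M' \<and> fin_dim (quot_module M M')"

definition finite_sub ::
  "('k::field, 'a) graded_space \<Rightarrow> ('k, 'm, 'a) graded_rmodule \<Rightarrow> 'm set \<Rightarrow> bool" where
  "finite_sub R N N' \<longleftrightarrow> graded_submodule R N N' \<and> fin_dim (sub_module N N')"

definition qgr_mor ::
  "('k::field, 'a) graded_space \<Rightarrow> ('k, 'm, 'a) graded_rmodule \<Rightarrow> ('k, 'n, 'a) graded_rmodule
   \<Rightarrow> ('m, 'n) qgr_rep set" where
  "qgr_mor R M N =
     {(M', N', f). cofinite_sub R M M' \<and> finite_sub R N N' \<and>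
                   f \<in> graded_hom R (sub_module M M') (quot_module N N')}"

definition qgr_eq ::
  "('k::field, 'a) graded_space \<Rightarrow> ('k, 'm, 'a) graded_rmodule \<Rightarrow> ('k, 'n, 'a) graded_rmodule
   \<Rightarrow> ('m, 'n) qgr_rep \<Rightarrow> ('m, 'n) qgr_rep \<Rightarrow> bool" where
  "qgr_eq R M N = (\<lambda>(M1, N1, f) (M2, N2, g).
     \<exists>M' N'. cofinite_sub R M M' \<and> M' \<subseteq> M1 \<inter> M2 \<and> finite_sub R N N' \<and> N1 \<union> N2 \<subseteq> N' \<and>
             (\<forall>m \<in> M'. f m <+>\<^bsub>N\<^esub> N' = g m <+>\<^bsub>N\<^esub> N'))"

definition qgr_id :: "('k, 'm, 'a) graded_rmodule \<Rightarrow> ('m, 'm) qgr_rep" where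
  "qgr_id M = (carrier M, {\<zero>\<^bsub>M\<^esub>}, \<lambda>m. {m})"

definition qgr_zero_mor ::
  "('k, 'm, 'a) graded_rmodule \<Rightarrow> ('k, 'n, 'a) graded_rmodule \<Rightarrow> ('m, 'n) qgr_rep" where
  "qgr_zero_mor M N = (carrier M, {\<zero>\<^bsub>N\<^esub>}, \<lambda>m. {\<zero>\<^bsub>N\<^esub>})"

text \<open>
  Composition, in diagrammatic order. For $f : M' \to N/N_1$ and $g : N_2 \to P/P'$ the composite is
  defined on $f^{-1}((N_2 + N_1)/N_1)$ and takes values in $P/P''$, where $P''/P' = g(N_1 \cap N_2)$;
  $m$ is sent to the image under $g$ of any representative of $f(m)$ lying in $N_2$. Since $g$ is
  coset-valued, the images below are unions of cosets of $P'$.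
\<close>

definition qgr_comp ::
  "('m, 'n) qgr_rep \<Rightarrow> ('n, 'p) qgr_rep \<Rightarrow> ('m, 'p) qgr_rep" where
  "qgr_comp = (\<lambda>(M', N1, f) (N2, P', g).
     ({m \<in> M'. f m \<inter> N2 \<noteq> {}}, \<Union>n \<in> N1 \<inter> N2. g n, \<lambda>m. \<Union>n \<in> f m \<inter> N2. g n))"

definition qgr_iso ::
  "('k::field, 'a) graded_space \<Rightarrow> ('k, 'm, 'a) graded_rmodule \<Rightarrow> ('k, 'n, 'a) graded_rmodule
   \<Rightarrow> ('m, 'n) qgr_rep \<Rightarrow> bool" where
  "qgr_iso R M N f \<longleftrightarrow>
     f \<in> qgr_mor R M N \<and>
     (\<exists>g \<in> qgr_mor R N M. qgr_eq R M M (qgr_comp f g) (qgr_id M) \<and>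
                          qgr_eq R N N (qgr_comp g f) (qgr_id N))"

definition qgr_isomorphic ::
  "('k::field, 'a) graded_space \<Rightarrow> ('k, 'm, 'a) graded_rmodule \<Rightarrow> ('k, 'n, 'a) graded_rmodule
   \<Rightarrow> bool" where
  "qgr_isomorphic R M N \<longleftrightarrow> qgr_object R M \<and> qgr_object R N \<and> (\<exists>f. qgr_iso R M N f)"

definition qgr_is_zero ::
  "('k::field, 'a) graded_space \<Rightarrow> ('k, 'm, 'a) graded_rmodule \<Rightarrow> bool" where
  "qgr_is_zero R M \<longleftrightarrow> qgr_eq R M M (qgr_id M) (qgr_zero_mor M M)"

text \<open>
  In the next two definitions the test objects range over modules whose elements have the same type
  as those of the given module. This is no restriction: kernels, and representatives of subobjects,
  can be taken among the submodules of the given module.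
\<close>

definition qgr_mono ::
  "('k::field, 'a) graded_space \<Rightarrow> ('k, 'm, 'a) graded_rmodule \<Rightarrow> ('k, 'n, 'a) graded_rmodule
   \<Rightarrow> ('m, 'n) qgr_rep \<Rightarrow> bool" where
  "qgr_mono R M N f \<longleftrightarrow>
     f \<in> qgr_mor R M N \<and>
     (\<forall>Z :: ('k, 'm, 'a) graded_rmodule. qgr_object R Z \<longrightarrow>
        (\<forall>g \<in> qgr_mor R Z M. \<forall>h \<in> qgr_mor R Z M.
           qgr_eq R Z N (qgr_comp g f) (qgr_comp h f) \<longrightarrow> qgr_eq R Z M g h))"

definition qgr_irreducible ::
  "('k::field, 'a) graded_space \<Rightarrow> ('k, 'm, 'a) graded_rmodule \<Rightarrow> bool" where
  "qgr_irreducible R M \<longleftrightarrow>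
     qgr_object R M \<and> \<not> qgr_is_zero R M \<and>
     (\<forall>(Y :: ('k, 'm, 'a) graded_rmodule) f.
        qgr_object R Y \<and> qgr_mono R Y M f \<longrightarrow> qgr_is_zero R Y \<or> qgr_iso R Y M f)"


section \<open>Growth, Hilbert series, point modules\<close>

text \<open>\<open>growth M V F n\<close> is the subspace $F V^n$ of $M$, for the spans of finite sets \<open>F\<close> and \<open>V\<close>.\<close>

primrec growth ::
  "('k::field, 'm, 'a) graded_rmodule \<Rightarrow> 'a set \<Rightarrow> 'm set \<Rightarrow> nat \<Rightarrow> 'm set" where
  "growth M V F 0 = LinearCombinations.module.span class_ring M F"
| "growth M V F (Suc n) = LinearCombinations.module.span class_ring M {act M m v | m v. m \<in> growth M V F n \<and> v \<in> V}"

text \<open>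
  $\mathrm{GKdim}(M) = \sup_{V, F} \limsup_n \log_n \dim (F V^n)$, over the finite-dimensional
  subspaces $1 \in V \subseteq R$ and $F \subseteq M$. With \<open>ln 0 = 0\<close> the zero module gets dimension
  $0$ instead of $-\infty$.
\<close>

definition GKdim ::
  "('k::field, 'a) graded_space \<Rightarrow> ('k, 'm, 'a) graded_rmodule \<Rightarrow> ereal" where
  "GKdim R M =
     (SUP (V, F) \<in> {(V, F). finite V \<and> V \<subseteq> carrier R \<and> \<one>\<^bsub>R\<^esub> \<in> V \<and> finite F \<and> F \<subseteq> carrier M}.
        limsup (\<lambda>n. ereal (ln (real (dimension (M \<lparr>carrier := growth M V F n\<rparr>))) / ln (real n))))"

definition one_critical ::
  "('k::field, 'a) graded_space \<Rightarrow> ('k, 'm, 'a) graded_rmodule \<Rightarrow> bool" where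
  "one_critical R M \<longleftrightarrow>
     graded_module R M \<and> finitely_generated R M \<and> GKdim R M = 1 \<and>
     (\<forall>N. graded_submodule R M N \<and> N \<noteq> {\<zero>\<^bsub>M\<^esub>} \<longrightarrow> GKdim R (quot_module M N) < 1)"

definition has_hilbert_series ::
  "('k::field, 'm, 'a) graded_rmodule \<Rightarrow> rat fps \<Rightarrow> bool" where
  "has_hilbert_series M h \<longleftrightarrow>
     (\<forall>n. fin_dim (M \<lparr>carrier := piece M n\<rparr>)) \<and>
     Abs_fps (\<lambda>n. of_nat (dimension (M \<lparr>carrier := piece M n\<rparr>))) = h"

definition point_module ::
  "('k::field, 'a) graded_space \<Rightarrow> ('k, 'm, 'a) graded_rmodule \<Rightarrow> bool" where
  "point_module R M \<longleftrightarrow>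
     graded_module R M \<and> (\<exists>m. generates R M {m}) \<and> has_hilbert_series M (1 / (1 - fps_X))"

definition fat_point_module ::
  "('k::field, 'a) graded_space \<Rightarrow> nat \<Rightarrow> ('k, 'm, 'a) graded_rmodule \<Rightarrow> bool" where
  "fat_point_module R e M \<longleftrightarrow>
     graded_module R M \<and> has_hilbert_series M (of_nat e / (1 - fps_X)) \<and>
     generates R M (piece M 0) \<and>
     (\<forall>N. graded_submodule R M N \<and> N \<noteq> {\<zero>\<^bsub>M\<^esub>} \<longrightarrow> fin_dim (quot_module M N))"


section \<open>The Sklyanin algebra and its quotient B\<close>

datatype gen = X0 | X1 | X2 | X3

text \<open>Elements of the free algebra are the finitely supported functions on words.\<close>

definition free_algebra :: "('k::field, gen list \<Rightarrow> 'k) graded_space" where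
  "free_algebra =
     \<lparr>carrier = {f. finite {w. f w \<noteq> 0}},
      mult = (\<lambda>f g w. \<Sum>i\<le>length w. f (take i w) * g (drop i w)),
      one = (\<lambda>w. if w = [] then 1 else 0),
      zero = (\<lambda>w. 0),
      add = (\<lambda>f g w. f w + g w),
      smult = (\<lambda>c f w. c * f w),
      piece = (\<lambda>n. {f. finite {w. f w \<noteq> 0} \<and> (\<forall>w. f w \<noteq> 0 \<longrightarrow> length w = n)})\<rparr>"

definition var :: "gen \<Rightarrow> gen list \<Rightarrow> 'k::field" where
  "var i = (\<lambda>w. if w = [i] then 1 else 0)"

definition commutator :: "('a, 'z) ring_scheme \<Rightarrow> 'a \<Rightarrow> 'a \<Rightarrow> 'a" where
  "commutator R a b = a \<otimes>\<^bsub>R\<^esub> b \<ominus>\<^bsub>R\<^esub> b \<otimes>\<^bsub>R\<^esub> a"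

definition anticommutator :: "('a, 'z) ring_scheme \<Rightarrow> 'a \<Rightarrow> 'a \<Rightarrow> 'a" where
  "anticommutator R a b = a \<otimes>\<^bsub>R\<^esub> b \<oplus>\<^bsub>R\<^esub> b \<otimes>\<^bsub>R\<^esub> a"

definition sklyanin_parameters :: "'k::field \<Rightarrow> 'k \<Rightarrow> 'k \<Rightarrow> bool" where
  "sklyanin_parameters \<alpha> \<beta> \<gamma> \<longleftrightarrow>
     \<alpha> + \<beta> + \<gamma> + \<alpha> * \<beta> * \<gamma> = 0 \<and> {\<alpha>, \<beta>, \<gamma>} \<inter> {0, 1, - 1} = {}"

definition sklyanin_relations :: "'k::field \<Rightarrow> 'k \<Rightarrow> 'k \<Rightarrow> (gen list \<Rightarrow> 'k) set" where
  "sklyanin_relations \<alpha> \<beta> \<gamma> =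
     (let F = free_algebra; x = var in
      {commutator F (x X0) (x X1) \<ominus>\<^bsub>F\<^esub> (\<alpha> \<odot>\<^bsub>F\<^esub> anticommutator F (x X2) (x X3)),
       anticommutator F (x X0) (x X1) \<ominus>\<^bsub>F\<^esub> commutator F (x X2) (x X3),
       commutator F (x X0) (x X2) \<ominus>\<^bsub>F\<^esub> (\<beta> \<odot>\<^bsub>F\<^esub> anticommutator F (x X3) (x X1)),
       anticommutator F (x X0) (x X2) \<ominus>\<^bsub>F\<^esub> commutator F (x X3) (x X1),
       commutator F (x X0) (x X3) \<ominus>\<^bsub>F\<^esub> (\<gamma> \<odot>\<^bsub>F\<^esub> anticommutator F (x X1) (x X2)),
       anticommutator F (x X0) (x X3) \<ominus>\<^bsub>F\<^esub> commutator F (x X1) (x X2)})"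

definition sklyanin_ideal :: "'k::field \<Rightarrow> 'k \<Rightarrow> 'k \<Rightarrow> (gen list \<Rightarrow> 'k) set" where
  "sklyanin_ideal \<alpha> \<beta> \<gamma> = genideal free_algebra (sklyanin_relations \<alpha> \<beta> \<gamma>)"

definition alg_A :: "'k::field \<Rightarrow> 'k \<Rightarrow> 'k \<Rightarrow> ('k, (gen list \<Rightarrow> 'k) set) graded_space" where
  "alg_A \<alpha> \<beta> \<gamma> = quot_algebra free_algebra (sklyanin_ideal \<alpha> \<beta> \<gamma>)"

definition gen_A :: "'k::field \<Rightarrow> 'k \<Rightarrow> 'k \<Rightarrow> gen \<Rightarrow> (gen list \<Rightarrow> 'k) set" where
  "gen_A \<alpha> \<beta> \<gamma> i =
     a_r_coset (free_algebra :: ('k, gen list \<Rightarrow> 'k) graded_space) (sklyanin_ideal \<alpha> \<beta> \<gamma>) (var i)"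

definition Omega1 :: "'k::field \<Rightarrow> 'k \<Rightarrow> 'k \<Rightarrow> (gen list \<Rightarrow> 'k) set" where
  "Omega1 \<alpha> \<beta> \<gamma> =
     (let A = alg_A \<alpha> \<beta> \<gamma>; sq = (\<lambda>i. gen_A \<alpha> \<beta> \<gamma> i \<otimes>\<^bsub>A\<^esub> gen_A \<alpha> \<beta> \<gamma> i) in
      (\<ominus>\<^bsub>A\<^esub> sq X0) \<oplus>\<^bsub>A\<^esub> sq X1 \<oplus>\<^bsub>A\<^esub> sq X2 \<oplus>\<^bsub>A\<^esub> sq X3)"

definition Omega2 :: "'k::field \<Rightarrow> 'k \<Rightarrow> 'k \<Rightarrow> (gen list \<Rightarrow> 'k) set" where
  "Omega2 \<alpha> \<beta> \<gamma> =
     (let A = alg_A \<alpha> \<beta> \<gamma>; sq = (\<lambda>i. gen_A \<alpha> \<beta> \<gamma> i \<otimes>\<^bsub>A\<^esub> gen_A \<alpha> \<beta> \<gamma> i) in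
      sq X1 \<oplus>\<^bsub>A\<^esub> (((1 + \<alpha>) / (1 - \<beta>)) \<odot>\<^bsub>A\<^esub> sq X2) \<oplus>\<^bsub>A\<^esub> (((1 - \<alpha>) / (1 + \<gamma>)) \<odot>\<^bsub>A\<^esub> sq X3))"

definition Omega_ideal :: "'k::field \<Rightarrow> 'k \<Rightarrow> 'k \<Rightarrow> (gen list \<Rightarrow> 'k) set set" where
  "Omega_ideal \<alpha> \<beta> \<gamma> = genideal (alg_A \<alpha> \<beta> \<gamma>) {Omega1 \<alpha> \<beta> \<gamma>, Omega2 \<alpha> \<beta> \<gamma>}"

type_synonym 'k elem_B = "(gen list \<Rightarrow> 'k) set set"

definition alg_B :: "'k::field \<Rightarrow> 'k \<Rightarrow> 'k \<Rightarrow> ('k, 'k elem_B) graded_space" where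
  "alg_B \<alpha> \<beta> \<gamma> = quot_algebra (alg_A \<alpha> \<beta> \<gamma>) (Omega_ideal \<alpha> \<beta> \<gamma>)"

definition gen_B :: "'k::field \<Rightarrow> 'k \<Rightarrow> 'k \<Rightarrow> gen \<Rightarrow> 'k elem_B" where
  "gen_B \<alpha> \<beta> \<gamma> i = a_r_coset (alg_A \<alpha> \<beta> \<gamma>) (Omega_ideal \<alpha> \<beta> \<gamma>) (gen_A \<alpha> \<beta> \<gamma> i)"


section \<open>The curve E and its point modules\<close>

text \<open>A point of $\mathbb{P}^3$ is the set of its homogeneous coordinate vectors.\<close>

type_synonym 'k point = "(gen \<Rightarrow> 'k) set"

definition proj_point :: "(gen \<Rightarrow> 'k::field) \<Rightarrow> 'k point" where
  "proj_point y = {\<lambda>i. c * y i | c. c \<noteq> 0}"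

definition curve_E :: "'k::field \<Rightarrow> 'k \<Rightarrow> 'k \<Rightarrow> 'k point set" where
  "curve_E \<alpha> \<beta> \<gamma> =
     {proj_point y | y. (\<exists>i. y i \<noteq> 0) \<and>
        (y X0)\<^sup>2 + (y X1)\<^sup>2 + (y X2)\<^sup>2 + (y X3)\<^sup>2 = 0 \<and>
        (y X3)\<^sup>2 + (1 - \<gamma>) / (1 + \<alpha>) * (y X1)\<^sup>2 + (1 + \<gamma>) / (1 - \<beta>) * (y X2)\<^sup>2 = 0}"

definition point_module_at ::
  "'k::field \<Rightarrow> 'k \<Rightarrow> 'k \<Rightarrow> 'k point \<Rightarrow> ('k, 'm, 'k elem_B) graded_rmodule \<Rightarrow> bool" where
  "point_module_at \<alpha> \<beta> \<gamma> p M \<longleftrightarrow>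
     point_module (alg_B \<alpha> \<beta> \<gamma>) M \<and>
     (\<exists>m0 \<in> piece M 0 - {\<zero>\<^bsub>M\<^esub>}. \<exists>m1 \<in> piece M 1 - {\<zero>\<^bsub>M\<^esub>}. \<exists>y \<in> p.
        \<forall>i. act M m0 (gen_B \<alpha> \<beta> \<gamma> i) = y i \<odot>\<^bsub>M\<^esub> m1)"

text \<open>
  The condition $M_p[1]_{\ge 0} \cong M_{\sigma(p)}$ determines $\sigma$ on the curve, because point
  modules at distinct points are not isomorphic.
\<close>

definition shift_automorphism ::
  "'k::field \<Rightarrow> 'k \<Rightarrow> 'k \<Rightarrow> ('k point \<Rightarrow> ('k, 'm, 'k elem_B) graded_rmodule)
   \<Rightarrow> ('k point \<Rightarrow> 'k point) \<Rightarrow> bool" where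
  "shift_automorphism \<alpha> \<beta> \<gamma> Mp \<sigma> \<longleftrightarrow>
     bij_betw \<sigma> (curve_E \<alpha> \<beta> \<gamma>) (curve_E \<alpha> \<beta> \<gamma>) \<and>
     (\<forall>p \<in> curve_E \<alpha> \<beta> \<gamma>.
        graded_isomorphic (alg_B \<alpha> \<beta> \<gamma>) (truncated_shift (Mp p)) (Mp (\<sigma> p)))"

definition infinite_order_on :: "'p set \<Rightarrow> ('p \<Rightarrow> 'p) \<Rightarrow> bool" where
  "infinite_order_on E \<sigma> \<longleftrightarrow> (\<forall>n>0. \<exists>p \<in> E. (\<sigma> ^^ n) p \<noteq> p)"


section \<open>The cocycle twist\<close>

text \<open>The pair $(p, q)$ stands for $g_1^p g_2^q$.\<close>

type_synonym klein = "bit \<times> bit"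

definition bit_sign :: "bit \<Rightarrow> 'k::field" where
  "bit_sign b = (if b = 0 then 1 else - 1)"

fun gen_sign :: "klein \<Rightarrow> gen \<Rightarrow> 'k::field" where
  "gen_sign (r, s) X0 = 1"
| "gen_sign (r, s) X1 = bit_sign s"
| "gen_sign (r, s) X2 = bit_sign r"
| "gen_sign (r, s) X3 = bit_sign (r + s)"

text \<open>
  \<open>G\<close> acts on the free algebra by automorphisms scaling the generators; elements of \<open>alg_B\<close> are
  cosets of cosets, and the induced action is the image of such a set.
\<close>

definition free_action :: "klein \<Rightarrow> (gen list \<Rightarrow> 'k::field) \<Rightarrow> gen list \<Rightarrow> 'k" where
  "free_action g f = (\<lambda>w. prod_list (map (gen_sign g) w) * f w)"

definition action_B :: "klein \<Rightarrow> 'k::field elem_B \<Rightarrow> 'k elem_B" where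
  "action_B g X = image (image (free_action g)) X"

text \<open>
  The component of degree $g$ is the isotypic component of the character \<open>klein_char g\<close>; this
  identification of \<open>G\<close> with its dual puts $x_0, x_1, x_2, x_3$ in degrees $e, g_1, g_2, g_1 g_2$.
\<close>

fun klein_char :: "klein \<Rightarrow> klein \<Rightarrow> 'k::field" where
  "klein_char (p, q) (r, s) = bit_sign (q * r + p * s)"

definition G_piece :: "'k::field \<Rightarrow> 'k \<Rightarrow> 'k \<Rightarrow> klein \<Rightarrow> 'k elem_B set" where
  "G_piece \<alpha> \<beta> \<gamma> g =
     {b \<in> carrier (alg_B \<alpha> \<beta> \<gamma>). \<forall>h. action_B h b = klein_char g h \<odot>\<^bsub>alg_B \<alpha> \<beta> \<gamma>\<^esub> b}"

definition G_component :: "'k::field \<Rightarrow> 'k \<Rightarrow> 'k \<Rightarrow> 'k elem_B \<Rightarrow> klein \<Rightarrow> 'k elem_B" where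
  "G_component \<alpha> \<beta> \<gamma> b =
     (THE c. (\<forall>g. c g \<in> G_piece \<alpha> \<beta> \<gamma> g) \<and> b = finsum (alg_B \<alpha> \<beta> \<gamma>) c UNIV)"

fun cocycle :: "klein \<Rightarrow> klein \<Rightarrow> 'k::field" where
  "cocycle (p, q) (r, s) = bit_sign (p * s)"

definition alg_twist :: "'k::field \<Rightarrow> 'k \<Rightarrow> 'k \<Rightarrow> ('k, 'k elem_B) graded_space" where
  "alg_twist \<alpha> \<beta> \<gamma> =
     (let B = alg_B \<alpha> \<beta> \<gamma>; comp = G_component \<alpha> \<beta> \<gamma> in
      B \<lparr>mult := (\<lambda>a b. finsum B
           (\<lambda>(g, h). cocycle g h \<odot>\<^bsub>B\<^esub> (comp a g \<otimes>\<^bsub>B\<^esub> comp b h)) UNIV)\<rparr>)"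

text \<open>
  The embedding of the twist into $M_2(B)$; a matrix with rows $(a, b)$ and $(c, d)$ is encoded
  as \<open>((a, b), (c, d))\<close>. The component of \<open>b\<close> in degree $e$, $g_1$, $g_2$, $g_1 g_2$ is
  multiplied by the scalar matrix occurring in the image of $x_0$, $x_1$, $x_2$, $x_3$, respectively.
\<close>

definition twist_matrix ::
  "'k::field \<Rightarrow> 'k \<Rightarrow> 'k \<Rightarrow> 'k elem_B \<Rightarrow> ('k elem_B \<times> 'k elem_B) \<times> ('k elem_B \<times> 'k elem_B)" where
  "twist_matrix \<alpha> \<beta> \<gamma> b =
     (let B = alg_B \<alpha> \<beta> \<gamma>; c = G_component \<alpha> \<beta> \<gamma> b in
      ((c (0, 0) \<oplus>\<^bsub>B\<^esub> c (1, 0), c (0, 1) \<ominus>\<^bsub>B\<^esub> c (1, 1)),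
       (c (0, 1) \<oplus>\<^bsub>B\<^esub> c (1, 1), c (0, 0) \<ominus>\<^bsub>B\<^esub> c (1, 0))))"

text \<open>The row vectors $M^2$ over a \<open>B\<close>-module $M$, restricted to the twist.\<close>

definition row_module ::
  "'k::field \<Rightarrow> 'k \<Rightarrow> 'k \<Rightarrow> ('k, 'm, 'k elem_B) graded_rmodule
   \<Rightarrow> ('k, 'm \<times> 'm, 'k elem_B) graded_rmodule" where
  "row_module \<alpha> \<beta> \<gamma> M =
     \<lparr>carrier = carrier (direct_sum M M), mult = undefined, one = undefined,
      zero = zero (direct_sum M M), add = add (direct_sum M M), smult = smult (direct_sum M M),
      piece = (\<lambda>n. piece M n \<times> piece M n),
      act = (\<lambda>(m, m') x. case twist_matrix \<alpha> \<beta> \<gamma> x of ((a, b), (c, d)) \<Rightarrow>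
               (act M m a \<oplus>\<^bsub>M\<^esub> act M m' c, act M m b \<oplus>\<^bsub>M\<^esub> act M m' d))\<rparr>"

end

theory Submission
  imports Defs "Jordan_Normal_Form.Char_Poly"
begin

text \<open>
  The algebra \<open>B\<close> embeds in the twisted ring of functions on \<open>E\<close>: a form on words that vanishes on
  the orbits of \<open>\<sigma>\<close> is a combination of the relations, because plane sections of \<open>E\<close> supply
  enough independent evaluations. Multiplying and dividing by elements with few zeros shows that
  the tail of every proper graded right ideal lies in the annihilator of a tail of a point module,
  so every \<open>B\<close>-module that is not finite dimensional has a nonzero functional \<open>\<Lambda>\<close>, in all large
  degrees, with \<open>\<Lambda> (u x\<^sub>i) = (\<sigma>\<^sup>n p)\<^sub>i \<Lambda> u\<close>.

  Since \<open>\<mu>\<^sup>2 = 1\<close>, row vectors over a module over the twist form a \<open>B\<close>-module. For an irreducible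
  \<open>M\<close>, evaluating \<open>\<Lambda>\<close> on \<open>(u, 0)\<close> and \<open>(0, u)\<close> gives a map from a tail of \<open>M\<close> to \<open>M\<^sub>p\<^sup>2\<close> that is linear
  over the twist. The bilinear relations determine \<open>p\<close> from \<open>\<sigma>(p)\<close>, which makes its kernel finitely
  generated; by irreducibility the kernel is finite dimensional. For \<open>M\<^sub>p\<^sup>2\<close> itself, a point of \<open>E\<close> has
  at most one vanishing coordinate, so a nonzero homogeneous row vector generates the whole next piece.
\<close>

section \<open>Linear algebra over a finite index set\<close>

text \<open>The geometry of E enters through one count. The degree-n part of B has dimension at most
  4n, by an induction that divides out x_0, and at least 4n, because suitable sets of 4n points have
  independent evaluations. The same count shows that a form which does not vanish identically on E
  has only finitely many zeros. The point attached to a proper right ideal comes from an eigenvalue.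
  Enlarge the ideal to a maximal proper one, K. The dimensions of F_n / K_n are bounded, so where
  they are largest x_1 acts bijectively, unless it kills something; an eigenvector of x_1^{-1} x_0
  is then annihilated by a plane x_0 - t x_1. Division by the form of this plane leaves only its
  points on E as candidates. The division needs four distinct points, hence the detour around the
  tangent planes. On the twisted side the obstacle is that irreducibility only tests subobjects that
  are themselves finitely generated. The kernel of the map to \<open>M_p^2\<close> is therefore
  shown to be finitely generated directly: in large degrees, every linear syzygy of the image comes
  from a quadratic relation and can be lifted to the irreducible module.\<close>

lemma nontrivial_solution:
 fixes a :: "'j => 's => 'k::field"
 assumes "finite S" "finite J" "card S < card J"
 shows "EX c. (\<exists>j\<in>J. c j ~= 0) & (\<forall>s\<in>S. (\<Sum>j\<in>J. c j * a j s) = 0)"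
 using assms
proof (induction S arbitrary: J a rule: finite_induct)
 case empty
 then obtain j where "j \<in> J" by fastforce
 then show ?case by (intro exI[of _ "%_. 1"]) auto
next
 case (insert p S)
 show ?case
 proof (cases "\<forall>j\<in>J. a j p = 0")
  case True
  have "card S < card J" using insert by auto
  from insert.IH[OF insert.prems(1) this, of a] True show ?thesis by auto
 next
  case False
  then obtain j0 where j0: "j0 \<in> J" "a j0 p ~= 0" by auto
  define J' where "J' = J - {j0}"
  have fin: "finite J'" and cJ: "card S < card J'"
   using insert j0 by (auto simp: J'_def)
  define r where "r j = a j p / a j0 p" for j
  from insert.IH[OF fin cJ, of "%j s. a j s - r j * a j0 s"]
  obtain c where c: "\<exists>j\<in>J'. c j ~= 0"
   "!!s. s \<in> S ==> (\<Sum>j\<in>J'. c j * (a j s - r j * a j0 s)) = 0" by auto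
  define c' where "c' j = (if j = j0 then - (\<Sum>j\<in>J'. c j * r j) else c j)" for j
  have e: "(\<Sum>j\<in>J. c' j * a j s) = (\<Sum>j\<in>J'. c j * (a j s - r j * a j0 s))" for s
  proof -
   have "(\<Sum>j\<in>J. c' j * a j s) = c' j0 * a j0 s + (\<Sum>j\<in>J'. c' j * a j s)"
    unfolding J'_def using insert.prems j0 by (simp add: sum.remove)
   also have "(\<Sum>j\<in>J'. c' j * a j s) = (\<Sum>j\<in>J'. c j * a j s)"
    by (rule sum.cong) (auto simp: c'_def J'_def)
   finally show ?thesis
    by (simp add: c'_def right_diff_distrib sum_subtractf sum_distrib_right sum_negf mult.assoc)
  qed
  have "(\<Sum>j\<in>J. c' j * a j p) = 0" unfolding e by (rule sum.neutral) (use j0 in \<open>auto simp: r_def\<close>)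
  moreover have "\<exists>j\<in>J. c' j ~= 0" using c(1) by (auto simp: c'_def J'_def)
  ultimately show ?thesis using c(2) e by (intro exI[of _ c']) auto
 qed
qed

text \<open>Membership in a span is tested by functionals. This is the bridge between algebra and
  geometry: that a form is a combination of relations, or a tuple a combination of syzygies, is
  checked on the functionals that kill the latter. The rows are added one at a time.\<close>

lemma double_annihilator:
 fixes a :: "'s => 'w => 'k::field"
 assumes "finite S" "finite W"
  and "!!\<phi>. (!!p. p \<in> S ==> (\<Sum>w\<in>W. \<phi> w * a p w) = 0) ==> (\<Sum>w\<in>W. \<phi> w * b w) = 0"
 shows "EX c. \<forall>w\<in>W. b w = (\<Sum>p\<in>S. c p * a p w)"
 using assms(1,3)
proof (induction S arbitrary: b rule: finite_induct)
 case empty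
 have "b w = 0" if "w \<in> W" for w
  using empty[of "%v. if v = w then 1 else 0"] assms(2) that by (simp add: if_distrib[of "%x. x * _"] sum.delta cong: if_cong)
 then show ?case by auto
next
 case (insert p S)
 define ap where "ap \<phi> f = (\<Sum>w\<in>W. \<phi> w * f w)" for \<phi> f :: "'w => 'k"
 have sub: "ap \<phi> (%w. f w - c * g w) = ap \<phi> f - c * ap \<phi> g" for \<phi> f g c
  by (simp add: ap_def right_diff_distrib sum_subtractf sum_distrib_left mult_ac)
 have sub2: "ap (%w. \<phi> w - c * \<psi> w) f = ap \<phi> f - c * ap \<psi> f" for \<phi> f \<psi> c
  by (simp add: ap_def left_diff_distrib sum_subtractf sum_distrib_left)
   (simp add: mult_ac)
 show ?case
 proof (cases "\<forall>\<phi>. (\<forall>q\<in>S. ap \<phi> (a q) = 0) --> ap \<phi> (a p) = 0")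
  case True
  have "EX c. \<forall>w\<in>W. b w = (\<Sum>p\<in>S. c p * a p w)"
   by (rule insert.IH) (use True in \<open>auto simp: ap_def intro!: insert.prems\<close>)
  then obtain c where c: "\<forall>w\<in>W. b w = (\<Sum>p\<in>S. c p * a p w)" by auto
  define c' where "c' = c(p := 0)"
  have "(\<Sum>q\<in>insert p S. c' q * a q w) = (\<Sum>q\<in>S. c q * a q w)" for w
   using insert.hyps by (auto simp: c'_def intro!: sum.cong)
  then show ?thesis using c by metis
 next
  case False
  \<comment> \<open>\<phi>1 sees the new row \<open>a p\<close> but none of the old ones. Normalised
    to 1 on \<open>a p\<close> it reads off the coefficient of \<open>a p\<close> in
    \<open>b\<close>; the remainder is left to the rows in \<open>S\<close>.\<close>
  then obtain \<phi>1 where \<phi>1: "\<forall>q\<in>S. ap \<phi>1 (a q) = 0" "ap \<phi>1 (a p) ~= 0" by auto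
  define \<phi>0 where "\<phi>0 w = \<phi>1 w / ap \<phi>1 (a p)" for w
  have sc: "ap \<phi>0 f = ap \<phi>1 f / ap \<phi>1 (a p)" for f
   by (simp add: ap_def \<phi>0_def sum_divide_distrib)
  have \<phi>0: "\<forall>q\<in>S. ap \<phi>0 (a q) = 0" "ap \<phi>0 (a p) = 1" using \<phi>1 by (auto simp: sc)
  define b' where "b' w = b w - ap \<phi>0 b * a p w" for w
  have "EX c. \<forall>w\<in>W. b' w = (\<Sum>p\<in>S. c p * a p w)"
  proof (rule insert.IH)
   fix \<phi> assume \<phi>: "!!q. q \<in> S ==> (\<Sum>w\<in>W. \<phi> w * a q w) = 0"
   define \<psi> where "\<psi> w = \<phi> w - ap \<phi> (a p) * \<phi>0 w" for w
   have "ap \<psi> b = 0" unfolding ap_def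
    by (rule insert.prems, fold ap_def) (use \<phi> \<phi>0 in \<open>auto simp: sub2 \<psi>_def[abs_def] ap_def[symmetric]\<close>)
   moreover have "ap \<psi> b = ap \<phi> b - ap \<phi> (a p) * ap \<phi>0 b" unfolding \<psi>_def by (rule sub2)
   moreover have "ap \<phi> b' = ap \<phi> b - ap \<phi>0 b * ap \<phi> (a p)" unfolding b'_def by (rule sub)
   ultimately have "ap \<phi> b' = 0" by (simp add: mult.commute)
   then show "(\<Sum>w\<in>W. \<phi> w * b' w) = 0" by (simp add: ap_def)
  qed
  then obtain c where c: "\<forall>w\<in>W. b' w = (\<Sum>p\<in>S. c p * a p w)" by auto
  define c' where "c' = c(p := ap \<phi>0 b)"
  have "(\<Sum>q\<in>S. c' q * a q w) = (\<Sum>q\<in>S. c q * a q w)" for w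
   using insert.hyps by (auto simp: c'_def intro!: sum.cong)
  then have "(\<Sum>q\<in>insert p S. c' q * a q w) = ap \<phi>0 b * a p w + (\<Sum>q\<in>S. c q * a q w)" for w
   using insert.hyps by (simp add: c'_def)
  then have "\<forall>w\<in>W. b w = (\<Sum>q\<in>insert p S. c' q * a q w)"
   using c by (metis (no_types, lifting) add.commute b'_def diff_eq_eq)
  then show ?thesis by blast
 qed
qed

text \<open>If no functional separated the row p from the others, \<open>double_annihilator\<close>
  would make it a combination of them.\<close>

lemma independent_rows_dual:
 fixes a :: "'s => 'w => 'k::field"
 assumes "finite S" "finite W"
  and ind: "!!c. (!!w. w \<in> W ==> (\<Sum>p\<in>S. c p * a p w) = 0) ==> \<forall>p\<in>S. c p = 0"
  and "p \<in> S"
 shows "\<exists>\<phi>. \<forall>q\<in>S. (\<Sum>w\<in>W. \<phi> w * a q w) = (if q = p then 1 else 0)"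
proof -
 have "\<exists>\<phi>. (\<forall>q\<in>S - {p}. (\<Sum>w\<in>W. \<phi> w * a q w) = 0) & (\<Sum>w\<in>W. \<phi> w * a p w) ~= 0"
 proof (rule ccontr)
  assume neg: "~ ?thesis"
  then have "EX c. \<forall>w\<in>W. a p w = (\<Sum>q\<in>S - {p}. c q * a q w)"
   by (intro double_annihilator) (use assms in auto)
  then obtain c where c: "!!w. w \<in> W ==> a p w = (\<Sum>q\<in>S - {p}. c q * a q w)" by auto
  define c' where "c' = c(p := -1)"
  have "(\<Sum>q\<in>S. c' q * a q w) = 0" if "w \<in> W" for w
  proof -
   have "(\<Sum>q\<in>S - {p}. c' q * a q w) = (\<Sum>q\<in>S - {p}. c q * a q w)"
    by (rule sum.cong) (auto simp: c'_def)
   then show ?thesis using c[OF that] assms(1,4) by (simp add: sum.remove[of S p] c'_def)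
  qed
  from ind[OF this] \<open>p \<in> S\<close> show False by (auto simp: c'_def)
 qed
 then obtain \<phi> where \<phi>: "\<forall>q\<in>S - {p}. (\<Sum>w\<in>W. \<phi> w * a q w) = 0" "(\<Sum>w\<in>W. \<phi> w * a p w) ~= 0"
  by blast
 let ?d = "\<Sum>w\<in>W. \<phi> w * a p w"
 have "(\<Sum>w\<in>W. (\<phi> w / ?d) * a q w) = (\<Sum>w\<in>W. \<phi> w * a q w) / ?d" for q
  by (simp add: sum_divide_distrib)
 then show ?thesis using \<phi> by (intro exI[of _ "%w. \<phi> w / ?d"]) auto
qed

lemma independent_rows_surj:
 fixes a :: "'s => 'w => 'k::field"
 assumes "finite S" "finite W"
  and "!!c. (!!w. w \<in> W ==> (\<Sum>p\<in>S. c p * a p w) = 0) ==> \<forall>p\<in>S. c p = 0"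
 shows "EX t. \<forall>q\<in>S. (\<Sum>w\<in>W. t w * a q w) = b q"
proof -
 have "\<forall>p\<in>S. \<exists>\<phi>. \<forall>q\<in>S. (\<Sum>w\<in>W. \<phi> w * a q w) = (if q = p then 1 else 0)"
  using independent_rows_dual[OF assms] by auto
 then obtain \<phi> where \<phi>: "!!p q. p \<in> S ==> q \<in> S ==>
   (\<Sum>w\<in>W. \<phi> p w * a q w) = (if q = p then 1 else 0)" by metis
 have "(\<Sum>w\<in>W. (\<Sum>p\<in>S. b p * \<phi> p w) * a q w) = b q" if "q \<in> S" for q
 proof -
  have "(\<Sum>w\<in>W. (\<Sum>p\<in>S. b p * \<phi> p w) * a q w) = (\<Sum>p\<in>S. b p * (\<Sum>w\<in>W. \<phi> p w * a q w))"
   by (simp add: sum_distrib_left sum_distrib_right mult.assoc) (rule sum.swap)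
  also have "... = (\<Sum>p\<in>S. if p = q then b p else 0)" using that by (intro sum.cong) (auto simp: \<phi>)
  also have "... = b q" using that assms(1) by simp
  finally show ?thesis .
 qed
 then show ?thesis by (intro exI[of _ "%w. \<Sum>p\<in>S. b p * \<phi> p w"]) auto
qed

lemma independent_rows_span:
 fixes a :: "'s => 'w => 'k::field"
 assumes fin: "finite S" "finite W" and card: "card W <= card S"
  and ind: "!!c. (!!w. w \<in> W ==> (\<Sum>p\<in>S. c p * a p w) = 0) ==> \<forall>p\<in>S. c p = 0"
 shows "EX c. \<forall>w\<in>W. b w = (\<Sum>p\<in>S. c p * a p w)"
proof -
 \<comment> \<open>\<open>b\<close> joins as one more row, indexed by \<open>None\<close>. There are
   now more rows than columns, and in the resulting relation independence forces the coefficient of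
   \<open>b\<close> to be nonzero.\<close>
 define a' where "a' j w = (case j of None => b w | Some p => a p w)" for j w
 define J where "J = insert None (Some ` S)"
 have "finite J" "card W < card J"
  using fin card by (auto simp: J_def card_image)
 from nontrivial_solution[OF fin(2) this, of a'] obtain c where
  c: "\<exists>j\<in>J. c j ~= 0" "!!w. w \<in> W ==> (\<Sum>j\<in>J. c j * a' j w) = 0" by auto
 have e: "(\<Sum>j\<in>J. c j * a' j w) = c None * b w + (\<Sum>p\<in>S. c (Some p) * a p w)" for w
  unfolding J_def using fin by (subst sum.insert) (auto simp: a'_def sum.reindex)
 have "c None ~= 0"
 proof
  assume 0: "c None = 0"
  have "\<forall>p\<in>S. c (Some p) = 0" by (rule ind) (use c(2) e 0 in auto)
  with c(1) 0 show False by (auto simp: J_def)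
 qed
 have "b w = (\<Sum>p\<in>S. (- c (Some p) / c None) * a p w)" if "w \<in> W" for w
 proof -
  have "b w = - (\<Sum>p\<in>S. c (Some p) * a p w) / c None"
   using c(2)[OF that] e[of w] \<open>c None ~= 0\<close> by (simp add: field_simps add_eq_0_iff)
  then show ?thesis by (simp add: sum_divide_distrib sum_negf)
 qed
 then show ?thesis by (intro exI[of _ "%p. - c (Some p) / c None"]) auto
qed

section \<open>The quadratic relations\<close>

lemma UNIV_gen: "(UNIV :: gen set) = {X0, X1, X2, X3}"
 using gen.exhaust by auto

instance gen :: finite
 by standard (simp add: UNIV_gen)

lemma sum_gen: "(\<Sum>i\<in>UNIV. f i) = f X0 + f X1 + f X2 + f X3"
 for f :: "gen => 'a::comm_monoid_add"
 by (simp add: UNIV_gen add.assoc)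

text \<open>The Klein four-group, with $x_i$ in degree $i$.\<close>

fun gadd :: "gen => gen => gen" (infixl "\<boxplus>" 65) where
 "X0 \<boxplus> i = i"
| "i \<boxplus> X0 = i"
| "X1 \<boxplus> X1 = X0" | "X1 \<boxplus> X2 = X3" | "X1 \<boxplus> X3 = X2"
| "X2 \<boxplus> X1 = X3" | "X2 \<boxplus> X2 = X0" | "X2 \<boxplus> X3 = X1"
| "X3 \<boxplus> X1 = X2" | "X3 \<boxplus> X2 = X1" | "X3 \<boxplus> X3 = X0"

lemma gadd_X0 [simp]: "i \<boxplus> X0 = i" by (cases i) auto
lemma gadd_self [simp]: "i \<boxplus> i = X0" by (cases i) auto
lemma gadd_comm: "i \<boxplus> j = j \<boxplus> i" by (cases i; cases j) auto
lemma gadd_assoc: "i \<boxplus> j \<boxplus> l = i \<boxplus> (j \<boxplus> l)" by (cases i; cases j; cases l) auto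
lemma gadd_lcomm: "i \<boxplus> (j \<boxplus> l) = j \<boxplus> (i \<boxplus> l)" by (metis gadd_assoc gadd_comm)
lemma gadd_cancel [simp]: "i \<boxplus> (i \<boxplus> j) = j" by (simp flip: gadd_assoc)
lemma gadd_cancel_right [simp]: "j \<boxplus> i \<boxplus> i = j" by (simp add: gadd_assoc)
lemma gadd_left_inj [simp]: "i \<boxplus> j = i \<boxplus> l \<longleftrightarrow> j = l" by (metis gadd_cancel)
lemma gadd_eq_X0 [simp]: "i \<boxplus> j = X0 \<longleftrightarrow> i = j" by (cases i; cases j) auto

definition word_deg :: "gen list => gen" where
 "word_deg w = foldr gadd w X0"

lemma word_deg_simps [simp]:
 "word_deg [] = X0" "word_deg (i # w) = i \<boxplus> word_deg w"
 by (simp_all add: word_deg_def)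

lemma word_deg_append [simp]: "word_deg (u @ v) = word_deg u \<boxplus> word_deg v"
 by (induction u) (simp_all add: gadd_assoc)

text \<open>
  The eight relations are $\sum_i r^{h,s}_i x_i x_{i+h}$, two in each degree $h$ of the Klein group;
  in degree $0$ they are $\Omega_1$ and $\Omega_2$.
\<close>

fun rel :: "'k::field => 'k => 'k => gen => bool => gen => 'k" where
 "rel \<alpha> \<beta> \<gamma> X0 s i = (case i of X0 => if s then 0 else -1 | X1 => 1
   | X2 => if s then (1 + \<alpha>) / (1 - \<beta>) else 1 | X3 => if s then (1 - \<alpha>) / (1 + \<gamma>) else 1)"
| "rel \<alpha> \<beta> \<gamma> X1 s i = (case i of X0 => 1 | X1 => if s then 1 else -1
   | X2 => if s then -1 else -\<alpha> | X3 => if s then 1 else -\<alpha>)"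
| "rel \<alpha> \<beta> \<gamma> X2 s i = (case i of X0 => 1 | X2 => if s then 1 else -1
   | X3 => if s then -1 else -\<beta> | X1 => if s then 1 else -\<beta>)"
| "rel \<alpha> \<beta> \<gamma> X3 s i = (case i of X0 => 1 | X3 => if s then 1 else -1
   | X1 => if s then -1 else -\<gamma> | X2 => if s then 1 else -\<gamma>)"

text \<open>The multilinearised relation: the value of the quadratic form when the first letter is
  evaluated at y and the second at z. In a point module y and z are consecutive points.\<close>

definition bilin :: "'k::field => 'k => 'k => gen => bool => (gen => 'k) => (gen => 'k) => 'k" where
 "bilin \<alpha> \<beta> \<gamma> h s y z = (\<Sum>i\<in>UNIV. rel \<alpha> \<beta> \<gamma> h s i * y i * z (i \<boxplus> h))"

locale sklyanin =
 fixes \<alpha> \<beta> \<gamma> :: "'k::alg_closed_field"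
 assumes two: "(2::'k) ~= 0" and parameters: "sklyanin_parameters \<alpha> \<beta> \<gamma>"
begin

lemma par0: "\<alpha> + \<beta> + \<gamma> + \<alpha> * \<beta> * \<gamma> = 0"
 and par_nz [simp]: "\<alpha> ~= 0" "\<beta> ~= 0" "\<gamma> ~= 0" "1 + \<alpha> ~= 0" "1 + \<beta> ~= 0" "1 + \<gamma> ~= 0"
  "1 - \<alpha> ~= 0" "1 - \<beta> ~= 0" "1 - \<gamma> ~= 0"
 using parameters by (auto simp: sklyanin_parameters_def add_eq_0_iff)

lemma par_ne1 [simp]: "\<alpha> ~= 1" "\<beta> ~= 1" "\<gamma> ~= 1"
 using par_nz by auto

text \<open>The parameter equation reads (b + c) + a (1 + b c) = 0, so b + c and 1 + b c can only
  vanish together, and then b^2 = 1. Many of the later determinants are products of these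
  quantities.\<close>

lemma par_sum_nz: "\<alpha> + \<beta> ~= 0" "\<beta> + \<gamma> ~= 0" "\<alpha> + \<gamma> ~= 0"
 and par_prod_nz: "1 + \<alpha> * \<beta> ~= 0" "1 + \<beta> * \<gamma> ~= 0" "1 + \<alpha> * \<gamma> ~= 0"
proof -
 have *: "b + c ~= 0 & 1 + b * c ~= 0" if "a + b + c + a * b * c = 0" "a ~= 0" "b ~= 0" "1 + b ~= 0" "1 - b ~= 0"
  for a b c :: 'k
 proof -
  have sq: "c ~= - b \<or> 1 + b * c ~= 0"
  proof (rule ccontr)
   assume "~ ?thesis"
   then have "(1 + b) * (1 - b) = 0" by (auto simp: algebra_simps)
   then show False using that by auto
  qed
  have "(b + c) + a * (1 + b * c) = 0" using that(1) by (simp add: algebra_simps)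
  then have "b + c = 0 \<longleftrightarrow> 1 + b * c = 0" using that(2) by auto
  moreover have "b + c = 0 \<longleftrightarrow> c = - b" by (simp add: eq_neg_iff_add_eq_0 add.commute)
  ultimately show ?thesis using sq by blast
 qed
 show "\<alpha> + \<beta> ~= 0" "\<beta> + \<gamma> ~= 0" "\<alpha> + \<gamma> ~= 0" "1 + \<alpha> * \<beta> ~= 0" "1 + \<beta> * \<gamma> ~= 0" "1 + \<alpha> * \<gamma> ~= 0"
  using *[of \<gamma> \<alpha> \<beta>] *[of \<alpha> \<beta> \<gamma>] *[of \<beta> \<alpha> \<gamma>] par0 par_nz by (auto simp: ac_simps)
qed

end

lemma proportional:
 fixes x x' :: "gen => 'k::field"
 assumes "!!i j. x i * x' j = x j * x' i" "x' l ~= 0"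
 shows "EX c. ALL i. x i = c * x' i"
 using assms by (intro exI[of _ "x l / x' l"]) (simp add: field_simps)

text \<open>The four bilinear equations in two of the degrees $x_1, x_2, x_3$ determine $z$ up to a scalar.\<close>

lemma two_blocks_rank:
 fixes a b y0 y1 y2 y3 :: "'k::field"
 assumes two: "(2::'k) ~= 0" and nz: "1 + a ~= 0" "1 - a ~= 0" "1 + b ~= 0" "1 - b ~= 0" "y2 ~= 0" "y3 ~= 0"
  and z: "2 * y0 * z1 = (1 + a) * y2 * z3 - (1 - a) * y3 * z2"
   "2 * y1 * z0 = (1 - a) * y2 * z3 - (1 + a) * y3 * z2"
   "2 * y0 * z2 = (1 + b) * y3 * z1 - (1 - b) * y1 * z3"
   "2 * y2 * z0 = (1 - b) * y3 * z1 - (1 + b) * y1 * z3"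
  and w: "2 * y0 * w1 = (1 + a) * y2 * w3 - (1 - a) * y3 * w2"
   "2 * y1 * w0 = (1 - a) * y2 * w3 - (1 + a) * y3 * w2"
   "2 * y0 * w2 = (1 + b) * y3 * w1 - (1 - b) * y1 * w3"
   "2 * y2 * w0 = (1 - b) * y3 * w1 - (1 + b) * y1 * w3"
 shows "z0 * w1 = z1 * w0 & z0 * w2 = z2 * w0 & z0 * w3 = z3 * w0 & z1 * w2 = z2 * w1 &
  z1 * w3 = z3 * w1 & z2 * w3 = z3 * w2"
proof -
 \<comment> \<open>Coefficients of two consequences in z_1 and z_2 alone: \<open>c1\<close>,
   \<open>c2\<close> arise by cancelling z_3 between the first and third equations,
   \<open>d1\<close>, \<open>d2\<close> by cancelling z_0 between the second and fourth and then z_3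
   against the first. If (z_1, z_2) and (w_1, w_2) were independent, all four coefficients would
   vanish.\<close>
 define c1 where "c1 = (1 + a) * (1 + b) * y2 * y3 - 2 * (1 - b) * y0 * y1"
 define c2 where "c2 = - (2 * (1 + a) * y0 * y2 + (1 - a) * (1 - b) * y1 * y3)"
 define S where "S = (1 - a) * y2^2 + (1 + b) * y1^2"
 define d1 where "d1 = (1 - b) * (1 + a) * y1 * y2 * y3 - 2 * y0 * S"
 define d2 where "d2 = y3 * ((1 + a)^2 * y2^2 - (1 - a) * S)"
 have lin: "c1 * x1 + c2 * x2 = 0" "d1 * x1 + d2 * x2 = 0"
  if x: "2 * y0 * x1 = (1 + a) * y2 * x3 - (1 - a) * y3 * x2"
   "2 * y1 * x0 = (1 - a) * y2 * x3 - (1 + a) * y3 * x2"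
   "2 * y0 * x2 = (1 + b) * y3 * x1 - (1 - b) * y1 * x3"
   "2 * y2 * x0 = (1 - b) * y3 * x1 - (1 + b) * y1 * x3" for x0 x1 x2 x3
 proof -
  define R1 where "R1 = 2 * y0 * x1 - (1 + a) * y2 * x3 + (1 - a) * y3 * x2"
  define R2 where "R2 = 2 * y1 * x0 - (1 - a) * y2 * x3 + (1 + a) * y3 * x2"
  define R3 where "R3 = 2 * y0 * x2 - (1 + b) * y3 * x1 + (1 - b) * y1 * x3"
  define R4 where "R4 = 2 * y2 * x0 - (1 - b) * y3 * x1 + (1 + b) * y1 * x3"
  have R: "R1 = 0" "R2 = 0" "R3 = 0" "R4 = 0"
   unfolding R1_def R2_def R3_def R4_def x by simp_all
  have "c1 * x1 + c2 * x2 = - (1 + a) * y2 * R3 - (1 - b) * y1 * R1"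
   unfolding c1_def c2_def R1_def R3_def by (simp add: algebra_simps)
  then show "c1 * x1 + c2 * x2 = 0" by (simp add: R)
  have "d1 * x1 + d2 * x2 = (1 + a) * y2 * (y2 * R2 - y1 * R4) - S * R1"
   unfolding d1_def d2_def R1_def R2_def R4_def S_def by (simp add: algebra_simps power2_eq_square)
  then show "d1 * x1 + d2 * x2 = 0" by (simp add: R)
 qed
 note ez = lin[OF z] and ew = lin[OF w]
 have d12: "z1 * w2 = z2 * w1"
 proof (rule ccontr)
  assume "z1 * w2 ~= z2 * w1"
  then have D: "z1 * w2 - z2 * w1 ~= 0" by simp
  have D': "c * (z1 * w2 - z2 * w1) = 0 & c' * (z1 * w2 - z2 * w1) = 0"
   if "c * z1 + c' * z2 = 0" "c * w1 + c' * w2 = 0" for c c'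
  proof -
   have "c * (z1 * w2 - z2 * w1) = w2 * (c * z1 + c' * z2) - z2 * (c * w1 + c' * w2)"
    "c' * (z1 * w2 - z2 * w1) = z1 * (c * w1 + c' * w2) - w1 * (c * z1 + c' * z2)"
    by (simp_all add: algebra_simps)
   then show ?thesis unfolding that by simp
  qed
  have "c1 * (z1 * w2 - z2 * w1) = 0" "c2 * (z1 * w2 - z2 * w1) = 0"
   "d1 * (z1 * w2 - z2 * w1) = 0" "d2 * (z1 * w2 - z2 * w1) = 0"
   using D'[OF ez(1) ew(1)] D'[OF ez(2) ew(2)] by blast+
  with D have c: "c1 = 0" "c2 = 0" "d1 = 0" "d2 = 0" by auto
  have "y1 ~= 0"
  proof
   assume "y1 = 0"
   with c(1) have "(1 + a) * (1 + b) * y2 * y3 = 0" by (simp add: c1_def)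
   with nz show False by simp
  qed
  \<comment> \<open>Putting \<open>d2 = 0\<close> into \<open>d1\<close> and comparing with
    \<open>c2\<close> leaves a nonzero multiple of y1 y2 y3.\<close>
  have "(1 + a)^2 * y2^2 = (1 - a) * S" using c(4) nz by (simp add: d2_def)
  then have "2 * y0 * ((1 + a)^2 * y2^2) = 2 * y0 * ((1 - a) * S)" by simp
  then have "(1 - a) * d1 = (1 - a) * (1 - b) * (1 + a) * y1 * y2 * y3 - 2 * y0 * ((1 + a)^2 * y2^2)"
   by (simp only: d1_def) (simp add: algebra_simps)
  also have "... = 2 * ((1 - a) * (1 - b) * (1 + a) * y1 * y2 * y3) + (1 + a) * y2 * c2"
   by (simp add: c2_def algebra_simps power2_eq_square)
  finally have "2 * ((1 - a) * (1 - b) * (1 + a) * y1 * y2 * y3) = 0" using c(2,3) by simp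
  with nz two \<open>y1 ~= 0\<close> show False by simp
 qed
 \<comment> \<open>The coefficient of z_3 in the first equation; it is nonzero, so the minors with
   z_3 reduce to the one already treated.\<close>
 define u where "u = (1 + a) * y2"
 have u: "u ~= 0" "u * z3 = 2 * y0 * z1 + (1 - a) * y3 * z2" "u * w3 = 2 * y0 * w1 + (1 - a) * y3 * w2"
  using nz z w by (auto simp: u_def)
 have "u * (z1 * w3) - u * (z3 * w1) = z1 * (u * w3) - (u * z3) * w1" by (simp add: algebra_simps)
 also have "... = (1 - a) * y3 * (z1 * w2 - z2 * w1)" unfolding u(2,3) by (simp add: algebra_simps)
 finally have 1: "u * (z1 * w3) = u * (z3 * w1)" using d12 by simp
 have "u * (z2 * w3) - u * (z3 * w2) = z2 * (u * w3) - (u * z3) * w2" by (simp add: algebra_simps)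
 also have "... = 2 * y0 * (z2 * w1 - z1 * w2)" unfolding u(2,3) by (simp add: algebra_simps)
 finally have 2: "u * (z2 * w3) = u * (z3 * w2)" using d12 by simp
 have d13: "z1 * w3 = z3 * w1" "z2 * w3 = z3 * w2" using u(1) 1 2 by auto
 have "2 * y2 * (z0 * v - x * w0) = (2 * y2 * z0) * v - x * (2 * y2 * w0)" for v x by (simp add: algebra_simps)
 also have "(2 * y2 * z0) * v - x * (2 * y2 * w0) =
   (1 - b) * y3 * (z1 * v - x * w1) - (1 + b) * y1 * (z3 * v - x * w3)" for v x
  unfolding z(4) w(4) by (simp add: algebra_simps)
 finally have *: "2 * y2 * (z0 * v - x * w0) = (1 - b) * y3 * (z1 * v - x * w1) - (1 + b) * y1 * (z3 * v - x * w3)" for v x .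
 have "2 * y2 * (z0 * w1 - z1 * w0) = 0" "2 * y2 * (z0 * w2 - z2 * w0) = 0" "2 * y2 * (z0 * w3 - z3 * w0) = 0"
  unfolding * using d12 d13 by simp_all
 then show ?thesis using d12 d13 nz two by auto
qed

context sklyanin
begin

abbreviation "bil \<equiv> bilin \<alpha> \<beta> \<gamma>"

lemma four_nz: "(4::'k) ~= 0"
proof -
 have "(2::'k) * 2 ~= 0" using two by (metis mult_eq_0_iff)
 then show ?thesis by simp
qed

lemma bil1:
 assumes "bil X1 False y z = 0" "bil X1 True y z = 0"
 shows "2 * y X0 * z X1 = (1 + \<alpha>) * y X2 * z X3 - (1 - \<alpha>) * y X3 * z X2"
  "2 * y X1 * z X0 = (1 - \<alpha>) * y X2 * z X3 - (1 + \<alpha>) * y X3 * z X2"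
proof -
 have e: "y X0 * z X1 - y X1 * z X0 - \<alpha> * (y X2 * z X3) - \<alpha> * (y X3 * z X2) = 0"
  "y X0 * z X1 + y X1 * z X0 - y X2 * z X3 + y X3 * z X2 = 0"
  using assms by (simp_all add: bilin_def sum_gen algebra_simps)
 show "2 * y X0 * z X1 = (1 + \<alpha>) * y X2 * z X3 - (1 - \<alpha>) * y X3 * z X2"
  using arg_cong2[OF e, of "(+)"] by (simp add: algebra_simps)
 show "2 * y X1 * z X0 = (1 - \<alpha>) * y X2 * z X3 - (1 + \<alpha>) * y X3 * z X2"
  using arg_cong2[OF e(2,1), of "(-)"] by (simp add: algebra_simps)
qed

lemma bil2:
 assumes "bil X2 False y z = 0" "bil X2 True y z = 0"
 shows "2 * y X0 * z X2 = (1 + \<beta>) * y X3 * z X1 - (1 - \<beta>) * y X1 * z X3"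
  "2 * y X2 * z X0 = (1 - \<beta>) * y X3 * z X1 - (1 + \<beta>) * y X1 * z X3"
proof -
 have e: "y X0 * z X2 - y X2 * z X0 - \<beta> * (y X3 * z X1) - \<beta> * (y X1 * z X3) = 0"
  "y X0 * z X2 + y X2 * z X0 - y X3 * z X1 + y X1 * z X3 = 0"
  using assms by (simp_all add: bilin_def sum_gen algebra_simps)
 show "2 * y X0 * z X2 = (1 + \<beta>) * y X3 * z X1 - (1 - \<beta>) * y X1 * z X3"
  using arg_cong2[OF e, of "(+)"] by (simp add: algebra_simps)
 show "2 * y X2 * z X0 = (1 - \<beta>) * y X3 * z X1 - (1 + \<beta>) * y X1 * z X3"
  using arg_cong2[OF e(2,1), of "(-)"] by (simp add: algebra_simps)
qed

lemma bil3:
 assumes "bil X3 False y z = 0" "bil X3 True y z = 0"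
 shows "2 * y X0 * z X3 = (1 + \<gamma>) * y X1 * z X2 - (1 - \<gamma>) * y X2 * z X1"
  "2 * y X3 * z X0 = (1 - \<gamma>) * y X1 * z X2 - (1 + \<gamma>) * y X2 * z X1"
proof -
 have e: "y X0 * z X3 - y X3 * z X0 - \<gamma> * (y X1 * z X2) - \<gamma> * (y X2 * z X1) = 0"
  "y X0 * z X3 + y X3 * z X0 - y X1 * z X2 + y X2 * z X1 = 0"
  using assms by (simp_all add: bilin_def sum_gen algebra_simps)
 show "2 * y X0 * z X3 = (1 + \<gamma>) * y X1 * z X2 - (1 - \<gamma>) * y X2 * z X1"
  using arg_cong2[OF e, of "(+)"] by (simp add: algebra_simps)
 show "2 * y X3 * z X0 = (1 - \<gamma>) * y X1 * z X2 - (1 + \<gamma>) * y X2 * z X1"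
  using arg_cong2[OF e(2,1), of "(-)"] by (simp add: algebra_simps)
qed

lemma all_minors:
 assumes "z X0 * w X1 = z X1 * w X0 & z X0 * w X2 = z X2 * w X0 & z X0 * w X3 = z X3 * w X0 &
  z X1 * w X2 = z X2 * w X1 & z X1 * w X3 = z X3 * w X1 & z X2 * w X3 = z X3 * (w X2 :: 'k)"
 shows "z i * w j = z j * w i"
 using assms by (cases i; cases j) (simp_all add: mult.commute)

text \<open>The relations are invariant under the cyclic exchange of x_1, x_2, x_3 together with
  \<alpha>, \<beta>, \<gamma>, so one computation serves for all three pairs of degrees.\<close>

lemma blocks_rank:
 assumes z: "!!s. bil h s y z = 0" "!!s. bil h' s y z = 0"
  and w: "!!s. bil h s y w = 0" "!!s. bil h' s y w = 0"
  and h: "h = X1 & h' = X2 & y X2 ~= 0 & y X3 ~= 0 \<or> h = X2 & h' = X3 & y X3 ~= 0 & y X1 ~= 0 \<or>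
   h = X3 & h' = X1 & y X1 ~= 0 & y X2 ~= 0"
 shows "z i * w j = z j * w i"
 using h
proof (elim disjE conjE)
 assume *: "h = X1" "h' = X2" "y X2 ~= 0" "y X3 ~= 0"
 show ?thesis
  using two_blocks_rank[OF two par_nz(4,7,5,8) *(3,4) bil1[of y z] bil2[of y z] bil1[of y w] bil2[of y w]]
   z w * by (intro all_minors) auto
next
 assume *: "h = X2" "h' = X3" "y X3 ~= 0" "y X1 ~= 0"
 show ?thesis
  using two_blocks_rank[OF two par_nz(5,8,6,9) *(3,4) bil2[of y z] bil3[of y z] bil2[of y w] bil3[of y w]]
   z w * by (intro all_minors) (auto simp: mult.commute)
next
 assume *: "h = X3" "h' = X1" "y X1 ~= 0" "y X2 ~= 0"
 show ?thesis
  using two_blocks_rank[OF two par_nz(6,9,4,7) *(3,4) bil3[of y z] bil1[of y z] bil3[of y w] bil1[of y w]]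
   z w * by (intro all_minors) (auto simp: mult.commute)
qed

lemma degree_two_minors:
 fixes a :: 'k
 assumes "- x1 - a * x2 - a * x3 = 0" "x1 - x2 + x3 = 0"
  "- w1 - a * w2 - a * w3 = 0" "w1 - w2 + w3 = 0" "1 + a ~= 0"
 shows "x1 * w2 = x2 * w1 & x1 * w3 = x3 * w1 & x2 * w3 = x3 * w2"
proof -
 have x1: "x1 = x2 - x3" "w1 = w2 - w3" using assms(2,4) by (simp_all add: algebra_simps)
 have x2: "(1 + a) * x2 = (1 - a) * x3" "(1 + a) * w2 = (1 - a) * w3"
  using assms(1,3) unfolding x1 by (simp_all add: algebra_simps)
 have "(1 + a) * (x2 * w3) - (1 + a) * (x3 * w2) = ((1 + a) * x2) * w3 - x3 * ((1 + a) * w2)"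
  by (simp add: algebra_simps)
 then have "(1 + a) * (x2 * w3) = (1 + a) * (x3 * w2)" unfolding x2 by simp
 then have "x2 * w3 = x3 * w2" using assms(5) by simp
 then show ?thesis unfolding x1 by (simp add: algebra_simps)
qed

text \<open>Once the coordinate \<open>X0\<close> is 0, each degree leaves two equations in three
  unknowns. They are independent: in degree 0 because \<alpha> + \<beta> is nonzero, in the other
  degrees because 1 + \<alpha>, 1 + \<beta>, 1 + \<gamma> are.\<close>

lemma degree_two_rank:
 assumes "x X0 = 0" "x' X0 = 0"
  and x: "!!s. (\<Sum>i\<in>UNIV. rel \<alpha> \<beta> \<gamma> h s i * x i) = 0"
  and x': "!!s. (\<Sum>i\<in>UNIV. rel \<alpha> \<beta> \<gamma> h s i * x' i) = 0"
 shows "x i * x' j = x j * (x' i :: 'k)"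
proof -
 have "(x X1 * x' X2 = x X2 * x' X1) & (x X1 * x' X3 = x X3 * x' X1) & (x X2 * x' X3 = x X3 * x' X2)"
 proof (cases h)
  case X0
  define c d where "c = (1 + \<alpha>) / (1 - \<beta>)" and "d = (1 - \<alpha>) / (1 + \<gamma>)"
  have c: "(1 - \<beta>) * c = 1 + \<alpha>" "(1 + \<gamma>) * d = 1 - \<alpha>" by (simp_all add: c_def d_def)
  have e: "x X1 + x X2 + x X3 = 0" "x X1 + c * x X2 + d * x X3 = 0"
   "x' X1 + x' X2 + x' X3 = 0" "x' X1 + c * x' X2 + d * x' X3 = 0"
   using x[of False] x[of True] x'[of False] x'[of True] assms(1,2) X0 by (auto simp: sum_gen c_def d_def)
  have x1: "x X1 = - x X2 - x X3" "x' X1 = - x' X2 - x' X3" using e(1,3) by (simp_all add: algebra_simps eq_neg_iff_add_eq_0)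
  have f: "(c - 1) * x X2 = (1 - d) * x X3" "(c - 1) * x' X2 = (1 - d) * x' X3"
   using e(2,4) unfolding x1 by (simp_all add: algebra_simps)
  have "(c - 1) * (x X2 * x' X3) - (c - 1) * (x X3 * x' X2) = ((c - 1) * x X2) * x' X3 - x X3 * ((c - 1) * x' X2)"
   by (simp add: algebra_simps)
  then have "(c - 1) * (x X2 * x' X3) = (c - 1) * (x X3 * x' X2)" unfolding f by simp
  moreover have "(1 - \<beta>) * (c - 1) = \<alpha> + \<beta>" using c(1) by (simp add: right_diff_distrib)
  then have "c - 1 ~= 0" using par_sum_nz by auto
  ultimately have "x X2 * x' X3 = x X3 * x' X2" by simp
  then show ?thesis unfolding x1 by (simp add: algebra_simps)
 next
  case X1
  have "x X1 * x' X2 = x X2 * x' X1 & x X1 * x' X3 = x X3 * x' X1 & x X2 * x' X3 = x X3 * x' X2"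
   by (rule degree_two_minors[of _ \<alpha>])
    (use x[of False] x[of True] x'[of False] x'[of True] assms(1,2) X1 in \<open>simp_all add: sum_gen algebra_simps\<close>)
  then show ?thesis by (simp add: algebra_simps)
 next
  case X2
  have "x X2 * x' X3 = x X3 * x' X2 & x X2 * x' X1 = x X1 * x' X2 & x X3 * x' X1 = x X1 * x' X3"
   by (rule degree_two_minors[of _ \<beta>])
    (use x[of False] x[of True] x'[of False] x'[of True] assms(1,2) X2 in \<open>simp_all add: sum_gen algebra_simps\<close>)
  then show ?thesis by (simp add: algebra_simps)
 next
  case X3
  have "x X3 * x' X1 = x X1 * x' X3 & x X3 * x' X2 = x X2 * x' X3 & x X1 * x' X2 = x X2 * x' X1"
   by (rule degree_two_minors[of _ \<gamma>])
    (use x[of False] x[of True] x'[of False] x'[of True] assms(1,2) X3 in \<open>simp_all add: sum_gen algebra_simps\<close>)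
  then show ?thesis by (simp add: algebra_simps)
 qed
 then show ?thesis using assms(1,2) by (intro all_minors) auto
qed

text \<open>The functionals on words of length n that kill the ideal generated by the eight
  relations, in other words the dual space of the degree-n part of B.\<close>

definition relation_free :: "nat => (gen list => 'k) => bool" where
 "relation_free n \<phi> \<longleftrightarrow> (ALL u v h s. length u + length v + 2 = n -->
   (\<Sum>i\<in>UNIV. rel \<alpha> \<beta> \<gamma> h s i * \<phi> (u @ i # (i \<boxplus> h) # v)) = 0)"

lemma relation_freeD:
 "relation_free n \<phi> ==> length u + length v + 2 = n ==>
  (\<Sum>i\<in>UNIV. rel \<alpha> \<beta> \<gamma> h s i * \<phi> (u @ i # (i \<boxplus> h) # v)) = 0"
 by (simp add: relation_free_def)

lemma relation_free_Cons:
 assumes "relation_free (Suc n) \<phi>"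
 shows "relation_free n (%w. \<phi> (j # w))"
 unfolding relation_free_def
proof (intro allI impI)
 fix u v :: "gen list" and h s assume "length u + length v + 2 = n"
 then show "(\<Sum>i\<in>UNIV. rel \<alpha> \<beta> \<gamma> h s i * \<phi> (j # u @ i # (i \<boxplus> h) # v)) = 0"
  using relation_freeD[OF assms, of "j # u" v] by simp
qed

lemma relation_free_snoc:
 assumes "relation_free (Suc n) \<phi>"
 shows "relation_free n (%w. \<phi> (w @ [j]))"
 unfolding relation_free_def
proof (intro allI impI)
 fix u v :: "gen list" and h s assume "length u + length v + 2 = n"
 then show "(\<Sum>i\<in>UNIV. rel \<alpha> \<beta> \<gamma> h s i * \<phi> ((u @ i # (i \<boxplus> h) # v) @ [j])) = 0"
  using relation_freeD[OF assms, of u "v @ [j]"] by simp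
qed

end

text \<open>Points are abstract indices with chosen coordinate vectors \<open>Y p\<close>;
  \<open>Y_inj\<close> and \<open>Y_surj\<close> make them the projective solutions of the two
  quadrics. Of the translation only its bijectivity and the relations between consecutive points are
  kept.\<close>

locale sklyanin_curve = sklyanin \<alpha> \<beta> \<gamma> for \<alpha> \<beta> \<gamma> :: "'k::alg_closed_field" +
 fixes E :: "'p set" and \<sigma> :: "'p => 'p" and Y :: "'p => gen => 'k"
 assumes bij: "bij_betw \<sigma> E E"
  and Y_nz: "!!p. p \<in> E ==> EX i. Y p i ~= 0"
  and eq1: "!!p. p \<in> E ==> (Y p X0)\<^sup>2 + (Y p X1)\<^sup>2 + (Y p X2)\<^sup>2 + (Y p X3)\<^sup>2 = 0"
  and eq2: "!!p. p \<in> E ==>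
   (Y p X3)\<^sup>2 + (1 - \<gamma>) / (1 + \<alpha>) * (Y p X1)\<^sup>2 + (1 + \<gamma>) / (1 - \<beta>) * (Y p X2)\<^sup>2 = 0"
  and Y_inj: "!!p q c. p \<in> E ==> q \<in> E ==> (!!i. Y q i = c * Y p i) ==> p = q"
  and Y_surj: "!!y. EX i. y i ~= 0 ==> (y X0)\<^sup>2 + (y X1)\<^sup>2 + (y X2)\<^sup>2 + (y X3)\<^sup>2 = 0 ==>
   (y X3)\<^sup>2 + (1 - \<gamma>) / (1 + \<alpha>) * (y X1)\<^sup>2 + (1 + \<gamma>) / (1 - \<beta>) * (y X2)\<^sup>2 = 0 ==>
   \<exists>p\<in>E. EX c. c ~= 0 & (ALL i. Y p i = c * y i)"
  and shift: "!!p h s. p \<in> E ==> bilin \<alpha> \<beta> \<gamma> h s (Y p) (Y (\<sigma> p)) = 0"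
begin

lemma \<sigma>_in [simp, intro]: "p \<in> E ==> \<sigma> p \<in> E"
 using bij by (auto simp: bij_betw_def)

lemma \<sigma>_pow_in [simp, intro]: "p \<in> E ==> (\<sigma> ^^ n) p \<in> E"
 by (induction n) auto

lemma \<sigma>_inj: "inj_on \<sigma> E"
 using bij by (auto simp: bij_betw_def)

lemma \<sigma>_pow_inj: "inj_on (\<sigma> ^^ n) E"
proof (induction n)
 case (Suc n)
 have "(\<sigma> ^^ n) ` E <= E" by auto
 then show ?case using comp_inj_on[OF Suc inj_on_subset[OF \<sigma>_inj]] by (simp add: o_def)
qed simp

lemma \<sigma>_pow_surj: "(\<sigma> ^^ n) ` E = E"
proof (induction n)
 case (Suc n)
 have "(\<sigma> ^^ Suc n) ` E = \<sigma> ` (\<sigma> ^^ n) ` E" by (simp add: image_comp)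
 then show ?case using Suc bij by (simp add: bij_betw_def)
qed simp

lemma eq2':
 assumes "p \<in> E"
 shows "(1 + \<alpha>) * (1 - \<beta>) * (Y p X3)\<^sup>2 + (1 - \<gamma>) * (1 - \<beta>) * (Y p X1)\<^sup>2 + (1 + \<gamma>) * (1 + \<alpha>) * (Y p X2)\<^sup>2 = 0"
proof -
 define A B where "A = (1 - \<gamma>) / (1 + \<alpha>)" and "B = (1 + \<gamma>) / (1 - \<beta>)"
 have "(1 + \<alpha>) * A = 1 - \<gamma>" "(1 - \<beta>) * B = 1 + \<gamma>" by (simp_all add: A_def B_def)
 then have AB: "1 - \<gamma> = (1 + \<alpha>) * A" "1 + \<gamma> = (1 - \<beta>) * B" by simp_all
 have "(1 + \<alpha>) * (1 - \<beta>) * (Y p X3)\<^sup>2 + (1 - \<gamma>) * (1 - \<beta>) * (Y p X1)\<^sup>2 + (1 + \<gamma>) * (1 + \<alpha>) * (Y p X2)\<^sup>2 =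
   (1 + \<alpha>) * (1 - \<beta>) * ((Y p X3)\<^sup>2 + A * (Y p X1)\<^sup>2 + B * (Y p X2)\<^sup>2)"
  unfolding AB by (simp add: algebra_simps)
 then show ?thesis using eq2[OF assms] by (simp add: A_def B_def)
qed

text \<open>Setting two coordinates to 0 turns the two quadrics into linear equations for the two
  remaining squares. Their determinants are nonzero by \<open>par_sum_nz\<close> and the parameter
  equation.\<close>

lemma one_zero:
 assumes p: "p \<in> E" and "i ~= j" "Y p i = 0"
 shows "Y p j ~= 0"
proof
 assume "Y p j = 0"
 note e = eq1[OF p] eq2'[OF p]
 define E1 where "E1 = (Y p X0)\<^sup>2 + (Y p X1)\<^sup>2 + (Y p X2)\<^sup>2 + (Y p X3)\<^sup>2"
 define E2 where "E2 = (1 + \<alpha>) * (1 - \<beta>) * (Y p X3)\<^sup>2 + (1 - \<gamma>) * (1 - \<beta>) * (Y p X1)\<^sup>2 + (1 + \<gamma>) * (1 + \<alpha>) * (Y p X2)\<^sup>2"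
 have E: "E1 = 0" "E2 = 0" using e by (simp_all add: E1_def E2_def)
 have nz: "\<alpha> + \<beta> ~= 0" "\<beta> + \<gamma> ~= 0" "\<alpha> + \<gamma> ~= 0" by (rule par_sum_nz)+
 have N: "False" if "Y p X0 = 0" "Y p X1 = 0" "Y p X2 = 0" "Y p X3 = 0"
  using Y_nz[OF p] that by (metis gen.exhaust)
 have "Y p X1 = 0 ==> Y p X2 = 0 ==> False" "Y p X1 = 0 ==> Y p X3 = 0 ==> False"
  "Y p X2 = 0 ==> Y p X3 = 0 ==> False" using e N by auto
 moreover have "False" if 0: "Y p X0 = 0" "Y p X1 = 0"
 proof -
  have "(1 + \<alpha>) * (\<beta> + \<gamma>) * (Y p X2)\<^sup>2 = E2 - (1 + \<alpha>) * (1 - \<beta>) * E1"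
   unfolding E1_def E2_def 0 by (simp add: algebra_simps)
  then have "Y p X2 = 0" using nz E par0 by simp
  with e 0 N show False by simp
 qed
 moreover have "False" if 0: "Y p X0 = 0" "Y p X2 = 0"
 proof -
  have "(1 - \<beta>) * (\<alpha> + \<gamma>) * (Y p X1)\<^sup>2 = (1 + \<alpha>) * (1 - \<beta>) * E1 - E2"
   unfolding E1_def E2_def 0 by (simp add: algebra_simps)
  then have "Y p X1 = 0" using nz E par0 by simp
  with e 0 N show False by simp
 qed
 moreover have "False" if 0: "Y p X0 = 0" "Y p X3 = 0"
 proof -
  have "\<gamma> * (1 + \<alpha>) * (1 - \<beta>) * (Y p X1)\<^sup>2 = (1 + \<gamma>) * (1 + \<alpha>) * E1 - E2 - (\<alpha> + \<beta> + \<gamma> + \<alpha> * \<beta> * \<gamma>) * (Y p X1)\<^sup>2"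
   unfolding E1_def E2_def 0 by (simp add: algebra_simps)
  then have "Y p X1 = 0" using E par0 by simp
  with e 0 N show False by simp
 qed
 ultimately show False using assms(2,3) \<open>Y p j = 0\<close> by (cases i; cases j) auto
qed

text \<open>At least two of y_1, y_2, y_3 are nonzero by \<open>one_zero\<close>, and each such pair
  selects two degrees whose four equations already have a solution space of dimension one. The
  relations thus determine the next point from the current one.\<close>

lemma bil_unique:
 assumes p: "p \<in> E" and z: "!!h s. bil h s (Y p) z = 0"
 shows "EX c. ALL i. z i = c * Y (\<sigma> p) i"
proof -
 obtain l where "Y (\<sigma> p) l ~= 0" using Y_nz p by blast
 moreover have "z i * Y (\<sigma> p) j = z j * Y (\<sigma> p) i" for i j
 proof -
  consider "Y p X2 ~= 0" "Y p X3 ~= 0" | "Y p X3 ~= 0" "Y p X1 ~= 0" | "Y p X1 ~= 0" "Y p X2 ~= 0"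
   using one_zero[OF p] by (metis gen.distinct(7,9,11))
  then show ?thesis
   by cases (rule blocks_rank[OF z z shift[OF p] shift[OF p], of X1 X2] blocks_rank[OF z z shift[OF p] shift[OF p], of X2 X3]
    blocks_rank[OF z z shift[OF p] shift[OF p], of X3 X1]; simp)+
 qed
 ultimately show ?thesis by (intro proportional)
qed

text \<open>When y_1, y_2, y_3 are all nonzero, any two of the three degrees suffice, so the
  relations of one degree may be missing. This occurs after a prefix of length 1, which cannot have
  every degree without vanishing.\<close>

lemma bil_unique_excl:
 assumes p: "p \<in> E" and z: "!!h s. h ~= h0 ==> bil h s (Y p) z = 0"
  and nz: "Y p X1 ~= 0" "Y p X2 ~= 0" "Y p X3 ~= 0"
 shows "EX c. ALL i. z i = c * Y (\<sigma> p) i"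
proof -
 obtain l where "Y (\<sigma> p) l ~= 0" using Y_nz p by blast
 moreover have "z i * Y (\<sigma> p) j = z j * Y (\<sigma> p) i" for i j
 proof -
  consider "h0 ~= X1" "h0 ~= X2" | "h0 ~= X2" "h0 ~= X3" | "h0 ~= X3" "h0 ~= X1" by (metis gen.distinct(7,9,11))
  then show ?thesis
  proof cases
   case 1 then show ?thesis by (intro blocks_rank[OF z z shift[OF p] shift[OF p], of X1 X2]) (use nz in auto)
  next
   case 2 then show ?thesis by (intro blocks_rank[OF z z shift[OF p] shift[OF p], of X2 X3]) (use nz in auto)
  next
   case 3 then show ?thesis by (intro blocks_rank[OF z z shift[OF p] shift[OF p], of X3 X1]) (use nz in auto)
  qed
 qed
 ultimately show ?thesis by (intro proportional)
qed

text \<open>In the point module of p, with suitable generators of the pieces, the word w sends the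
  generator in degree 0 to \<open>ev p w\<close> times the generator in degree
  \<open>length w\<close>.\<close>

primrec ev :: "'p => gen list => 'k" where
 "ev p [] = 1"
| "ev p (i # w) = Y p i * ev (\<sigma> p) w"

lemma ev_append: "ev p (u @ v) = ev p u * ev ((\<sigma> ^^ length u) p) v"
 by (induction u arbitrary: p) (simp_all add: funpow_swap1)

lemma relation_free_ev:
 assumes "p \<in> E"
 shows "relation_free n (ev p)"
 unfolding relation_free_def
proof (intro allI impI)
 fix u v :: "gen list" and h s
 let ?p = "(\<sigma> ^^ length u) p"
 assume "length u + length v + 2 = n"
 have "(\<Sum>i\<in>UNIV. rel \<alpha> \<beta> \<gamma> h s i * ev p (u @ i # (i \<boxplus> h) # v)) =
  ev p u * ev (\<sigma> (\<sigma> ?p)) v * bil h s (Y ?p) (Y (\<sigma> ?p))"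
  unfolding bilin_def by (simp add: ev_append sum_distrib_left mult_ac)
 then show "(\<Sum>i\<in>UNIV. rel \<alpha> \<beta> \<gamma> h s i * ev p (u @ i # (i \<boxplus> h) # v)) = 0"
  using shift[of ?p] assms by simp
qed

end

lemma infinite_alg_closed: "infinite (UNIV :: 'a::alg_closed_field set)"
proof
 assume fin: "finite (UNIV :: 'a set)"
 define p where "p = (\<Prod>a\<in>UNIV. [:- a, 1 :: 'a:])"
 have "degree p = card (UNIV :: 'a set)" unfolding p_def by (subst degree_prod_eq_sum_degree) auto
 then have "degree p > 0" using fin by (simp add: card_gt_0_iff)
 then have "degree (p + [:1:]) > 0" by (subst degree_add_eq_left) auto
 then obtain x where "poly (p + [:1:]) x = 0" using alg_closed_imp_poly_has_root by blast
 moreover have "poly p x = 0" using fin by (simp add: p_def poly_prod)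
 ultimately show False by simp
qed

context sklyanin_curve
begin

subsection \<open>Relation-free functionals vanishing on words that start with $x_0$\<close>

text \<open>With y_0 = 0 the first equation of each block has only two terms left, so z_1, z_2, z_3
  vanish all together or not at all; by \<open>one_zero\<close> they cannot all vanish.\<close>

lemma translate_X0_nz:
 assumes q: "q \<in> E" "Y q X0 = 0"
 shows "Y (\<sigma> q) X1 ~= 0 & Y (\<sigma> q) X2 ~= 0 & Y (\<sigma> q) X3 ~= 0"
proof -
 have nz: "Y q X1 ~= 0" "Y q X2 ~= 0" "Y q X3 ~= 0"
  using one_zero[OF q(1), of X0] q(2) by auto
 have "(1 + \<alpha>) * Y q X2 * Y (\<sigma> q) X3 = (1 - \<alpha>) * Y q X3 * Y (\<sigma> q) X2"
  "(1 + \<beta>) * Y q X3 * Y (\<sigma> q) X1 = (1 - \<beta>) * Y q X1 * Y (\<sigma> q) X3"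
  "(1 + \<gamma>) * Y q X1 * Y (\<sigma> q) X2 = (1 - \<gamma>) * Y q X2 * Y (\<sigma> q) X1"
  using bil1(1)[OF shift shift, of q] bil2(1)[OF shift shift, of q] bil3(1)[OF shift shift, of q] q by auto
 then have "(Y (\<sigma> q) X3 = 0 \<longleftrightarrow> Y (\<sigma> q) X2 = 0) & (Y (\<sigma> q) X3 = 0 \<longleftrightarrow> Y (\<sigma> q) X1 = 0)"
  using nz par_nz by (metis mult_eq_0_iff)
 then show ?thesis using one_zero[of "\<sigma> q"] q by (metis \<sigma>_in gen.distinct(11))
qed

text \<open>The exception in length 1 is forced: the only word of degree 0 is then x_0, which
  vanishes at q. In length 2 there is enough choice because at most one coordinate of \<sigma>(q)
  vanishes, and longer words are extended by any nonvanishing coordinate.\<close>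

lemma word_of_degree:
 assumes q: "q \<in> E" "Y q X0 = 0" and n: "n >= 2 \<or> n = 1 & g ~= X0"
 shows "EX w. length w = n & word_deg w = g & ev q w ~= 0"
proof -
 have nz: "i ~= X0 ==> Y q i ~= 0" for i using one_zero[OF q(1), of X0] q(2) by auto
 have 2: "EX w. length w = 2 & word_deg w = g & ev q w ~= 0" for g
 proof -
  have "Y (\<sigma> q) (X1 \<boxplus> g) ~= 0 \<or> Y (\<sigma> q) (X2 \<boxplus> g) ~= 0"
   using one_zero[of "\<sigma> q" "X1 \<boxplus> g" "X2 \<boxplus> g"] q by (cases g) auto
  then obtain i where "i ~= X0" "Y (\<sigma> q) (i \<boxplus> g) ~= 0" by blast
  then show ?thesis using nz by (intro exI[of _ "[i, i \<boxplus> g]"]) auto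
 qed
 have "EX w. length w = n & word_deg w = g & ev q w ~= 0" if "n >= 2" for n g
  using that
 proof (induction n arbitrary: g rule: nat_induct_at_least)
  case base then show ?case by (rule 2)
 next
  case (Suc n)
  let ?p = "(\<sigma> ^^ n) q"
  obtain j where j: "Y ?p j ~= 0" using Y_nz q by blast
  obtain w where "length w = n" "word_deg w = g \<boxplus> j" "ev q w ~= 0" using Suc.IH by blast
  then show ?case using j by (intro exI[of _ "w @ [j]"]) (simp add: ev_append)
 qed
 moreover have "EX w. length w = 1 & word_deg w = g & ev q w ~= 0" if "g ~= X0"
  using nz[OF that] by (intro exI[of _ "[g]"]) simp
 ultimately show ?thesis using n by blast
qed

text \<open>The functionals in question form the dual of B_n / x_0 B_{n-1}, and the functions on the
  right are the combinations of the evaluations at the sign changes of q, which lie on the plane y_0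
  = 0. The induction strips the last letter, so that the condition on the first letter is
  preserved.\<close>

lemma relation_free_kernel:
 assumes q: "q \<in> E" "Y q X0 = 0"
 shows "n >= 1 ==> relation_free n \<phi> ==> (!!w. length w + 1 = n ==> \<phi> (X0 # w) = 0) ==>
  EX a. ALL w. length w = n --> \<phi> w = a (word_deg w) * ev q w"
proof (induction n arbitrary: \<phi>)
 case 0 then show ?case by simp
next
 case (Suc m)
 have nz: "i ~= X0 ==> Y q i ~= 0" for i using one_zero[OF q(1), of X0] q(2) by auto
 consider "m = 0" | "m = 1" | "m >= 2" by linarith
 then show ?case
 proof cases
  case 1
  have "\<phi> [X0] = 0" using Suc.prems(3)[of "[]"] 1 by simp
  then have "\<phi> [i] = \<phi> [i] / Y q i * Y q i" for i using nz[of i] by (cases "i = X0") auto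
  then show ?thesis using 1
   by (intro exI[of _ "%g. \<phi> [g] / Y q g"]) (auto simp: length_Suc_conv)
 next
  case 2
  have "EX c. ALL i. \<phi> [i, i \<boxplus> h] = c * ev q [i, i \<boxplus> h]" for h
  proof -
   obtain i where i: "ev q [i, i \<boxplus> h] ~= 0"
   proof -
    obtain w where w: "length w = 2" "word_deg w = h" "ev q w ~= 0" using word_of_degree[OF q, of 2 h] by auto
    then obtain i j where ij: "w = [i, j]" by (auto simp: length_Suc_conv numeral_2_eq_2)
    then have "j = i \<boxplus> h" using w(2) by auto
    then show ?thesis using that w ij by blast
   qed
   have "\<phi> [i, i \<boxplus> h] * ev q [j, j \<boxplus> h] = \<phi> [j, j \<boxplus> h] * ev q [i, i \<boxplus> h]" for i j
    by (rule degree_two_rank[of "%i. \<phi> [i, i \<boxplus> h]" "%i. ev q [i, i \<boxplus> h]" h])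
     (use Suc.prems(3)[of "[h]"] 2 q relation_freeD[OF Suc.prems(2), of "[]" "[]"]
      relation_freeD[OF relation_free_ev[OF q(1)], of "[]" "[]" 2] in auto)
   then show ?thesis using i by (intro proportional[of "%i. \<phi> [i, i \<boxplus> h]"])
  qed
  then obtain a where a: "!!h i. \<phi> [i, i \<boxplus> h] = a h * ev q [i, i \<boxplus> h]" by metis
  have "\<phi> [i, j] = a (i \<boxplus> j) * ev q [i, j]" for i j using a[of i "i \<boxplus> j"] by simp
  then show ?thesis using 2 by (intro exI[of _ a]) (auto simp: length_Suc_conv)
 next
  case 3
  have "EX a. ALL w. length w = m --> \<phi> (w @ [j]) = a (word_deg w) * ev q w" for j
   by (rule Suc.IH) (use 3 Suc.prems(3)[of "_ @ [j]"] relation_free_snoc[OF Suc.prems(2)] in auto)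
  then obtain A where A: "!!j w. length w = m ==> \<phi> (w @ [j]) = A j (word_deg w) * ev q w" by metis
  obtain l where m: "m = Suc l" "l >= 1" using 3 by (cases m) auto
  let ?p = "(\<sigma> ^^ l) q"
  have pE: "?p \<in> E" using q by auto
  \<comment> \<open>A relation in the last two letters, placed after a prefix u of degree h + s. All
    words involved have degree h, so \<open>ev q u\<close> factors out and what is left is a
    bilinear relation for the unknown coefficients of degree h.\<close>
  have bil: "bil s t (Y ?p) (%j. A j (h \<boxplus> j)) = 0" if ls: "l >= 2 \<or> s ~= h" for h s t
  proof -
   obtain u where u: "length u = l" "word_deg u = h \<boxplus> s" "ev q u ~= 0"
    using word_of_degree[OF q, of l "h \<boxplus> s"] ls m(2) by (cases "l = 1") auto
   have "0 = (\<Sum>i\<in>UNIV. rel \<alpha> \<beta> \<gamma> s t i * \<phi> (u @ i # (i \<boxplus> s) # []))"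
    using relation_freeD[OF Suc.prems(2), of u "[]"] u(1) m by simp
   also have "... = (\<Sum>i\<in>UNIV. ev q u * (rel \<alpha> \<beta> \<gamma> s t i * Y ?p i * A (i \<boxplus> s) (h \<boxplus> (i \<boxplus> s))))"
   proof (rule sum.cong[OF refl])
    fix i
    have "\<phi> (u @ i # (i \<boxplus> s) # []) = A (i \<boxplus> s) (word_deg (u @ [i])) * ev q (u @ [i])"
     using A[of "u @ [i]" "i \<boxplus> s"] u(1) m by simp
    also have "word_deg (u @ [i]) = h \<boxplus> (i \<boxplus> s)" using u(2) by (simp add: gadd_assoc gadd_comm gadd_lcomm)
    finally show "rel \<alpha> \<beta> \<gamma> s t i * \<phi> (u @ i # (i \<boxplus> s) # []) =
      ev q u * (rel \<alpha> \<beta> \<gamma> s t i * Y ?p i * A (i \<boxplus> s) (h \<boxplus> (i \<boxplus> s)))"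
     using u(1) by (simp add: ev_append)
   qed
   also have "... = ev q u * bil s t (Y ?p) (%j. A j (h \<boxplus> j))"
    by (simp add: bilin_def sum_distrib_left)
   finally show ?thesis using u(3) by simp
  qed
  have "EX c. ALL j. A j (h \<boxplus> j) = c * Y (\<sigma> ?p) j" for h
  proof (cases "l >= 2")
   case True
   then show ?thesis by (intro bil_unique[OF pE] bil) auto
  next
   case False
   then have "l = 1" using m by simp
   then show ?thesis using translate_X0_nz[OF q] by (intro bil_unique_excl[OF pE, of h] bil) auto
  qed
  then obtain c where c: "!!h j. A j (h \<boxplus> j) = c h * Y (\<sigma> ?p) j" by metis
  have "\<phi> w = c (word_deg w) * ev q w" if len: "length w = Suc m" for w
  proof -
   obtain u j where w: "w = u @ [j]" "length u = m" using len by (cases w rule: rev_cases) auto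
   have "\<phi> w = A j (word_deg w \<boxplus> j) * ev q u" using A[OF w(2)] w(1) by simp
   also have "... = c (word_deg w) * ev q w" unfolding c using w m by (simp add: ev_append)
   finally show ?thesis .
  qed
  then show ?thesis by blast
 qed
qed

subsection \<open>Plane sections of the curve\<close>

definition c1 :: 'k where "c1 = (1 - \<gamma>) / (1 + \<alpha>)"
definition c2 :: 'k where "c2 = (1 + \<gamma>) / (1 - \<beta>)"

text \<open>The coefficients of y_0^2, y_1^2, y_2^2, y_3^2 in the two quadrics are (1, 0), (1, c1),
  (1, c2), (1, 1). These columns are pairwise independent, which expresses the smoothness of
  E.\<close>

lemma c12_nz: "c1 ~= 0" "c2 ~= 0" "c1 ~= 1" "c2 ~= 1" "c1 ~= c2"
proof -
 show "c1 ~= 0" "c2 ~= 0" by (simp_all add: c1_def c2_def)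
 have "(1 + \<alpha>) * c1 = 1 - \<gamma>" by (simp add: c1_def)
 then have "(1 + \<alpha>) * (c1 - 1) = - (\<alpha> + \<gamma>)" by (simp add: right_diff_distrib)
 then show "c1 ~= 1" using par_sum_nz by (metis cancel_comm_monoid_add_class.diff_cancel mult_zero_right neg_equal_0_iff_equal)
 have "(1 - \<beta>) * c2 = 1 + \<gamma>" by (simp add: c2_def)
 then have "(1 - \<beta>) * (c2 - 1) = \<beta> + \<gamma>" by (simp add: right_diff_distrib)
 then show "c2 ~= 1" using par_sum_nz by auto
 have "(1 + \<alpha>) * (1 - \<beta>) * c1 = (1 - \<beta>) * ((1 + \<alpha>) * c1)" by (simp only: mult_ac)
 also have "(1 + \<alpha>) * c1 = 1 - \<gamma>" by (simp add: c1_def)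
 finally have 1: "(1 + \<alpha>) * (1 - \<beta>) * c1 = (1 - \<beta>) * (1 - \<gamma>)" .
 have "(1 + \<alpha>) * (1 - \<beta>) * c2 = (1 + \<alpha>) * ((1 - \<beta>) * c2)" by (simp only: mult_ac)
 also have "(1 - \<beta>) * c2 = 1 + \<gamma>" by (simp add: c2_def)
 finally have 2: "(1 + \<alpha>) * (1 - \<beta>) * c2 = (1 + \<alpha>) * (1 + \<gamma>)" .
 have "(1 + \<alpha>) * (1 + \<gamma>) - (1 - \<beta>) * (1 - \<gamma>) = (\<alpha> + \<beta> + \<gamma> + \<alpha> * \<beta> * \<gamma>) + \<gamma> * (1 + \<alpha>) * (1 - \<beta>)"
  by (simp add: algebra_simps)
 also have "... = \<gamma> * (1 + \<alpha>) * (1 - \<beta>)" by (simp only: par0) simp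
 finally have "(1 + \<alpha>) * (1 + \<gamma>) - (1 - \<beta>) * (1 - \<gamma>) ~= 0" by simp
 then show "c1 ~= c2" using 1 2 by (metis diff_self)
qed

text \<open>
  On $E$ with $y_1 = 1$, the squares $y_2^2$ and $y_3^2$ are linear functions of $y_0^2$.
\<close>

definition sq2 :: "'k => 'k" where "sq2 s = (1 + s - c1) / (c2 - 1)"
definition sq3 :: "'k => 'k" where "sq3 s = - (1 + s) - sq2 s"

lemma sq23:
 "s + 1 + sq2 s + sq3 s = 0" "sq3 s + c1 + c2 * sq2 s = 0"
proof -
 show "s + 1 + sq2 s + sq3 s = 0" by (simp add: sq3_def)
 have "(c2 - 1) * sq2 s = 1 + s - c1" using c12_nz by (simp add: sq2_def)
 then show "sq3 s + c1 + c2 * sq2 s = 0" by (simp add: sq3_def algebra_simps)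
qed

lemma sq23_unique:
 assumes "s + 1 + a + b = 0" "b + c1 + c2 * a = 0"
 shows "a = sq2 s" "b = sq3 s"
proof -
 have "b = - (1 + s) - a" using assms(1) by (simp add: algebra_simps eq_neg_iff_add_eq_0)
 moreover have "(c2 - 1) * a = (b + c1 + c2 * a) - (s + 1 + a + b) + (1 + s - c1)" by (simp add: algebra_simps)
 then have "(c2 - 1) * a = 1 + s - c1" using assms by simp
 moreover from this have "a = sq2 s" unfolding sq2_def using c12_nz by (subst nonzero_eq_divide_eq) (simp_all add: mult.commute)
 ultimately show "a = sq2 s" "b = sq3 s" by (simp_all add: sq3_def)
qed

lemma point_squares:
 assumes p: "p \<in> E" and nz: "Y p X1 ~= 0"
 shows "(Y p X2 / Y p X1)\<^sup>2 = sq2 ((Y p X0 / Y p X1)\<^sup>2)" "(Y p X3 / Y p X1)\<^sup>2 = sq3 ((Y p X0 / Y p X1)\<^sup>2)"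
proof -
 let ?s = "(Y p X0 / Y p X1)\<^sup>2" and ?a = "(Y p X2 / Y p X1)\<^sup>2" and ?b = "(Y p X3 / Y p X1)\<^sup>2"
 have "?s + 1 + ?a + ?b = ((Y p X0)\<^sup>2 + (Y p X1)\<^sup>2 + (Y p X2)\<^sup>2 + (Y p X3)\<^sup>2) / (Y p X1)\<^sup>2"
  using nz by (simp add: add_divide_distrib power_divide)
 then have e1: "?s + 1 + ?a + ?b = 0" using eq1[OF p] by simp
 have "?b + c1 + c2 * ?a = ((Y p X3)\<^sup>2 + c1 * (Y p X1)\<^sup>2 + c2 * (Y p X2)\<^sup>2) / (Y p X1)\<^sup>2"
  using nz by (simp add: add_divide_distrib power_divide)
 then have e2: "?b + c1 + c2 * ?a = 0" using eq2[OF p] by (simp add: c1_def c2_def)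
 show "?a = sq2 ?s" "?b = sq3 ?s" using sq23_unique[OF e1 e2] .
qed

lemma point_exists:
 assumes "r2\<^sup>2 = sq2 (t\<^sup>2)" "r3\<^sup>2 = sq3 (t\<^sup>2)"
 shows "\<exists>p\<in>E. Y p X1 ~= 0 & Y p X0 = t * Y p X1 & Y p X2 = r2 * Y p X1 & Y p X3 = r3 * Y p X1"
proof -
 define y where "y i = (case i of X0 => t | X1 => 1 | X2 => r2 | X3 => r3)" for i
 have "\<exists>p\<in>E. EX c. c ~= 0 & (ALL i. Y p i = c * y i)"
 proof (rule Y_surj)
  show "EX i. y i ~= 0" by (rule exI[of _ X1]) (simp add: y_def)
  show "(y X0)\<^sup>2 + (y X1)\<^sup>2 + (y X2)\<^sup>2 + (y X3)\<^sup>2 = 0" using sq23(1)[of "t\<^sup>2"] assms by (simp add: y_def)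
  show "(y X3)\<^sup>2 + (1 - \<gamma>) / (1 + \<alpha>) * (y X1)\<^sup>2 + (1 + \<gamma>) / (1 - \<beta>) * (y X2)\<^sup>2 = 0"
   using sq23(2)[of "t\<^sup>2"] assms by (simp add: y_def c1_def c2_def)
 qed
 then obtain p c where "p \<in> E" "c ~= 0" and Y: "!!i. Y p i = c * y i" by blast
 then show ?thesis by (intro bexI[of _ p]) (auto simp: Y y_def)
qed

definition lin :: "(gen => 'k) => 'p => 'k" where
 "lin l p = (\<Sum>i\<in>UNIV. l i * Y p i)"

definition pencil :: "'k => gen => 'k" where
 "pencil t i = (case i of X0 => 1 | X1 => - t | _ => 0)"

lemma lin_pencil: "lin (pencil t) p = Y p X0 - t * Y p X1"
 by (simp add: lin_def sum_gen pencil_def)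

definition psection :: "'k => 'p set" where
 "psection t = {p \<in> E. Y p X0 = t * Y p X1}"

lemma psection_X1:
 assumes "p \<in> psection t"
 shows "Y p X1 ~= 0"
proof
 assume "Y p X1 = 0"
 moreover from this have "Y p X0 = 0" using assms by (simp add: psection_def)
 ultimately show False using one_zero[of p X0 X1] assms by (simp add: psection_def)
qed

lemma psection_points:
 assumes r: "r2\<^sup>2 = sq2 (t\<^sup>2)" "r3\<^sup>2 = sq3 (t\<^sup>2)"
 obtains s where "psection t = {s True True, s True False, s False True, s False False}"
  "!!a b. s a b \<in> E" "!!a b. Y (s a b) X1 ~= 0"
  "!!a b. Y (s a b) X2 = (if a then r2 else - r2) * Y (s a b) X1"
  "!!a b. Y (s a b) X3 = (if b then r3 else - r3) * Y (s a b) X1"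
proof -
 have "\<exists>p\<in>E. Y p X1 ~= 0 & Y p X0 = t * Y p X1 & Y p X2 = (if a then r2 else - r2) * Y p X1 &
   Y p X3 = (if b then r3 else - r3) * Y p X1" for a b
  by (rule point_exists) (use r in auto)
 then obtain s where s: "!!a b. s a b \<in> E" "!!a b. Y (s a b) X1 ~= 0" "!!a b. Y (s a b) X0 = t * Y (s a b) X1"
  "!!a b. Y (s a b) X2 = (if a then r2 else - r2) * Y (s a b) X1"
  "!!a b. Y (s a b) X3 = (if b then r3 else - r3) * Y (s a b) X1" by metis
 have "p \<in> {s True True, s True False, s False True, s False False}" if p: "p \<in> psection t" for p
 proof -
  have pE: "p \<in> E" and p0: "Y p X0 = t * Y p X1" using p by (auto simp: psection_def)
  note nz = psection_X1[OF p]
  have "(Y p X2 / Y p X1)\<^sup>2 = r2\<^sup>2" "(Y p X3 / Y p X1)\<^sup>2 = r3\<^sup>2"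
   using point_squares[OF pE nz] r nz p0 by simp_all
  then have "EX a. Y p X2 / Y p X1 = (if a then r2 else - r2)" "EX b. Y p X3 / Y p X1 = (if b then r3 else - r3)"
   unfolding power2_eq_iff by (metis (full_types))+
  then obtain a b where "Y p X2 / Y p X1 = (if a then r2 else - r2)" "Y p X3 / Y p X1 = (if b then r3 else - r3)"
   by blast
  then have e: "Y p X2 = (if a then r2 else - r2) * Y p X1" "Y p X3 = (if b then r3 else - r3) * Y p X1"
   using nz by (metis nonzero_divide_eq_eq)+
  have "s a b = p"
  proof (rule Y_inj[OF s(1) pE])
   fix i show "Y p i = (Y p X1 / Y (s a b) X1) * Y (s a b) i"
    using e p0 s(2-)[of a b] by (cases i) auto
  qed
  then show ?thesis by (cases a; cases b) auto
 qed
 moreover have "s a b \<in> psection t" for a b using s by (simp add: psection_def)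
 ultimately have "psection t = {s True True, s True False, s False True, s False False}" by auto
 then show thesis using that s by blast
qed

lemma sqrt_exists: "EX r. r\<^sup>2 = (x::'k)"
 by (rule nth_root_exists) simp

lemma finite_psection: "finite (psection t)"
proof -
 obtain r2 r3 where "r2\<^sup>2 = sq2 (t\<^sup>2)" "r3\<^sup>2 = sq3 (t\<^sup>2)" using sqrt_exists by metis
 from psection_points[OF this] show ?thesis by (metis finite.emptyI finite.insertI)
qed

lemma psection_nonempty: "psection t ~= {}"
proof -
 obtain r2 r3 where "r2\<^sup>2 = sq2 (t\<^sup>2)" "r3\<^sup>2 = sq3 (t\<^sup>2)" using sqrt_exists by metis
 from psection_points[OF this] show ?thesis by (metis insert_not_empty)
qed

lemma X0_point: "\<exists>q\<in>E. Y q X0 = 0"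
 using psection_nonempty[of 0] by (auto simp: psection_def)

text \<open>With nonzero square roots the four sign choices give distinct points, and the plane y_2
  = r2 y_1 contains exactly two of them. Separating the section into two pairs allows its
  independence to be proved in two steps.\<close>

lemma psection_split:
 assumes good: "sq2 (t\<^sup>2) ~= 0" "sq3 (t\<^sup>2) ~= 0"
 obtains l s1 s2 s3 s4 where "psection t = {s1, s2, s3, s4}" "distinct [s1, s2, s3, s4]"
  "lin l s1 = 0" "lin l s2 = 0" "lin l s3 ~= 0" "lin l s4 ~= 0"
proof -
 obtain r2 r3 where r: "r2\<^sup>2 = sq2 (t\<^sup>2)" "r3\<^sup>2 = sq3 (t\<^sup>2)" using sqrt_exists by metis
 then have nz: "r2 ~= 0" "r3 ~= 0" using good by auto
 have neg: "r ~= - r" if "r ~= 0" for r :: 'k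
 proof
  assume "r = - r"
  then have "r + r = 0" by (metis add.right_inverse)
  then have "2 * r = 0" by (simp only: mult_2)
  with two that show False by simp
 qed
 from psection_points[OF r] obtain s where s: "psection t = {s True True, s True False, s False True, s False False}"
  "!!a b. s a b \<in> E" "!!a b. Y (s a b) X1 ~= 0"
  "!!a b. Y (s a b) X2 = (if a then r2 else - r2) * Y (s a b) X1"
  "!!a b. Y (s a b) X3 = (if b then r3 else - r3) * Y (s a b) X1" by blast
 define l where "l i = (case i of X2 => 1 | X1 => - r2 | _ => 0)" for i
 have l: "lin l p = Y p X2 - r2 * Y p X1" for p by (simp add: lin_def sum_gen l_def)
 have lz: "lin l (s a b) = 0 \<longleftrightarrow> a" for a b
  unfolding l s(4) using s(3)[of a b] neg[OF nz(1)] by (auto simp flip: left_diff_distrib)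
 have "s a True ~= s a' False" for a a'
  using s(5)[of a True] s(5)[of a' False] s(3)[of a True] neg[OF nz(2)] by auto
 moreover have "s True b ~= s False b'" for b b' using lz by metis
 ultimately have "distinct [s True True, s True False, s False True, s False False]" by auto
 then show thesis using that s(1) lz by blast
qed

text \<open>The values of t for which points of the section coincide, that is, for which the plane
  y_0 = t y_1 is tangent to E.\<close>

lemma bad_pencil:
 shows "sq2 (t\<^sup>2) = 0 ==> t\<^sup>2 = c1 - 1" "sq3 (t\<^sup>2) = 0 ==> t\<^sup>2 = c1 / c2 - 1"
proof -
 show "t\<^sup>2 = c1 - 1" if "sq2 (t\<^sup>2) = 0" using that c12_nz by (simp add: sq2_def algebra_simps)
 assume *: "sq3 (t\<^sup>2) = 0"
 then have "c1 + c2 * sq2 (t\<^sup>2) = 0" "t\<^sup>2 + 1 + sq2 (t\<^sup>2) = 0" using sq23[of "t\<^sup>2"] by simp_all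
 then have "c2 * (t\<^sup>2 + 1) = c1" by (metis add_eq_0_iff2 mult_minus_right neg_equal_iff_equal)
 then show "t\<^sup>2 = c1 / c2 - 1" using c12_nz by (simp add: field_simps)
qed

lemma finite_sqrts: "finite {t::'k. t\<^sup>2 = x}"
proof -
 have "finite {t. poly [:- x, 0, 1:] t = 0}" by (rule poly_roots_finite) simp
 then show ?thesis by (rule rev_finite_subset) (auto simp: power2_eq_square)
qed

text \<open>Since t = y_0 / y_1 is determined by any point of the section, different planes of the
  pencil have disjoint sections, and only finitely many t are excluded in an infinite field.\<close>

lemma good_psection_avoiding:
 assumes "finite X"
 shows "EX t. sq2 (t\<^sup>2) ~= 0 & sq3 (t\<^sup>2) ~= 0 & psection t Int X = {}"
proof -
 have "finite ((%p. Y p X0 / Y p X1) ` X Un {t. t\<^sup>2 = c1 - 1} Un {t. t\<^sup>2 = c1 / c2 - 1})"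
  using assms finite_sqrts by blast
 from ex_new_if_finite[OF infinite_alg_closed this]
 obtain t where t: "t ~: (%p. Y p X0 / Y p X1) ` X Un {t. t\<^sup>2 = c1 - 1} Un {t. t\<^sup>2 = c1 / c2 - 1}" ..
 have "p ~: X" if "p \<in> psection t" for p
 proof
  assume "p \<in> X"
  moreover have "t = Y p X0 / Y p X1" using psection_X1[OF that] that by (simp add: psection_def)
  ultimately show False using t by auto
 qed
 then show ?thesis using t bad_pencil[of t] by blast
qed

lemma infinite_E: "infinite E"
proof
 assume "finite E"
 from good_psection_avoiding[OF this] obtain t where "psection t Int E = {}" by blast
 then show False using psection_nonempty[of t] by (auto simp: psection_def)
qed

end

definition words :: "nat => gen list set" where
 "words n = {w. length w = n}"

lemma in_words [simp]: "w \<in> words n \<longleftrightarrow> length w = n"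
 by (simp add: words_def)

lemma finite_words [simp]: "finite (words n)"
 using finite_lists_length_eq[of "UNIV :: gen set" n] by (simp add: words_def)

lemma words_1: "words (Suc 0) = range (%i. [i])"
 by (auto simp: length_Suc_conv)

lemma sum_words_1: "(\<Sum>w\<in>words (Suc 0). f w) = (\<Sum>i\<in>UNIV. f [i])"
 for f :: "gen list => 'a::comm_monoid_add"
 unfolding words_1 by (subst sum.reindex) (auto simp: inj_on_def)

lemma sum_words_add:
 "(\<Sum>w\<in>words (n + m). f w) = (\<Sum>u\<in>words n. \<Sum>v\<in>words m. f (u @ v))"
 for f :: "gen list => 'a::comm_monoid_add"
proof -
 have "words (n + m) = (%(u, v). u @ v) ` (words n \<times> words m)"
 proof
  show "words (n + m) <= (%(u, v). u @ v) ` (words n \<times> words m)"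
  proof
   fix w assume "w \<in> words (n + m)"
   then show "w \<in> (%(u, v). u @ v) ` (words n \<times> words m)"
    by (intro image_eqI[of _ _ "(take n w, drop n w)"]) auto
  qed
 qed auto
 then have "(\<Sum>w\<in>words (n + m). f w) = (\<Sum>(u, v)\<in>words n \<times> words m. f (u @ v))"
  by (simp add: sum.reindex inj_on_def case_prod_unfold o_def)
 then show ?thesis by (simp add: sum.cartesian_product)
qed

context sklyanin_curve
begin

subsection \<open>Points in general position\<close>

text \<open>Classically: the points of \<open>S\<close> impose independent conditions on forms of
  degree n.\<close>

definition indep :: "nat => 'p set => bool" where
 "indep n S \<longleftrightarrow> (ALL c. (ALL w. length w = n --> (\<Sum>p\<in>S. c p * ev p w) = 0) --> (\<forall>p\<in>S. c p = 0))"

lemma indepD: "indep n S ==> (!!w. length w = n ==> (\<Sum>p\<in>S. c p * ev p w) = 0) ==> p \<in> S ==> c p = 0"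
 unfolding indep_def by blast

definition form :: "nat => (gen list => 'k) => 'p => 'k" where
 "form n t p = (\<Sum>w\<in>words n. t w * ev p w)"

text \<open>Multiply a dependency by a form that vanishes on \<open>S1\<close> and nowhere on
  \<open>S2\<close>. Only the terms of \<open>S2\<close> survive, and they give a dependency of
  lower degree among the translated points.\<close>

lemma indep_step_form:
 assumes S: "finite S1" "finite S2" "S1 <= E" "S2 <= E"
  and t: "!!p. p \<in> S1 ==> form n t p = 0" "!!p. p \<in> S2 ==> form n t p ~= 0"
  and ind: "indep m ((\<sigma> ^^ n) ` S2)" "indep (n + m) S1"
 shows "indep (n + m) (S1 Un S2)"
 unfolding indep_def
proof (intro allI impI)
 fix c assume c: "ALL w. length w = n + m --> (\<Sum>p\<in>S1 Un S2. c p * ev p w) = 0"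
 have disj: "S1 Int S2 = {}" using t by blast
 have inj: "inj_on (\<sigma> ^^ n) S2" using \<sigma>_pow_inj S inj_on_subset by blast
 define d where "d p = c (the_inv_into S2 (\<sigma> ^^ n) p) * form n t (the_inv_into S2 (\<sigma> ^^ n) p)" for p
 have d: "d ((\<sigma> ^^ n) p) = c p * form n t p" if "p \<in> S2" for p
  using that inj by (simp add: d_def the_inv_into_f_f)
 have "(\<Sum>p\<in>(\<sigma> ^^ n) ` S2. d p * ev p w) = 0" if w: "length w = m" for w
 proof -
  have "0 = (\<Sum>u\<in>words n. t u * (\<Sum>p\<in>S1 Un S2. c p * ev p (u @ w)))" using c w by simp
  also have "... = (\<Sum>p\<in>S1 Un S2. \<Sum>u\<in>words n. t u * (c p * ev p (u @ w)))"
   unfolding sum_distrib_left by (rule sum.swap)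
  also have "... = (\<Sum>p\<in>S1 Un S2. c p * form n t p * ev ((\<sigma> ^^ n) p) w)"
   by (rule sum.cong[OF refl]) (simp add: form_def sum_distrib_left sum_distrib_right ev_append mult_ac)
  also have "... = (\<Sum>p\<in>S1. c p * form n t p * ev ((\<sigma> ^^ n) p) w) + (\<Sum>p\<in>S2. c p * form n t p * ev ((\<sigma> ^^ n) p) w)"
   using S disj by (simp add: sum.union_disjoint)
  also have "(\<Sum>p\<in>S1. c p * form n t p * ev ((\<sigma> ^^ n) p) w) = 0" by (rule sum.neutral) (use t in auto)
  finally show ?thesis using inj by (simp add: sum.reindex d)
 qed
 from indepD[OF ind(1) this] have "d ((\<sigma> ^^ n) p) = 0" if "p \<in> S2" for p using that by blast
 then have 2: "c p = 0" if "p \<in> S2" for p using that d t by simp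
 have "(\<Sum>p\<in>S1. c p * ev p w) = 0" if w: "length w = n + m" for w
 proof -
  have "(\<Sum>p\<in>S1 Un S2. c p * ev p w) = (\<Sum>p\<in>S1. c p * ev p w) + (\<Sum>p\<in>S2. c p * ev p w)"
   using S disj by (simp add: sum.union_disjoint)
  also have "(\<Sum>p\<in>S2. c p * ev p w) = 0" by (rule sum.neutral) (use 2 in auto)
  finally show ?thesis using c w by simp
 qed
 from indepD[OF ind(2) this] show "\<forall>p\<in>S1 Un S2. c p = 0" using 2 by blast
qed

lemma lin_form: "lin l = form 1 (%w. l (hd w))"
proof -
 have "words 1 = (%i. [i]) ` UNIV" by (auto simp: length_Suc_conv)
 then show ?thesis by (auto simp: form_def lin_def sum.reindex inj_on_def)
qed

lemma indep_step:
 assumes "finite S1" "finite S2" "S1 <= E" "S2 <= E"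
  and "!!p. p \<in> S1 ==> lin l p = 0" "!!p. p \<in> S2 ==> lin l p ~= 0"
  and "indep n (\<sigma> ` S2)" "indep (Suc n) S1"
 shows "indep (Suc n) (S1 Un S2)"
 using indep_step_form[OF assms(1-4), of 1 "%w. l (hd w)" n] assms(5-) by (simp add: lin_form)

lemma ev_nonzero: "p \<in> E ==> EX w. length w = n & ev p w ~= 0"
proof (induction n arbitrary: p)
 case 0 show ?case by simp
next
 case (Suc n)
 obtain i where "Y p i ~= 0" using Y_nz Suc.prems by blast
 moreover obtain w where "length w = n" "ev (\<sigma> p) w ~= 0" using Suc by blast
 ultimately show ?case by (intro exI[of _ "i # w"]) simp
qed

lemma separating_form:
 assumes "p \<in> E" "q \<in> E" "p ~= q"
 shows "EX l. lin l p = 0 & lin l q ~= 0"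
proof -
 obtain i where i: "Y p i ~= 0" using Y_nz assms by blast
 have "EX j. Y p i * Y q j ~= Y p j * Y q i"
 proof (rule ccontr)
  assume "~ ?thesis"
  then have "Y q j = Y q i / Y p i * Y p j" for j using i by (simp add: field_simps)
  from Y_inj[OF assms(1,2) this] show False using assms(3) by simp
 qed
 then obtain j where j: "Y p i * Y q j ~= Y p j * Y q i" by blast
 define l where "l m = (if m = j then Y p i else 0) - (if m = i then Y p j else 0)" for m
 have "lin l x = Y p i * Y x j - Y p j * Y x i" for x
  by (simp add: lin_def l_def left_diff_distrib sum_subtractf if_distrib[of "%x. x * _"] cong: if_cong)
 then show ?thesis using j by (intro exI[of _ l]) (auto simp: mult.commute)
qed

text \<open>A plane separating two of the points splits the set into two smaller ones. The part off
  the plane is translated and passes to degree n - 1; having lost at least one point, it still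
  satisfies the bound there.\<close>

lemma indep_small:
 "finite S ==> S <= E ==> card S <= Suc n ==> indep n S"
proof (induction "card S" arbitrary: S n rule: less_induct)
 case less
 show ?case
 proof (cases "EX p q. p \<in> S & q \<in> S & p ~= q")
  case False
  show ?thesis unfolding indep_def
  proof (intro allI impI ballI)
   fix c p assume c: "ALL w. length w = n --> (\<Sum>p\<in>S. c p * ev p w) = 0" and p: "p \<in> S"
   then have S: "S = {p}" using False by blast
   obtain w where "length w = n" "ev p w ~= 0" using ev_nonzero p less.prems by blast
   then show "c p = 0" using c S by auto
  qed
 next
  case True
  then obtain p q where pq: "p \<in> S" "q \<in> S" "p ~= q" by blast
  then obtain l where l: "lin l p = 0" "lin l q ~= 0" using separating_form less.prems by blast
  define S1 S2 where "S1 = {x \<in> S. lin l x = 0}" and "S2 = {x \<in> S. lin l x ~= 0}"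
  have fin: "finite S1" "finite S2" "S1 <= E" "S2 <= E" using less.prems by (auto simp: S1_def S2_def)
  have "S1 \<subset> S" "S2 \<subset> S" using pq l by (auto simp: S1_def S2_def)
  then have c: "card S1 < card S" "card S2 < card S" using less.prems psubset_card_mono by blast+
  have c2: "card (\<sigma> ` S2) <= card S2" using fin by (intro card_image_le)
  have "2 <= card S" using pq less.prems(1) by (metis card_2_iff card_mono empty_subsetI insert_subset)
  then obtain m where m: "n = Suc m" using less.prems(3) by (cases n) auto
  have "indep (Suc m) (S1 Un S2)"
  proof (rule indep_step[OF fin])
   show "indep m (\<sigma> ` S2)" using less.hyps[of "\<sigma> ` S2" m] c c2 fin less.prems m by auto
   show "indep (Suc m) S1" using less.hyps[of S1 "Suc m"] c fin less.prems m by auto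
  qed (auto simp: S1_def S2_def)
  moreover have "S1 Un S2 = S" by (auto simp: S1_def S2_def)
  ultimately show ?thesis using m by simp
 qed
qed

lemma relation_free_comb:
 assumes "finite S" "!!p. p \<in> S ==> relation_free n (f p)"
 shows "relation_free n (%w. \<Sum>p\<in>S. c p * f p w)"
 unfolding relation_free_def
proof (intro allI impI)
 fix u v :: "gen list" and h s assume len: "length u + length v + 2 = n"
 have "(\<Sum>i\<in>UNIV. rel \<alpha> \<beta> \<gamma> h s i * (\<Sum>p\<in>S. c p * f p (u @ i # (i \<boxplus> h) # v))) =
  (\<Sum>p\<in>S. c p * (\<Sum>i\<in>UNIV. rel \<alpha> \<beta> \<gamma> h s i * f p (u @ i # (i \<boxplus> h) # v)))"
  unfolding sum_distrib_left by (subst sum.swap) (simp add: mult_ac)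
 also have "... = 0" by (rule sum.neutral) (use assms(2) relation_freeD len in force)
 finally show "(\<Sum>i\<in>UNIV. rel \<alpha> \<beta> \<gamma> h s i * (\<Sum>p\<in>S. c p * f p (u @ i # (i \<boxplus> h) # v))) = 0" .
qed

lemma relation_free_diff:
 assumes "relation_free n f" "relation_free n g"
 shows "relation_free n (%w. f w - g w)"
 using relation_freeD[OF assms(1)] relation_freeD[OF assms(2)]
 by (auto simp: relation_free_def right_diff_distrib sum_subtractf)

text \<open>Hence the relation-free functionals of degree $n$ form a space of dimension at most $4n$.\<close>

lemma test_words:
 assumes "n >= 1"
 shows "EX W. W <= words n & card W <= 4 * n &
  (\<forall>\<phi>. relation_free n \<phi> --> (\<forall>w\<in>W. \<phi> w = 0) --> (ALL w. length w = n --> \<phi> w = 0))"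
 using assms
proof (induction n rule: nat_induct_at_least)
 case base
 have "card (words 1) <= 4"
 proof -
  have "words 1 = (%i. [i]) ` UNIV" by (auto simp: length_Suc_conv)
  then have "card (words 1) = card (UNIV :: gen set)" by (simp add: card_image inj_on_def)
  then show ?thesis by (simp add: UNIV_gen)
 qed
 then show ?case by (intro exI[of _ "words 1"]) simp
next
 case (Suc n)
 obtain q where q: "q \<in> E" "Y q X0 = 0" using X0_point by blast
 obtain W where W: "W <= words n" "card W <= 4 * n"
  "!!\<phi> w. relation_free n \<phi> ==> \<forall>w\<in>W. \<phi> w = 0 ==> length w = n ==> \<phi> w = 0"
  using Suc.IH by blast
 have "EX w. length w = Suc n & word_deg w = g & ev q w ~= 0" for g
  using word_of_degree[OF q, of "Suc n" g] Suc.hyps by simp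
 \<comment> \<open>On functionals that vanish on the words starting with x_0, the value at
   \<open>v g\<close> determines the coefficient in degree g. Four more words therefore suffice for
   one more degree.\<close>
 then obtain v where v: "!!g. length (v g) = Suc n" "!!g. word_deg (v g) = g" "!!g. ev q (v g) ~= 0" by metis
 let ?W = "(#) X0 ` W Un range v"
 have "finite W" using W(1) finite_subset finite_words by blast
 then have A: "card ((#) X0 ` W) <= 4 * n" using W(2) card_image_le le_trans by blast
 have B: "card (range v) <= 4"
  using card_image_le[of "UNIV :: gen set" v] by (simp add: UNIV_gen)
 have card: "card ?W <= 4 * Suc n" using le_trans[OF card_Un_le add_mono[OF A B]] by simp
 have "\<phi> w = 0" if \<phi>: "relation_free (Suc n) \<phi>" "\<forall>w\<in>?W. \<phi> w = 0" and w: "length w = Suc n" for \<phi> w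
 proof -
  have "\<phi> (X0 # u) = 0" if "length u = n" for u
   using W(3)[OF relation_free_Cons[OF \<phi>(1), of X0] _ that] \<phi>(2) by simp
  then obtain a where a: "!!w. length w = Suc n ==> \<phi> w = a (word_deg w) * ev q w"
   using relation_free_kernel[OF q _ \<phi>(1)] by auto
  have "a g = 0" for g using a[OF v(1), of g] v \<phi>(2) by simp
  then show ?thesis using a[OF w] by simp
 qed
 then show ?case using card W(1) v(1) by (intro exI[of _ ?W]) auto
qed

lemma indep_card:
 assumes "n >= 1" "finite S" "S <= E" "indep n S"
 shows "card S <= 4 * n"
proof (rule ccontr)
 assume "~ ?thesis"
 obtain W where W: "W <= words n" "card W <= 4 * n"
  "!!\<phi> w. relation_free n \<phi> ==> \<forall>w\<in>W. \<phi> w = 0 ==> length w = n ==> \<phi> w = 0"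
  using test_words[OF assms(1)] by blast
 have "finite W" using W(1) finite_subset finite_words by blast
 from nontrivial_solution[OF this assms(2), of ev] \<open>~ ?thesis\<close> W(2)
 obtain c where c: "\<exists>p\<in>S. c p ~= 0" "\<forall>w\<in>W. (\<Sum>p\<in>S. c p * ev p w) = 0" by force
 have "relation_free n (%w. \<Sum>p\<in>S. c p * ev p w)"
  using assms by (intro relation_free_comb relation_free_ev) auto
 from W(3)[OF this] c(2) have "!!w. length w = n ==> (\<Sum>p\<in>S. c p * ev p w) = 0" by simp
 then show False using indepD[OF assms(4)] c(1) by blast
qed

text \<open>By \<open>test_words\<close> the space of relation-free functionals has dimension at
  most 4n, so 4n independent evaluations span it.\<close>

lemma indep_basis_spans:
 assumes n: "n >= 1" and S: "finite S" "S <= E" "card S = 4 * n" "indep n S" and \<phi>: "relation_free n \<phi>"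
 shows "EX c. ALL w. length w = n --> \<phi> w = (\<Sum>p\<in>S. c p * ev p w)"
proof -
 obtain W where W: "W <= words n" "card W <= 4 * n"
  "!!\<phi> w. relation_free n \<phi> ==> \<forall>w\<in>W. \<phi> w = 0 ==> length w = n ==> \<phi> w = 0"
  using test_words[OF n] by blast
 have fin: "finite W" using W(1) finite_subset finite_words by blast
 have rf: "relation_free n (%w. \<Sum>p\<in>S. c p * ev p w)" for c
  using S by (intro relation_free_comb relation_free_ev) auto
 have "EX c. \<forall>w\<in>W. \<phi> w = (\<Sum>p\<in>S. c p * ev p w)"
 proof (rule independent_rows_span[OF S(1) fin])
  fix c assume "!!w. w \<in> W ==> (\<Sum>p\<in>S. c p * ev p w) = 0"
  then show "\<forall>p\<in>S. c p = 0" using W(3)[OF rf[of c]] indepD[OF S(4)] by blast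
 qed (use W(2) S in simp)
 then obtain c where c: "\<forall>w\<in>W. \<phi> w = (\<Sum>p\<in>S. c p * ev p w)" by blast
 have "\<phi> w - (\<Sum>p\<in>S. c p * ev p w) = 0" if "length w = n" for w
  by (rule W(3)[OF relation_free_diff[OF \<phi> rf] _ that]) (use c in simp)
 then show ?thesis by (intro exI[of _ c]) simp
qed

text \<open>In degree 1 four coplanar points are dependent. From degree 2 on a second plane
  separates them into two pairs, to which \<open>indep_small\<close> applies.\<close>

lemma indep_psection:
 assumes good: "sq2 (t\<^sup>2) ~= 0" "sq3 (t\<^sup>2) ~= 0" and n: "n >= 2"
 shows "indep n (psection t)"
proof -
 obtain l s1 s2 s3 s4 where s: "psection t = {s1, s2, s3, s4}" "distinct [s1, s2, s3, s4]"
  "lin l s1 = 0" "lin l s2 = 0" "lin l s3 ~= 0" "lin l s4 ~= 0" using psection_split[OF good] .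
 obtain m where m: "n = Suc m" "m >= 1" using n by (cases n) auto
 have E: "{s1, s2, s3, s4} <= E" unfolding s(1)[symmetric] by (auto simp: psection_def)
 have "indep (Suc m) ({s1, s2} Un {s3, s4})"
  by (rule indep_step[of _ _ l]) (use s E m in \<open>auto intro!: indep_small simp: card_insert_if\<close>)
 then show ?thesis using m s(1) by (simp add: insert_commute)
qed

lemma card_psection:
 assumes "sq2 (t\<^sup>2) ~= 0" "sq3 (t\<^sup>2) ~= 0"
 shows "card (psection t) = 4"
proof -
 obtain l s1 s2 s3 s4 where s: "psection t = {s1, s2, s3, s4}" "distinct [s1, s2, s3, s4]"
  using psection_split[OF assms] by metis
 then show ?thesis using distinct_card[OF s(2)] by simp
qed

text \<open>Each degree adds the four points of a fresh plane section to the preimage under \<sigma>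
  of a basis of the preceding degree. The freedom to avoid a finite set is what keeps the pieces
  disjoint, and later keeps zeros of forms out of the way.\<close>

lemma indep_basis_avoiding:
 assumes "finite X" "n >= 1"
 shows "EX S. finite S & S <= E & card S = 4 * n & S Int X = {} & indep n S"
 using assms(2,1)
proof (induction n arbitrary: X rule: nat_induct_at_least)
 case base
 obtain t where t: "sq2 (t\<^sup>2) ~= 0" "sq3 (t\<^sup>2) ~= 0" "psection t Int X = {}"
  using good_psection_avoiding[OF base] by blast
 obtain l s1 s2 s3 s4 where s: "psection t = {s1, s2, s3, s4}" "distinct [s1, s2, s3, s4]"
  "lin l s1 = 0" "lin l s2 = 0" "lin l s3 ~= 0" "lin l s4 ~= 0" using psection_split[OF t(1,2)] .
 have E: "{s1, s2, s3, s4} <= E" unfolding s(1)[symmetric] by (auto simp: psection_def)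
 \<comment> \<open>A full section is dependent in degree 1, so three of its points are taken and one
   point off the plane.\<close>
 have "finite (X Un psection t)" using base finite_psection by blast
 then obtain p where p: "p \<in> E" "p ~: X" "p ~: psection t"
  using infinite_E by (metis UnCI finite_subset subsetI)
 have 3: "indep (Suc 0) ({s1, s2} Un {s3})"
  by (rule indep_step[of _ _ l]) (use s E in \<open>auto intro!: indep_small simp: card_insert_if\<close>)
 have "indep (Suc 0) ({s1, s2, s3} Un {p})"
 proof (rule indep_step[of _ _ "pencil t"])
  show "indep 0 (\<sigma> ` {p})" using p by (intro indep_small) auto
  show "indep (Suc 0) {s1, s2, s3}" using 3 by (simp add: insert_commute)
  show "lin (pencil t) x = 0" if "x \<in> {s1, s2, s3}" for x
   using that s(1) unfolding lin_pencil psection_def by fastforce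
  show "lin (pencil t) x ~= 0" if "x \<in> {p}" for x
   using that p unfolding lin_pencil psection_def by auto
 qed (use E p in auto)
 moreover have "card ({s1, s2, s3} Un {p}) = 4" using s p by auto
 ultimately show ?case using E p t(3) s(1) by (intro exI[of _ "{s1, s2, s3} Un {p}"]) auto
next
 case (Suc n)
 obtain t where t: "sq2 (t\<^sup>2) ~= 0" "sq3 (t\<^sup>2) ~= 0" "psection t Int X = {}"
  using good_psection_avoiding[OF Suc.prems] by blast
 have "finite (\<sigma> ` (X Un psection t))" using Suc.prems finite_psection by blast
 from Suc.IH[OF this] obtain S where S: "finite S" "S <= E" "card S = 4 * n" "S Int \<sigma> ` (X Un psection t) = {}" "indep n S"
  by blast
 \<comment> \<open>\<open>S\<close> avoids the translates of \<open>X\<close> and of the section, so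
   its preimage avoids both; the form of the plane vanishes on the section and nowhere on
   \<open>S2\<close>.\<close>
 define S2 where "S2 = {p \<in> E. \<sigma> p \<in> S}"
 have im: "\<sigma> ` S2 = S"
 proof -
  have "E = \<sigma> ` E" using bij by (auto simp: bij_betw_def)
  then show ?thesis using S(2) by (auto simp: S2_def)
 qed
 have inj: "inj_on \<sigma> S2" using \<sigma>_inj by (rule inj_on_subset) (auto simp: S2_def)
 have fin2: "finite S2" using S(1) im inj finite_imageD by metis
 have c2: "card S2 = 4 * n" using S(3) im inj card_image by metis
 have d2: "S2 Int X = {}" "S2 Int psection t = {}" using S(4) by (auto simp: S2_def)
 have "indep (Suc n) (psection t Un S2)"
 proof (rule indep_step[of _ _ "pencil t"])
  show "indep n (\<sigma> ` S2)" using im S by simp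
  show "indep (Suc n) (psection t)" using t Suc.hyps by (intro indep_psection) auto
  show "lin (pencil t) x = 0" if "x \<in> psection t" for x
   using that unfolding lin_pencil psection_def by auto
  show "lin (pencil t) x ~= 0" if "x \<in> S2" for x
   using that d2 unfolding lin_pencil psection_def S2_def by auto
 qed (use finite_psection fin2 in \<open>auto simp: psection_def S2_def\<close>)
 moreover have "card (psection t Un S2) = 4 * Suc n"
  using card_psection[OF t(1,2)] c2 d2 fin2 finite_psection[of t] by (subst card_Un_disjoint) auto
 ultimately show ?case using finite_psection[of t] fin2 d2 t(3)
  by (intro exI[of _ "psection t Un S2"]) (auto simp: psection_def S2_def)
qed

subsection \<open>A plane meets the curve in a finite set\<close>

text \<open>These points lie outside the chart y_1 = 1 in which \<open>sq2\<close> and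
  \<open>sq3\<close> describe E. On them the squares of y_2 / y_0 and y_3 / y_0 are
  constant.\<close>

lemma finite_coordinate_plane: "finite {p \<in> E. Y p X1 = 0}"
proof -
 have "p = q" if p: "p \<in> E" "Y p X1 = 0" and q: "q \<in> E" "Y q X1 = 0"
  and e: "Y p X2 / Y p X0 = Y q X2 / Y q X0" "Y p X3 / Y p X0 = Y q X3 / Y q X0" for p q
 proof (rule Y_inj[OF p(1) q(1)])
  have "Y p X0 ~= 0" "Y q X0 ~= 0" using one_zero[of _ X1] p q by auto
  then show "Y q i = Y q X0 / Y p X0 * Y p i" for i
   using p q e by (cases i) (auto simp: field_simps)
 qed
 then have inj: "inj_on (%p. (Y p X2 / Y p X0, Y p X3 / Y p X0)) {p \<in> E. Y p X1 = 0}"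
  by (auto simp: inj_on_def)
 have "(Y p X2 / Y p X0)\<^sup>2 = 1 / (c2 - 1) & (Y p X3 / Y p X0)\<^sup>2 = - c2 / (c2 - 1)"
  if p: "p \<in> E" "Y p X1 = 0" for p
 proof -
  have nz: "Y p X0 ~= 0" using one_zero[of _ X1] p by auto
  let ?a = "(Y p X2 / Y p X0)\<^sup>2" and ?b = "(Y p X3 / Y p X0)\<^sup>2"
  have "1 + ?a + ?b = ((Y p X0)\<^sup>2 + (Y p X1)\<^sup>2 + (Y p X2)\<^sup>2 + (Y p X3)\<^sup>2) / (Y p X0)\<^sup>2"
   using nz p by (simp add: add_divide_distrib power_divide)
  then have e1: "1 + ?a + ?b = 0" using eq1[OF p(1)] by simp
  have "?b + c2 * ?a = ((Y p X3)\<^sup>2 + c1 * (Y p X1)\<^sup>2 + c2 * (Y p X2)\<^sup>2) / (Y p X0)\<^sup>2"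
   using nz p by (simp add: add_divide_distrib power_divide)
  then have e2: "?b + c2 * ?a = 0" using eq2[OF p(1)] by (simp add: c1_def c2_def)
  have "(c2 - 1) * ?a = (?b + c2 * ?a) - (1 + ?a + ?b) + 1" by (simp add: algebra_simps)
  then have "(c2 - 1) * ?a = 1" using e1 e2 by simp
  then have a: "?a = 1 / (c2 - 1)" using c12_nz by (subst nonzero_eq_divide_eq) (simp_all add: mult.commute)
  moreover have "?b = - c2 * ?a" using e2 by (simp add: eq_neg_iff_add_eq_0)
  ultimately show ?thesis by simp
 qed
 then have "(%p. (Y p X2 / Y p X0, Y p X3 / Y p X0)) ` {p \<in> E. Y p X1 = 0} <=
   {t. t\<^sup>2 = 1 / (c2 - 1)} \<times> {t. t\<^sup>2 = - c2 / (c2 - 1)}" by auto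
 then show ?thesis using finite_imageD[OF _ inj] finite_sqrts by (meson finite_SigmaI finite_subset)
qed

end

context sklyanin_curve
begin

lemma sq_zero_iff: "sq2 s = 0 \<longleftrightarrow> s = c1 - 1" "sq3 s = 0 \<longleftrightarrow> s = c1 / c2 - 1"
proof -
 show "sq2 s = 0 \<longleftrightarrow> s = c1 - 1" using c12_nz by (auto simp: sq2_def algebra_simps)
 obtain t where t: "t\<^sup>2 = s" using sqrt_exists by blast
 have "sq3 s = 0" if "s = c1 / c2 - 1"
 proof -
  have "c2 * (s + 1) = c1" using that c12_nz by simp
  then have "s + 1 + (- 1 - s) + 0 = 0" "0 + c1 + c2 * (- 1 - s) = 0" by (simp_all add: algebra_simps)
  from sq23_unique(2)[OF this] show ?thesis by simp
 qed
 then show "sq3 s = 0 \<longleftrightarrow> s = c1 / c2 - 1" using bad_pencil(2)[of t] t by auto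
qed

lemma c12_roots: "c1 - 1 ~= 0" "c1 / c2 - 1 ~= 0" "c1 - 1 ~= c1 / c2 - 1"
 using c12_nz by (auto simp: field_simps)

text \<open>
  Squaring twice eliminates $y_1, y_2, y_3$ from the equation of a plane; the eliminant $Q$ is
  non-zero because $y_0^2, y_1^2, y_2^2, y_3^2$ are pairwise independent linear functions on the
  line that $E$ maps to.
\<close>

lemma plane_eliminant_nonzero:
 fixes l :: "gen => 'k" and A B :: "'k poly"
 defines "A \<equiv> [:(1 - c1) / (c2 - 1), 1 / (c2 - 1):]"
 defines "B \<equiv> [:- 1 - (1 - c1) / (c2 - 1), - 1 - 1 / (c2 - 1):]"
 defines "L \<equiv> [:(l X1)\<^sup>2 - (l X2)\<^sup>2 * coeff A 0 - (l X3)\<^sup>2 * coeff B 0,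
  (l X0)\<^sup>2 - (l X2)\<^sup>2 * coeff A 1 - (l X3)\<^sup>2 * coeff B 1:]"
 defines "P \<equiv> L\<^sup>2 + Polynomial.smult (4 * (l X0 * l X1)\<^sup>2) [:0, 1:] - Polynomial.smult (4 * (l X2 * l X3)\<^sup>2) (A * B)"
 defines "Q \<equiv> P\<^sup>2 - Polynomial.smult (16 * (l X0 * l X1)\<^sup>2) ([:0, 1:] * L\<^sup>2)"
 shows "poly A s = sq2 s" "poly B s = sq3 s"
  "poly L s = (l X0)\<^sup>2 * s + (l X1)\<^sup>2 - (l X2)\<^sup>2 * sq2 s - (l X3)\<^sup>2 * sq3 s"
  "Q = 0 ==> l i = 0"
proof -
 show A: "poly A s = sq2 s" for s
  by (simp add: A_def sq2_def flip: add_divide_distrib)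
 then show B: "poly B s = sq3 s" for s
  using A[of s] by (simp add: A_def B_def sq3_def algebra_simps)
 have Lp: "poly L s = (l X1)\<^sup>2 + (l X0)\<^sup>2 * s - (l X2)\<^sup>2 * poly A s - (l X3)\<^sup>2 * poly B s" for s
  by (simp add: L_def A_def B_def algebra_simps)
 then show L: "poly L s = (l X0)\<^sup>2 * s + (l X1)\<^sup>2 - (l X2)\<^sup>2 * sq2 s - (l X3)\<^sup>2 * sq3 s" for s
  by (simp add: A B)
 have four: "(4::'k) ~= 0" "(16::'k) ~= 0"
 proof -
  have "(2::'k) * 2 ~= 0" "(2::'k) * 2 * (2 * 2) ~= 0" using two by (metis mult_eq_0_iff)+
  then show "(4::'k) ~= 0" "(16::'k) ~= 0" by simp_all
 qed
 have z: "sq2 0 ~= 0" "sq3 0 ~= 0" using sq_zero_iff[of 0] c12_roots by auto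
 assume "Q = 0"
 then have Q: "P\<^sup>2 = Polynomial.smult (16 * (l X0 * l X1)\<^sup>2) ([:0, 1:] * L\<^sup>2)" by (simp add: Q_def)
 have Pp: "poly P s = (poly L s)\<^sup>2 + 4 * (l X0 * l X1)\<^sup>2 * s - 4 * (l X2 * l X3)\<^sup>2 * (sq2 s * sq3 s)" for s
  by (simp add: P_def A B)
 have 01: "l X0 * l X1 = 0"
 proof (rule ccontr)
  assume nz: "l X0 * l X1 ~= 0"
  \<comment> \<open>Parity of degrees: \<open>P^2\<close> has even degree, whereas the variable
    times \<open>L^2\<close> has odd degree unless \<open>L\<close> is 0.\<close>
  have "L = 0"
  proof (rule ccontr)
   assume "L ~= 0"
   then have R: "[:0, 1:] * L\<^sup>2 ~= 0" by simp
   have "degree (Polynomial.smult (16 * (l X0 * l X1)\<^sup>2) ([:0, 1:] * L\<^sup>2)) = degree ([:0, 1:] * L\<^sup>2)"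
    using nz four by simp
   also have "... = degree [:0, 1::'k:] + degree (L\<^sup>2)" using \<open>L ~= 0\<close> by (intro degree_mult_eq) auto
   also have "... = 1 + 2 * degree L" using \<open>L ~= 0\<close> by (simp add: degree_power_eq)
   finally have d: "degree (P\<^sup>2) = 1 + 2 * degree L" by (simp only: Q)
   moreover have "degree (P\<^sup>2) = 2 * degree P" if "P ~= 0" using that by (simp add: degree_power_eq)
   moreover have "P ~= 0" using d by auto
   ultimately have "2 * degree P = 1 + 2 * degree L" by simp
   then show False by presburger
  qed
  then have "P\<^sup>2 = 0" using Q by simp
  then have "P = 0" by simp
  then have e: "4 * (l X0 * l X1)\<^sup>2 * s = 4 * (l X2 * l X3)\<^sup>2 * (sq2 s * sq3 s)" for s
   using Pp[of s] \<open>L = 0\<close> \<open>P = 0\<close> by simp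
  have "l X2 * l X3 = 0" using e[of 0] z four by auto
  then have "4 * (l X0 * l X1)\<^sup>2 * 1 = 4 * 0\<^sup>2 * (sq2 1 * sq3 1)" using e[of 1] by (simp only:)
  then show False using nz four by simp
 qed
 then have "P\<^sup>2 = 0" using Q by (simp only: 01) simp
 then have "P = 0" by simp
 then have e: "(poly L s)\<^sup>2 = 4 * (l X2 * l X3)\<^sup>2 * (sq2 s * sq3 s)" for s
  using Pp[of s] 01 \<open>P = 0\<close> by simp
 have r: "sq2 (c1 - 1) = 0" "sq3 (c1 / c2 - 1) = 0" using sq_zero_iff by auto
 \<comment> \<open>Otherwise \<open>L\<close>, of degree at most 1, would vanish at the two distinct
   roots of \<open>sq2\<close> and \<open>sq3\<close> and hence identically, while the right-hand
   side is nonzero at 0.\<close>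
 have 23: "l X2 * l X3 = 0"
 proof (rule ccontr)
  assume nz: "l X2 * l X3 ~= 0"
  obtain a b where ab: "L = [:a, b:]" by (simp add: L_def)
  have "(poly L (c1 - 1))\<^sup>2 = 0" "(poly L (c1 / c2 - 1))\<^sup>2 = 0" unfolding e r by simp_all
  then have "a + (c1 - 1) * b = 0" "a + (c1 / c2 - 1) * b = 0" by (simp_all add: ab)
  then have "((c1 - 1) - (c1 / c2 - 1)) * b = 0" by (metis add_left_cancel left_diff_distrib right_minus_eq)
  then have "b = 0" using c12_roots(3) by auto
  then have "a = 0" using \<open>a + (c1 - 1) * b = 0\<close> by simp
  then show False using e[of 0] nz z four \<open>b = 0\<close> by (simp add: ab)
 qed
 have "(poly L s)\<^sup>2 = 0" for s using e[of s] by (simp only: 23) simp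
 then have L0: "(l X0)\<^sup>2 * s + (l X1)\<^sup>2 - (l X2)\<^sup>2 * sq2 s - (l X3)\<^sup>2 * sq3 s = 0" for s
  by (simp flip: L)
 have two_zero: "l X0 = 0 & l X1 = 0" if "(l X0)\<^sup>2 * s + (l X1)\<^sup>2 = 0" "s ~= 0" for s
  using that 01 by auto
 have "l X0 = 0 & l X1 = 0 & l X2 = 0 & l X3 = 0"
 proof (cases "l X3 = 0")
  case True
  then have "l X0 = 0 & l X1 = 0" using L0[of "c1 - 1"] r two_zero[OF _ c12_roots(1)] by simp
  then show ?thesis using L0[of 0] True z by simp
 next
  case False
  then have "l X2 = 0" using 23 by simp
  then have "l X0 = 0 & l X1 = 0" using L0[of "c1 / c2 - 1"] r two_zero[OF _ c12_roots(2)] by simp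
  then show ?thesis using L0[of 0] \<open>l X2 = 0\<close> z by simp
 qed
 then show "l i = 0" by (cases i) auto
qed

text \<open>In the chart y_1 = 1 the square of y_0 is a root of the eliminant. Each root allows
  finitely many t, and the sections of the pencil are finite.\<close>

lemma finite_plane:
 assumes "l i ~= 0"
 shows "finite {p \<in> E. lin l p = 0}"
proof -
 define A where "A = [:(1 - c1) / (c2 - 1), 1 / (c2 - 1):]"
 define B where "B = [:- 1 - (1 - c1) / (c2 - 1), - 1 - 1 / (c2 - 1):]"
 define L where "L = [:(l X1)\<^sup>2 - (l X2)\<^sup>2 * coeff A 0 - (l X3)\<^sup>2 * coeff B 0,
  (l X0)\<^sup>2 - (l X2)\<^sup>2 * coeff A 1 - (l X3)\<^sup>2 * coeff B 1:]"
 define P where "P = L\<^sup>2 + Polynomial.smult (4 * (l X0 * l X1)\<^sup>2) [:0, 1:] - Polynomial.smult (4 * (l X2 * l X3)\<^sup>2) (A * B)"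
 define Q where "Q = P\<^sup>2 - Polynomial.smult (16 * (l X0 * l X1)\<^sup>2) ([:0, 1:] * L\<^sup>2)"
 note facts = plane_eliminant_nonzero(1,2)[folded A_def B_def]
  plane_eliminant_nonzero(3,4)[where l = l, folded A_def B_def, folded L_def, folded P_def, folded Q_def]
 have "Q ~= 0" using facts(4)[of i] assms by blast
 then have fin: "finite {s. poly Q s = 0}" by (rule poly_roots_finite)
 have "{p \<in> E. lin l p = 0} <= {p \<in> E. Y p X1 = 0} Un (\<Union>s\<in>{s. poly Q s = 0}. \<Union>t\<in>{t. t\<^sup>2 = s}. psection t)"
 proof
  fix p assume p: "p \<in> {p \<in> E. lin l p = 0}"
  show "p \<in> {p \<in> E. Y p X1 = 0} Un (\<Union>s\<in>{s. poly Q s = 0}. \<Union>t\<in>{t. t\<^sup>2 = s}. psection t)"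
  proof (cases "Y p X1 = 0")
   case False
   define u v w where "u = Y p X0 / Y p X1" and "v = Y p X2 / Y p X1" and "w = Y p X3 / Y p X1"
   have sq: "v\<^sup>2 = sq2 (u\<^sup>2)" "w\<^sup>2 = sq3 (u\<^sup>2)" using point_squares[of p] p False by (auto simp: u_def v_def w_def)
   have "(l X0 * u + l X1) + (l X2 * v + l X3 * w) = lin l p / Y p X1"
    using False by (simp add: lin_def sum_gen u_def v_def w_def add_divide_distrib)
   also have "... = 0" using p by simp
   finally have "l X0 * u + l X1 = - (l X2 * v + l X3 * w)" by (rule eq_neg_iff_add_eq_0[THEN iffD2])
   then have "(l X0 * u + l X1)\<^sup>2 = (l X2 * v + l X3 * w)\<^sup>2" by (simp only: power2_minus)
   then have "poly L (u\<^sup>2) + 2 * (l X0 * l X1) * u = 2 * (l X2 * l X3) * (v * w)"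
    unfolding facts(3) sq[symmetric] by (simp add: algebra_simps power2_eq_square)
   then have "(poly L (u\<^sup>2) + 2 * (l X0 * l X1) * u)\<^sup>2 = (2 * (l X2 * l X3) * (v * w))\<^sup>2" by simp
   also have "... = 4 * (l X2 * l X3)\<^sup>2 * (sq2 (u\<^sup>2) * sq3 (u\<^sup>2))" by (simp add: power_mult_distrib sq)
   finally have "poly P (u\<^sup>2) = - 4 * (l X0 * l X1) * u * poly L (u\<^sup>2)"
    by (simp add: P_def facts(1,2)) (simp add: algebra_simps power2_eq_square)
   then have "(poly P (u\<^sup>2))\<^sup>2 = 16 * (l X0 * l X1)\<^sup>2 * (u\<^sup>2 * (poly L (u\<^sup>2))\<^sup>2)"
    by (simp add: power_mult_distrib)
   then have "poly Q (u\<^sup>2) = 0" by (simp add: Q_def)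
   moreover have "p \<in> psection u" using p False by (simp add: psection_def u_def)
   ultimately show ?thesis by blast
  qed (use p in simp)
 qed
 moreover have "finite ..." using fin finite_sqrts finite_psection finite_coordinate_plane by blast
 ultimately show ?thesis by (rule finite_subset)
qed

lemma plane_through:
 assumes "finite S" "card S <= 3"
 shows "EX l i. l i ~= 0 & (\<forall>p\<in>S. lin l p = 0)"
 using nontrivial_solution[of S "UNIV :: gen set" "%i p. Y p i"] assms
 by (auto simp: lin_def UNIV_gen)

text \<open>Each degree gains three points of \<open>Z\<close> by means of a plane through them. A
  plane section with four points inside \<open>Z\<close> need not exist, but three per degree are
  enough for \<open>finite_zeros\<close>, where 3 * 2n + 3n exceeds 4 * 2n.\<close>

lemma indep_subset_infinite:
 "infinite Z ==> Z <= E ==> EX S. finite S & S <= Z & card S = 3 * n + 1 & indep n S"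
proof (induction n arbitrary: Z)
 case 0
 then obtain p where "p \<in> Z" by (metis finite.emptyI ex_in_conv)
 then show ?case using 0 by (intro exI[of _ "{p}"]) (auto intro!: indep_small)
next
 case (Suc n)
 have pick: "EX p. p \<in> Z & p ~: X" if "finite X" for X
  using Suc.prems(1) that by (meson finite_subset subsetI)
 obtain p1 where p1: "p1 \<in> Z" using pick[of "{}"] by auto
 obtain p2 where p2: "p2 \<in> Z" "p2 ~= p1" using pick[of "{p1}"] by auto
 obtain l' i' where l': "l' i' ~= 0" "\<forall>p\<in>{p1, p2}. lin l' p = 0"
 proof -
  have "card {p1, p2} <= 3" by (auto simp: card_insert_if)
  from plane_through[OF _ this] that show thesis by blast
 qed
 \<comment> \<open>Choosing the third point off a plane through the first two makes the three
   independent already in degree 1.\<close>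
 obtain p3 where p3: "p3 \<in> Z" "p3 ~: {p \<in> E. lin l' p = 0}" using pick[OF finite_plane[of l']] l'(1) by blast
 obtain l i where l: "l i ~= 0" "\<forall>p\<in>{p1, p2, p3}. lin l p = 0"
 proof -
  have "card {p1, p2, p3} <= 3" by (auto simp: card_insert_if)
  from plane_through[OF _ this] that show thesis by blast
 qed
 have E: "{p1, p2, p3} <= E" using p1 p2 p3 Suc.prems by auto
 have c3: "card {p1, p2, p3} = 3" using p1 p2 p3 l' Suc.prems(2) by (auto simp: card_insert_if)
 have 3: "indep (Suc n) ({p1, p2} Un {p3})"
  by (rule indep_step[of _ _ l']) (use p3 E l' in \<open>auto intro!: indep_small simp: card_insert_if\<close>)
 define Z2 where "Z2 = Z - {p \<in> E. lin l p = 0}"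
 have "infinite Z2" unfolding Z2_def using Suc.prems(1) finite_plane[of l i] l(1) by (rule_tac Diff_infinite_finite) auto
 moreover have inj: "inj_on \<sigma> Z2" using \<sigma>_inj Suc.prems(2) by (auto simp: Z2_def intro: inj_on_subset)
 ultimately have inf: "infinite (\<sigma> ` Z2)" using finite_imageD by blast
 have "\<sigma> ` Z2 <= E" using Suc.prems(2) by (auto simp: Z2_def)
 from Suc.IH[OF inf this] obtain S where S: "finite S" "S <= \<sigma> ` Z2" "card S = 3 * n + 1" "indep n S" by auto
 obtain S2 where S2: "S2 <= Z2" "S = \<sigma> ` S2" using S(2) by (auto simp: subset_image_iff)
 have inj2: "inj_on \<sigma> S2" using inj S2(1) inj_on_subset by blast
 have fin2: "finite S2" using S(1) S2(2) inj2 finite_imageD by metis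
 have c2: "card S2 = 3 * n + 1" using S(3) S2(2) inj2 card_image by metis
 have "indep (Suc n) ({p1, p2, p3} Un S2)"
 proof (rule indep_step[of _ _ l])
  show "indep n (\<sigma> ` S2)" using S S2 by simp
  show "indep (Suc n) {p1, p2, p3}" using 3 by (simp add: insert_commute)
  show "lin l p ~= 0" if "p \<in> S2" for p using that S2(1) Suc.prems(2) by (auto simp: Z2_def)
 qed (use l E fin2 S2 Suc.prems(2) in \<open>auto simp: Z2_def\<close>)
 moreover have "card ({p1, p2, p3} Un S2) = 3 * Suc n + 1"
 proof -
  have "{p1, p2, p3} Int S2 = {}" using l E S2(1) unfolding Z2_def by blast
  then show ?thesis using c3 c2 fin2 by (subst card_Un_disjoint) auto
 qed
 ultimately show ?case using fin2 S2(1) p1 p2 p3 by (intro exI[of _ "{p1, p2, p3} Un S2"]) (auto simp: Z2_def)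
qed

end

text \<open>The eigenvalue selects a plane of the pencil y_0 = t y_1 in
  \<open>annihilating_pencil\<close>; this is where a point on E is found by algebraic
  closedness.\<close>

lemma left_eigenvector_exists:
 fixes A :: "nat => nat => 'k::alg_closed_field"
 assumes "r > 0"
 shows "EX t c. (\<exists>i<r. c i ~= 0) & (\<forall>i<r. (\<Sum>j<r. c j * A j i) = t * c i)"
proof -
 define B where "B = mat r r (%(i, j). A j i)"
 have B: "B \<in> carrier_mat r r" by (simp add: B_def)
 have "degree (char_poly B) > 0" using degree_monic_char_poly[OF B] assms by simp
 then obtain t where "poly (char_poly B) t = 0" using alg_closed_imp_poly_has_root by blast
 then obtain v where v: "eigenvector B v t"
  using eigenvalue_root_char_poly[OF B] by (auto simp: eigenvalue_def)
 then have vc: "v \<in> carrier_vec r" and nz: "v ~= 0\<^sub>v r" and e: "B *\<^sub>v v = t \<cdot>\<^sub>v v"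
  using B by (auto simp: eigenvector_def)
 have "\<exists>i<r. v $ i ~= 0" using nz vc by (auto simp: vec_eq_iff)
 moreover have "(\<Sum>j<r. v $ j * A j i) = t * v $ i" if "i < r" for i
 proof -
  have "(B *\<^sub>v v) $ i = (\<Sum>j\<in>{0..<r}. A j i * v $ j)"
   using that vc by (simp add: B_def scalar_prod_def)
  then show ?thesis using e that vc by (simp add: lessThan_atLeast0 mult.commute)
 qed
 ultimately show ?thesis by (intro exI[of _ t] exI[of _ "%i. v $ i"]) simp
qed

context sklyanin_curve
begin

subsection \<open>The twisted ring of functions on the curve\<close>

text \<open>The value 0 off \<open>E\<close> makes equality of functions the same as equality on the
  curve. The values refer to the fixed coordinate vectors \<open>Y\<close>, so no line bundle is
  needed.\<close>

definition fn :: "nat => (gen list => 'k) => 'p => 'k" where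
 "fn n t p = (if p \<in> E then form n t p else 0)"

definition F :: "nat => ('p => 'k) set" where
 "F n = range (fn n)"

lemma fn_in_F [simp]: "fn n t \<in> F n"
 by (simp add: F_def)

lemma F_outside: "f \<in> F n ==> p ~: E ==> f p = 0"
 by (auto simp: F_def fn_def)

lemma fn_add: "fn n s p + fn n t p = fn n (%w. s w + t w) p"
 by (simp add: fn_def form_def distrib_right sum.distrib)

lemma fn_scale: "c * fn n t p = fn n (%w. c * t w) p"
 by (simp add: fn_def form_def sum_distrib_left mult.assoc)

lemma fn_zero: "fn n (%w. 0) p = 0"
 by (simp add: fn_def form_def)

definition subsp :: "('p => 'k) set => bool" where
 "subsp V \<longleftrightarrow> (%p. 0) \<in> V & (\<forall>f\<in>V. \<forall>g\<in>V. (%p. f p + g p) \<in> V) & (\<forall>f\<in>V. ALL c. (%p. c * f p) \<in> V)"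

lemma subspD:
 assumes "subsp V"
 shows "(%p. 0) \<in> V" "f \<in> V ==> g \<in> V ==> (%p. f p + g p) \<in> V" "f \<in> V ==> (%p. c * f p) \<in> V"
 using assms by (auto simp: subsp_def)

lemma subsp_diff:
 assumes "subsp V" "f \<in> V" "g \<in> V"
 shows "(%p. f p - g p) \<in> V"
 using subspD(2)[OF assms(1,2) subspD(3)[OF assms(1,3), of "- 1"]] by simp

lemma subsp_sum:
 assumes "subsp V" "!!j. j \<in> J ==> f j \<in> V"
 shows "(%p. \<Sum>j\<in>J. c j * f j p) \<in> V"
 using assms(2)
proof (induction J rule: infinite_finite_induct)
 case (insert j J)
 then show ?case using subspD(2)[OF assms(1) subspD(3)[OF assms(1), of "f j"]] by simp
qed (use subspD[OF assms(1)] in simp_all)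

lemma subsp_sum1:
 assumes "subsp V" "!!j. j \<in> J ==> f j \<in> V"
 shows "(%p. \<Sum>j\<in>J. f j p) \<in> V"
 using subsp_sum[OF assms, where c = "%_. 1"] by simp

lemma subsp_F: "subsp (F n)"
 unfolding subsp_def F_def
proof (intro conjI ballI allI)
 show "(%p. 0) \<in> range (fn n)" by (rule range_eqI[of _ _ "%w. 0"]) (simp add: fn_zero fun_eq_iff)
 show "(%p. f p + g p) \<in> range (fn n)" if "f \<in> range (fn n)" "g \<in> range (fn n)" for f g
  using that by (auto simp: fn_add)
 show "(%p. c * f p) \<in> range (fn n)" if "f \<in> range (fn n)" for f c
  using that by (auto simp: fn_scale)
qed

definition mon :: "gen list => 'p => 'k" where
 "mon w p = (if p \<in> E then ev p w else 0)"

lemma fn_mon: "fn n t p = (\<Sum>w\<in>words n. t w * mon w p)"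
 by (simp add: fn_def form_def mon_def)

lemma mon_in_F: "length w = n ==> mon w \<in> F n"
 unfolding F_def
 by (rule range_eqI[of _ _ "%v. if v = w then 1 else 0"])
  (auto simp: fn_def form_def mon_def fun_eq_iff if_distrib[of "%x. x * _"] cong: if_cong)

lemma F_subset: "subsp V ==> (!!w. length w = n ==> mon w \<in> V) ==> F n <= V"
 using subsp_sum[of V "words n" mon] by (auto simp: F_def fn_mon[abs_def])

text \<open>The product of the twisted homogeneous coordinate ring: the second factor is evaluated
  after as many translations as the degree n of the first.\<close>

definition tw :: "nat => ('p => 'k) => ('p => 'k) => 'p => 'k" where
 "tw n f g p = f p * g ((\<sigma> ^^ n) p)"

lemma tw_assoc: "tw n f (tw m g h) = tw (n + m) (tw n f g) h"
 by (simp add: tw_def fun_eq_iff funpow_add add.commute mult.assoc)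

lemma tw_in:
 assumes "f \<in> F n" "g \<in> F m"
 shows "tw n f g \<in> F (n + m)"
proof -
 obtain s t where st: "f = fn n s" "g = fn m t" using assms by (auto simp: F_def)
 have "tw n f g p = fn (n + m) (%w. s (take n w) * t (drop n w)) p" for p
 proof (cases "p \<in> E")
  case True
  have "form (n + m) (%w. s (take n w) * t (drop n w)) p =
    (\<Sum>u\<in>words n. \<Sum>v\<in>words m. s u * ev p u * (t v * ev ((\<sigma> ^^ n) p) v))"
   unfolding form_def sum_words_add by (intro sum.cong refl) (simp add: ev_append mult_ac)
  then show ?thesis using True
   by (simp add: tw_def st fn_def form_def sum_product)
 qed (simp add: tw_def st fn_def)
 then show ?thesis by (simp add: F_def image_iff fun_eq_iff) blast
qed

definition xx :: "gen => 'p => 'k" where "xx i = mon [i]"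

lemma xx_apply: "xx i p = (if p \<in> E then Y p i else 0)"
 by (simp add: xx_def mon_def)

lemma xx_in: "xx i \<in> F (Suc 0)"
 by (simp add: xx_def mon_in_F)

lemma F_left:
 assumes "g \<in> F (Suc m)"
 obtains h where "!!i. h i \<in> F m" "g = (%p. \<Sum>i\<in>UNIV. tw 1 (xx i) (h i) p)"
proof -
 obtain t where t: "g = fn (Suc m) t" using assms by (auto simp: F_def)
 have "form (1 + m) t p = (\<Sum>i\<in>UNIV. Y p i * form m (%w. t (i # w)) (\<sigma> p))" for p
  unfolding form_def sum_words_add by (simp add: sum_words_1 sum_distrib_left mult_ac)
 then have "g = (%p. \<Sum>i\<in>UNIV. tw 1 (xx i) (fn m (%w. t (i # w))) p)"
  by (auto simp: t fn_def tw_def xx_apply fun_eq_iff)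
 then show thesis using that[of "%i. fn m (%w. t (i # w))"] by simp
qed

lemma F_right:
 assumes "g \<in> F (Suc m)"
 obtains h where "!!i. h i \<in> F m" "g = (%p. \<Sum>i\<in>UNIV. tw m (h i) (xx i) p)"
proof -
 obtain t where t: "g = fn (Suc m) t" using assms by (auto simp: F_def)
 have "form (m + 1) t p = (\<Sum>i\<in>UNIV. form m (%w. t (w @ [i])) p * Y ((\<sigma> ^^ m) p) i)" for p
  unfolding form_def sum_words_add One_nat_def sum_words_1
  by (subst sum.swap) (simp add: sum_distrib_right sum_distrib_left ev_append mult_ac)
 then have "g = (%p. \<Sum>i\<in>UNIV. tw m (fn m (%w. t (w @ [i]))) (xx i) p)"
  by (auto simp: t fn_def tw_def xx_apply fun_eq_iff)
 then show thesis using that[of "%i. fn m (%w. t (w @ [i]))"] by simp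
qed

text \<open>The evaluation at any point of E is a combination of those at the 4n independent
  points.\<close>

lemma F_on_basis:
 assumes "n >= 1" "finite S" "S <= E" "card S = 4 * n" "indep n S" "f \<in> F n" "!!p. p \<in> S ==> f p = 0"
 shows "f = (%p. 0)"
proof -
 obtain t where t: "f = fn n t" using assms(6) by (auto simp: F_def)
 have "f q = 0" if q: "q \<in> E" for q
 proof -
  obtain c where c: "!!w. length w = n ==> ev q w = (\<Sum>p\<in>S. c p * ev p w)"
   using indep_basis_spans[OF assms(1-5) relation_free_ev[OF q]] by blast
  have "f q = (\<Sum>w\<in>words n. t w * (\<Sum>p\<in>S. c p * ev p w))" using q by (simp add: t fn_def form_def c)
  also have "... = (\<Sum>p\<in>S. c p * form n t p)"
   unfolding form_def sum_distrib_left by (subst sum.swap) (simp add: mult_ac)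
  also have "... = 0" by (rule sum.neutral) (use assms(3,7) t in \<open>force simp: fn_def\<close>)
  finally show ?thesis .
 qed
 then show ?thesis using F_outside[OF assms(6)] by (metis ext)
qed

lemma F_interpolate:
 assumes "finite S" "S <= E" "indep n S"
 shows "\<exists>f\<in>F n. \<forall>p\<in>S. f p = b p"
proof -
 have "EX t. \<forall>q\<in>S. (\<Sum>w\<in>words n. t w * ev q w) = b q"
 proof (rule independent_rows_surj[OF assms(1) finite_words])
  fix c assume "!!w. w \<in> words n ==> (\<Sum>p\<in>S. c p * ev p w) = 0"
  then show "\<forall>p\<in>S. c p = 0" using indepD[OF assms(3)] by simp
 qed
 then obtain t where t: "!!q. q \<in> S ==> form n t q = b q" by (auto simp: form_def)
 then show ?thesis using assms(2) by (intro bexI[of _ "fn n t"]) (auto simp: fn_def)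
qed

text \<open>If b had infinitely many zeros and infinitely many nonzeros, 6n + 1 of the former and 3n
  + 1 of the latter would be independent in degree 2n, more than the 8n allowed. If b is nonzero at
  finitely many points only, a basis of evaluations avoids them and forces b = 0.\<close>

lemma finite_zeros:
 assumes b: "b \<in> F n" and nz: "b ~= (%p. 0)"
 shows "finite {p \<in> E. b p = 0}"
proof (rule ccontr)
 define Z where "Z = {p \<in> E. b p = 0}"
 assume "~ finite {p \<in> E. b p = 0}"
 then have inf: "infinite Z" by (simp add: Z_def)
 obtain t where t: "b = fn n t" using b by (auto simp: F_def)
 have n: "n >= 1"
 proof (rule ccontr)
  assume "~ n >= 1"
  then have "n = 0" by simp
  then have "b p = (if p \<in> E then t [] else 0)" for p by (simp add: t fn_def form_def words_def)
  then have "t [] ~= 0" "b p = 0 --> t [] = 0 \<or> p ~: E" for p using nz by (auto simp: fun_eq_iff split: if_splits)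
  then have "Z = {}" by (auto simp: Z_def)
  then show False using inf by simp
 qed
 show False
 proof (cases "finite (E - Z)")
  case True
  obtain S where S: "finite S" "S <= E" "card S = 4 * n" "S Int (E - Z) = {}" "indep n S"
   using indep_basis_avoiding[OF True n] by blast
  have "b = (%p. 0)" by (rule F_on_basis[OF n S(1,2,3,5) b]) (use S in \<open>auto simp: Z_def\<close>)
  then show False using nz by simp
 next
  case False
  obtain S1 where S1: "finite S1" "S1 <= Z" "card S1 = 3 * (n + n) + 1" "indep (n + n) S1"
   using indep_subset_infinite[OF inf, of "n + n"] by (auto simp: Z_def)
  have inj: "inj_on (\<sigma> ^^ n) (E - Z)" using \<sigma>_pow_inj by (rule inj_on_subset) auto
  then have inf2: "infinite ((\<sigma> ^^ n) ` (E - Z))" using False finite_imageD by blast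
  have "(\<sigma> ^^ n) ` (E - Z) <= E" by auto
  from indep_subset_infinite[OF inf2 this, of n] obtain S where
   S: "finite S" "S <= (\<sigma> ^^ n) ` (E - Z)" "card S = 3 * n + 1" "indep n S" by blast
  obtain S2 where S2: "S2 <= E - Z" "S = (\<sigma> ^^ n) ` S2" using S(2) by (auto simp: subset_image_iff)
  have inj2: "inj_on (\<sigma> ^^ n) S2" using inj S2(1) inj_on_subset by blast
  have fin2: "finite S2" using S(1) S2(2) inj2 finite_imageD by metis
  have c2: "card S2 = 3 * n + 1" using S(3) S2(2) inj2 card_image by metis
  have "indep (n + n) (S1 Un S2)"
   by (rule indep_step_form[of _ _ n t])
    (use S1 S S2 fin2 in \<open>auto simp: Z_def t fn_def split: if_splits\<close>)
  then have "card (S1 Un S2) <= 4 * (n + n)" using n S1 S2 fin2 by (intro indep_card) (auto simp: Z_def)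
  moreover have "card (S1 Un S2) = card S1 + card S2"
   using S1 S2 fin2 by (intro card_Un_disjoint) auto
  ultimately show False using S1(3) c2 n by simp
 qed
qed

lemma F_nonzero_point: "p \<in> E ==> \<exists>f\<in>F n. f p ~= 0"
 using ev_nonzero[of p n] mon_in_F by (metis mon_def)

subsection \<open>Right ideals\<close>

definition right_ideal :: "(nat => ('p => 'k) set) => bool" where
 "right_ideal K \<longleftrightarrow> (ALL n. subsp (K n) & K n <= F n & (\<forall>f\<in>K n. ALL i. tw n f (xx i) \<in> K (Suc n)))"

lemma right_idealD:
 assumes "right_ideal K"
 shows "subsp (K n)" "f \<in> K n ==> f \<in> F n" "f \<in> K n ==> tw n f (xx i) \<in> K (Suc n)"
 using assms by (auto simp: right_ideal_def)

lemma right_ideal_mult: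
 assumes K: "right_ideal K" and f: "f \<in> K n" and g: "g \<in> F m"
 shows "tw n f g \<in> K (n + m)"
 using f g
proof (induction m arbitrary: f g n)
 case 0
 obtain t where t: "g = fn 0 t" using 0 by (auto simp: F_def)
 have "tw n f g = (%p. t [] * f p)"
 proof
  fix p show "tw n f g p = t [] * f p"
   using F_outside[OF right_idealD(2)[OF K 0(1)], of p]
   by (cases "p \<in> E") (simp_all add: tw_def t fn_def form_def words_def)
 qed
 then show ?case using subspD(3)[OF right_idealD(1)[OF K] 0(1)] by simp
next
 case (Suc m)
 obtain h where h: "!!i. h i \<in> F m" "g = (%p. \<Sum>i\<in>UNIV. tw 1 (xx i) (h i) p)"
  using F_left[OF Suc.prems(2)] by metis
 have "tw n f g = (%p. \<Sum>i\<in>UNIV. tw (Suc n) (tw n f (xx i)) (h i) p)"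
  by (simp add: tw_def h(2) sum_distrib_left mult.assoc fun_eq_iff)
 moreover have "tw (Suc n) (tw n f (xx i)) (h i) \<in> K (Suc n + m)" for i
  by (rule Suc.IH) (use right_idealD[OF K] Suc.prems h in auto)
 then have "(%p. \<Sum>i\<in>UNIV. tw (Suc n) (tw n f (xx i)) (h i) p) \<in> K (Suc n + m)"
  by (intro subsp_sum1 right_idealD(1)[OF K])
 ultimately show ?case by simp
qed

lemma right_ideal_full:
 assumes K: "right_ideal K" and "K n = F n" "n <= m"
 shows "K m = F m"
 using assms(3)
proof (induction m rule: dec_induct)
 case base show ?case by (rule assms(2))
next
 case (step m)
 have "g \<in> K (Suc m)" if "g \<in> F (Suc m)" for g
 proof -
  obtain h where h: "!!i. h i \<in> F m" "g = (%p. \<Sum>i\<in>UNIV. tw m (h i) (xx i) p)"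
   using F_right[OF \<open>g \<in> F (Suc m)\<close>] by metis
  moreover have "(%p. \<Sum>i\<in>UNIV. tw m (h i) (xx i) p) \<in> K (Suc m)"
   by (intro subsp_sum1 right_idealD(1,3)[OF K]) (use h(1) step.IH in simp)
  ultimately show ?thesis by simp
 qed
 then show ?case using right_idealD(2)[OF K] by blast
qed

text \<open>Since fullness persists in higher degrees (\<open>right_ideal_full\<close>), for a right
  ideal this says that its quotient is not finite dimensional.\<close>

definition proper :: "(nat => ('p => 'k) set) => bool" where
 "proper K \<longleftrightarrow> (ALL n. K n ~= F n)"

text \<open>Zorn applies because each \<open>F n\<close> is spanned by finitely many words: if the
  union of a chain were full in degree n, one member of the chain would contain all these
  words.\<close>

lemma maximal_right_ideal:
 assumes I: "right_ideal I" "proper I"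
 obtains K where "right_ideal K" "proper K" "!!n. I n <= K n"
  "!!K'. right_ideal K' ==> proper K' ==> (!!n. K n <= K' n) ==> K' = K"
proof -
 \<comment> \<open>A graded family is encoded as a set of pairs, so that inclusion and union of sets
   order the families degree by degree.\<close>
 define lev where "lev X n = {f. (n, f) \<in> X}" for X :: "(nat \<times> ('p => 'k)) set" and n
 define A where "A = {X. right_ideal (lev X) & proper (lev X) & (ALL n. I n <= lev X n)}"
 have levS: "lev (Sigma UNIV K) = K" for K by (auto simp: lev_def)
 have "Sigma UNIV I \<in> A" using I by (simp add: A_def levS)
 then have ne: "A ~= {}" by blast
 have "\<exists>M\<in>A. \<forall>X\<in>A. M <= X --> X = M"
 proof (rule subset_Zorn_nonempty[OF ne])
  fix C assume C: "C ~= {}" "subset.chain A C"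
  have CA: "X \<in> A" if "X \<in> C" for X using C(2) that by (auto simp: subset_chain_def)
  have "right_ideal (lev (\<Union>C))"
   unfolding right_ideal_def
  proof (intro allI conjI ballI)
   fix n
   obtain X where "X \<in> C" using C(1) by blast
   show "subsp (lev (\<Union>C) n)" unfolding subsp_def
   proof (intro conjI ballI allI)
    have "right_ideal (lev X)" using CA[OF \<open>X \<in> C\<close>] by (simp add: A_def)
    then have "(%p. 0) \<in> lev X n" using subspD(1)[OF right_idealD(1)] by blast
    then show "(%p. 0) \<in> lev (\<Union>C) n" using \<open>X \<in> C\<close> by (auto simp: lev_def)
    fix f assume f: "f \<in> lev (\<Union>C) n"
    show "(%p. f p + g p) \<in> lev (\<Union>C) n" if g: "g \<in> lev (\<Union>C) n" for g
    proof -
     have "{(n, f), (n, g)} <= \<Union>C" using f g by (auto simp: lev_def)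
     then obtain Z where Z: "Z \<in> C" "{(n, f), (n, g)} <= Z"
      using finite_subset_Union_chain[OF _ _ C] by (metis finite.emptyI finite.insertI)
     then have fg: "f \<in> lev Z n" "g \<in> lev Z n" by (auto simp: lev_def)
     have ri: "right_ideal (lev Z)" using CA[OF Z(1)] by (simp add: A_def)
     have "(%p. f p + g p) \<in> lev Z n" using subspD(2)[OF right_idealD(1)[OF ri] fg] .
     then show ?thesis using Z(1) by (auto simp: lev_def)
    qed
    fix c
    obtain Z where Z: "Z \<in> C" "f \<in> lev Z n" using f by (auto simp: lev_def)
    have ri: "right_ideal (lev Z)" using CA[OF Z(1)] by (simp add: A_def)
    have "(%p. c * f p) \<in> lev Z n" using subspD(3)[OF right_idealD(1)[OF ri] Z(2)] .
    then show "(%p. c * f p) \<in> lev (\<Union>C) n" using Z(1) by (auto simp: lev_def)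
   qed
   show "lev (\<Union>C) n <= F n" using CA right_idealD(2) by (fastforce simp: A_def lev_def)
   fix f i assume "f \<in> lev (\<Union>C) n"
   then obtain Z where Z: "Z \<in> C" "f \<in> lev Z n" by (auto simp: lev_def)
   then have "tw n f (xx i) \<in> lev Z (Suc n)" using right_idealD(3) CA[OF Z(1)] by (auto simp: A_def)
   then show "tw n f (xx i) \<in> lev (\<Union>C) (Suc n)" using Z(1) by (auto simp: lev_def)
  qed
  moreover have "proper (lev (\<Union>C))"
   unfolding proper_def
  proof (intro allI notI)
   fix n assume full: "lev (\<Union>C) n = F n"
   have "(%w. (n, mon w)) ` words n <= \<Union>C"
   proof
    fix x assume "x \<in> (%w. (n, mon w)) ` words n"
    then obtain w where "length w = n" "x = (n, mon w)" by auto
    moreover from this have "mon w \<in> lev (\<Union>C) n" using full mon_in_F[of w n] by simp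
    ultimately show "x \<in> \<Union>C" by (auto simp: lev_def)
   qed
   then obtain Z where Z: "Z \<in> C" "(%w. (n, mon w)) ` words n <= Z"
    using finite_subset_Union_chain[OF _ _ C] by (metis finite_imageI finite_words)
   have ZA: "right_ideal (lev Z)" "proper (lev Z)" using CA[OF Z(1)] by (auto simp: A_def)
   have "F n <= lev Z n" by (rule F_subset[OF right_idealD(1)[OF ZA(1)]]) (use Z(2) in \<open>auto simp: lev_def\<close>)
   then show False using ZA right_idealD(2)[OF ZA(1)] by (auto simp: proper_def)
  qed
  moreover have "I n <= lev (\<Union>C) n" for n
   using C(1) CA by (fastforce simp: A_def lev_def)
  ultimately show "\<Union>C \<in> A" by (simp add: A_def)
 qed
 then obtain M where M: "M \<in> A" "!!X. X \<in> A ==> M <= X ==> X = M" by blast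
 show thesis
 proof (rule that[of "lev M"])
  show "right_ideal (lev M)" "proper (lev M)" "I n <= lev M n" for n using M(1) by (auto simp: A_def)
  fix K' assume K': "right_ideal K'" "proper K'" "!!n. lev M n <= K' n"
  have "Sigma UNIV K' \<in> A" using K' M(1) by (force simp: A_def levS)
  moreover have "M <= Sigma UNIV K'" using K'(3) by (fastforce simp: lev_def)
  ultimately have "Sigma UNIV K' = M" by (rule M(2))
  then show "K' = lev M" using levS by metis
 qed
qed

end

section \<open>Planes that meet the curve in four distinct points\<close>

context sklyanin_curve
begin

lemma tw_linear:
 "tw n f (%p. g p + h p) = (%p. tw n f g p + tw n f h p)"
 "tw n f (%p. c * g p) = (%p. c * tw n f g p)"
 "tw n (%p. f p + h p) g = (%p. tw n f g p + tw n h g p)"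
 "tw n (%p. c * f p) g = (%p. c * tw n f g p)"
 "tw n f (%p. 0) = (%p. 0)"
 by (simp_all add: tw_def fun_eq_iff algebra_simps)

lemma tw_sum:
 "tw n (%p. \<Sum>j\<in>J. c j * f j p) g = (%p. \<Sum>j\<in>J. c j * tw n (f j) g p)"
 "tw n g (%p. \<Sum>j\<in>J. c j * f j p) = (%p. \<Sum>j\<in>J. c j * tw n g (f j) p)"
 by (simp_all add: tw_def fun_eq_iff sum_distrib_left sum_distrib_right mult_ac)

lemma tw_one: "f \<in> F n ==> tw n f (mon []) = f"
 using F_outside[of f n] by (auto simp: tw_def mon_def fun_eq_iff)

definition xl :: "(gen => 'k) => 'p => 'k" where
 "xl l = (%p. \<Sum>i\<in>UNIV. l i * xx i p)"

lemma xl_apply: "xl l p = (if p \<in> E then lin l p else 0)"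
 by (simp add: xl_def xx_apply lin_def)

lemma xl_in: "xl l \<in> F (Suc 0)"
 unfolding xl_def by (rule subsp_sum[OF subsp_F]) (rule xx_in)

text \<open>Four distinct zeros on E are what makes division by the form of the plane possible in
  \<open>divide_by_form\<close>.\<close>

definition good :: "(gen => 'k) => bool" where
 "good l \<longleftrightarrow> (EX i. l i ~= 0) & (EX Z. Z <= E & card Z = 4 & (\<forall>p\<in>Z. lin l p = 0))"

lemma good_pencil:
 assumes "sq2 (t\<^sup>2) ~= 0" "sq3 (t\<^sup>2) ~= 0"
 shows "good (pencil t)"
 unfolding good_def
proof (intro conjI exI[of _ X0] exI[of _ "psection t"])
 show "pencil t X0 ~= 0" by (simp add: pencil_def)
qed (use card_psection[OF assms] in \<open>auto simp: lin_pencil psection_def\<close>)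

text \<open>The characters of the Klein group; it acts on $E$ by sign changes of the coordinates.\<close>

fun chi :: "gen => gen => 'k" where
 "chi X0 i = 1"
| "chi X1 i = (if i = X0 \<or> i = X1 then 1 else - 1)"
| "chi X2 i = (if i = X0 \<or> i = X2 then 1 else - 1)"
| "chi X3 i = (if i = X0 \<or> i = X3 then 1 else - 1)"

lemma chi_sq: "(chi h i)\<^sup>2 = 1"
 by (cases h) auto

definition unit_form :: "gen => gen => 'k" where
 "unit_form i j = (if j = i then 1 else 0)"

lemma lin_unit_form: "lin (unit_form i) p = Y p i"
 by (simp add: lin_def unit_form_def if_distrib[of "%x. x * _"] cong: if_cong)

lemma xl_unit_form: "xl (unit_form i) = xx i"
 by (simp add: xl_apply xx_apply lin_unit_form fun_eq_iff)

text \<open>The sign changes of one point with y_i = 0 supply all four points.\<close>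

lemma good_coordinate:
 assumes p: "p \<in> E" "Y p i = 0"
 shows "good (unit_form i)"
proof -
 have "\<exists>q\<in>E. EX c. c ~= 0 & (ALL j. Y q j = c * (chi h j * Y p j))" for h
 proof (rule Y_surj)
  obtain j where "Y p j ~= 0" using Y_nz p by blast
  moreover have "chi h j ~= 0" using chi_sq[of h j] by auto
  ultimately show "EX j. chi h j * Y p j ~= 0" by auto
 qed (use eq1[OF p(1)] eq2[OF p(1)] in \<open>simp_all add: power_mult_distrib chi_sq\<close>)
 then obtain q c where q: "!!h. q h \<in> E" "!!h. c h ~= 0" "!!h j. Y (q h) j = c h * (chi h j * Y p j)" by metis
 have nz: "Y p j ~= 0" if "j ~= i" for j using one_zero[OF p(1), of i j] p that by auto
 have two1: "(1::'k) ~= - 1"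
 proof
  assume "(1::'k) = - 1"
  then have "(1::'k) + 1 = 0" by (metis add.right_inverse)
  then show False using two by simp
 qed
 \<comment> \<open>Two characters giving the same point are proportional on the three coordinates
   other than i, which are nonzero; as 1 and -1 differ, the characters coincide.\<close>
 have inj: "h = h'" if e: "q h = q h'" for h h'
 proof -
  have e: "c h * chi h j = c h' * chi h' j" if "j ~= i" for j
   using q(3)[of h j] q(3)[of h' j] nz[OF that] e by (simp add: mult.assoc[symmetric])
  consider "i = X0" | "i = X1" | "i = X2" | "i = X3" by (cases i) auto
  then show ?thesis
   using e[of X0] e[of X1] e[of X2] e[of X3] q(2)[of h] q(2)[of h'] two1
   by cases (cases h; cases h'; auto)+
 qed
 then have "card (range q) = 4" by (subst card_image) (auto simp: inj_on_def UNIV_gen)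
 then show ?thesis unfolding good_def
  using q p by (intro conjI exI[of _ i] exI[of _ "range q"]) (auto simp: unit_form_def[of i i] lin_unit_form)
qed

lemma good_coordinates: "good (unit_form i)"
proof -
 have root: "\<exists>p\<in>E. Y p X2 = 0" "\<exists>p\<in>E. Y p X3 = 0" "\<exists>p\<in>E. Y p X0 = 0"
 proof -
  obtain t where "t\<^sup>2 = c1 - 1" using sqrt_exists by blast
  then obtain r where r: "0\<^sup>2 = sq2 (t\<^sup>2)" "r\<^sup>2 = sq3 (t\<^sup>2)" using sq_zero_iff sqrt_exists by force
  show "\<exists>p\<in>E. Y p X2 = 0" using point_exists[OF r] by auto
  obtain t where "t\<^sup>2 = c1 / c2 - 1" using sqrt_exists by blast
  then obtain r where r: "r\<^sup>2 = sq2 (t\<^sup>2)" "0\<^sup>2 = sq3 (t\<^sup>2)" using sq_zero_iff sqrt_exists by force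
  show "\<exists>p\<in>E. Y p X3 = 0" using point_exists[OF r] by auto
  show "\<exists>p\<in>E. Y p X0 = 0" by (rule X0_point)
 qed
 have "\<exists>p\<in>E. Y p X1 = 0"
 proof -
  obtain v w where vw: "v\<^sup>2 = 1 / (c2 - 1)" "w\<^sup>2 = - c2 / (c2 - 1)" using sqrt_exists by metis
  define y where "y i = (case i of X0 => 1 | X1 => 0 | X2 => v | X3 => w)" for i
  have "\<exists>p\<in>E. EX c. c ~= 0 & (ALL i. Y p i = c * y i)"
  proof (rule Y_surj)
   show "EX i. y i ~= 0" by (rule exI[of _ X0]) (simp add: y_def)
   have "c2 - 1 ~= 0" using c12_nz by simp
   then have "1 + 1 / (c2 - 1) + - c2 / (c2 - 1) = 0" by (simp add: field_simps)
   then show "(y X0)\<^sup>2 + (y X1)\<^sup>2 + (y X2)\<^sup>2 + (y X3)\<^sup>2 = 0" by (simp add: y_def vw)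
   show "(y X3)\<^sup>2 + (1 - \<gamma>) / (1 + \<alpha>) * (y X1)\<^sup>2 + (1 + \<gamma>) / (1 - \<beta>) * (y X2)\<^sup>2 = 0"
    by (simp add: y_def vw flip: c2_def)
  qed
  then obtain p c where "p \<in> E" "!!i. Y p i = c * y i" by blast
  then show ?thesis by (intro bexI[of _ p]) (simp_all add: y_def)
 qed
 then show ?thesis using root good_coordinate by (cases i) blast+
qed

text \<open>The tangency conditions with \<alpha> eliminated by the parameter equation, in the form
  in which they are compared with the relations of degree x_2 and x_3.\<close>

lemma bad_t:
 shows "t\<^sup>2 = c1 - 1 ==> t\<^sup>2 * (1 - \<beta>) = \<beta> * (1 + \<gamma>)"
  "t\<^sup>2 = c1 / c2 - 1 ==> t\<^sup>2 * (1 + \<gamma>) = - \<gamma> * (1 - \<beta>)"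
proof -
 have 1: "(1 + \<alpha>) * c1 = 1 - \<gamma>" "(1 - \<beta>) * c2 = 1 + \<gamma>" by (simp_all add: c1_def c2_def)
 assume t: "t\<^sup>2 = c1 - 1"
 have "(1 + \<alpha>) * (t\<^sup>2 * (1 - \<beta>)) - (1 + \<alpha>) * (\<beta> * (1 + \<gamma>)) =
   ((1 + \<alpha>) * c1 - (1 - \<gamma>)) * (1 - \<beta>) - (\<alpha> + \<beta> + \<gamma> + \<alpha> * \<beta> * \<gamma>)"
  unfolding t by (simp add: algebra_simps)
 also have "... = 0" by (simp only: 1 par0) simp
 finally show "t\<^sup>2 * (1 - \<beta>) = \<beta> * (1 + \<gamma>)" by (simp only: right_minus_eq mult_left_cancel[OF par_nz(4)])
next
 have 1: "(1 + \<alpha>) * c1 = 1 - \<gamma>" "(1 - \<beta>) * c2 = 1 + \<gamma>" by (simp_all add: c1_def c2_def)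
 assume "t\<^sup>2 = c1 / c2 - 1"
 then have t: "(t\<^sup>2 + 1) * c2 = c1" using c12_nz by simp
 have "(1 + \<alpha>) * (t\<^sup>2 * (1 + \<gamma>)) - (1 + \<alpha>) * (- \<gamma> * (1 - \<beta>)) =
   (1 - \<beta>) * ((1 + \<alpha>) * ((t\<^sup>2 + 1) * c2) - (1 - \<gamma>)) + (t\<^sup>2 + 1) * (1 + \<alpha>) * ((1 + \<gamma>) - (1 - \<beta>) * c2)
    - (\<alpha> + \<beta> + \<gamma> + \<alpha> * \<beta> * \<gamma>)"
  by (simp add: algebra_simps)
 also have "... = 0" unfolding t by (simp only: 1 par0) simp
 finally show "t\<^sup>2 * (1 + \<gamma>) = - \<gamma> * (1 - \<beta>)" by (simp only: right_minus_eq mult_left_cancel[OF par_nz(4)])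
qed

lemma good_pencilI:
 assumes "t\<^sup>2 * (1 - \<beta>) ~= \<beta> * (1 + \<gamma>)" "t\<^sup>2 * (1 + \<gamma>) ~= - \<gamma> * (1 - \<beta>)"
 shows "good (pencil t)"
 using bad_pencil[of t] bad_t[of t] assms by (intro good_pencil) blast+

text \<open>These ensure that the plane obtained by the exchange is not tangent again; both reduce
  to \<beta> + \<gamma> and 1 + \<beta> \<gamma> being nonzero.\<close>

lemma cross_nz: "\<beta> * (1 - \<gamma>)\<^sup>2 + \<gamma> * (1 + \<beta>)\<^sup>2 ~= 0" "((1 + \<beta>) * (1 + \<gamma>))\<^sup>2 ~= ((1 - \<beta>) * (1 - \<gamma>))\<^sup>2"
proof -
 have "\<beta> * (1 - \<gamma>)\<^sup>2 + \<gamma> * (1 + \<beta>)\<^sup>2 = (\<beta> + \<gamma>) * (1 + \<beta> * \<gamma>)"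
  by (simp add: algebra_simps power2_eq_square)
 then show "\<beta> * (1 - \<gamma>)\<^sup>2 + \<gamma> * (1 + \<beta>)\<^sup>2 ~= 0" using par_sum_nz par_prod_nz by simp
 have "((1 + \<beta>) * (1 + \<gamma>))\<^sup>2 - ((1 - \<beta>) * (1 - \<gamma>))\<^sup>2 = (2 * (\<beta> + \<gamma>)) * (2 * (1 + \<beta> * \<gamma>))"
  by (simp add: algebra_simps power2_eq_square)
 then show "((1 + \<beta>) * (1 + \<gamma>))\<^sup>2 ~= ((1 - \<beta>) * (1 - \<gamma>))\<^sup>2" using par_sum_nz(2) par_prod_nz(2) two
  by (metis mult_eq_0_iff right_minus_eq)
qed

text \<open>
  The planes of the pencil $y_0 = t y_1$ tangent to $E$ are avoided by means of the identities
  $x_3 (x_0 - t' x_1) = (x_0 - t x_1)(d_2 x_2 + d_3 x_3)$ and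
  $x_2 (x_0 - t' x_1) = (x_0 - t x_1)(d_2 x_2 + d_3 x_3)$ in $B$.
\<close>

lemma bad_pencil_exchange:
 assumes bad: "~ good (pencil t)"
 obtains j t' d where "good (pencil t')" "tw 1 (xx j) (xl (pencil t')) = tw 1 (xl (pencil t)) (xl d)"
proof -
 have R: "2 * Y p X0 * Y (\<sigma> p) X2 = (1 + \<beta>) * Y p X3 * Y (\<sigma> p) X1 - (1 - \<beta>) * Y p X1 * Y (\<sigma> p) X3"
   "2 * Y p X2 * Y (\<sigma> p) X0 = (1 - \<beta>) * Y p X3 * Y (\<sigma> p) X1 - (1 + \<beta>) * Y p X1 * Y (\<sigma> p) X3"
   "2 * Y p X0 * Y (\<sigma> p) X3 = (1 + \<gamma>) * Y p X1 * Y (\<sigma> p) X2 - (1 - \<gamma>) * Y p X2 * Y (\<sigma> p) X1"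
   "2 * Y p X3 * Y (\<sigma> p) X0 = (1 - \<gamma>) * Y p X1 * Y (\<sigma> p) X2 - (1 + \<gamma>) * Y p X2 * Y (\<sigma> p) X1"
  if "p \<in> E" for p using bil2[OF shift shift, of p] bil3[OF shift shift, of p] that by auto
 define D where "D d2 d3 i = (case i of X2 => d2 | X3 => d3 | _ => 0)" for d2 d3 :: 'k and i
 have lD: "lin (D d2 d3) p = d2 * Y p X2 + d3 * Y p X3" for d2 d3 p by (simp add: lin_def sum_gen D_def)
 have twE: "tw 1 (xx j) (xl (pencil t')) = tw 1 (xl (pencil t)) (xl (D d2 d3))"
  if "!!p. p \<in> E ==> Y p j * (Y (\<sigma> p) X0 - t' * Y (\<sigma> p) X1) =
   (Y p X0 - t * Y p X1) * (d2 * Y (\<sigma> p) X2 + d3 * Y (\<sigma> p) X3)" for j t' d2 d3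
  using that by (auto simp: tw_def xx_apply xl_apply lin_pencil lD fun_eq_iff)
 consider "t\<^sup>2 * (1 + \<gamma>) = - \<gamma> * (1 - \<beta>)" | "t\<^sup>2 * (1 - \<beta>) = \<beta> * (1 + \<gamma>)" using good_pencilI bad by blast
 then show thesis
 proof cases
  case 1
  have t0: "t ~= 0" using 1 by auto
  \<comment> \<open>Rewrite both sides of the identity by the relations in terms of x_1 x_2, x_2
    x_1, x_1 x_3, x_3 x_1. Three of the four coefficients determine \<open>d2\<close>,
    \<open>d3\<close>, \<open>t'\<close>; the fourth, for x_1 x_3, is fact \<open>e\<close> below
    and amounts to the tangency of the plane.\<close>
  define d2 where "d2 = 2 * \<gamma> / ((1 - \<gamma>) * t)"
  define d3 where "d3 = (1 + \<gamma>) / (1 - \<gamma>)"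
  define t' where "t' = - d2 * (1 + \<beta>) / 2"
  have d: "(1 - \<gamma>) * (t * d2) = 2 * \<gamma>" "(1 - \<gamma>) * d3 = 1 + \<gamma>" "2 * t' = - d2 * (1 + \<beta>)"
   using t0 two by (simp_all add: d2_def d3_def t'_def)
  have e: "2 * (t * d3) = - (1 - \<beta>) * d2"
  proof -
   have "(1 - \<gamma>) * t * (2 * (t * d3)) = 2 * (t\<^sup>2 * ((1 - \<gamma>) * d3))" by (simp add: algebra_simps power2_eq_square)
   also have "... = 2 * (t\<^sup>2 * (1 + \<gamma>))" by (simp only: d)
   also have "... = - (1 - \<beta>) * (2 * \<gamma>)" by (simp only: 1) (simp add: algebra_simps)
   also have "... = (1 - \<gamma>) * t * (- (1 - \<beta>) * d2)" unfolding d(1)[symmetric] by (simp add: algebra_simps)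
   finally show ?thesis using t0 by simp
  qed
  have tt: "t'\<^sup>2 * (t\<^sup>2 * (1 - \<gamma>)\<^sup>2) = \<gamma>\<^sup>2 * (1 + \<beta>)\<^sup>2"
  proof -
   have "4 * (t'\<^sup>2 * (t\<^sup>2 * (1 - \<gamma>)\<^sup>2)) = ((1 - \<gamma>) * t * (2 * t'))\<^sup>2" by (simp add: power_mult_distrib)
   also have "(1 - \<gamma>) * t * (2 * t') = - ((1 - \<gamma>) * (t * d2)) * (1 + \<beta>)" unfolding d(3) by (simp add: algebra_simps)
   also have "(...)\<^sup>2 = 4 * (\<gamma>\<^sup>2 * (1 + \<beta>)\<^sup>2)" unfolding d(1) by (simp add: power_mult_distrib)
   finally show ?thesis using four_nz by simp
  qed
  have tt2: "t'\<^sup>2 * (1 - \<gamma>)\<^sup>2 * (1 - \<beta>) = - \<gamma> * (1 + \<gamma>) * (1 + \<beta>)\<^sup>2"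
  proof -
   have "\<gamma> * (t'\<^sup>2 * (1 - \<gamma>)\<^sup>2 * (1 - \<beta>)) = - (t'\<^sup>2 * (1 - \<gamma>)\<^sup>2) * (- \<gamma> * (1 - \<beta>))" by (simp add: algebra_simps)
   also have "... = - (t'\<^sup>2 * (t\<^sup>2 * (1 - \<gamma>)\<^sup>2)) * (1 + \<gamma>)" unfolding 1[symmetric] by (simp add: algebra_simps)
   also have "... = \<gamma> * (- \<gamma> * (1 + \<gamma>) * (1 + \<beta>)\<^sup>2)" unfolding tt by (simp add: algebra_simps power2_eq_square)
   finally show ?thesis by (simp only: mult_left_cancel[OF par_nz(2)] mult_left_cancel[OF par_nz(3)])
  qed
  have "good (pencil t')"
  proof (rule good_pencilI; rule notI)
   assume a: "t'\<^sup>2 * (1 - \<beta>) = \<beta> * (1 + \<gamma>)"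
   have "(\<beta> * (1 + \<gamma>)) * (1 - \<gamma>)\<^sup>2 = t'\<^sup>2 * (1 - \<gamma>)\<^sup>2 * (1 - \<beta>)" unfolding a[symmetric] by (simp only: mult_ac)
   then have "(\<beta> * (1 + \<gamma>)) * (1 - \<gamma>)\<^sup>2 = - \<gamma> * (1 + \<gamma>) * (1 + \<beta>)\<^sup>2" unfolding tt2 .
   then have "(1 + \<gamma>) * (\<beta> * (1 - \<gamma>)\<^sup>2 + \<gamma> * (1 + \<beta>)\<^sup>2) = 0" by (simp add: algebra_simps)
   then show False using cross_nz(1) by simp
  next
   assume "t'\<^sup>2 * (1 + \<gamma>) = - \<gamma> * (1 - \<beta>)"
   from this[symmetric] have "(1 + \<gamma>) * (- \<gamma> * (1 + \<gamma>) * (1 + \<beta>)\<^sup>2) = (- \<gamma> * (1 - \<beta>)) * ((1 - \<gamma>)\<^sup>2 * (1 - \<beta>))"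
    unfolding tt2[symmetric] by (simp only: mult_ac)
   then have "\<gamma> * (((1 + \<beta>) * (1 + \<gamma>))\<^sup>2 - ((1 - \<beta>) * (1 - \<gamma>))\<^sup>2) = 0"
    by (simp add: algebra_simps power2_eq_square)
   then show False using cross_nz(2) by simp
  qed
  moreover have "tw 1 (xx X3) (xl (pencil t')) = tw 1 (xl (pencil t)) (xl (D d2 d3))"
  proof (rule twE)
   fix p assume p: "p \<in> E"
   let ?y = "Y p" and ?z = "Y (\<sigma> p)"
   have "2 * (1 - \<gamma>) * (?y X3 * (?z X0 - t' * ?z X1) - (?y X0 - t * ?y X1) * (d2 * ?z X2 + d3 * ?z X3)) =
    (1 - \<gamma>) * (2 * ?y X3 * ?z X0) - ((1 - \<gamma>) * d3) * (2 * ?y X0 * ?z X3) + 2 * ((1 - \<gamma>) * (t * d2)) * (?y X1 * ?z X2)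
    + (1 - \<gamma>) * (- (2 * t') * (?y X3 * ?z X1) - d2 * (2 * ?y X0 * ?z X2) + (2 * (t * d3)) * (?y X1 * ?z X3))"
    by (simp add: algebra_simps)
   also have "... = 0" unfolding R[OF p] d e by (simp add: algebra_simps)
   finally show "?y X3 * (?z X0 - t' * ?z X1) = (?y X0 - t * ?y X1) * (d2 * ?z X2 + d3 * ?z X3)"
    using two by simp
  qed
  ultimately show thesis by (rule that)
 next
  case 2
  have t0: "t ~= 0" using 2 by auto
  \<comment> \<open>The same comparison for the identity with x_2 on the left; now the condition
    left over is the other tangency, for x_1 x_2.\<close>
  define d3 where "d3 = 2 * \<beta> / ((1 + \<beta>) * t)"
  define d2 where "d2 = (1 - \<beta>) / (1 + \<beta>)"
  define t' where "t' = d3 * (1 - \<gamma>) / 2"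
  have d: "(1 + \<beta>) * (t * d3) = 2 * \<beta>" "(1 + \<beta>) * d2 = 1 - \<beta>" "2 * t' = d3 * (1 - \<gamma>)"
   using t0 two by (simp_all add: d2_def d3_def t'_def)
  have e: "2 * (t * d2) = (1 + \<gamma>) * d3"
  proof -
   have "(1 + \<beta>) * t * (2 * (t * d2)) = 2 * (t\<^sup>2 * ((1 + \<beta>) * d2))" by (simp add: algebra_simps power2_eq_square)
   also have "... = 2 * (t\<^sup>2 * (1 - \<beta>))" by (simp only: d)
   also have "... = (1 + \<gamma>) * (2 * \<beta>)" by (simp only: 2) (simp add: algebra_simps)
   also have "... = (1 + \<beta>) * t * ((1 + \<gamma>) * d3)" unfolding d(1)[symmetric] by (simp add: algebra_simps)
   finally show ?thesis using t0 by simp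
  qed
  have tt: "t'\<^sup>2 * (t\<^sup>2 * (1 + \<beta>)\<^sup>2) = \<beta>\<^sup>2 * (1 - \<gamma>)\<^sup>2"
  proof -
   have "4 * (t'\<^sup>2 * (t\<^sup>2 * (1 + \<beta>)\<^sup>2)) = ((1 + \<beta>) * t * (2 * t'))\<^sup>2" by (simp add: power_mult_distrib)
   also have "(1 + \<beta>) * t * (2 * t') = ((1 + \<beta>) * (t * d3)) * (1 - \<gamma>)" unfolding d(3) by (simp add: algebra_simps)
   also have "(...)\<^sup>2 = 4 * (\<beta>\<^sup>2 * (1 - \<gamma>)\<^sup>2)" unfolding d(1) by (simp add: power_mult_distrib)
   finally show ?thesis using four_nz by simp
  qed
  have tt2: "t'\<^sup>2 * (1 + \<beta>)\<^sup>2 * (1 + \<gamma>) = \<beta> * (1 - \<beta>) * (1 - \<gamma>)\<^sup>2"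
  proof -
   have "\<beta> * (t'\<^sup>2 * (1 + \<beta>)\<^sup>2 * (1 + \<gamma>)) = (t'\<^sup>2 * (1 + \<beta>)\<^sup>2) * (\<beta> * (1 + \<gamma>))" by (simp add: algebra_simps)
   also have "... = (t'\<^sup>2 * (t\<^sup>2 * (1 + \<beta>)\<^sup>2)) * (1 - \<beta>)" unfolding 2[symmetric] by (simp add: algebra_simps)
   also have "... = \<beta> * (\<beta> * (1 - \<beta>) * (1 - \<gamma>)\<^sup>2)" unfolding tt by (simp add: algebra_simps power2_eq_square)
   finally show ?thesis by (simp only: mult_left_cancel[OF par_nz(2)] mult_left_cancel[OF par_nz(3)])
  qed
  have "good (pencil t')"
  proof (rule good_pencilI; rule notI)
   assume "t'\<^sup>2 * (1 - \<beta>) = \<beta> * (1 + \<gamma>)"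
   from this[symmetric] have "(1 - \<beta>) * (\<beta> * (1 - \<beta>) * (1 - \<gamma>)\<^sup>2) = (\<beta> * (1 + \<gamma>)) * ((1 + \<beta>)\<^sup>2 * (1 + \<gamma>))"
    unfolding tt2[symmetric] by (simp only: mult_ac)
   then have "\<beta> * (((1 + \<beta>) * (1 + \<gamma>))\<^sup>2 - ((1 - \<beta>) * (1 - \<gamma>))\<^sup>2) = 0"
    by (simp add: algebra_simps power2_eq_square)
   then show False using cross_nz(2) by simp
  next
   assume a: "t'\<^sup>2 * (1 + \<gamma>) = - \<gamma> * (1 - \<beta>)"
   have "(- \<gamma> * (1 - \<beta>)) * (1 + \<beta>)\<^sup>2 = t'\<^sup>2 * (1 + \<beta>)\<^sup>2 * (1 + \<gamma>)" unfolding a[symmetric] by (simp only: mult_ac)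
   then have "(- \<gamma> * (1 - \<beta>)) * (1 + \<beta>)\<^sup>2 = \<beta> * (1 - \<beta>) * (1 - \<gamma>)\<^sup>2" unfolding tt2 .
   then have "(1 - \<beta>) * (\<beta> * (1 - \<gamma>)\<^sup>2 + \<gamma> * (1 + \<beta>)\<^sup>2) = 0" by (simp add: algebra_simps)
   then show False using cross_nz(1) by simp
  qed
  moreover have "tw 1 (xx X2) (xl (pencil t')) = tw 1 (xl (pencil t)) (xl (D d2 d3))"
  proof (rule twE)
   fix p assume p: "p \<in> E"
   let ?y = "Y p" and ?z = "Y (\<sigma> p)"
   have "2 * (1 + \<beta>) * (?y X2 * (?z X0 - t' * ?z X1) - (?y X0 - t * ?y X1) * (d2 * ?z X2 + d3 * ?z X3)) =
    (1 + \<beta>) * (2 * ?y X2 * ?z X0) - ((1 + \<beta>) * d2) * (2 * ?y X0 * ?z X2) + 2 * ((1 + \<beta>) * (t * d3)) * (?y X1 * ?z X3)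
    + (1 + \<beta>) * (- (2 * t') * (?y X2 * ?z X1) - d3 * (2 * ?y X0 * ?z X3) + (2 * (t * d2)) * (?y X1 * ?z X2))"
    by (simp add: algebra_simps)
   also have "... = 0" unfolding R[OF p] d e by (simp add: algebra_simps)
   finally show "?y X2 * (?z X0 - t' * ?z X1) = (?y X0 - t * ?y X1) * (d2 * ?z X2 + d3 * ?z X3)"
    using two par_nz(5) by (metis mult_eq_0_iff right_minus_eq)
  qed
  ultimately show thesis by (rule that)
 qed
qed

end

section \<open>Right ideals that are maximal among the proper ones\<close>

locale maximal_right_ideal = sklyanin_curve \<alpha> \<beta> \<gamma> E \<sigma> Y
 for \<alpha> \<beta> \<gamma> :: "'k::alg_closed_field" and E :: "'p set" and \<sigma> Y +
 fixes K :: "nat => ('p => 'k) set"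
 assumes K: "right_ideal K" and K_proper: "proper K"
  and K_max: "!!K'. right_ideal K' ==> proper K' ==> (!!n. K n <= K' n) ==> K' = K"
begin

lemmas K_subsp = right_idealD(1)[OF K] and K_F = right_idealD(2)[OF K] and K_xx = right_idealD(3)[OF K]
lemmas K_mult = right_ideal_mult[OF K]

text \<open>K + mF is a strictly larger right ideal, hence no longer proper. Up to finitely many
  degrees, every element outside K generates the whole quotient.\<close>

lemma maximal_full:
 assumes m: "m \<in> F d" "m ~: K d"
 obtains N where "N >= d" "!!n f. n >= N ==> f \<in> F n ==> \<exists>c\<in>F (n - d). (%p. f p - tw d m c p) \<in> K n"
proof -
 \<comment> \<open>Below degree d only K is kept, because \<open>n - d\<close> is truncated to 0
   there.\<close>
 define S where "S n = (if n < d then K n else {%p. k p + tw d m c p | k c. k \<in> K n & c \<in> F (n - d)})" for n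
 have KS: "K n <= S n" for n
 proof
  fix k assume "k \<in> K n"
  moreover have "k = (%p. k p + tw d m (%p. 0) p)" by (simp add: tw_linear)
  ultimately show "k \<in> S n" unfolding S_def using subspD(1)[OF subsp_F] by auto
 qed
 have S: "right_ideal S"
  unfolding right_ideal_def
 proof (intro allI conjI ballI)
  fix n
  show "subsp (S n)"
  proof (cases "n < d")
   case False
   show ?thesis unfolding subsp_def
   proof (intro conjI ballI allI)
    show "(%p. 0) \<in> S n" using KS subspD(1)[OF K_subsp] by blast
    fix f assume "f \<in> S n"
    then obtain k c where f: "f = (%p. k p + tw d m c p)" "k \<in> K n" "c \<in> F (n - d)"
     using False by (auto simp: S_def)
    show "(%p. f p + g p) \<in> S n" if gS: "g \<in> S n" for g
    proof -
     obtain k' c' where g: "g = (%p. k' p + tw d m c' p)" "k' \<in> K n" "c' \<in> F (n - d)"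
      using False gS by (auto simp: S_def)
     have "(%p. f p + g p) = (%p. (k p + k' p) + tw d m (%p. c p + c' p) p)"
      by (simp add: f g tw_linear fun_eq_iff)
     then show ?thesis unfolding S_def
      using False subspD(2)[OF K_subsp f(2) g(2)] subspD(2)[OF subsp_F f(3) g(3)] by auto
    qed
    fix a
    have "(%p. a * f p) = (%p. a * k p + tw d m (%p. a * c p) p)"
     by (simp add: f tw_linear fun_eq_iff distrib_left)
    then show "(%p. a * f p) \<in> S n" unfolding S_def
     using False subspD(3)[OF K_subsp f(2), of a] subspD(3)[OF subsp_F f(3), of a] by auto
   qed
  qed (simp add: S_def K_subsp)
  show "S n <= F n"
  proof (cases "n < d")
   case False
   show ?thesis
   proof
    fix f assume "f \<in> S n"
    then obtain k c where f: "f = (%p. k p + tw d m c p)" "k \<in> K n" "c \<in> F (n - d)"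
     using False by (auto simp: S_def)
    have "tw d m c \<in> F n" using tw_in[OF m(1) f(3)] False by simp
    then show "f \<in> F n" unfolding f(1) using subspD(2)[OF subsp_F K_F[OF f(2)]] by blast
   qed
  qed (use K_F in \<open>auto simp: S_def\<close>)
  fix f i assume fS: "f \<in> S n"
  show "tw n f (xx i) \<in> S (Suc n)"
  proof (cases "n < d")
   case True
   then show ?thesis using fS KS[of "Suc n"] K_xx by (auto simp: S_def[of n])
  next
   case False
   then obtain k c where f: "f = (%p. k p + tw d m c p)" "k \<in> K n" "c \<in> F (n - d)"
    using fS by (auto simp: S_def)
   have "tw n f (xx i) = (%p. tw n k (xx i) p + tw d m (tw (n - d) c (xx i)) p)"
    using False by (simp add: f tw_linear tw_assoc)
   moreover have "tw (n - d) c (xx i) \<in> F (Suc n - d)"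
    using tw_in[OF f(3) xx_in, of i] False by (simp add: Suc_diff_le)
   ultimately show ?thesis using False K_xx[OF f(2), of i] unfolding S_def by auto
  qed
 qed
 have "m \<in> S d"
 proof -
  have "EX k c. m = (%p. k p + tw d m c p) & k \<in> K d & c \<in> F (d - d)"
   using subspD(1)[OF K_subsp, of d] mon_in_F[of "[]" 0] tw_one[OF m(1)]
   by (intro exI[of _ "%p. 0"] exI[of _ "mon []"]) simp
  then show ?thesis unfolding S_def by simp
 qed
 then have "S ~= K" using m by auto
 then have "~ proper S" using K_max[OF S _ KS] by blast
 then obtain N where N: "S N = F N" by (auto simp: proper_def)
 show thesis
 proof (rule that[of "max N d"])
  fix n f assume n: "n >= max N d" and f: "f \<in> F n"
  then have "f \<in> S n" using right_ideal_full[OF S N, of n] by simp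
  then obtain k c where f: "f = (%p. k p + tw d m c p)" "k \<in> K n" "c \<in> F (n - d)"
   using n by (auto simp: S_def)
  then show "\<exists>c\<in>F (n - d). (%p. f p - tw d m c p) \<in> K n" by (intro bexI[of _ c]) simp_all
 qed simp
qed

text \<open>If K were 0, then x_0 F would be everything in large degrees; but all its elements
  vanish at a point of E with y_0 = 0.\<close>

lemma K_nonzero: "EX d b. b \<in> K d & b ~= (%p. 0)"
proof (rule ccontr)
 assume "~ ?thesis"
 then have zero: "b = (%p. 0)" if "b \<in> K d" for b d using that by blast
 obtain q where q: "q \<in> E" "Y q X0 = 0" using X0_point by blast
 have "xx X0 ~: K (Suc 0)"
 proof
  assume "xx X0 \<in> K (Suc 0)"
  then have z: "xx X0 p = 0" for p using zero by metis
  obtain t where "psection t Int {q} = {}" "psection 1 ~= {}" using good_psection_avoiding[of "{q}"] psection_nonempty by auto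
  then obtain p where p: "p \<in> psection 1" by blast
  then show False using z[of p] psection_X1[OF p] by (simp add: xx_apply psection_def)
 qed
 from maximal_full[OF xx_in this] obtain N where
  N: "!!n f. n >= N ==> f \<in> F n ==> \<exists>c\<in>F (n - Suc 0). (%p. f p - tw (Suc 0) (xx X0) c p) \<in> K n" by metis
 obtain f where f: "f \<in> F N" "f q ~= 0" using F_nonzero_point q by blast
 then obtain c where "(%p. f p - tw (Suc 0) (xx X0) c p) \<in> K N" using N by blast
 then have "f q - tw (Suc 0) (xx X0) c q = 0" using zero by metis
 then show False using f q by (simp add: tw_def xx_apply)
qed

definition indmod :: "nat => nat => (nat => 'p => 'k) => bool" where
 "indmod n r a \<longleftrightarrow> (\<forall>j<r. a j \<in> F n) & (ALL c. (%p. \<Sum>j<r. c j * a j p) \<in> K n --> (\<forall>j<r. c j = 0))"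

text \<open>K_n contains b F_{n-d}, which has dimension 4(n - d), while F_n has dimension
  4n.\<close>

lemma indmod_bound:
 assumes b: "b \<in> K d" "b ~= (%p. 0)" and n: "n > d" and a: "indmod n r a"
 shows "r <= 4 * d"
proof (rule ccontr)
 assume r: "~ r <= 4 * d"
 define m where "m = n - d"
 have m: "m >= 1" "d + m = n" using n by (auto simp: m_def)
 have "finite {p \<in> E. b p = 0}" by (rule finite_zeros[OF K_F[OF b(1)] b(2)])
 then have "finite ((\<sigma> ^^ d) ` {p \<in> E. b p = 0})" by blast
 \<comment> \<open>At the preimage under the d-th translation of a point s of \<open>S\<close> the
   factor b is nonzero, so the products of b with the dual basis of \<open>S\<close> stay
   independent.\<close>
 from indep_basis_avoiding[OF this m(1)] obtain S where S: "finite S" "S <= E" "card S = 4 * m"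
  "S Int (\<sigma> ^^ d) ` {p \<in> E. b p = 0} = {}" "indep m S" by blast
 have "\<forall>s\<in>S. \<exists>g\<in>F m. \<forall>p\<in>S. g p = (if p = s then 1 else 0)"
  using F_interpolate[OF S(1,2,5), of "%p. if p = _ then 1 else 0"] by blast
 then obtain g where g: "!!s. s \<in> S ==> g s \<in> F m" "!!s p. s \<in> S ==> p \<in> S ==> g s p = (if p = s then 1 else 0)"
  by metis
 have n1: "n >= 1" using n by simp
 from indep_basis_avoiding[of "{}", OF _ n1] obtain T where T: "finite T" "T <= E" "card T = 4 * n" "indep n T" by auto
 define J where "J = Inl ` {..<r} Un Inr ` S"
 define v where "v j = (case j of Inl j => a j | Inr s => tw d b (g s))" for j
 have "card J = r + 4 * m" unfolding J_def using S by (subst card_Un_disjoint) (auto simp: card_image)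
 then have "card T < card J" using T r m by simp
 moreover have "finite J" using S by (simp add: J_def)
 ultimately obtain c where c: "\<exists>j\<in>J. c j ~= 0" "!!p. p \<in> T ==> (\<Sum>j\<in>J. c j * v j p) = 0"
  using nontrivial_solution[OF T(1), of J v] by blast
 have split: "(\<Sum>j\<in>J. c j * v j p) = (\<Sum>j<r. c (Inl j) * a j p) + (\<Sum>s\<in>S. c (Inr s) * tw d b (g s) p)" for p
  unfolding J_def using S by (subst sum.union_disjoint) (auto simp: sum.reindex v_def)
 have bK: "tw d b (g s) \<in> K n" if "s \<in> S" for s using K_mult[OF b(1) g(1)[OF that]] m by simp
 have vF: "v j \<in> F n" if "j \<in> J" for j
  using that a bK K_F by (auto simp: J_def v_def indmod_def)
 have zero: "(%p. \<Sum>j\<in>J. c j * v j p) = (%p. 0)"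
  by (rule F_on_basis[OF n1 T subsp_sum[OF subsp_F vF] c(2)])
 then have e: "(\<Sum>j<r. c (Inl j) * a j p) = - (\<Sum>s\<in>S. c (Inr s) * tw d b (g s) p)" for p
  using fun_cong[OF zero, of p] unfolding split by (simp add: eq_neg_iff_add_eq_0)
 have "(%p. \<Sum>s\<in>S. (- c (Inr s)) * tw d b (g s) p) \<in> K n" by (rule subsp_sum[OF K_subsp bK])
 then have "(%p. \<Sum>j<r. c (Inl j) * a j p) \<in> K n" by (simp add: e sum_negf)
 then have c1: "c (Inl j) = 0" if "j < r" for j using a that by (auto simp: indmod_def)
 have "c (Inr s) = 0" if s: "s \<in> S" for s
 proof -
  obtain p where p: "p \<in> E" "(\<sigma> ^^ d) p = s" using s S(2) \<sigma>_pow_surj by (metis imageE subsetD)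
  have "b p ~= 0" using S(4) p s by blast
  have "0 = (\<Sum>s\<in>S. c (Inr s) * tw d b (g s) p)" using e[of p] c1 by simp
  also have "... = (\<Sum>s'\<in>S. if s' = s then b p * c (Inr s) else 0)"
   by (rule sum.cong[OF refl]) (use g(2) s in \<open>auto simp: tw_def p\<close>)
  finally show ?thesis using \<open>b p ~= 0\<close> S(1) s by simp
 qed
 then show False using c1 c(1) by (auto simp: J_def)
qed

text \<open>Among the degrees beyond d, where the dimension of F_n / K_n is bounded, take one where
  it is maximal. There the injective multiplication by x_1 is bijective, and an eigenvector m of
  x_1^{-1} x_0 with eigenvalue t satisfies m (x_0 - t x_1) = 0 modulo K.\<close>

lemma annihilating_pencil:
 assumes inj: "!!n m. m \<in> F n ==> tw n m (xx X1) \<in> K (Suc n) ==> m \<in> K n"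
 shows "EX n m t. m \<in> F n & m ~: K n & tw n m (xl (pencil t)) \<in> K (Suc n)"
proof -
 obtain d b where b: "b \<in> K d" "b ~= (%p. 0)" using K_nonzero by blast
 define P where "P r \<longleftrightarrow> (EX n a. n > d & indmod n r a)" for r
 have "P 1"
 proof -
  obtain f where f: "f \<in> F (Suc d)" "f ~: K (Suc d)" using K_proper K_F unfolding proper_def by blast
  have "c = 0" if "(%p. c * f p) \<in> K (Suc d)" for c
  proof (rule ccontr)
   assume "c ~= 0"
   then show False using subspD(3)[OF K_subsp that, of "1 / c"] f by simp
  qed
  then show ?thesis unfolding P_def indmod_def
   using f by (intro exI[of _ "Suc d"] exI[of _ "%_. f"]) auto
 qed
 moreover have bd: "!!r. P r ==> r <= 4 * d" using indmod_bound[OF b] by (auto simp: P_def)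
 ultimately obtain r where r: "P r" "!!s. P s ==> s <= r"
  using GreatestI_nat[of P 1 "4 * d"] Greatest_le_nat[of P _ "4 * d"] by blast
 have r0: "r > 0" using r(2)[OF \<open>P 1\<close>] by simp
 obtain n a where n: "n > d" and a: "indmod n r a" using r(1) by (auto simp: P_def)
 have aF: "a j \<in> F n" if "j < r" for j using a that by (simp add: indmod_def)
 define a' where "a' j = tw n (a j) (xx X1)" for j
 have a'F: "a' j \<in> F (Suc n)" if "j < r" for j
  using tw_in[OF aF[OF that] xx_in] by (simp add: a'_def)
 have a'ind: "c j = 0" if c: "(%p. \<Sum>j<r. c j * a' j p) \<in> K (Suc n)" "j < r" for c j
 proof -
  have 1: "tw n (%p. \<Sum>j<r. c j * a j p) (xx X1) \<in> K (Suc n)" using c(1) by (simp add: tw_sum a'_def)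
  have "(%p. \<Sum>j<r. c j * a j p) \<in> F n" by (rule subsp_sum[OF subsp_F]) (use aF in auto)
  then have "(%p. \<Sum>j<r. c j * a j p) \<in> K n" using 1 by (rule inj)
  then show ?thesis using a c(2) by (auto simp: indmod_def)
 qed
 \<comment> \<open>An element outside the span of the \<open>a'\<close> modulo K would give r + 1
   independent classes in degree n + 1, against the choice of r.\<close>
 have spanning: "EX A. (%p. f p - (\<Sum>i<r. A i * a' i p)) \<in> K (Suc n)" if f: "f \<in> F (Suc n)" for f
 proof -
  define a'' where "a'' = a'(r := f)"
  have sum_a'': "(\<Sum>j<Suc r. c j * a'' j p) = (\<Sum>j<r. c j * a' j p) + c r * f p" for c p
   by (simp add: a''_def)
  have "~ indmod (Suc n) (Suc r) a''"
  proof
   assume "indmod (Suc n) (Suc r) a''"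
   then have "P (Suc r)" unfolding P_def using n by (intro exI[of _ "Suc n"] exI[of _ a'']) simp
   then show False using r(2) by fastforce
  qed
  moreover have "\<forall>j<Suc r. a'' j \<in> F (Suc n)" using f a'F by (auto simp: a''_def less_Suc_eq)
  ultimately obtain c j where c: "(%p. (\<Sum>j<r. c j * a' j p) + c r * f p) \<in> K (Suc n)" "j < Suc r" "c j ~= 0"
   unfolding indmod_def sum_a'' by blast
  have "c r ~= 0"
  proof
   assume "c r = 0"
   then have "(%p. \<Sum>j<r. c j * a' j p) \<in> K (Suc n)" using c(1) by simp
   then show False using a'ind c \<open>c r = 0\<close> by (metis less_SucE)
  qed
  have "(%p. (1 / c r) * ((\<Sum>j<r. c j * a' j p) + c r * f p)) \<in> K (Suc n)" by (rule subspD(3)[OF K_subsp c(1)])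
  moreover have "(%p. (1 / c r) * ((\<Sum>j<r. c j * a' j p) + c r * f p)) = (%p. f p - (\<Sum>j<r. (- c j / c r) * a' j p))"
   using \<open>c r ~= 0\<close> by (simp add: fun_eq_iff distrib_left sum_distrib_left sum_negf)
  ultimately show ?thesis by (intro exI[of _ "%j. - c j / c r"]) simp
 qed
 have "\<forall>j<r. EX A. (%p. tw n (a j) (xx X0) p - (\<Sum>i<r. A i * a' i p)) \<in> K (Suc n)"
  using spanning tw_in[OF aF xx_in] by simp
 then obtain A where A: "!!j. j < r ==> (%p. tw n (a j) (xx X0) p - (\<Sum>i<r. A j i * a' i p)) \<in> K (Suc n)" by metis
 \<comment> \<open>\<open>A\<close> is the matrix of x_1^{-1} x_0 in the basis \<open>a\<close>,
   with rows as images; so a left eigenvector gives the coefficients of m.\<close>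
 obtain t c where c: "\<exists>i<r. c i ~= 0" "!!i. i < r ==> (\<Sum>j<r. c j * A j i) = t * c i"
  using left_eigenvector_exists[OF r0, of A] by blast
 define m where "m = (%p. \<Sum>j<r. c j * a j p)"
 have mF: "m \<in> F n" unfolding m_def by (rule subsp_sum[OF subsp_F]) (use aF in simp)
 have mK: "m ~: K n" using a c(1) by (auto simp: m_def indmod_def)
 have "(%p. \<Sum>j<r. c j * (tw n (a j) (xx X0) p - (\<Sum>i<r. A j i * a' i p))) \<in> K (Suc n)"
  by (rule subsp_sum[OF K_subsp]) (use A in simp)
 moreover have "(\<Sum>j<r. c j * (tw n (a j) (xx X0) p - (\<Sum>i<r. A j i * a' i p))) = tw n m (xl (pencil t)) p" for p
 proof -
  have "(\<Sum>j<r. c j * (\<Sum>i<r. A j i * a' i p)) = (\<Sum>i<r. (\<Sum>j<r. c j * A j i) * a' i p)"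
   unfolding sum_distrib_left sum_distrib_right by (subst sum.swap) (simp add: mult_ac)
  also have "... = t * (\<Sum>i<r. c i * a' i p)" using c(2) by (simp add: sum_distrib_left mult.assoc)
  also have "... = t * tw n m (xx X1) p" by (simp add: m_def tw_sum a'_def)
  finally have "(\<Sum>j<r. c j * (tw n (a j) (xx X0) p - (\<Sum>i<r. A j i * a' i p))) =
    tw n m (xx X0) p - t * tw n m (xx X1) p"
   by (simp add: right_diff_distrib sum_subtractf m_def tw_sum)
  also have "... = tw n m (xl (pencil t)) p"
   by (simp add: tw_def xl_apply xx_apply lin_pencil algebra_simps)
  finally show ?thesis .
 qed
 ultimately have "tw n m (xl (pencil t)) \<in> K (Suc n)" by simp
 then show ?thesis using mF mK by blast
qed

text \<open>If a coordinate kills something, its plane is already good. Otherwise a tangent plane of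
  the pencil is exchanged: m x_j is not in K, and m x_j (x_0 - t' x_1) = m (x_0 - t x_1) d lies in
  K.\<close>

lemma annihilating_good_form:
 obtains n m l where "m \<in> F n" "m ~: K n" "good l" "tw n m (xl l) \<in> K (Suc n)"
proof (cases "EX n m i. m \<in> F n & m ~: K n & tw n m (xx i) \<in> K (Suc n)")
 case True
 then obtain n m i where "m \<in> F n" "m ~: K n" "tw n m (xx i) \<in> K (Suc n)" by blast
 then show thesis using that[of m n "unit_form i"] good_coordinates by (simp add: xl_unit_form)
next
 case False
 then obtain n m t where m: "m \<in> F n" "m ~: K n" "tw n m (xl (pencil t)) \<in> K (Suc n)"
  using annihilating_pencil by blast
 show thesis
 proof (cases "good (pencil t)")
  case True then show thesis using that m by blast
 next
  case bad: False
  obtain j t' d where *: "good (pencil t')" "tw 1 (xx j) (xl (pencil t')) = tw 1 (xl (pencil t)) (xl d)"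
   using bad_pencil_exchange[OF bad] .
  have "tw (Suc n) (tw n m (xx j)) (xl (pencil t')) = tw n m (tw 1 (xx j) (xl (pencil t')))"
   using tw_assoc[of n m 1 "xx j" "xl (pencil t')"] by simp
  also have "... = tw (Suc n) (tw n m (xl (pencil t))) (xl d)"
   unfolding *(2) using tw_assoc[of n m 1 "xl (pencil t)" "xl d"] by simp
  also have "... \<in> K (Suc (Suc n))" using K_mult[OF m(3) xl_in, of d] by simp
  finally have "tw (Suc n) (tw n m (xx j)) (xl (pencil t')) \<in> K (Suc (Suc n))" .
  moreover have "tw n m (xx j) \<in> F (Suc n)" using tw_in[OF m(1) xx_in] by simp
  moreover have "tw n m (xx j) ~: K (Suc n)" using False m by blast
  ultimately show thesis using that *(1) by blast
 qed
qed

text \<open>Interpolate the quotient f / l at 4n independent points away from the plane. The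
  difference of f and the product then vanishes at these preimages and at the four points of the
  plane, which is a basis of evaluations in degree n + 1.\<close>

lemma divide_by_form:
 assumes Z: "Z <= E" "card Z = 4" "!!p. p \<in> Z ==> lin l p = 0" and l: "l i ~= 0" and n: "n >= 3"
  and f: "f \<in> F (Suc n)" "!!p. p \<in> Z ==> f p = 0"
 shows "\<exists>g\<in>F n. f = tw 1 (xl l) g"
proof -
 have fZ: "finite Z" using Z(2) by (metis card.infinite zero_neq_numeral)
 have "finite (\<sigma> ` {p \<in> E. lin l p = 0})" using finite_plane[of l i] l by blast
 from indep_basis_avoiding[OF this, of n] n obtain S where S: "finite S" "S <= E" "card S = 4 * n" "S Int \<sigma> ` {p \<in> E. lin l p = 0} = {}" "indep n S" by auto
 define S2 where "S2 = {p \<in> E. \<sigma> p \<in> S}"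
 have im: "\<sigma> ` S2 = S" using S(2) \<sigma>_pow_surj[of 1] by (auto simp: S2_def)
 have inj: "inj_on \<sigma> S2" using \<sigma>_inj by (rule inj_on_subset) (auto simp: S2_def)
 have fin2: "finite S2" using S(1) im inj finite_imageD by metis
 have c2: "card S2 = 4 * n" using S(3) im inj card_image by metis
 have nz: "lin l p ~= 0" if "p \<in> S2" for p using that S(4) by (auto simp: S2_def)
 have ind: "indep (Suc n) (Z Un S2)"
  by (rule indep_step[of _ _ l]) (use fZ fin2 Z S im nz n in \<open>auto simp: S2_def intro!: indep_small\<close>)
 have card: "card (Z Un S2) = 4 * Suc n"
  using Z c2 nz fZ fin2 by (subst card_Un_disjoint) auto
 define b where "b s = (let p = the_inv_into S2 \<sigma> s in f p / lin l p)" for s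
 obtain g where g: "g \<in> F n" "!!s. s \<in> S ==> g s = b s" using F_interpolate[OF S(1,2,5)] by blast
 have tF: "tw 1 (xl l) g \<in> F (Suc n)" using tw_in[OF xl_in g(1)] by simp
 have "(%p. f p - tw 1 (xl l) g p) = (%p. 0)"
 proof (rule F_on_basis[OF _ _ _ card ind subsp_diff[OF subsp_F f(1) tF]])
  fix p assume p: "p \<in> Z Un S2"
  show "f p - tw 1 (xl l) g p = 0"
  proof (cases "p \<in> S2")
   case True
   then have "g (\<sigma> p) = f p / lin l p" using g(2)[of "\<sigma> p"] im inj by (auto simp: b_def the_inv_into_f_f)
   then show ?thesis using nz[OF True] True by (simp add: tw_def xl_apply S2_def)
  next
   case False
   then show ?thesis using p f(2) Z by (simp add: tw_def xl_apply)
  qed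
 qed (use fZ fin2 Z in \<open>auto simp: S2_def\<close>)
 then show ?thesis using g(1) by (intro bexI[of _ g]) (auto simp: fun_eq_iff)
qed

text \<open>Otherwise each of the four points of the plane has an annihilator of m that is nonzero
  there. Their multiples can cancel the values of any f of large degree at the four points; the rest
  is divisible by l. So m f would lie in K for all such f, and \<open>maximal_full\<close> would
  make K full.\<close>

lemma common_zero:
 assumes m: "m \<in> F n" "m ~: K n" and l: "good l" "tw n m (xl l) \<in> K (Suc n)"
 shows "\<exists>q\<in>E. ALL j c. c \<in> F j --> tw n m c \<in> K (n + j) --> c q = 0"
proof (rule ccontr)
 assume "~ ?thesis"
 then have "\<forall>q\<in>E. EX j c. c \<in> F j & tw n m c \<in> K (n + j) & c q ~= 0" by blast
 then obtain J C where C: "!!q. q \<in> E ==> C q \<in> F (J q)" "!!q. q \<in> E ==> tw n m (C q) \<in> K (n + J q)" "!!q. q \<in> E ==> C q q ~= 0"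
  by metis
 obtain i Z where Z: "l i ~= 0" "Z <= E" "card Z = 4" "!!p. p \<in> Z ==> lin l p = 0" using l(1) by (auto simp: good_def)
 have fZ: "finite Z" using Z(3) by (metis card.infinite zero_neq_numeral)
 \<comment> \<open>All C q have degree at most M - 3, so the complementary factors have degree at
   least 4, where the four translated points are independent by \<open>indep_small\<close>.\<close>
 define M where "M = 3 + (\<Sum>q\<in>Z. J q)"
 have JM: "J q + 3 <= M" if "q \<in> Z" for q
  using member_le_sum[of q Z J] that fZ by (simp add: M_def)
 have "\<exists>g\<in>F (Suc M - J q). \<forall>p\<in>Z. g ((\<sigma> ^^ J q) p) = (if p = q then 1 else 0)" if q: "q \<in> Z" for q
 proof -
  let ?s = "\<sigma> ^^ J q"
  have inj: "inj_on ?s Z" using \<sigma>_pow_inj Z(2) inj_on_subset by blast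
  have ind: "indep (Suc M - J q) (?s ` Z)"
   using fZ Z JM[OF q] card_image_le[OF fZ, of ?s] by (intro indep_small) auto
  have "finite (?s ` Z)" "?s ` Z <= E" using fZ Z by auto
  from F_interpolate[OF this ind, of "%p. if p = ?s q then 1 else 0"]
  obtain g where "g \<in> F (Suc M - J q)" "\<forall>p\<in>?s ` Z. g p = (if p = ?s q then 1 else 0)" by blast
  moreover from this have "\<forall>p\<in>Z. g (?s p) = (if p = q then 1 else 0)"
   using inj_on_eq_iff[OF inj _ q] by auto
  ultimately show ?thesis by blast
 qed
 then obtain g where g: "!!q. q \<in> Z ==> g q \<in> F (Suc M - J q)"
  "!!q p. q \<in> Z ==> p \<in> Z ==> g q ((\<sigma> ^^ J q) p) = (if p = q then 1 else 0)" by metis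
 define h where "h q = tw (J q) (C q) (g q)" for q
 have hF: "h q \<in> F (Suc M)" if "q \<in> Z" for q
  using tw_in[OF C(1)[of q] g(1)[OF that]] that Z(2) JM[OF that] by (auto simp: h_def)
 have hK: "tw n m (h q) \<in> K (n + Suc M)" if "q \<in> Z" for q
 proof -
  have "tw (n + J q) (tw n m (C q)) (g q) \<in> K (n + J q + (Suc M - J q))"
   using K_mult[OF C(2) g(1)[OF that]] that Z(2) by blast
  then show ?thesis using JM[OF that] by (simp add: h_def tw_assoc)
 qed
 have all: "tw n m f \<in> K (n + Suc M)" if f: "f \<in> F (Suc M)" for f
 proof -
  \<comment> \<open>The multiples h q of C q are supported at q alone among the four points, so this
    difference vanishes on all of \<open>Z\<close> and is divisible by l.\<close>
  define f' where "f' = (%p. f p - (\<Sum>q\<in>Z. (f q / C q q) * h q p))"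
  have f'F: "f' \<in> F (Suc M)" unfolding f'_def
   by (intro subsp_diff[OF subsp_F f] subsp_sum[OF subsp_F] hF)
  have "f' p = 0" if p: "p \<in> Z" for p
  proof -
   have "(\<Sum>q\<in>Z. (f q / C q q) * h q p) = (\<Sum>q\<in>Z. if q = p then f p else 0)"
    by (rule sum.cong[OF refl]) (use g(2) p C(3) Z(2) in \<open>auto simp: h_def tw_def\<close>)
   then show ?thesis using p fZ by (simp add: f'_def)
  qed
  then obtain u where u: "u \<in> F M" "f' = tw 1 (xl l) u"
   using divide_by_form[OF Z(2,3,4) Z(1) _ f'F] by (auto simp: M_def)
  have "tw n m f' = tw (Suc n) (tw n m (xl l)) u" unfolding u(2) tw_assoc by simp
  then have 1: "tw n m f' \<in> K (n + Suc M)" using K_mult[OF l(2) u(1)] by simp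
  have 2: "(%p. \<Sum>q\<in>Z. (f q / C q q) * tw n m (h q) p) \<in> K (n + Suc M)"
   by (rule subsp_sum[OF K_subsp]) (rule hK)
  have "f = (%p. f' p + (\<Sum>q\<in>Z. (f q / C q q) * h q p))" by (simp add: f'_def)
  then have "tw n m f = tw n m (%p. f' p + (\<Sum>q\<in>Z. (f q / C q q) * h q p))" by simp
  also have "... = (%p. tw n m f' p + (\<Sum>q\<in>Z. (f q / C q q) * tw n m (h q) p))" by (simp only: tw_linear tw_sum)
  finally show ?thesis using subspD(2)[OF K_subsp 1 2] by simp
 qed
 have all': "tw n m f \<in> K (n + j)" if j: "j >= Suc M" and f: "f \<in> F j" for j f
  using j f
 proof (induction j arbitrary: f rule: dec_induct)
  case base then show ?case by (rule all)
 next
  case (step j)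
  obtain h where h: "!!i. h i \<in> F j" "f = (%p. \<Sum>i\<in>UNIV. tw j (h i) (xx i) p)"
   using F_right[OF step.prems] by metis
  have "tw n m f = (%p. \<Sum>i\<in>UNIV. tw n m (tw j (h i) (xx i)) p)"
   unfolding h(2) using tw_sum(2)[of n m "%_. 1" "%i. tw j (h i) (xx i)" UNIV] by simp
  also have "... = (%p. \<Sum>i\<in>UNIV. tw (n + j) (tw n m (h i)) (xx i) p)" by (simp only: tw_assoc)
  also have "... \<in> K (Suc (n + j))"
   by (intro subsp_sum1[OF K_subsp] K_xx step.IH h)
  finally show ?case by simp
 qed
 obtain N where N: "N >= n" "!!n' f. n' >= N ==> f \<in> F n' ==> \<exists>c\<in>F (n' - n). (%p. f p - tw n m c p) \<in> K n'"
  using maximal_full[OF m] by metis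
 define n' where "n' = max N (n + Suc M)"
 have "f \<in> K n'" if fF: "f \<in> F n'" for f
 proof -
  obtain c where c: "c \<in> F (n' - n)" "(%p. f p - tw n m c p) \<in> K n'" using N(2)[OF _ fF] by (auto simp: n'_def)
  have "tw n m c \<in> K (n + (n' - n))" by (rule all'[OF _ c(1)]) (simp add: n'_def)
  then have "tw n m c \<in> K n'" by (simp add: n'_def)
  from subspD(2)[OF K_subsp c(2) this] show ?thesis by simp
 qed
 then show False using K_proper K_F unfolding proper_def by blast
qed

end

context sklyanin_curve
begin

text \<open>In large degrees every f is congruent to some m c modulo the maximal right ideal. The
  value c(q) does not depend on the choice of c because annihilators of m vanish at q; it is taken
  as \<Lambda>(f).\<close>

theorem point_functional:
 assumes I: "right_ideal I" "proper I"
 obtains p N \<Lambda> where "p \<in> E"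
  "!!n f g. n >= N ==> f \<in> F n ==> g \<in> F n ==> \<Lambda> n (%p. f p + g p) = \<Lambda> n f + (\<Lambda> n g :: 'k)"
  "!!n f c. n >= N ==> f \<in> F n ==> \<Lambda> n (%p. c * f p) = c * \<Lambda> n f"
  "!!n f. n >= N ==> f \<in> I n ==> \<Lambda> n f = 0"
  "!!n f i. n >= N ==> f \<in> F n ==> \<Lambda> (Suc n) (tw n f (xx i)) = Y ((\<sigma> ^^ n) p) i * \<Lambda> n f"
  "!!n. n >= N ==> \<exists>f\<in>F n. \<Lambda> n f ~= 0"
proof -
 obtain K where K0: "right_ideal K" "proper K" "!!n. I n <= K n"
  "!!K'. right_ideal K' ==> proper K' ==> (!!n. K n <= K' n) ==> K' = K"
  using maximal_right_ideal[OF I] by metis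
 interpret maximal_right_ideal \<alpha> \<beta> \<gamma> E \<sigma> Y K by unfold_locales (use K0 in auto)
 obtain e m l where m: "m \<in> F e" "m ~: K e" and l: "good l" "tw e m (xl l) \<in> K (Suc e)"
  using annihilating_good_form by metis
 obtain q where q: "q \<in> E" "!!j c. c \<in> F j ==> tw e m c \<in> K (e + j) ==> c q = 0" using common_zero[OF m l] by blast
 obtain N where N: "N >= e" "!!n f. n >= N ==> f \<in> F n ==> \<exists>c\<in>F (n - e). (%p. f p - tw e m c p) \<in> K n"
  using maximal_full[OF m] by metis
 \<comment> \<open>m has degree e, so the evaluation at q of its cofactor belongs to the orbit of
   the point that reaches q after e translations.\<close>
 obtain p where p: "p \<in> E" "(\<sigma> ^^ e) p = q" using q(1) \<sigma>_pow_surj by (metis imageE)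
 define R where "R n f c \<longleftrightarrow> c \<in> F (n - e) & (%p. f p - tw e m c p) \<in> K n" for n f c
 have R_unique: "c q = c' q" if "n >= N" "R n f c" "R n f c'" for n f c c'
 proof -
  have R: "(%p. f p - tw e m c p) \<in> K n" "(%p. f p - tw e m c' p) \<in> K n" using that by (auto simp: R_def)
  have "(%p. (f p - tw e m c' p) - (f p - tw e m c p)) \<in> K n" by (rule subsp_diff[OF K_subsp R(2,1)])
  also have "(%p. (f p - tw e m c' p) - (f p - tw e m c p)) = tw e m (%p. c p - c' p)"
   by (simp add: tw_def fun_eq_iff algebra_simps)
  finally have "tw e m (%p. c p - c' p) \<in> K (e + (n - e))" using that N(1) by simp
  moreover have "(%p. c p - c' p) \<in> F (n - e)" by (rule subsp_diff[OF subsp_F]) (use that in \<open>simp_all add: R_def\<close>)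
  ultimately have "c q - c' q = 0" by (rule q(2)[rotated])
  then show ?thesis by simp
 qed
 define \<Lambda> where "\<Lambda> n f = (SOME c. R n f c) q" for n f
 have R_ex: "EX c. R n f c" if "n >= N" "f \<in> F n" for n f using N(2)[OF that] by (auto simp: R_def)
 have \<Lambda>: "\<Lambda> n f = c q" if "n >= N" "R n f c" for n f c
  unfolding \<Lambda>_def by (rule R_unique[OF that(1) someI[of "R n f", OF that(2)] that(2)])
 show thesis
 proof (rule that[of p N \<Lambda>, OF p(1)])
  fix n assume n: "n >= N"
  fix f assume f: "f \<in> F n"
  obtain c where c: "R n f c" using R_ex[OF n f] by blast
  show "\<Lambda> n (%p. f p + g p) = \<Lambda> n f + \<Lambda> n g" if g: "g \<in> F n" for g
  proof -
   obtain c' where c': "R n g c'" using R_ex[OF n g] by blast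
   have "(%p. (f p - tw e m c p) + (g p - tw e m c' p)) \<in> K n"
    by (rule subspD(2)[OF K_subsp]) (use c c' in \<open>simp_all add: R_def\<close>)
   also have "(%p. (f p - tw e m c p) + (g p - tw e m c' p)) = (%p. (f p + g p) - tw e m (%p. c p + c' p) p)"
    by (simp add: tw_def fun_eq_iff algebra_simps)
   finally have "R n (%p. f p + g p) (%p. c p + c' p)"
    using subspD(2)[OF subsp_F, of c "n - e" c'] c c' by (simp add: R_def)
   then show ?thesis using \<Lambda>[OF n] c c' by simp
  qed
  show "\<Lambda> n (%p. a * f p) = a * \<Lambda> n f" for a
  proof -
   have "(%p. a * (f p - tw e m c p)) \<in> K n"
    by (rule subspD(3)[OF K_subsp]) (use c in \<open>simp add: R_def\<close>)
   also have "(%p. a * (f p - tw e m c p)) = (%p. a * f p - tw e m (%p. a * c p) p)"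
    by (simp add: tw_def fun_eq_iff algebra_simps)
   finally have "R n (%p. a * f p) (%p. a * c p)" using subspD(3)[OF subsp_F, of c "n - e" a] c by (simp add: R_def)
   then show ?thesis using \<Lambda>[OF n] c by simp
  qed
  show "\<Lambda> (Suc n) (tw n f (xx i)) = Y ((\<sigma> ^^ n) p) i * \<Lambda> n f" for i
  proof -
   have "tw n (%p. f p - tw e m c p) (xx i) \<in> K (Suc n)" using K_xx c by (simp add: R_def)
   also have "tw n (%p. f p - tw e m c p) (xx i) = (%p. tw n f (xx i) p - tw n (tw e m c) (xx i) p)"
    by (rule ext) (simp add: tw_def left_diff_distrib)
   also have "tw n (tw e m c) (xx i) = tw e m (tw (n - e) c (xx i))" using n N(1) by (simp add: tw_assoc)
   finally have "R (Suc n) (tw n f (xx i)) (tw (n - e) c (xx i))"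
    using tw_in[of c "n - e" "xx i" 1] xx_in c n N(1) by (simp add: R_def Suc_diff_le)
   then have "\<Lambda> (Suc n) (tw n f (xx i)) = tw (n - e) c (xx i) q" using \<Lambda> n by simp
   also have "... = c q * Y ((\<sigma> ^^ (n - e)) q) i" using q(1) by (simp add: tw_def xx_apply)
   also have "(\<sigma> ^^ (n - e)) q = (\<sigma> ^^ n) p" using n N(1) funpow_add[of "n - e" e \<sigma>] by (simp add: p(2))
   finally show ?thesis using \<Lambda>[OF n c] by simp
  qed
 next
  fix n f assume n: "n >= N" and f: "f \<in> I n"
  have "R n f (%p. 0)" using f K0(3) subspD(1)[OF subsp_F] by (auto simp: R_def tw_linear)
  then show "\<Lambda> n f = 0" using \<Lambda>[OF n] by simp
 next
  fix n assume n: "n >= N"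
  obtain c where c: "c \<in> F (n - e)" "c q ~= 0" using F_nonzero_point q(1) by blast
  have tF: "tw e m c \<in> F n" using tw_in[OF m(1) c(1)] n N(1) by simp
  have "R n (tw e m c) c" using c subspD(1)[OF K_subsp] by (simp add: R_def)
  then show "\<exists>f\<in>F n. \<Lambda> n f ~= 0" using tF \<Lambda>[OF n] c(2) by metis
 qed
qed

end

hide_const (open) Multiset.mult

section \<open>Algebras over a field and their quotients\<close>

locale kalg = ring R for R :: "('k::field, 'a) graded_space" (structure) +
 assumes smult_closed [simp, intro]: "x \<in> carrier R ==> c \<odot> x \<in> carrier R"
  and smult_l_distr: "x \<in> carrier R ==> (a + b) \<odot> x = a \<odot> x \<oplus> b \<odot> x"
  and smult_r_distr: "x \<in> carrier R ==> y \<in> carrier R ==> a \<odot> (x \<oplus> y) = a \<odot> x \<oplus> a \<odot> y"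
  and smult_smult: "x \<in> carrier R ==> (a * b) \<odot> x = a \<odot> (b \<odot> x)"
  and smult_one: "x \<in> carrier R ==> 1 \<odot> x = x"
  and smult_mult: "x \<in> carrier R ==> y \<in> carrier R ==> (c \<odot> x) \<otimes> y = c \<odot> (x \<otimes> y)"
  and mult_smult: "x \<in> carrier R ==> y \<in> carrier R ==> x \<otimes> (c \<odot> y) = c \<odot> (x \<otimes> y)"
begin

lemma module: "Module.module class_ring R"
 by (rule moduleI)
  (auto simp: smult_l_distr smult_r_distr smult_smult smult_one class_field[THEN field.axioms(1), THEN domain.axioms(1)]
   local.ring_axioms ring.is_abelian_group abelian_group_axioms)

lemma smult_zero [simp]: "c \<odot> \<zero> = \<zero>"
 using smult_r_distr[of \<zero> \<zero> c] by (simp add: add.l_cancel_one)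

lemma zero_smult [simp]: "x \<in> carrier R ==> 0 \<odot> x = \<zero>"
 using smult_l_distr[of x 0 0] by (simp add: add.l_cancel_one)

lemma minus_smult: "x \<in> carrier R ==> (- 1) \<odot> x = \<ominus> x"
 using smult_l_distr[of x "- 1" 1] by (simp add: smult_one minus_equality)

context
 fixes I assumes I: "ideal I R"
begin

interpretation I: ideal I R by (rule I)

lemma I_smult: "i \<in> I ==> c \<odot> i \<in> I"
 using smult_mult[of \<one> i c] I.I_l_closed[of i "c \<odot> \<one>"] I.Icarr by simp

lemma coset_eq_iff: "x \<in> carrier R ==> I +> x = I \<longleftrightarrow> x \<in> I"
 using I.a_rcos_const I.a_rcos_self by auto

lemma quot_smult:
 assumes x: "x \<in> carrier R"
 shows "c \<odot>\<^bsub>quot_algebra R I\<^esub> (I +> x) = I +> (c \<odot> x)"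
proof -
 have "I +> (c \<odot> z) = I +> (c \<odot> x)" if z: "z \<in> I +> x" for z
 proof -
  obtain i where i: "i \<in> I" "z = i \<oplus> x" using z by (auto simp: a_r_coset_def')
  have "c \<odot> z = c \<odot> i \<oplus> c \<odot> x" using i x I.Icarr by (simp add: smult_r_distr)
  then have "c \<odot> z \<in> I +> (c \<odot> x)" using I_smult[OF i(1)] by (auto simp: a_r_coset_def')
  from I.a_repr_independence'[OF this] show ?thesis using x by simp
 qed
 moreover have "I +> x ~= {}" using I.a_rcos_self[OF x] by blast
 ultimately show ?thesis by (auto simp: quot_algebra_def)
qed

lemma quot_facts:
 "carrier (quot_algebra R I) = (+>) I ` carrier R"
 "x \<in> carrier R ==> y \<in> carrier R ==> (I +> x) \<otimes>\<^bsub>quot_algebra R I\<^esub> (I +> y) = I +> (x \<otimes> y)"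
 "x \<in> carrier R ==> y \<in> carrier R ==> (I +> x) \<oplus>\<^bsub>quot_algebra R I\<^esub> (I +> y) = I +> (x \<oplus> y)"
 "\<one>\<^bsub>quot_algebra R I\<^esub> = I +> \<one>" "\<zero>\<^bsub>quot_algebra R I\<^esub> = I"
 "piece (quot_algebra R I) n = (+>) I ` piece R n"
 by (auto simp: quot_algebra_def FactRing_def A_RCOSETS_def' I.rcoset_mult_add I.a_rcos_sum)

lemma quot_kalg: "kalg (quot_algebra R I)"
proof -
 interpret Q: ring "R Quot I" by (rule I.quotient_is_ring)
 let ?Q = "quot_algebra R I"
 have Q: "carrier ?Q = carrier (R Quot I)" "mult ?Q = mult (R Quot I)" "add ?Q = add (R Quot I)"
  "one ?Q = one (R Quot I)" "zero ?Q = zero (R Quot I)"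
  by (simp_all add: quot_algebra_def)
 have "ring ?Q"
 proof (rule ringI)
  show "abelian_group ?Q"
   by (rule abelian_groupI, unfold Q) (simp_all add: Q.a_ac)
  show "monoid ?Q"
   by (rule monoidI, unfold Q) (simp_all add: Q.m_assoc)
 qed (unfold Q, simp_all add: Q.l_distr Q.r_distr)
 then show ?thesis
  by (intro kalg.intro kalg_axioms.intro)
   (auto simp: quot_facts quot_smult smult_l_distr smult_r_distr smult_smult smult_one smult_mult mult_smult)
qed

end

lemmas cosets = coset_eq_iff quot_smult quot_facts

end

text \<open>Involutive automorphisms, as given by the elements of the Klein group. Involutivity
  turns an inclusion of an ideal into its image into an equality, which is what the passage to the
  quotient needs.\<close>

definition kaut :: "('k::field, 'a) graded_space => ('a => 'a) => bool" where
 "kaut R \<phi> \<longleftrightarrow> (\<forall>x\<in>carrier R. \<phi> x \<in> carrier R & \<phi> (\<phi> x) = x) &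
  (\<forall>x\<in>carrier R. \<forall>y\<in>carrier R. \<phi> (x \<oplus>\<^bsub>R\<^esub> y) = \<phi> x \<oplus>\<^bsub>R\<^esub> \<phi> y & \<phi> (x \<otimes>\<^bsub>R\<^esub> y) = \<phi> x \<otimes>\<^bsub>R\<^esub> \<phi> y) &
  (\<forall>x\<in>carrier R. ALL c. \<phi> (c \<odot>\<^bsub>R\<^esub> x) = c \<odot>\<^bsub>R\<^esub> \<phi> x)"

lemma kautD:
 assumes "kaut R \<phi>" "x \<in> carrier R"
 shows "\<phi> x \<in> carrier R" "\<phi> (\<phi> x) = x" "\<phi> (c \<odot>\<^bsub>R\<^esub> x) = c \<odot>\<^bsub>R\<^esub> \<phi> x"
  "y \<in> carrier R ==> \<phi> (x \<oplus>\<^bsub>R\<^esub> y) = \<phi> x \<oplus>\<^bsub>R\<^esub> \<phi> y" "y \<in> carrier R ==> \<phi> (x \<otimes>\<^bsub>R\<^esub> y) = \<phi> x \<otimes>\<^bsub>R\<^esub> \<phi> y"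
 using assms by (auto simp: kaut_def)

context kalg
begin

lemma kaut_zero:
 assumes "kaut R \<phi>"
 shows "\<phi> \<zero> = \<zero>"
 using kautD(4)[OF assms, of \<zero> \<zero>] kautD(1)[OF assms, of \<zero>] by (simp add: add.l_cancel_one)

lemma kaut_minus:
 assumes "kaut R \<phi>" "x \<in> carrier R"
 shows "\<phi> (\<ominus> x) = \<ominus> \<phi> x"
 using kautD[OF assms] assms(2) by (simp flip: minus_smult)

lemma kaut_genideal:
 assumes \<phi>: "kaut R \<phi>" and S: "S <= carrier R" "\<phi> ` S <= Idl S"
 shows "\<phi> ` (Idl S) <= Idl S"
proof -
 interpret I: ideal "Idl S" R by (rule genideal_ideal[OF S(1)])
 let ?J = "{x \<in> carrier R. \<phi> x \<in> Idl S}"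
 have "ideal ?J R"
 proof (rule idealI[OF local.ring_axioms])
  show "subgroup ?J (add_monoid R)"
   by (rule add.subgroupI) (auto simp: kautD[OF \<phi>] kaut_zero[OF \<phi>] kaut_minus[OF \<phi>] I.a_closed I.a_inv_closed simp flip: a_inv_def intro!: exI[of _ \<zero>])
 qed (auto simp: kautD[OF \<phi>] I.I_l_closed I.I_r_closed)
 then have "Idl S <= ?J" by (rule genideal_minimal) (use S in auto)
 then show ?thesis by auto
qed

lemma kaut_quot:
 assumes \<phi>: "kaut R \<phi>" and I: "ideal I R" "\<phi> ` I <= I"
 shows "x \<in> carrier R ==> \<phi> ` (I +> x) = I +> \<phi> x" "kaut (quot_algebra R I) (image \<phi>)"
proof -
 interpret I: ideal I R by (rule I(1))
 have eq: "\<phi> ` I = I"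
 proof
  show "I <= \<phi> ` I"
  proof
   fix i assume i: "i \<in> I"
   then have "i = \<phi> (\<phi> i)" using kautD(2)[OF \<phi>] I.Icarr by simp
   then show "i \<in> \<phi> ` I" using I(2) i by blast
  qed
 qed (rule I(2))
 show *: "\<phi> ` (I +> x) = I +> \<phi> x" if x: "x \<in> carrier R" for x
 proof -
  have "\<phi> ` (I +> x) = (%i. \<phi> i \<oplus> \<phi> x) ` I"
   using x I.Icarr by (auto simp: a_r_coset_def' kautD[OF \<phi>] image_iff)
  also have "... = (%i. i \<oplus> \<phi> x) ` (\<phi> ` I)" by (simp add: image_image)
  finally show ?thesis by (auto simp: eq a_r_coset_def')
 qed
 show "kaut (quot_algebra R I) (image \<phi>)"
  unfolding kaut_def quot_facts[OF I(1)]
  by (auto simp: * kautD[OF \<phi>] cosets[OF I(1)])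
qed

end

section \<open>The free algebra\<close>

definition conv :: "(gen list => 'k::field) => (gen list => 'k) => gen list => 'k" where
 "conv f g w = (\<Sum>i\<le>length w. f (take i w) * g (drop i w))"

abbreviation FA :: "('k::field, gen list => 'k) graded_space" where "FA \<equiv> free_algebra"

lemma FA_simps [simp]:
 "carrier FA = {f :: gen list => 'k::field. finite {w. f w ~= 0}}"
 "f \<otimes>\<^bsub>FA\<^esub> g = conv f g"
 "\<one>\<^bsub>FA\<^esub> = (%w. if w = [] then 1 else 0)" "\<zero>\<^bsub>FA\<^esub> = (%w. 0)"
 "f \<oplus>\<^bsub>FA\<^esub> g = (%w. f w + g w)" "c \<odot>\<^bsub>FA\<^esub> f = (%w. c * f w)"
 "piece FA n = {f. finite {w. f w ~= 0} & (ALL w. f w ~= 0 --> length w = n)}"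
 by (simp_all add: free_algebra_def conv_def[abs_def])

lemma conv_Nil: "conv f g [] = f [] * g []"
 by (simp add: conv_def)

lemma conv_Cons: "conv f g (x # w) = f [] * g (x # w) + conv (%u. f (x # u)) g w"
 unfolding conv_def by (subst sum.atMost_shift) (simp add: lessThan_Suc_atMost)

lemma conv_linear:
 "conv (%w. f w + f' w) g w = conv f g w + conv f' g w"
 "conv g (%w. f w + f' w) w = conv g f w + conv g f' w"
 "conv (%w. c * f w) g w = c * conv f g w"
 "conv g (%w. c * f w) w = c * conv g f w"
 by (simp_all add: conv_def distrib_left distrib_right sum.distrib sum_distrib_left mult_ac)

text \<open>Induction on the word by way of \<open>conv_Cons\<close>, with the first factor
  arbitrary, takes the place of reindexing a double sum.\<close>

lemma conv_assoc: "conv (conv f g) h w = conv f (conv g h) w"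
proof (induction w arbitrary: f)
 case Nil show ?case by (simp add: conv_Nil mult.assoc)
next
 case (Cons x w)
 have "conv (conv f g) h (x # w) = conv f g [] * h (x # w) + conv (%u. f [] * g (x # u) + conv (%u. f (x # u)) g u) h w"
  by (simp add: conv_Cons[of "conv f g"] conv_Cons[of f])
 also have "... = f [] * (g [] * h (x # w) + conv (%u. g (x # u)) h w) + conv (%u. f (x # u)) (conv g h) w"
  by (simp add: conv_linear conv_Nil Cons.IH algebra_simps)
 also have "... = conv f (conv g h) (x # w)" by (simp add: conv_Cons[of f] conv_Cons[of g])
 finally show ?case .
qed

lemma conv_finite:
 assumes "finite {w. f w ~= 0}" "finite {w. g w ~= (0::'k::field)}"
 shows "finite {w. conv f g w ~= 0}"
proof (rule finite_subset)
 show "{w. conv f g w ~= 0} <= (%(u, v). u @ v) ` ({w. f w ~= 0} \<times> {w. g w ~= 0})"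
 proof
  fix w assume "w \<in> {w. conv f g w ~= 0}"
  then obtain i where "f (take i w) * g (drop i w) ~= 0"
   unfolding conv_def by (metis (mono_tags, lifting) mem_Collect_eq sum.neutral)
  then show "w \<in> (%(u, v). u @ v) ` ({w. f w ~= 0} \<times> {w. g w ~= 0})"
   by (intro image_eqI[of _ _ "(take i w, drop i w)"]) auto
 qed
qed (use assms in auto)

lemma finite_support_add:
 "finite {w. f w ~= 0} ==> finite {w. g w ~= (0::'k::field)} ==> finite {w. f w + g w ~= 0}"
 by (rule finite_subset[of _ "{w. f w ~= 0} Un {w. g w ~= 0}"]) auto

lemma finite_support_scale: "finite {w. f w ~= 0} ==> finite {w. (c::'k::field) * f w ~= 0}"
 by (rule finite_subset[of _ "{w. f w ~= 0}"]) auto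

interpretation FA: kalg "FA :: ('k::field, gen list => 'k) graded_space"
proof (intro kalg.intro kalg_axioms.intro ringI)
 show "abelian_group (FA :: ('k, gen list => 'k) graded_space)"
 proof (rule abelian_groupI)
  fix f :: "gen list => 'k" assume "f \<in> carrier FA"
  then show "\<exists>y\<in>carrier FA. y \<oplus>\<^bsub>FA\<^esub> f = \<zero>\<^bsub>FA\<^esub>" by (intro bexI[of _ "%w. - f w"]) auto
 qed (auto simp: finite_support_add fun_eq_iff add_ac)
 show "monoid (FA :: ('k, gen list => 'k) graded_space)"
 proof (rule monoidI)
  fix f g h :: "gen list => 'k"
  show "f \<otimes>\<^bsub>FA\<^esub> g \<in> carrier FA" if "f \<in> carrier FA" "g \<in> carrier FA"
   using conv_finite[of f g] that by simp
  show "f \<otimes>\<^bsub>FA\<^esub> g \<otimes>\<^bsub>FA\<^esub> h = f \<otimes>\<^bsub>FA\<^esub> (g \<otimes>\<^bsub>FA\<^esub> h)"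
   by (simp add: conv_assoc fun_eq_iff)
  show "\<one>\<^bsub>FA\<^esub> \<otimes>\<^bsub>FA\<^esub> f = f"
  proof
   fix w :: "gen list"
   have "(\<Sum>i\<le>length w. (if take i w = [] then 1 else 0) * f (drop i w)) = (\<Sum>i\<le>length w. if i = 0 then f w else 0)"
    by (rule sum.cong) auto
   then show "(\<one>\<^bsub>FA\<^esub> \<otimes>\<^bsub>FA\<^esub> f) w = f w" by (simp add: conv_def)
  qed
  show "f \<otimes>\<^bsub>FA\<^esub> \<one>\<^bsub>FA\<^esub> = f"
  proof
   fix w :: "gen list"
   have "(\<Sum>i\<le>length w. f (take i w) * (if drop i w = [] then 1 else 0)) = (\<Sum>i\<le>length w. if i = length w then f w else 0)"
    by (rule sum.cong) auto
   then show "(f \<otimes>\<^bsub>FA\<^esub> \<one>\<^bsub>FA\<^esub>) w = f w" by (simp add: conv_def)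
  qed
 qed simp
qed (simp_all add: finite_support_scale conv_linear algebra_simps fun_eq_iff)

definition mono :: "gen list => gen list => 'k::field" where
 "mono v = (%w. if w = v then 1 else 0)"

lemma mono_carrier [simp]: "mono v \<in> carrier FA"
 by (simp add: mono_def)

lemma mono_mult: "mono u \<otimes>\<^bsub>FA\<^esub> mono v = (mono (u @ v) :: gen list => 'k::field)"
proof
 fix w
 have "(\<Sum>i\<le>length w. mono u (take i w) * mono v (drop i w)) =
   (\<Sum>i\<le>length w. if i = length u then (if w = u @ v then 1 else 0) else (0::'k))"
 proof (rule sum.cong[OF refl])
  fix i assume "i \<in> {..length w}"
  then have "take i w = u \<longleftrightarrow> i = length u & take (length u) w = u" by auto
  moreover have "w = u @ v \<longleftrightarrow> take (length u) w = u & drop (length u) w = v"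
   by (metis append_eq_conv_conj)
  ultimately show "mono u (take i w) * mono v (drop i w) = (if i = length u then (if w = u @ v then 1 else 0) else (0::'k))"
   unfolding mono_def by (cases "i = length u") simp_all
 qed
 also have "... = mono (u @ v) w" by (auto simp: mono_def)
 finally show "(mono u \<otimes>\<^bsub>FA\<^esub> mono v) w = (mono (u @ v) w :: 'k)" by (simp add: conv_def)
qed

text \<open>The set A bounds the support, so that one rule serves for the whole free algebra and for
  a single degree.\<close>

lemma FA_induct [consumes 2, case_names zero add smult mono]:
 assumes "f \<in> carrier FA" and "{w. f w ~= (0 :: 'k::field)} <= A"
  and "P (%w. 0)" "!!f g. f \<in> carrier FA ==> g \<in> carrier FA ==> P f ==> P g ==> P (f \<oplus>\<^bsub>FA\<^esub> g)"
  and "!!c f. f \<in> carrier FA ==> P f ==> P (c \<odot>\<^bsub>FA\<^esub> f)" "!!v. v \<in> A ==> P (mono v)"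
 shows "P f"
proof -
 have "finite S ==> S <= A ==> P f" if "{w. f w ~= 0} <= S" for S f
  using that
 proof (induction S arbitrary: f rule: infinite_finite_induct)
  case empty
  then have "f = (%w. 0)" by auto
  then show ?case using assms(3) by simp
 next
  case (insert v S)
  define g where "g w = (if w = v then 0 else f w)" for w
  have sub: "{w. g w ~= 0} <= S" using insert.prems by (auto simp: g_def)
  have gP: "P g" using insert.IH[OF insert.hyps(1) _ sub] insert.prems by auto
  have gc: "g \<in> carrier FA" using sub insert.hyps by (simp add: finite_subset)
  have "f = (f v \<odot>\<^bsub>FA\<^esub> mono v) \<oplus>\<^bsub>FA\<^esub> g" by (auto simp: g_def mono_def fun_eq_iff)
  then show ?case
   using assms(4)[OF FA.smult_closed[OF mono_carrier] gc assms(5)[OF mono_carrier] gP] assms(6)[of v] insert.prems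
   by (metis insert_subset)
 qed simp
 then show ?thesis using assms(1,2) by auto
qed

section \<open>The algebra \<open>B\<close> and its gradings\<close>

lemma bit_cases: "(b::bit) = 0 \<or> b = 1"
 by (cases b) auto

lemma bit_sign_simps [simp]: "bit_sign 0 = 1" "bit_sign 1 = - 1"
 by (simp_all add: bit_sign_def)

text \<open>The degree of x_i as a group element; \<open>gadd\<close> is the group law carried back
  to the generators.\<close>

fun kd :: "gen => klein" where
 "kd X0 = (0, 0)" | "kd X1 = (1, 0)" | "kd X2 = (0, 1)" | "kd X3 = (1, 1)"

lemma kd_inj [simp]: "kd i = kd j \<longleftrightarrow> i = j"
 by (cases i; cases j) auto

lemma UNIV_klein: "(UNIV :: klein set) = range kd"
proof -
 have "(a, b) \<in> range kd" for a b :: bit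
  using bit_cases[of a] bit_cases[of b] by (auto simp: UNIV_gen)
 then show ?thesis by auto
qed

lemma finite_klein [simp]: "finite (UNIV :: klein set)" "finite (UNIV :: (klein \<times> klein) set)"
 by (simp_all add: UNIV_klein flip: UNIV_Times_UNIV)

lemma klein_kd: "EX i. g = kd i"
 using UNIV_klein by blast

lemma gen_sign_kd [simp]:
 "gen_sign (kd j) i = (if i = X0 \<or> j = X0 then 1 else if i = X1 then (if j = X1 then 1 else - 1)
   else if i = X2 then (if j = X2 then 1 else - 1) else (if j = X3 then 1 else - 1))"
 by (cases i; cases j) auto

lemma gen_sign_add: "gen_sign g i * gen_sign g j = (gen_sign g (i \<boxplus> j) :: 'k::field)"
proof -
 obtain l where "g = kd l" using klein_kd by blast
 then show ?thesis by (cases i; cases j; cases l) auto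
qed

lemma gen_sign_sq: "gen_sign g i * gen_sign g i = (1 :: 'k::field)"
 using gen_sign_add[of g i i] by (cases g) simp

lemma klein_char_kd: "klein_char (kd i) g = (gen_sign g i :: 'k::field)"
proof -
 obtain l where "g = kd l" using klein_kd by blast
 then show ?thesis by (cases i; cases l) auto
qed

definition mu :: "gen => gen => 'k::field" where
 "mu i j = cocycle (kd i) (kd j)"

lemma mu_eval: "mu i j = (if (i = X1 \<or> i = X3) & (j = X2 \<or> j = X3) then - 1 else 1)"
 by (cases i; cases j) (auto simp: mu_def)

lemma mu_sq [simp]: "mu i j * mu i j = 1"
 by (simp add: mu_eval)

lemma free_action_mono: "free_action g (mono v) = gen_sign g (word_deg v) \<odot>\<^bsub>FA\<^esub> (mono v :: gen list => 'k::field)"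
proof -
 have "prod_list (map (gen_sign g) v) = (gen_sign g (word_deg v) :: 'k)"
  by (induction v) (cases g, simp, simp add: gen_sign_add)
 then show ?thesis by (auto simp: free_action_def mono_def fun_eq_iff)
qed

lemma kaut_free_action: "kaut FA (free_action g :: (gen list => 'k::field) => _)"
proof -
 let ?s = "%w. prod_list (map (gen_sign g) w) :: 'k"
 have sq: "?s w * ?s w = 1" for w
 proof (induction w)
  case (Cons i w)
  have "?s (i # w) * ?s (i # w) = (gen_sign g i * gen_sign g i) * (?s w * ?s w)" by (simp add: mult_ac)
  then show ?case using Cons.IH gen_sign_sq[of g i, where ?'k = 'k] by simp
 qed simp
 have "conv (free_action g f) (free_action g h) = free_action g (conv f h)" for f h :: "gen list => 'k"
 proof
  fix w
  have s: "?s (take i w) * ?s (drop i w) = ?s w" for i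
   by (simp flip: prod_list.append map_append)
  have "(a * b) * (c * d) = (a * c) * (b * d)" for a b c d :: 'k
   by (simp add: mult_ac)
  then show "conv (free_action g f) (free_action g h) w = free_action g (conv f h) w"
   unfolding conv_def free_action_def sum_distrib_left by (intro sum.cong refl) (metis s)
 qed
 moreover have "finite {w. free_action g f w ~= 0}" if "finite {w. f w ~= 0}" for f :: "gen list => 'k"
  by (rule finite_subset[OF _ that]) (auto simp: free_action_def)
 moreover have "free_action g (free_action g f) = f" for f :: "gen list => 'k"
  using sq by (simp add: free_action_def fun_eq_iff flip: mult.assoc)
 ultimately show ?thesis
  unfolding kaut_def by (simp add: free_action_def fun_eq_iff algebra_simps)
qed

lemma var_mono: "var i = mono [i]"
 by (simp add: var_def mono_def)

lemma FA_minus: "f \<in> carrier FA ==> g \<in> carrier FA ==> f \<ominus>\<^bsub>FA\<^esub> g = (%w. f w - (g w :: 'k::field))"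
 unfolding a_minus_def FA.minus_smult[symmetric] by simp

lemma commutator_var:
 "commutator FA (var i) (var j) = (%w. mono [i, j] w - (mono [j, i] w :: 'k::field))"
 "anticommutator FA (var i) (var j) = (%w. mono [i, j] w + (mono [j, i] w :: 'k))"
 unfolding commutator_def anticommutator_def var_mono mono_mult
 by (simp_all add: FA_minus del: FA_simps(1))

definition rel_elem :: "'k::field => 'k => 'k => gen => bool => gen list => 'k" where
 "rel_elem \<alpha> \<beta> \<gamma> h s w = (\<Sum>i\<in>UNIV. rel \<alpha> \<beta> \<gamma> h s i * mono [i, i \<boxplus> h] w)"

lemma finite_mono [simp]: "finite {w. mono v w ~= (0::'k::field)}"
 using mono_carrier[of v] by simp

lemma rel_elem_carrier [simp]: "rel_elem \<alpha> \<beta> \<gamma> h s \<in> carrier FA"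
 by (auto simp: rel_elem_def[abs_def] sum_gen intro!: finite_support_add finite_support_scale)

lemma sklyanin_relations_eq:
 "sklyanin_relations \<alpha> \<beta> \<gamma> = {rel_elem \<alpha> \<beta> \<gamma> h s | h s. h ~= X0}"
proof -
 have c: "(%w. mono u w - mono v w) \<in> carrier FA" "(%w. mono u w + mono v w) \<in> carrier FA"
  "(%w. c * (mono u w + mono v w)) \<in> carrier FA" for u v and c :: 'a
  using finite_support_add[OF finite_mono finite_support_scale[OF finite_mono, of "- 1"], of u v]
  by (auto intro!: finite_support_add finite_support_scale)
 have "sklyanin_relations \<alpha> \<beta> \<gamma> = (%(h, s). rel_elem \<alpha> \<beta> \<gamma> h s) ` {(X1, False), (X1, True), (X2, False), (X2, True), (X3, False), (X3, True)}"
  unfolding sklyanin_relations_def Let_def commutator_var FA_simps(6)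
  by (simp add: FA_minus c del: FA_simps(1)) (simp add: rel_elem_def[abs_def] sum_gen algebra_simps)
 also have "... = {rel_elem \<alpha> \<beta> \<gamma> h s | h s. h ~= X0}"
 proof -
  have "(EX h s. f = rel_elem \<alpha> \<beta> \<gamma> h s & h ~= X0) \<longleftrightarrow>
   (EX s. f = rel_elem \<alpha> \<beta> \<gamma> X1 s \<or> f = rel_elem \<alpha> \<beta> \<gamma> X2 s \<or> f = rel_elem \<alpha> \<beta> \<gamma> X3 s)" for f
   by (metis gen.exhaust gen.distinct(1,3,5))
  then show ?thesis by (auto simp: ex_bool_eq)
 qed
 finally show ?thesis .
qed

lemma free_action_rel: "free_action g (rel_elem \<alpha> \<beta> \<gamma> h s) = gen_sign g h \<odot>\<^bsub>FA\<^esub> rel_elem \<alpha> \<beta> \<gamma> h s"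
proof
 fix w
 have "free_action g (rel_elem \<alpha> \<beta> \<gamma> h s) w = (\<Sum>i\<in>UNIV. rel \<alpha> \<beta> \<gamma> h s i * free_action g (mono [i, i \<boxplus> h]) w)"
  by (simp add: rel_elem_def free_action_def sum_distrib_left mult_ac)
 also have "... = (gen_sign g h \<odot>\<^bsub>FA\<^esub> rel_elem \<alpha> \<beta> \<gamma> h s) w"
  by (simp add: free_action_mono rel_elem_def sum_distrib_left mult_ac)
 finally show "free_action g (rel_elem \<alpha> \<beta> \<gamma> h s) w = (gen_sign g h \<odot>\<^bsub>FA\<^esub> rel_elem \<alpha> \<beta> \<gamma> h s) w" .
qed

context sklyanin
begin

abbreviation "I0 \<equiv> sklyanin_ideal \<alpha> \<beta> \<gamma>"
abbreviation "A \<equiv> alg_A \<alpha> \<beta> \<gamma>"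
abbreviation "Om \<equiv> Omega_ideal \<alpha> \<beta> \<gamma>"
abbreviation "B \<equiv> alg_B \<alpha> \<beta> \<gamma>"
abbreviation "re \<equiv> rel_elem \<alpha> \<beta> \<gamma>"

definition pA :: "(gen list => 'k) => (gen list => 'k) set" where "pA f = I0 +>\<^bsub>FA\<^esub> f"
definition pB :: "(gen list => 'k) => 'k elem_B" where "pB f = Om +>\<^bsub>A\<^esub> pA f"

lemma rels_carrier: "sklyanin_relations \<alpha> \<beta> \<gamma> <= carrier FA"
 using rel_elem_carrier by (auto simp: sklyanin_relations_eq simp del: FA_simps(1))

lemma ideal_I0: "ideal I0 FA"
 unfolding sklyanin_ideal_def by (rule FA.genideal_ideal[OF rels_carrier])

lemma A_kalg: "kalg A"
 unfolding alg_A_def by (rule FA.quot_kalg[OF ideal_I0])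

interpretation A: kalg A by (rule A_kalg)

lemma pA_facts:
 "f \<in> carrier FA ==> g \<in> carrier FA ==> pA f \<otimes>\<^bsub>A\<^esub> pA g = pA (f \<otimes>\<^bsub>FA\<^esub> g)"
 "f \<in> carrier FA ==> g \<in> carrier FA ==> pA f \<oplus>\<^bsub>A\<^esub> pA g = pA (f \<oplus>\<^bsub>FA\<^esub> g)"
 "f \<in> carrier FA ==> c \<odot>\<^bsub>A\<^esub> pA f = pA (c \<odot>\<^bsub>FA\<^esub> f)"
 "carrier A = pA ` carrier FA" "\<one>\<^bsub>A\<^esub> = pA \<one>\<^bsub>FA\<^esub>" "\<zero>\<^bsub>A\<^esub> = I0" "piece A n = pA ` piece FA n"
 "f \<in> carrier FA ==> pA f = I0 \<longleftrightarrow> f \<in> I0"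
 unfolding pA_def alg_A_def by (auto simp: FA.cosets[OF ideal_I0] simp del: FA_simps)

lemma pA_carrier: "f \<in> carrier FA ==> pA f \<in> carrier A"
 by (simp add: pA_facts(4) del: FA_simps)

lemma kaut_A: "kaut A (image (free_action g))" "f \<in> carrier FA ==> free_action g ` pA f = pA (free_action g f)"
proof -
 have "free_action g ` sklyanin_relations \<alpha> \<beta> \<gamma> <= I0"
 proof -
  have "gen_sign g h \<odot>\<^bsub>FA\<^esub> re h s \<in> I0" if "h ~= X0" for h s
  proof (rule FA.I_smult[OF ideal_I0])
   show "re h s \<in> I0" using FA.genideal_self[OF rels_carrier] that
    by (auto simp: sklyanin_relations_eq sklyanin_ideal_def)
  qed
  then show ?thesis by (auto simp: sklyanin_relations_eq free_action_rel simp del: FA_simps)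
 qed
 then have "free_action g ` I0 <= I0"
  unfolding sklyanin_ideal_def by (rule FA.kaut_genideal[OF kaut_free_action rels_carrier])
 from FA.kaut_quot[OF kaut_free_action ideal_I0 this]
 show "kaut A (image (free_action g))" "f \<in> carrier FA ==> free_action g ` pA f = pA (free_action g f)"
  unfolding alg_A_def pA_def by auto
qed

lemma Omega_eq: "Omega1 \<alpha> \<beta> \<gamma> = pA (re X0 False)" "Omega2 \<alpha> \<beta> \<gamma> = pA (re X0 True)"
proof -
 have sq: "gen_A \<alpha> \<beta> \<gamma> i \<otimes>\<^bsub>A\<^esub> gen_A \<alpha> \<beta> \<gamma> i = pA (mono [i, i])" for i
  using pA_facts(1)[OF mono_carrier mono_carrier, of "[i]" "[i]"]
  unfolding gen_A_def var_mono mono_mult by (simp add: pA_def)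
 have cl: "f \<in> carrier FA ==> g \<in> carrier FA ==> f \<oplus>\<^bsub>FA\<^esub> g \<in> carrier FA" for f g :: "gen list => 'k"
  by (rule FA.add.m_closed)
 show "Omega1 \<alpha> \<beta> \<gamma> = pA (re X0 False)"
  unfolding Omega1_def Let_def sq A.minus_smult[OF pA_carrier[OF mono_carrier], symmetric]
  by (simp add: pA_facts cl FA.smult_closed del: FA_simps) (simp add: rel_elem_def[abs_def] sum_gen)
 show "Omega2 \<alpha> \<beta> \<gamma> = pA (re X0 True)"
  unfolding Omega2_def Let_def sq
  by (simp add: pA_facts cl FA.smult_closed del: FA_simps) (simp add: rel_elem_def[abs_def] sum_gen)
qed

lemma Omegas_carrier: "{Omega1 \<alpha> \<beta> \<gamma>, Omega2 \<alpha> \<beta> \<gamma>} <= carrier A"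
 unfolding Omega_eq using pA_carrier rel_elem_carrier by blast

lemma ideal_Om: "ideal Om A"
 unfolding Omega_ideal_def by (rule A.genideal_ideal[OF Omegas_carrier])

lemma B_kalg: "kalg B"
 unfolding alg_B_def by (rule A.quot_kalg[OF ideal_Om])

sublocale B: kalg B by (rule B_kalg)

lemma pB_facts:
 "f \<in> carrier FA ==> g \<in> carrier FA ==> pB f \<otimes>\<^bsub>B\<^esub> pB g = pB (f \<otimes>\<^bsub>FA\<^esub> g)"
 "f \<in> carrier FA ==> g \<in> carrier FA ==> pB f \<oplus>\<^bsub>B\<^esub> pB g = pB (f \<oplus>\<^bsub>FA\<^esub> g)"
 "f \<in> carrier FA ==> c \<odot>\<^bsub>B\<^esub> pB f = pB (c \<odot>\<^bsub>FA\<^esub> f)"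
 "carrier B = pB ` carrier FA" "\<one>\<^bsub>B\<^esub> = pB \<one>\<^bsub>FA\<^esub>" "\<zero>\<^bsub>B\<^esub> = Om" "piece B n = pB ` piece FA n"
 "f \<in> carrier FA ==> pB f = Om \<longleftrightarrow> pA f \<in> Om"
 unfolding pB_def alg_B_def
 by (auto simp: A.cosets[OF ideal_Om] pA_facts pA_carrier image_image simp del: FA_simps)

lemma pB_carrier: "f \<in> carrier FA ==> pB f \<in> carrier B"
 by (simp add: pB_facts(4) del: FA_simps)

lemma pB_zero: "pB (%w. 0) = \<zero>\<^bsub>B\<^esub>"
proof -
 have "pA \<zero>\<^bsub>FA\<^esub> = I0" using pA_facts(8)[OF FA.zero_closed] ideal.axioms(1)[OF ideal_I0, THEN additive_subgroup.zero_closed] by blast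
 then have "pA \<zero>\<^bsub>FA\<^esub> \<in> Om" using pA_facts(6) ideal.axioms(1)[OF ideal_Om, THEN additive_subgroup.zero_closed] by simp
 then show ?thesis using pB_facts(6) pB_facts(8)[OF FA.zero_closed] by simp
qed

text \<open>The relations of degree 0 are \<Omega>_1 and \<Omega>_2 and die in the second quotient,
  the other six already in the first.\<close>

lemma pB_rel: "pB (re h s) = \<zero>\<^bsub>B\<^esub>"
proof -
 have "pA (re h s) \<in> Om"
 proof (cases "h = X0")
  case True
  have "{Omega1 \<alpha> \<beta> \<gamma>, Omega2 \<alpha> \<beta> \<gamma>} <= Om"
   unfolding Omega_ideal_def by (rule A.genideal_self[OF Omegas_carrier])
  then show ?thesis unfolding Omega_eq True by (cases s) auto
 next
  case False
  then have "re h s \<in> I0" using FA.genideal_self[OF rels_carrier]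
   by (auto simp: sklyanin_relations_eq sklyanin_ideal_def)
  then have "pA (re h s) = \<zero>\<^bsub>A\<^esub>" using pA_facts(6,8) rel_elem_carrier by blast
  then show ?thesis using ideal.axioms(1)[OF ideal_Om, THEN additive_subgroup.zero_closed] by simp
 qed
 then show ?thesis using pB_facts(6,8) rel_elem_carrier by blast
qed

lemma action_B_pB: "f \<in> carrier FA ==> action_B g (pB f) = pB (free_action g f)"
 and kaut_B: "kaut B (action_B g)"
proof -
 have "image (free_action g) ` {Omega1 \<alpha> \<beta> \<gamma>, Omega2 \<alpha> \<beta> \<gamma>} <= Om"
 proof -
  have "free_action g ` pA (re X0 s) \<in> Om" for s
  proof -
   have "pA (re X0 s) \<in> Om" using A.genideal_self[OF Omegas_carrier] Omega_eq
    by (cases s) (auto simp: Omega_ideal_def)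
   moreover have "free_action g ` pA (re X0 s) = gen_sign g X0 \<odot>\<^bsub>A\<^esub> pA (re X0 s)"
    unfolding kaut_A(2)[OF rel_elem_carrier] free_action_rel pA_facts(3)[OF rel_elem_carrier] ..
   ultimately show ?thesis using A.I_smult[OF ideal_Om] by simp
  qed
  then show ?thesis unfolding Omega_eq by auto
 qed
 then have "image (free_action g) ` Om <= Om"
  unfolding Omega_ideal_def by (rule A.kaut_genideal[OF kaut_A(1) Omegas_carrier])
 note q = A.kaut_quot[OF kaut_A(1) ideal_Om this]
 show "action_B g (pB f) = pB (free_action g f)" if "f \<in> carrier FA"
  using q(1)[OF pA_carrier[OF that]] kaut_A(2)[OF that] by (simp add: pB_def action_B_def)
 show "kaut B (action_B g)" using q(2) unfolding alg_B_def action_B_def[abs_def] .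
qed

definition bw :: "gen list => 'k elem_B" where "bw v = pB (mono v)"

lemma bw_carrier [simp, intro]: "bw v \<in> carrier B"
 by (simp only: bw_def pB_carrier mono_carrier)

lemma bw_mult: "bw u \<otimes>\<^bsub>B\<^esub> bw v = bw (u @ v)"
 by (simp only: bw_def pB_facts(1)[OF mono_carrier mono_carrier] mono_mult)

lemma bw_Nil: "bw [] = \<one>\<^bsub>B\<^esub>"
 unfolding bw_def pB_facts(5) by (simp add: mono_def)

lemma gen_B_bw: "gen_B \<alpha> \<beta> \<gamma> i = bw [i]"
 by (simp add: gen_B_def bw_def pB_def pA_def gen_A_def var_mono)

lemma bw_piece: "bw v \<in> piece B (length v)"
 unfolding bw_def pB_facts(7) by (rule imageI) (auto simp: mono_def)

lemma action_B_bw: "action_B g (bw v) = gen_sign g (word_deg v) \<odot>\<^bsub>B\<^esub> bw v"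
 unfolding bw_def action_B_pB[OF mono_carrier] free_action_mono pB_facts(3)[OF mono_carrier] ..

lemma B_induct [consumes 1, case_names zero add smult bw]:
 assumes "b \<in> carrier B" "P \<zero>\<^bsub>B\<^esub>"
  "!!a b. a \<in> carrier B ==> b \<in> carrier B ==> P a ==> P b ==> P (a \<oplus>\<^bsub>B\<^esub> b)"
  "!!c a. a \<in> carrier B ==> P a ==> P (c \<odot>\<^bsub>B\<^esub> a)" "!!v. P (bw v)"
 shows "P b"
proof -
 obtain f where f: "f \<in> carrier FA" "b = pB f" using assms(1) unfolding pB_facts(4) by blast
 have "P (pB f)" using f(1) subset_UNIV
 proof (induction f rule: FA_induct[where A = UNIV])
  case (add f g) then show ?case using assms(3)[OF pB_carrier pB_carrier, of f g] by (simp only: pB_facts(2))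
 next
  case (smult c f) then show ?case using assms(4)[OF pB_carrier, of f c] by (simp only: pB_facts(3))
 next
  case (mono v) show ?case using assms(5)[of v] by (simp only: bw_def)
 qed (use assms(2) pB_zero in simp_all)
 then show ?thesis using f by simp
qed

lemma B_piece_induct [consumes 1, case_names zero add smult bw]:
 assumes "b \<in> piece B n" "P \<zero>\<^bsub>B\<^esub>"
  "!!a b. a \<in> carrier B ==> b \<in> carrier B ==> P a ==> P b ==> P (a \<oplus>\<^bsub>B\<^esub> b)"
  "!!c a. a \<in> carrier B ==> P a ==> P (c \<odot>\<^bsub>B\<^esub> a)" "!!v. length v = n ==> P (bw v)"
 shows "P b"
proof -
 obtain f where f: "f \<in> piece FA n" "b = pB f" using assms(1) unfolding pB_facts(7) by blast
 then have "f \<in> carrier FA" "{w. f w ~= 0} <= words n" by auto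
 then have "P (pB f)"
 proof (induction f rule: FA_induct[where A = "words n"])
  case (add f g) then show ?case using assms(3)[OF pB_carrier pB_carrier, of f g] by (simp only: pB_facts(2))
 next
  case (smult c f) then show ?case using assms(4)[OF pB_carrier, of f c] by (simp only: pB_facts(3))
 next
  case (mono v) then show ?case using assms(5)[of v] by (simp only: bw_def in_words)
 qed (use assms(2) pB_zero in simp_all)
 then show ?thesis using f by simp
qed

subsection \<open>The grading by the Klein group\<close>

abbreviation "GP \<equiv> G_piece \<alpha> \<beta> \<gamma>"
abbreviation "GC \<equiv> G_component \<alpha> \<beta> \<gamma>"

lemma GP_carrier: "x \<in> GP g ==> x \<in> carrier B"
 by (simp add: G_piece_def)

lemma GP_add: "x \<in> GP g ==> y \<in> GP g ==> x \<oplus>\<^bsub>B\<^esub> y \<in> GP g"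
 using kautD[OF kaut_B] by (auto simp: G_piece_def B.smult_r_distr)

lemma GP_smult: "x \<in> GP g ==> c \<odot>\<^bsub>B\<^esub> x \<in> GP g"
 using kautD[OF kaut_B] by (auto simp: G_piece_def mult.commute simp flip: B.smult_smult)

lemma GP_zero: "\<zero>\<^bsub>B\<^esub> \<in> GP g"
 by (simp add: G_piece_def B.kaut_zero[OF kaut_B])

lemma GP_bw: "bw v \<in> GP (kd (word_deg v))"
 by (simp add: G_piece_def action_B_bw klein_char_kd)

text \<open>The projection to the component of degree \<open>i\<close> is the average of the action against a character.\<close>

definition avg :: "gen => 'k elem_B => 'k elem_B" where
 "avg i b = (1 / 4) \<odot>\<^bsub>B\<^esub> finsum B (%j. gen_sign (kd j) i \<odot>\<^bsub>B\<^esub> action_B (kd j) b) UNIV"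

lemma finsum_gen:
 assumes "!!j. f j \<in> carrier B"
 shows "finsum B f UNIV = f X0 \<oplus>\<^bsub>B\<^esub> f X1 \<oplus>\<^bsub>B\<^esub> f X2 \<oplus>\<^bsub>B\<^esub> f X3"
 unfolding UNIV_gen using assms by (simp add: Pi_def B.a_assoc)

lemma avg_add:
 assumes "x \<in> carrier B" "y \<in> carrier B"
 shows "avg i (x \<oplus>\<^bsub>B\<^esub> y) = avg i x \<oplus>\<^bsub>B\<^esub> avg i y"
proof -
 have c: "gen_sign (kd j) i \<odot>\<^bsub>B\<^esub> action_B (kd j) z \<in> carrier B" if "z \<in> carrier B" for j z
  using kautD(1)[OF kaut_B that] by blast
 have "finsum B (%j. gen_sign (kd j) i \<odot>\<^bsub>B\<^esub> action_B (kd j) (x \<oplus>\<^bsub>B\<^esub> y)) UNIV =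
  finsum B (%j. gen_sign (kd j) i \<odot>\<^bsub>B\<^esub> action_B (kd j) x) UNIV \<oplus>\<^bsub>B\<^esub> finsum B (%j. gen_sign (kd j) i \<odot>\<^bsub>B\<^esub> action_B (kd j) y) UNIV"
  using c assms kautD[OF kaut_B] by (subst B.finsum_addf[symmetric]) (auto simp: B.smult_r_distr)
 then show ?thesis unfolding avg_def using c assms by (simp add: B.smult_r_distr)
qed

lemma avg_GP:
 assumes "x \<in> GP (kd l)"
 shows "avg i x = (if i = l then x else \<zero>\<^bsub>B\<^esub>)"
proof -
 have x: "x \<in> carrier B" by (rule GP_carrier[OF assms])
 have "finsum B (%j. gen_sign (kd j) i \<odot>\<^bsub>B\<^esub> action_B (kd j) x) UNIV =
   finsum B (%j. (gen_sign (kd j) i * gen_sign (kd j) l) \<odot>\<^bsub>B\<^esub> x) UNIV"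
  using assms x by (simp only: G_piece_def klein_char_kd B.smult_smult mem_Collect_eq)
 also have "... = (\<Sum>j\<in>UNIV. gen_sign (kd j) i * gen_sign (kd j) l) \<odot>\<^bsub>B\<^esub> x"
  using x by (simp only: finsum_gen B.smult_closed sum_gen B.smult_l_distr)
 also have "(\<Sum>j\<in>UNIV. gen_sign (kd j) i * gen_sign (kd j) l) = (if i = l then 4 else (0::'k))"
  unfolding sum_gen by (cases i; cases l) simp_all
 finally show ?thesis unfolding avg_def using x four_nz by (simp add: B.smult_one flip: B.smult_smult)
qed

lemma finsum_klein:
 assumes "!!g. c g \<in> carrier B"
 shows "finsum B c (UNIV :: klein set) = finsum B (c \<circ> kd) UNIV"
 unfolding UNIV_klein by (subst B.finsum_reindex) (use assms in \<open>auto simp: inj_on_def o_def\<close>)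

lemma avg_finsum:
 assumes c: "!!g. c g \<in> GP g"
 shows "avg i (finsum B c UNIV) = c (kd i)"
proof -
 have cc: "c g \<in> carrier B" for g using GP_carrier c by blast
 have "finsum B c UNIV = c (kd X0) \<oplus>\<^bsub>B\<^esub> c (kd X1) \<oplus>\<^bsub>B\<^esub> c (kd X2) \<oplus>\<^bsub>B\<^esub> c (kd X3)"
  using finsum_klein[of c] finsum_gen[of "c \<circ> kd"] cc by simp
 then show ?thesis using cc by (cases i) (simp_all add: avg_add avg_GP[OF c] del: kd.simps)
qed

text \<open>The averages recover every component from the sum, so the definite description in
  \<open>G_component\<close> is justified.\<close>

lemma GC_unique:
 assumes c: "!!g. c g \<in> GP g" and b: "b = finsum B c UNIV"
 shows "GC b = c"
 unfolding G_component_def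
proof (rule the_equality)
 fix c' assume c': "(ALL g. c' g \<in> GP g) & b = finsum B c' UNIV"
 have "c' (kd i) = c (kd i)" for i using avg_finsum[of c' i] avg_finsum[of c i] c c' b by simp
 then show "c' = c" using klein_kd by (metis ext)
qed (use assms in simp)

lemma finsum_smult:
 assumes "finite S" "!!g. g \<in> S ==> c g \<in> carrier B"
 shows "e \<odot>\<^bsub>B\<^esub> finsum B c S = finsum B (%g. e \<odot>\<^bsub>B\<^esub> c g) S"
 using assms by (intro module.finsum_smult_ldistr[OF B.module]) auto

lemma GC_exists:
 assumes "b \<in> carrier B"
 shows "EX c. (ALL g. c g \<in> GP g) & b = finsum B c UNIV"
 using assms
proof (induction rule: B_induct)
 case zero
 show ?case by (intro exI[of _ "%_. \<zero>\<^bsub>B\<^esub>"]) (simp add: GP_zero)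
next
 case (add a b)
 then obtain c d where cd: "ALL g. c g \<in> GP g" "a = finsum B c UNIV" "ALL g. d g \<in> GP g" "b = finsum B d UNIV" by blast
 then have "finsum B (%g. c g \<oplus>\<^bsub>B\<^esub> d g) UNIV = a \<oplus>\<^bsub>B\<^esub> b"
  using B.finsum_addf[of c UNIV d] GP_carrier by blast
 then show ?case using cd GP_add by (intro exI[of _ "%g. c g \<oplus>\<^bsub>B\<^esub> d g"]) (simp del: split_paired_All)
next
 case (smult e a)
 then obtain c where c: "ALL g. c g \<in> GP g" "a = finsum B c UNIV" by blast
 then have cc: "c g \<in> carrier B" for g using GP_carrier by blast
 have "e \<odot>\<^bsub>B\<^esub> a = finsum B (%g. e \<odot>\<^bsub>B\<^esub> c g) UNIV"
  using cc by (simp add: c(2) finsum_smult)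
 then show ?case using c(1) GP_smult by (intro exI[of _ "%g. e \<odot>\<^bsub>B\<^esub> c g"]) (simp del: split_paired_All)
next
 case (bw v)
 have "bw v = finsum B (%g. if kd (word_deg v) = g then bw v else \<zero>\<^bsub>B\<^esub>) UNIV"
  by (subst B.add.finprod_singleton[of "kd (word_deg v)" UNIV "%_. bw v"]) (auto simp: UNIV_klein)
 then show ?case
  by (intro exI[of _ "%g. if kd (word_deg v) = g then bw v else \<zero>\<^bsub>B\<^esub>"]) (use GP_bw[of v] GP_zero in auto)
qed

lemma GC_GP: "b \<in> carrier B ==> GC b g \<in> GP g" and GC_sum: "b \<in> carrier B ==> finsum B (GC b) UNIV = b"
 using GC_exists[of b] GC_unique by (metis, metis)

lemma GC_carrier [simp, intro]: "b \<in> carrier B ==> GC b g \<in> carrier B"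
 using GC_GP GP_carrier by blast

lemma GC_avg: "b \<in> carrier B ==> GC b (kd i) = avg i b"
 using avg_finsum[of "GC b" i] GC_GP GC_sum by simp

lemma GC_add:
 assumes "a \<in> carrier B" "b \<in> carrier B"
 shows "GC (a \<oplus>\<^bsub>B\<^esub> b) g = GC a g \<oplus>\<^bsub>B\<^esub> GC b g"
proof -
 obtain i where "g = kd i" using klein_kd by blast
 then show ?thesis using assms by (simp add: GC_avg avg_add)
qed

lemma GC_GP_eq: "x \<in> GP (kd l) ==> GC x (kd i) = (if i = l then x else \<zero>\<^bsub>B\<^esub>)"
 using avg_GP GC_avg GP_carrier by metis

lemma GC_bw: "GC (bw v) (kd i) = (if i = word_deg v then bw v else \<zero>\<^bsub>B\<^esub>)"
 by (rule GC_GP_eq[OF GP_bw])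

lemma GC_smult:
 assumes "b \<in> carrier B"
 shows "GC (c \<odot>\<^bsub>B\<^esub> b) g = c \<odot>\<^bsub>B\<^esub> GC b g"
proof -
 have "GC (c \<odot>\<^bsub>B\<^esub> b) = (%g. c \<odot>\<^bsub>B\<^esub> GC b g)"
  using assms by (intro GC_unique) (simp_all add: GP_smult GC_GP GC_sum flip: finsum_smult)
 then show ?thesis by simp
qed

end

section \<open>The twisted multiplication on words\<close>

context sklyanin
begin

abbreviation "TW \<equiv> alg_twist \<alpha> \<beta> \<gamma>"

lemma TW_simps:
 "carrier TW = carrier B" "add TW = add B" "zero TW = zero B" "one TW = one B"
 "module.smult TW = module.smult B" "piece TW = piece B"
 by (simp_all add: alg_twist_def Let_def)

lemma TW_mult: "a \<otimes>\<^bsub>TW\<^esub> b = finsum B (%(g, h). cocycle g h \<odot>\<^bsub>B\<^esub> (GC a g \<otimes>\<^bsub>B\<^esub> GC b h)) UNIV"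
 by (simp add: alg_twist_def Let_def)

text \<open>Both \<open>B\<close> and its twist have a multiplication which on words is concatenation up to a
  scalar \<open>r\<close> depending on the degrees of the words.\<close>

definition word_algebra :: "('k, 'k elem_B) graded_space => (gen => gen => 'k) => bool" where
 "word_algebra R r \<longleftrightarrow> carrier R = carrier B & add R = add B & zero R = zero B & one R = one B &
  module.smult R = module.smult B & piece R = piece B &
  (ALL u v. bw u \<otimes>\<^bsub>R\<^esub> bw v = r (word_deg u) (word_deg v) \<odot>\<^bsub>B\<^esub> bw (u @ v)) &
  (ALL i j. r i j * r i j = 1) &
  (\<forall>a\<in>carrier B. \<forall>b\<in>carrier B. a \<otimes>\<^bsub>R\<^esub> b \<in> carrier B) &
  (\<forall>a\<in>carrier B. \<forall>a'\<in>carrier B. \<forall>b\<in>carrier B. (a \<oplus>\<^bsub>B\<^esub> a') \<otimes>\<^bsub>R\<^esub> b = a \<otimes>\<^bsub>R\<^esub> b \<oplus>\<^bsub>B\<^esub> a' \<otimes>\<^bsub>R\<^esub> b &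
   b \<otimes>\<^bsub>R\<^esub> (a \<oplus>\<^bsub>B\<^esub> a') = b \<otimes>\<^bsub>R\<^esub> a \<oplus>\<^bsub>B\<^esub> b \<otimes>\<^bsub>R\<^esub> a') &
  (\<forall>a\<in>carrier B. \<forall>b\<in>carrier B. ALL c. (c \<odot>\<^bsub>B\<^esub> a) \<otimes>\<^bsub>R\<^esub> b = c \<odot>\<^bsub>B\<^esub> (a \<otimes>\<^bsub>R\<^esub> b) &
   a \<otimes>\<^bsub>R\<^esub> (c \<odot>\<^bsub>B\<^esub> b) = c \<odot>\<^bsub>B\<^esub> (a \<otimes>\<^bsub>R\<^esub> b))"

lemma word_algebra_B: "word_algebra B (%_ _. 1)"
 unfolding word_algebra_def
 by (simp add: bw_mult B.smult_one B.l_distr B.r_distr B.smult_mult B.mult_smult)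

lemma TW_mult_bw: "bw u \<otimes>\<^bsub>TW\<^esub> bw v = mu (word_deg u) (word_deg v) \<odot>\<^bsub>B\<^esub> bw (u @ v)"
proof -
 let ?a = "kd (word_deg u)" and ?b = "kd (word_deg v)"
 have GC: "GC (bw w) g = (if g = kd (word_deg w) then bw w else \<zero>\<^bsub>B\<^esub>)" for w g
  using klein_kd[of g] GC_bw[of w] by (auto simp del: kd.simps)
 have "bw u \<otimes>\<^bsub>TW\<^esub> bw v = finsum B (%p. if (?a, ?b) = p then cocycle ?a ?b \<odot>\<^bsub>B\<^esub> bw (u @ v) else \<zero>\<^bsub>B\<^esub>) UNIV"
  unfolding TW_mult
 proof (rule B.finsum_cong'[OF refl])
  fix p :: "klein \<times> klein"
  obtain g h where p: "p = (g, h)" by (rule prod.exhaust)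
  show "(case p of (g, h) => cocycle g h \<odot>\<^bsub>B\<^esub> (GC (bw u) g \<otimes>\<^bsub>B\<^esub> GC (bw v) h)) =
    (if (?a, ?b) = p then cocycle ?a ?b \<odot>\<^bsub>B\<^esub> bw (u @ v) else \<zero>\<^bsub>B\<^esub>)"
   unfolding p prod.case GC prod.inject by (cases "g = ?a"; cases "h = ?b") (auto simp only: bw_mult B.l_null B.r_null bw_carrier B.smult_zero B.zero_closed if_True if_False simp_thms split: if_split)
 qed simp
 also have "... = cocycle ?a ?b \<odot>\<^bsub>B\<^esub> bw (u @ v)"
  by (subst B.add.finprod_singleton[of "(?a, ?b)" UNIV "%_. cocycle ?a ?b \<odot>\<^bsub>B\<^esub> bw (u @ v)"]) simp_all
 finally show ?thesis by (simp add: mu_def)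
qed

lemma word_algebra_TW: "word_algebra TW mu"
proof -
 define t where "t a b = (%(g, h). cocycle g h \<odot>\<^bsub>B\<^esub> (GC a g \<otimes>\<^bsub>B\<^esub> GC b h))" for a b
 have TW: "a \<otimes>\<^bsub>TW\<^esub> b = finsum B (t a b) UNIV" for a b
  by (simp add: TW_mult t_def)
 have tc: "t a b p \<in> carrier B" if "a \<in> carrier B" "b \<in> carrier B" for a b p
  using that by (cases p) (simp add: t_def)
 have add: "(a \<oplus>\<^bsub>B\<^esub> a') \<otimes>\<^bsub>TW\<^esub> b = a \<otimes>\<^bsub>TW\<^esub> b \<oplus>\<^bsub>B\<^esub> a' \<otimes>\<^bsub>TW\<^esub> b"
   "b \<otimes>\<^bsub>TW\<^esub> (a \<oplus>\<^bsub>B\<^esub> a') = b \<otimes>\<^bsub>TW\<^esub> a \<oplus>\<^bsub>B\<^esub> b \<otimes>\<^bsub>TW\<^esub> a'"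
  if "a \<in> carrier B" "a' \<in> carrier B" "b \<in> carrier B" for a a' b
 proof -
  have "t (a \<oplus>\<^bsub>B\<^esub> a') b = (%p. t a b p \<oplus>\<^bsub>B\<^esub> t a' b p)" "t b (a \<oplus>\<^bsub>B\<^esub> a') = (%p. t b a p \<oplus>\<^bsub>B\<^esub> t b a' p)"
   using that by (simp_all add: t_def GC_add B.l_distr B.r_distr B.smult_r_distr case_prod_unfold)
  then show "(a \<oplus>\<^bsub>B\<^esub> a') \<otimes>\<^bsub>TW\<^esub> b = a \<otimes>\<^bsub>TW\<^esub> b \<oplus>\<^bsub>B\<^esub> a' \<otimes>\<^bsub>TW\<^esub> b"
   "b \<otimes>\<^bsub>TW\<^esub> (a \<oplus>\<^bsub>B\<^esub> a') = b \<otimes>\<^bsub>TW\<^esub> a \<oplus>\<^bsub>B\<^esub> b \<otimes>\<^bsub>TW\<^esub> a'"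
   unfolding TW using that tc by (simp_all add: B.finsum_addf Pi_def)
 qed
 have smult: "(c \<odot>\<^bsub>B\<^esub> a) \<otimes>\<^bsub>TW\<^esub> b = c \<odot>\<^bsub>B\<^esub> (a \<otimes>\<^bsub>TW\<^esub> b)" "a \<otimes>\<^bsub>TW\<^esub> (c \<odot>\<^bsub>B\<^esub> b) = c \<odot>\<^bsub>B\<^esub> (a \<otimes>\<^bsub>TW\<^esub> b)"
  if "a \<in> carrier B" "b \<in> carrier B" for a b c
 proof -
  have "t (c \<odot>\<^bsub>B\<^esub> a) b = (%p. c \<odot>\<^bsub>B\<^esub> t a b p)" "t a (c \<odot>\<^bsub>B\<^esub> b) = (%p. c \<odot>\<^bsub>B\<^esub> t a b p)"
   using that by (simp_all add: t_def GC_smult B.smult_mult B.mult_smult mult.commute case_prod_unfold flip: B.smult_smult)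
  then show "(c \<odot>\<^bsub>B\<^esub> a) \<otimes>\<^bsub>TW\<^esub> b = c \<odot>\<^bsub>B\<^esub> (a \<otimes>\<^bsub>TW\<^esub> b)" "a \<otimes>\<^bsub>TW\<^esub> (c \<odot>\<^bsub>B\<^esub> b) = c \<odot>\<^bsub>B\<^esub> (a \<otimes>\<^bsub>TW\<^esub> b)"
   unfolding TW using that tc by (simp_all add: finsum_smult)
 qed
 have "a \<otimes>\<^bsub>TW\<^esub> b \<in> carrier B" if "a \<in> carrier B" "b \<in> carrier B" for a b
  unfolding TW using that tc by (intro B.finsum_closed) auto
 with add smult show ?thesis
  unfolding word_algebra_def TW_simps by (simp add: TW_mult_bw)
qed

lemma word_algebraD:
 assumes "word_algebra R r"
 shows "carrier R = carrier B" "add R = add B" "zero R = zero B" "one R = one B"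
  "module.smult R = module.smult B" "piece R = piece B"
  "bw u \<otimes>\<^bsub>R\<^esub> bw v = r (word_deg u) (word_deg v) \<odot>\<^bsub>B\<^esub> bw (u @ v)" "r i j * r i j = 1"
  "a \<in> carrier B ==> b \<in> carrier B ==> a \<otimes>\<^bsub>R\<^esub> b \<in> carrier B"
  "a \<in> carrier B ==> a' \<in> carrier B ==> b \<in> carrier B ==> (a \<oplus>\<^bsub>B\<^esub> a') \<otimes>\<^bsub>R\<^esub> b = a \<otimes>\<^bsub>R\<^esub> b \<oplus>\<^bsub>B\<^esub> a' \<otimes>\<^bsub>R\<^esub> b"
  "a \<in> carrier B ==> a' \<in> carrier B ==> b \<in> carrier B ==> b \<otimes>\<^bsub>R\<^esub> (a \<oplus>\<^bsub>B\<^esub> a') = b \<otimes>\<^bsub>R\<^esub> a \<oplus>\<^bsub>B\<^esub> b \<otimes>\<^bsub>R\<^esub> a'"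
  "a \<in> carrier B ==> b \<in> carrier B ==> (c \<odot>\<^bsub>B\<^esub> a) \<otimes>\<^bsub>R\<^esub> b = c \<odot>\<^bsub>B\<^esub> (a \<otimes>\<^bsub>R\<^esub> b)"
  "a \<in> carrier B ==> b \<in> carrier B ==> a \<otimes>\<^bsub>R\<^esub> (c \<odot>\<^bsub>B\<^esub> b) = c \<odot>\<^bsub>B\<^esub> (a \<otimes>\<^bsub>R\<^esub> b)"
 using assms unfolding word_algebra_def by blast+

end

section \<open>Graded vector spaces\<close>

locale kspace = vectorspace class_ring V for V :: "('k::field, 'm, 'z) module_scheme" (structure)
begin

lemma sc [simp, intro]: "x \<in> carrier V ==> c \<odot> x \<in> carrier V"
 using smult_closed[of c x] by (simp add: class_ring_simps)

lemma s_add: "x \<in> carrier V ==> (a + b) \<odot> x = a \<odot> x \<oplus> b \<odot> x"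
 using smult_l_distr[of a b x] by (simp add: class_ring_simps)

lemma s_mult: "x \<in> carrier V ==> (a * b) \<odot> x = a \<odot> (b \<odot> x)"
 using smult_assoc1[of a b x] by (simp add: class_ring_simps)

lemma s_one [simp]: "x \<in> carrier V ==> 1 \<odot> x = x"
 using smult_one[of x] by (simp add: class_ring_simps)

lemma add_s: "x \<in> carrier V ==> y \<in> carrier V ==> a \<odot> (x \<oplus> y) = a \<odot> x \<oplus> a \<odot> y"
 using smult_r_distr[of a x y] by (simp add: class_ring_simps)

lemma s_zero [simp]: "c \<odot> \<zero> = \<zero>"
 using add_s[of \<zero> \<zero> c] by (simp add: M.add.l_cancel_one)

lemma zero_s [simp]: "x \<in> carrier V ==> 0 \<odot> x = \<zero>"
 using s_add[of x 0 0] by (simp add: M.add.l_cancel_one)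

lemma minus_s: "x \<in> carrier V ==> (- 1) \<odot> x = \<ominus> x"
 using s_add[of x "- 1" 1] by (simp add: M.minus_equality)

lemma s_eq_zero: "x \<in> carrier V ==> c \<odot> x = \<zero> \<longleftrightarrow> c = 0 \<or> x = \<zero>"
 using s_mult[of x "inverse c" c] by (cases "c = 0") auto

lemma diff_zero: "x \<in> carrier V ==> y \<in> carrier V ==> x \<oplus> (- 1) \<odot> y = \<zero> \<longleftrightarrow> x = y"
 using M.r_neg M.minus_equality[of x "\<ominus> y"] by (auto simp: minus_s)

abbreviation "sub N \<equiv> submodule class_ring N V"

lemma subI:
 assumes "N <= carrier V" "\<zero> \<in> N" "!!x y. x \<in> N ==> y \<in> N ==> x \<oplus> y \<in> N" "!!c x. x \<in> N ==> c \<odot> x \<in> N"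
 shows "sub N"
 using assms module_axioms by (simp add: submodule_def)

lemma subD:
 assumes "sub N"
 shows "N <= carrier V" "\<zero> \<in> N" "x \<in> N ==> y \<in> N ==> x \<oplus> y \<in> N" "x \<in> N ==> c \<odot> x \<in> N"
  "x \<in> N ==> x \<in> carrier V" "x \<in> N ==> \<ominus> x \<in> N"
proof -
 show *: "N <= carrier V" "\<zero> \<in> N" "x \<in> N ==> y \<in> N ==> x \<oplus> y \<in> N"
  using assms by (simp_all add: submodule_def)
 show s: "x \<in> N ==> c \<odot> x \<in> N" for c
  using assms by (simp add: submodule_def class_ring_simps)
 show x: "x \<in> N ==> x \<in> carrier V" using * by blast
 show "x \<in> N ==> \<ominus> x \<in> N" using s[of "- 1"] minus_s x by force
qed

lemma sub_carrier: "sub (carrier V)"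
 by (rule subI) auto

lemma sub_kspace: "sub N ==> kspace (V\<lparr>carrier := N\<rparr>)"
 unfolding kspace_def by (rule subspace_is_vs) (simp add: VectorSpace.subspace_def vectorspace_axioms)

lemma finsum_in:
 assumes "sub N" "!!i. i \<in> S ==> f i \<in> N"
 shows "finsum V f S \<in> N"
 using assms(2)
proof (induction S rule: infinite_finite_induct)
 case (insert x S)
 then show ?case using subD(3)[OF assms(1)] subD(5)[OF assms(1)] by (subst M.finsum_insert) auto
qed (use subD(2)[OF assms(1)] in auto)

lemma span_least: "S <= N ==> sub N ==> span S <= N"
 by (rule span_is_subset)

lemma span_sub: "S <= carrier V ==> sub (span S)"
 by (rule span_is_submodule)

text \<open>Phrased through subspaces instead of spans, the condition transfers to submodules and
  quotients, whose subspaces are known in terms of those of the ambient space.\<close>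

lemma fin_dim_iff: "fin_dim \<longleftrightarrow> (EX S. finite S & S <= carrier V & (ALL N. sub N & S <= N --> carrier V <= N))"
proof -
 have "span S = carrier V \<longleftrightarrow> (ALL N. sub N & S <= N --> carrier V <= N)" if "S <= carrier V" for S
  using span_least span_sub[OF that] in_own_span[OF that] span_is_subset2[OF that] by blast
 then show ?thesis unfolding fin_dim_def by (intro ex_cong1 conj_cong refl)
qed

lemma span_comb2:
 assumes "a \<in> carrier V" "b \<in> carrier V" "x \<in> span {a, b}"
 shows "EX c d. x = c \<odot> a \<oplus> d \<odot> b"
proof -
 let ?N = "{c \<odot> a \<oplus> d \<odot> b | c d. True}"
 have "sub ?N"
 proof (rule subI)
  show "?N <= carrier V" using assms by auto
  show "\<zero> \<in> ?N" using assms by (auto intro!: exI[of _ 0])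
  fix x y assume "x \<in> ?N" "y \<in> ?N"
  then obtain c d e f where "x = c \<odot> a \<oplus> d \<odot> b" "y = e \<odot> a \<oplus> f \<odot> b" by blast
  then have "x \<oplus> y = (c + e) \<odot> a \<oplus> (d + f) \<odot> b" using assms by (simp add: s_add M.a_ac)
  then show "x \<oplus> y \<in> ?N" by blast
 next
  fix g x assume "x \<in> ?N"
  then obtain c d where "x = c \<odot> a \<oplus> d \<odot> b" by blast
  then have "g \<odot> x = (g * c) \<odot> a \<oplus> (g * d) \<odot> b" using assms by (simp add: add_s s_mult)
  then show "g \<odot> x \<in> ?N" by blast
 qed
 moreover have "a = 1 \<odot> a \<oplus> 0 \<odot> b" "b = 0 \<odot> a \<oplus> 1 \<odot> b" using assms by auto
 then have "{a, b} <= ?N" by blast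
 ultimately show ?thesis using span_least assms(3) by blast
qed

end

locale gspace = kspace V for V :: "('k::field, 'm, 'z) graded_space_scheme" (structure) +
 assumes piece_sub: "submodule class_ring (piece V n) V"
  and decomp_ex1: "v \<in> carrier V ==> \<exists>!c. homog_decomp V c v"

lemma gspace_iff: "gspace V \<longleftrightarrow> graded_vector_space V"
 by (simp add: gspace_def gspace_axioms_def graded_vector_space_def kspace_def Ball_def)

context gspace
begin

definition comp :: "nat => 'm => 'm" where "comp n v = (THE c. homog_decomp V c v) n"

lemmas pD = subD[OF piece_sub]

lemma homog_decompI:
 assumes c: "!!n. c n \<in> piece V n" and S: "finite S" "!!n. n ~: S ==> c n = \<zero>" and v: "v = finsum V c S"
 shows "homog_decomp V c v"
proof -
 have sub: "{n. c n ~= \<zero>} <= S" using S(2) by blast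
 have "finsum V c {n. c n ~= \<zero>} = finsum V c S"
  by (rule M.add.finprod_mono_neutral_cong_left) (use S(1) sub c pD in auto)
 then show ?thesis using c v finite_subset[OF sub S(1)] by (simp add: homog_decomp_def)
qed

lemma homog_decompD:
 assumes "homog_decomp V c v"
 shows "c n \<in> piece V n" "c n \<in> carrier V" "v \<in> carrier V" "EX N. \<forall>n\<ge>N. c n = \<zero>"
  "(\<forall>n\<ge>N. c n = \<zero>) ==> v = finsum V c {..<N}"
proof -
 show c: "c n \<in> piece V n" for n using assms by (simp add: homog_decomp_def)
 then show cc: "c n \<in> carrier V" for n using pD by blast
 have fin: "finite {n. c n ~= \<zero>}" and v: "v = finsum V c {n. c n ~= \<zero>}" using assms by (auto simp: homog_decomp_def)
 show "v \<in> carrier V" unfolding v using cc by (intro M.finsum_closed) auto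
 show "EX N. \<forall>n\<ge>N. c n = \<zero>"
  using fin finite_nat_set_iff_bounded by (metis (mono_tags, lifting) mem_Collect_eq not_le)
 show "v = finsum V c {..<N}" if "\<forall>n\<ge>N. c n = \<zero>"
 proof -
  have "{n. c n ~= \<zero>} <= {..<N}" using that by (auto simp: not_le[symmetric])
  then have "finsum V c {n. c n ~= \<zero>} = finsum V c {..<N}"
   by (intro M.add.finprod_mono_neutral_cong_left) (use cc in auto)
  then show ?thesis using v by simp
 qed
qed

lemma comp_eq: "homog_decomp V c v ==> comp n v = c n"
 unfolding comp_def by (rule arg_cong[of _ _ "%c. c n"]) (rule the1_equality[OF decomp_ex1[OF homog_decompD(3)]])

lemma comp_decomp: "v \<in> carrier V ==> homog_decomp V (%n. comp n v) v"
 unfolding comp_def using theI'[OF decomp_ex1] .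

lemma comp_piece [intro]: "v \<in> carrier V ==> comp n v \<in> piece V n"
 using homog_decompD(1)[OF comp_decomp] by blast

lemma comp_closed [simp, intro]: "v \<in> carrier V ==> comp n v \<in> carrier V"
 using homog_decompD(2)[OF comp_decomp] by blast

lemma comp_bound: "v \<in> carrier V ==> EX N. \<forall>n\<ge>N. comp n v = \<zero>"
 using homog_decompD(4)[OF comp_decomp] .

lemma comp_sum: "v \<in> carrier V ==> (\<forall>n\<ge>N. comp n v = \<zero>) ==> v = finsum V (%n. comp n v) {..<N}"
 using homog_decompD(5)[OF comp_decomp] .

lemma comp_bound_finite:
 assumes "finite S" "S <= carrier V"
 obtains K where "!!s n. s \<in> S ==> n >= K ==> comp n s = \<zero>"
proof -
 have "\<forall>s\<in>S. EX K. \<forall>n\<ge>K. comp n s = \<zero>" using comp_bound assms(2) by blast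
 then obtain f where f: "\<forall>s\<in>S. \<forall>n\<ge>f s. comp n s = \<zero>" by metis
 show ?thesis
 proof (rule that[of "Max (f ` S)"])
  fix s n assume s: "s \<in> S" and n: "Max (f ` S) <= n"
  have "f s <= Max (f ` S)" using assms(1) s by simp
  then show "comp n s = \<zero>" using f s n by simp
 qed
qed

lemma comps_in:
 assumes "v \<in> carrier V" "sub N" "!!n. comp n v \<in> N"
 shows "v \<in> N"
proof -
 obtain K where K: "\<forall>n\<ge>K. comp n v = \<zero>" using comp_bound[OF assms(1)] by blast
 show ?thesis using comp_sum[OF assms(1) K] finsum_in[OF assms(2), of "{..<K}" "%n. comp n v"] assms(3) by metis
qed

lemma comp_homog: 
 assumes "v \<in> piece V m"
 shows "comp n v = (if n = m then v else \<zero>)"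
proof -
 have "homog_decomp V (%n. if n = m then v else \<zero>) v"
  by (rule homog_decompI[of _ "{m}"]) (use assms pD in auto)
 from comp_eq[OF this] show ?thesis .
qed

lemma comp_add:
 assumes v: "v \<in> carrier V" and w: "w \<in> carrier V"
 shows "comp n (v \<oplus> w) = comp n v \<oplus> comp n w"
proof -
 obtain K L where KL: "\<forall>n\<ge>K. comp n v = \<zero>" "\<forall>n\<ge>L. comp n w = \<zero>" using comp_bound v w by metis
 have "homog_decomp V (%n. comp n v \<oplus> comp n w) (v \<oplus> w)"
 proof (rule homog_decompI[of _ "{..<max K L}"])
  show "v \<oplus> w = finsum V (%n. comp n v \<oplus> comp n w) {..<max K L}"
  proof -
   have "finsum V (%n. comp n v \<oplus> comp n w) {..<max K L} =
     finsum V (%n. comp n v) {..<max K L} \<oplus> finsum V (%n. comp n w) {..<max K L}"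
    by (rule M.finsum_addf) (use v w in auto)
   then show ?thesis using comp_sum[OF v, of "max K L"] comp_sum[OF w, of "max K L"] KL by simp
  qed
  show "comp n v \<oplus> comp n w \<in> piece V n" for n
   using pD(3)[OF comp_piece[OF v] comp_piece[OF w]] .
  show "comp n v \<oplus> comp n w = \<zero>" if "n ~: {..<max K L}" for n
   using KL that by (simp add: not_less)
 qed simp
 from comp_eq[OF this] show ?thesis .
qed

lemma comp_smult:
 assumes v: "v \<in> carrier V"
 shows "comp n (a \<odot> v) = a \<odot> comp n v"
proof -
 obtain K where K: "\<forall>n\<ge>K. comp n v = \<zero>" using comp_bound v by metis
 have "homog_decomp V (%n. a \<odot> comp n v) (a \<odot> v)"
 proof (rule homog_decompI[of _ "{..<K}"])
  show "a \<odot> v = finsum V (%n. a \<odot> comp n v) {..<K}"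
   using comp_sum[OF v K] v finsum_smult_ldistr[of "{..<K}" a "%n. comp n v"] by (auto simp: class_ring_simps)
  show "a \<odot> comp n v \<in> piece V n" for n
   using pD(4)[OF comp_piece[OF v]] .
  show "a \<odot> comp n v = \<zero>" if "n ~: {..<K}" for n
   using K that by (simp add: not_less)
 qed simp
 from comp_eq[OF this] show ?thesis .
qed

lemma comp_zero [simp]: "comp n \<zero> = \<zero>"
 using comp_homog[OF pD(2)] by metis

lemma eq_by_comps:
 assumes "v \<in> carrier V" "w \<in> carrier V" "!!n. comp n v = comp n w"
 shows "v = w"
proof -
 have "v \<oplus> (- 1) \<odot> w \<in> {\<zero>}"
 proof (rule comps_in)
  show "sub {\<zero>}" by (rule subI) auto
  show "comp n (v \<oplus> (- 1) \<odot> w) \<in> {\<zero>}" for n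
   using assms diff_zero[of "comp n w" "comp n w"] by (simp add: comp_add comp_smult)
 qed (use assms in auto)
 then show ?thesis using diff_zero assms by simp
qed

end

section \<open>Graded modules over \<open>B\<close> and over its twist\<close>

text \<open>One setting for modules over B, with r constantly 1, and over the twist, with r =
  \<open>mu\<close>: the two differ only by the sign that appears when two words act in
  succession.\<close>

locale gmod = sklyanin \<alpha> \<beta> \<gamma> for \<alpha> \<beta> \<gamma> :: "'k::alg_closed_field" +
 fixes R :: "('k, 'k elem_B) graded_space" and r :: "gen => gen => 'k"
  and M :: "('k, 'm, 'k elem_B) graded_rmodule"
 assumes wa: "word_algebra R r" and gm: "graded_module R M"

sublocale gmod \<subseteq> gspace M
 using gm by (simp add: gspace_iff graded_module_def)

context gmod
begin

lemma act_closed [simp, intro]: "m \<in> carrier M ==> b \<in> carrier B ==> act M m b \<in> carrier M"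
 and act_add: "m \<in> carrier M ==> m' \<in> carrier M ==> b \<in> carrier B ==> act M (m \<oplus>\<^bsub>M\<^esub> m') b = act M m b \<oplus>\<^bsub>M\<^esub> act M m' b"
 and act_add_r: "m \<in> carrier M ==> a \<in> carrier B ==> b \<in> carrier B ==> act M m (a \<oplus>\<^bsub>B\<^esub> b) = act M m a \<oplus>\<^bsub>M\<^esub> act M m b"
 and act_smult: "m \<in> carrier M ==> b \<in> carrier B ==> act M (c \<odot>\<^bsub>M\<^esub> m) b = c \<odot>\<^bsub>M\<^esub> act M m b"
 and act_smult_r: "m \<in> carrier M ==> b \<in> carrier B ==> act M m (c \<odot>\<^bsub>B\<^esub> b) = c \<odot>\<^bsub>M\<^esub> act M m b"
 and act_Nil [simp]: "m \<in> carrier M ==> act M m (bw []) = m"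
 and act_piece: "m \<in> piece M i ==> b \<in> piece B j ==> act M m b \<in> piece M (i + j)"
 and act_mult: "m \<in> carrier M ==> a \<in> carrier B ==> b \<in> carrier B ==> act M m (a \<otimes>\<^bsub>R\<^esub> b) = act M (act M m a) b"
 using gm unfolding graded_module_def word_algebraD(1-6)[OF wa] bw_Nil by blast+

lemma act_bw: "m \<in> carrier M ==> act M (act M m (bw u)) (bw v) = r (word_deg u) (word_deg v) \<odot>\<^bsub>M\<^esub> act M m (bw (u @ v))"
 using act_mult[of m "bw u" "bw v"] word_algebraD(7)[OF wa, of u v] act_smult_r by simp

lemma r_sq [simp]: "r i j * r i j = 1"
 by (rule word_algebraD(8)[OF wa])

lemma act_bw_append: "m \<in> carrier M ==> act M m (bw (u @ v)) = r (word_deg u) (word_deg v) \<odot>\<^bsub>M\<^esub> act M (act M m (bw u)) (bw v)"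
 by (simp add: act_bw flip: s_mult)

lemma act_zero [simp]: "b \<in> carrier B ==> act M \<zero>\<^bsub>M\<^esub> b = \<zero>\<^bsub>M\<^esub>"
 using act_smult[of "\<zero>\<^bsub>M\<^esub>" b 0] by simp

lemma act_zero_r [simp]: "m \<in> carrier M ==> act M m \<zero>\<^bsub>B\<^esub> = \<zero>\<^bsub>M\<^esub>"
 using act_smult_r[of m "\<zero>\<^bsub>B\<^esub>" 0] by simp

abbreviation actx :: "'m => gen => 'm" (infixl "\<cdot>" 75) where "m \<cdot> i \<equiv> act M m (bw [i])"

lemma actx_piece: "m \<in> piece M n ==> m \<cdot> i \<in> piece M (Suc n)"
 using act_piece[of m n "bw [i]" 1] bw_piece[of "[i]"] by simp

lemma act_bw_piece: "m \<in> piece M n ==> act M m (bw w) \<in> piece M (n + length w)"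
 by (rule act_piece[OF _ bw_piece])

lemma right_submoduleI:
 assumes N: "sub N" "!!m i. m \<in> N ==> m \<cdot> i \<in> N"
 shows "right_submodule R M N"
proof -
 have w: "act M m (bw w) \<in> N" if "m \<in> N" for m w
  using that
 proof (induction w arbitrary: m)
  case (Cons i w)
  then have "act M (m \<cdot> i) (bw w) \<in> N" using N(2) by blast
  then show ?case using act_bw_append[of m "[i]" w] subD(4,5)[OF N(1)] Cons.prems by simp
 qed (use subD(5)[OF N(1)] in simp)
 have "act M m b \<in> N" if m: "m \<in> N" and b: "b \<in> carrier B" for m b
  using b
 proof (induction rule: B_induct)
  case zero show ?case using subD(2,5)[OF N(1)] m by simp
 next
  case (add a b) then show ?case using act_add_r subD(3,5)[OF N(1)] m by simp
 next
  case (smult c a) then show ?case using act_smult_r subD(4,5)[OF N(1)] m by simp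
 qed (use w m in simp)
 then show ?thesis using N(1) by (simp add: right_submodule_def word_algebraD(1)[OF wa])
qed

lemma right_submoduleD: "right_submodule R M N ==> sub N" "right_submodule R M N ==> m \<in> N ==> b \<in> carrier B ==> act M m b \<in> N"
 by (auto simp: right_submodule_def word_algebraD(1)[OF wa])

lemma graded_submodule_iff: "graded_submodule R M N \<longleftrightarrow> sub N & (\<forall>m\<in>N. ALL i. m \<cdot> i \<in> N) & (\<forall>m\<in>N. ALL n. comp n m \<in> N)"
proof -
 have "(EX c. homog_decomp M c m & (ALL n. c n \<in> N)) \<longleftrightarrow> (ALL n. comp n m \<in> N)" if "m \<in> carrier M" for m
  using comp_decomp[OF that] comp_eq by metis
 then show ?thesis
  unfolding graded_submodule_def using right_submoduleI right_submoduleD subD(5) bw_carrier by meson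
qed

lemma comp_actx: assumes "m \<in> carrier M" shows "comp (Suc n) (m \<cdot> i) = comp n m \<cdot> i" "comp 0 (m \<cdot> i) = \<zero>\<^bsub>M\<^esub>"
proof -
 let ?N = "{m \<in> carrier M. comp (Suc n) (m \<cdot> i) = comp n m \<cdot> i & comp 0 (m \<cdot> i) = \<zero>\<^bsub>M\<^esub>}"
 have "m \<in> ?N"
 proof (rule comps_in[OF assms])
  show "sub ?N"
   by (rule subI) (auto simp: act_add comp_add act_smult comp_smult)
  fix k
  have p: "comp k m \<in> piece M k" using assms by blast
  show "comp k m \<in> ?N" using comp_homog[OF p] comp_homog[OF actx_piece[OF p]] assms by auto
 qed
 then show "comp (Suc n) (m \<cdot> i) = comp n m \<cdot> i" "comp 0 (m \<cdot> i) = \<zero>\<^bsub>M\<^esub>" by auto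
qed

lemma actx_in_span:
 assumes U: "U <= carrier M" and m: "m \<in> span U"
 shows "m \<cdot> i \<in> span ((%u. u \<cdot> i) ` U)"
proof -
 have c: "(%u. u \<cdot> i) ` U <= carrier M" using U by auto
 have "sub {m \<in> carrier M. m \<cdot> i \<in> span ((%u. u \<cdot> i) ` U)}"
  using subD[OF span_sub[OF c]] by (intro subI) (auto simp: act_add act_smult)
 moreover have "U <= {m \<in> carrier M. m \<cdot> i \<in> span ((%u. u \<cdot> i) ` U)}"
  using U in_own_span[OF c] by auto
 ultimately have "span U <= {m \<in> carrier M. m \<cdot> i \<in> span ((%u. u \<cdot> i) ` U)}" by (rule span_least[rotated])
 then show ?thesis using m by auto
qed

definition next_gens :: "'m set => 'm set" where "next_gens U = (%(u, i). u \<cdot> i) ` (U \<times> UNIV)"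

lemma next_gens_finite: "finite U ==> finite (next_gens U)"
 by (simp add: next_gens_def)

lemma next_gens_piece: "U <= piece M n ==> next_gens U <= piece M (Suc n)"
 using actx_piece by (auto simp: next_gens_def)

primrec span_gens :: "'m set => nat => 'm set" where
 "span_gens S 0 = comp 0 ` S"
| "span_gens S (Suc n) = comp (Suc n) ` S Un next_gens (span_gens S n)"

text \<open>The components of finitely many generators, pushed forward by the x_i, span each piece.
  Beyond the largest degree of such a component nothing new enters, so each piece is generated by
  the one before.\<close>

lemma fin_gen_pieces:
 assumes "finitely_generated R M"
 obtains U n0 where "!!n. finite (U n)" "!!n. U n <= piece M n" "!!n. piece M n = span (U n)"
  "!!n. n >= n0 ==> piece M (Suc n) = span (next_gens (U n))"
proof -
 obtain S where S: "finite S" "S <= carrier M" "!!N. right_submodule R M N ==> S <= N ==> N = carrier M"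
  using assms by (auto simp: finitely_generated_def generates_def)
 let ?U = "span_gens S"
 have fin: "finite (?U n)" for n
  by (induction n) (use S(1) next_gens_finite in auto)
 have up: "?U n <= piece M n" for n
 proof (induction n)
  case (Suc n) then show ?case using next_gens_piece[OF Suc] comp_piece S(2) by auto
 qed (use comp_piece S(2) in auto)
 have uc: "?U n <= carrier M" for n using up pD(1) by blast
 let ?N = "{m \<in> carrier M. ALL n. comp n m \<in> span (?U n)}"
 have "right_submodule R M ?N"
 proof (rule right_submoduleI)
  show "sub ?N"
   by (rule subI) (auto simp: comp_add comp_smult subD[OF span_sub[OF uc]])
  fix m i assume m: "m \<in> ?N"
  have "comp n (m \<cdot> i) \<in> span (?U n)" for n
  proof (cases n)
   case 0 then show ?thesis using comp_actx(2)[of m i] m subD(2)[OF span_sub[OF uc], of n] by simp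
  next
   case (Suc k)
   have "comp k m \<cdot> i \<in> span ((%u. u \<cdot> i) ` ?U k)" using actx_in_span[OF uc] m by blast
   also have "... <= span (?U n)" by (rule span_is_monotone) (auto simp: Suc next_gens_def)
   finally show ?thesis using comp_actx(1)[of m k i] m Suc by simp
  qed
  then show "m \<cdot> i \<in> ?N" using m by simp
 qed
 moreover have "S <= ?N"
 proof
  fix s assume s: "s \<in> S"
  have "comp n s \<in> ?U n" for n using s by (cases n) auto
  then show "s \<in> ?N" using s S(2) in_own_span[OF uc] by blast
 qed
 ultimately have N: "?N = carrier M" by (rule S(3))
 have eq: "piece M n = span (?U n)" for n
 proof
  show "span (?U n) <= piece M n" by (rule span_least[OF up piece_sub])
  show "piece M n <= span (?U n)"
  proof
   fix m assume m: "m \<in> piece M n"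
   then have "m \<in> ?N" using N pD(5) by blast
   then have "comp n m \<in> span (?U n)" by blast
   then show "m \<in> span (?U n)" using comp_homog[OF m, of n] by simp
  qed
 qed
 obtain K where K: "!!s n. s \<in> S ==> n >= K ==> comp n s = \<zero>\<^bsub>M\<^esub>"
  by (rule comp_bound_finite[OF S(1,2)]) blast
 show ?thesis
 proof (rule that[of ?U K, OF fin up eq])
  fix n assume n: "K <= n"
  have c: "next_gens (?U n) <= carrier M" using next_gens_piece[OF up] pD(1) by blast
  have "?U (Suc n) <= span (next_gens (?U n))"
   using K n in_own_span[OF c] subD(2)[OF span_sub[OF c]] by auto
  then have "span (?U (Suc n)) <= span (next_gens (?U n))" by (rule span_least[OF _ span_sub[OF c]])
  moreover have "span (next_gens (?U n)) <= span (?U (Suc n))" by (rule span_is_monotone) auto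
  ultimately show "piece M (Suc n) = span (next_gens (?U n))" using eq by blast
 qed
qed

end

section \<open>Criteria for graded spaces and modules, and finiteness of submodules\<close>

lemma kspaceI:
 fixes W :: "('k::field, 'm, 'z) module_scheme" (structure)
 assumes "abelian_group W" "!!c x. x \<in> carrier W ==> c \<odot> x \<in> carrier W"
  "!!a b x. x \<in> carrier W ==> (a + b) \<odot> x = a \<odot> x \<oplus> b \<odot> x"
  "!!a x y. x \<in> carrier W ==> y \<in> carrier W ==> a \<odot> (x \<oplus> y) = a \<odot> x \<oplus> a \<odot> y"
  "!!a b x. x \<in> carrier W ==> (a * b) \<odot> x = a \<odot> (b \<odot> x)" "!!x. x \<in> carrier W ==> 1 \<odot> x = x"
 shows "kspace W"
 unfolding kspace_def vectorspace_def
 using assms class_field by (auto intro!: moduleI simp: class_ring_simps dest: field.axioms(1) domain.axioms(1))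

lemma kspace_transfer:
 assumes V: "kspace V" and W: "carrier W = carrier V" "add W = add V" "zero W = zero V" "module.smult W = module.smult V"
 shows "kspace W"
proof -
 interpret kspace V by (rule V)
 show ?thesis
 proof (rule kspaceI)
  show "abelian_group W"
  proof (rule abelian_groupI, unfold W)
   show "\<exists>y\<in>carrier V. y \<oplus>\<^bsub>V\<^esub> x = \<zero>\<^bsub>V\<^esub>" if "x \<in> carrier V" for x
    using that M.l_neg by blast
  qed (simp_all add: M.a_ac)
 qed (simp_all add: W s_add add_s s_mult)
qed

text \<open>A grading is specified here by its projections: if they are additive, act correctly on
  the pieces and separate elements, the unique decomposition required by the definition
  follows.\<close>

lemma gspaceI:
 fixes W :: "('k::field, 'm, 'z) graded_space_scheme" (structure)
 assumes W: "kspace W" and p: "!!n. submodule class_ring (piece W n) W"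
  and c: "!!n v. v \<in> carrier W ==> cmp n v \<in> piece W n"
  and bound: "!!v. v \<in> carrier W ==> EX K. \<forall>n\<ge>K. cmp n v = \<zero>"
  and add: "!!n v w. v \<in> carrier W ==> w \<in> carrier W ==> cmp n (v \<oplus> w) = cmp n v \<oplus> cmp n w"
  and hom: "!!n m v. v \<in> piece W m ==> cmp n v = (if n = m then v else \<zero>)"
  and inj: "!!v w. v \<in> carrier W ==> w \<in> carrier W ==> (!!n. cmp n v = cmp n w) ==> v = w"
 shows "gspace W"
proof -
 interpret kspace W by (rule W)
 have pc: "x \<in> piece W n ==> x \<in> carrier W" for x n using subD(5)[OF p] .
 have z: "cmp n \<zero> = \<zero>" for n using hom[OF subD(2)[OF p], of n 0] by simp
 have sum: "cmp n (finsum W d S) = (if n \<in> S then d n else \<zero>)" if "finite S" "!!n. d n \<in> piece W n" for d S n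
  using that
 proof (induction S)
  case (insert i S)
  have dc: "d n \<in> carrier W" for n using pc insert.prems by blast
  then have "cmp n (finsum W d (insert i S)) = cmp n (d i) \<oplus> cmp n (finsum W d S)"
   using insert.hyps by (simp add: add M.finsum_closed Pi_def)
  also have "... = (if n \<in> insert i S then d n else \<zero>)"
   using insert dc hom[OF insert.prems, of n i] by auto
  finally show ?case .
 qed (simp add: z)
 show ?thesis
 proof (intro gspace.intro[OF W] gspace_axioms.intro p)
  fix v assume v: "v \<in> carrier W"
  obtain K where K: "\<forall>n\<ge>K. cmp n v = \<zero>" using bound[OF v] by blast
  let ?S = "{n. cmp n v ~= \<zero>}"
  have fin: "finite ?S" by (rule finite_subset[of _ "{..<K}"]) (use K in \<open>auto simp: not_le[symmetric]\<close>)
  have "v = finsum W (%n. cmp n v) ?S"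
  proof (rule inj[OF v])
   show "finsum W (%n. cmp n v) ?S \<in> carrier W" using c[OF v] pc by (intro M.finsum_closed) auto
   show "cmp n v = cmp n (finsum W (%n. cmp n v) ?S)" for n
    using sum[of ?S "%n. cmp n v" n] fin c[OF v] by simp
  qed
  then have "homog_decomp W (%n. cmp n v) v" using c[OF v] fin by (simp add: homog_decomp_def)
  moreover have "d = (%n. cmp n v)" if "homog_decomp W d v" for d
  proof
   fix n
   have "finite {n. d n ~= \<zero>}" "!!n. d n \<in> piece W n" "v = finsum W d {n. d n ~= \<zero>}"
    using that by (auto simp: homog_decomp_def)
   then show "d n = cmp n v" using sum[of "{n. d n ~= \<zero>}" d n] by auto
  qed
  ultimately show "\<exists>!c. homog_decomp W c v" by blast
 qed
qed

text \<open>Gaussian elimination, one generator of the ambient span at a time.\<close>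

lemma (in kspace) sub_fin_span:
 assumes "finite U" "U <= carrier V" "sub N" "N <= span U"
 shows "EX T. finite T & T <= N & N = span T"
 using assms
proof (induction U arbitrary: N)
 case empty
 then show ?case using span_least[OF empty_subsetI, of N] by (intro exI[of _ "{}"]) auto
next
 case (insert u U)
 have Uc: "U <= carrier V" and uc: "u \<in> carrier V" using insert.prems by auto
 note sU = subD[OF span_sub[OF Uc]] and N = subD[OF insert.prems(2)]
 have "sub (N Int span U)" by (rule subI) (use N sU in auto)
 then obtain T where T: "finite T" "T <= N Int span U" "N Int span U = span T"
  using insert.IH[OF Uc _ Int_lower2] by metis
 have dec: "EX c. x \<oplus> c \<odot> u \<in> span U" if "x \<in> N" for x
 proof -
  let ?L = "{x \<in> carrier V. EX c. x \<oplus> c \<odot> u \<in> span U}"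
  have "sub ?L"
  proof (rule subI)
   show "\<zero> \<in> ?L" using uc sU by (auto intro!: exI[of _ 0])
  next
   fix x y assume "x \<in> ?L" "y \<in> ?L"
   then obtain c d where *: "x \<oplus> c \<odot> u \<in> span U" "y \<oplus> d \<odot> u \<in> span U" "x \<in> carrier V" "y \<in> carrier V" by blast
   then have "(x \<oplus> y) \<oplus> (c + d) \<odot> u = (x \<oplus> c \<odot> u) \<oplus> (y \<oplus> d \<odot> u)"
    using uc by (simp add: s_add M.a_ac)
   with sU(3)[OF *(1,2)] have "x \<oplus> y \<oplus> (c + d) \<odot> u \<in> span U" by simp
   then show "x \<oplus> y \<in> ?L" using * by blast
  next
   fix e x assume "x \<in> ?L"
   then obtain c where *: "x \<oplus> c \<odot> u \<in> span U" "x \<in> carrier V" by blast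
   then have "e \<odot> x \<oplus> (e * c) \<odot> u = e \<odot> (x \<oplus> c \<odot> u)" using uc by (simp add: add_s s_mult)
   with sU(4)[OF *(1), of e] have "e \<odot> x \<oplus> (e * c) \<odot> u \<in> span U" by simp
   then show "e \<odot> x \<in> ?L" using *(2) by blast
  qed auto
  moreover have "insert u U <= ?L"
  proof -
   have "u \<oplus> (- 1) \<odot> u \<in> span U" using diff_zero[OF uc uc] sU(2) by simp
   then have "u \<in> ?L" using uc by blast
   moreover have "y \<in> ?L" if y: "y \<in> U" for y
   proof -
    have "y \<oplus> 0 \<odot> u \<in> span U" using y Uc uc in_own_span[OF Uc] by auto
    then show ?thesis using y Uc by blast
   qed
   ultimately show ?thesis by blast
  qed
  ultimately have "span (insert u U) <= ?L" by (rule span_least[rotated])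
  then show ?thesis using insert.prems(3) that by blast
 qed
 show ?case
 proof (cases "N <= span U")
  case True
  then show ?thesis using T by (metis inf.absorb1)
 next
  case False
  \<comment> \<open>y has a nonzero component along u and serves as a pivot: a multiple of it clears
    u from any other element of \<open>N\<close>.\<close>
  then obtain y where y: "y \<in> N" "y ~: span U" by blast
  obtain c where c: "y \<oplus> c \<odot> u \<in> span U" using dec[OF y(1)] by blast
  have yc: "y \<in> carrier V" using y N by blast
  have c0: "c ~= 0" using c y(2) uc yc by auto
  have Ty: "insert y T <= carrier V" using T yc N by blast
  note sT = subD[OF span_sub[OF Ty]]
  have "N <= span (insert y T)"
  proof
   fix x assume x: "x \<in> N"
   obtain d where d: "x \<oplus> d \<odot> u \<in> span U" using dec[OF x] by blast
   have xc: "x \<in> carrier V" using x N by blast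
   define z where "z = x \<oplus> (- (d / c)) \<odot> y"
   have zN: "z \<in> N" unfolding z_def using N x y by blast
   have "(x \<oplus> d \<odot> u) \<oplus> (- (d / c)) \<odot> (y \<oplus> c \<odot> u) = z \<oplus> (d \<odot> u \<oplus> (- d) \<odot> u)"
    unfolding z_def using xc yc uc c0 by (simp add: add_s M.a_ac flip: s_mult)
   also have "d \<odot> u \<oplus> (- d) \<odot> u = \<zero>" using s_add[OF uc, of d "- d"] uc by simp
   finally have "z \<in> span U" using sU(3)[OF d sU(4)[OF c, of "- (d / c)"]] xc yc z_def by simp
   then have "z \<in> span T" using T(3) zN by blast
   then have "z \<in> span (insert y T)" using span_is_monotone[of T "insert y T"] by blast
   moreover have "x = z \<oplus> (d / c) \<odot> y"
   proof -
    have "z \<oplus> (d / c) \<odot> y = x \<oplus> ((- (d / c)) \<odot> y \<oplus> (d / c) \<odot> y)"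
     unfolding z_def using xc yc by (simp add: M.a_assoc)
    also have "(- (d / c)) \<odot> y \<oplus> (d / c) \<odot> y = \<zero>" using s_add[OF yc, of "- (d / c)" "d / c"] yc by simp
    finally show ?thesis using xc by simp
   qed
   moreover have "y \<in> span (insert y T)" using in_own_span[OF Ty] by blast
   ultimately show "x \<in> span (insert y T)" using sT(3,4) by blast
  qed
  moreover have "span (insert y T) <= N" by (rule span_least[OF _ insert.prems(2)]) (use T y in auto)
  ultimately show ?thesis using T y by (intro exI[of _ "insert y T"]) auto
 qed
qed

text \<open>By linearity, associativity of the action and its compatibility with degrees need only
  be checked on words.\<close>

lemma (in sklyanin) graded_moduleI:
 fixes M :: "('k, 'm, 'k elem_B) graded_rmodule"
 assumes wa: "word_algebra R r" and M: "gspace M"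
  and cl: "!!m b. m \<in> carrier M ==> b \<in> carrier B ==> act M m b \<in> carrier M"
  and add: "!!m m' b. m \<in> carrier M ==> m' \<in> carrier M ==> b \<in> carrier B ==> act M (m \<oplus>\<^bsub>M\<^esub> m') b = act M m b \<oplus>\<^bsub>M\<^esub> act M m' b"
  and add_r: "!!m a b. m \<in> carrier M ==> a \<in> carrier B ==> b \<in> carrier B ==> act M m (a \<oplus>\<^bsub>B\<^esub> b) = act M m a \<oplus>\<^bsub>M\<^esub> act M m b"
  and smult: "!!m b c. m \<in> carrier M ==> b \<in> carrier B ==> act M (c \<odot>\<^bsub>M\<^esub> m) b = c \<odot>\<^bsub>M\<^esub> act M m b"
  and smult_r: "!!m b c. m \<in> carrier M ==> b \<in> carrier B ==> act M m (c \<odot>\<^bsub>B\<^esub> b) = c \<odot>\<^bsub>M\<^esub> act M m b"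
  and Nil: "!!m. m \<in> carrier M ==> act M m (bw []) = m"
  and app: "!!m u v. m \<in> carrier M ==> act M (act M m (bw u)) (bw v) = r (word_deg u) (word_deg v) \<odot>\<^bsub>M\<^esub> act M m (bw (u @ v))"
  and pc: "!!m i w. m \<in> piece M i ==> act M m (bw w) \<in> piece M (i + length w)"
 shows "graded_module R M"
proof -
 interpret M: gspace M by (rule M)
 note wD = word_algebraD[OF wa]
 have z: "act M m \<zero>\<^bsub>B\<^esub> = \<zero>\<^bsub>M\<^esub>" if "m \<in> carrier M" for m
  using smult_r[OF that B.zero_closed, of 0] cl[OF that B.zero_closed] by simp
 have zl: "act M \<zero>\<^bsub>M\<^esub> b = \<zero>\<^bsub>M\<^esub>" if "b \<in> carrier B" for b
  using smult[OF M.M.zero_closed that, of 0] cl[OF M.M.zero_closed that] by simp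
 have zR: "a \<otimes>\<^bsub>R\<^esub> \<zero>\<^bsub>B\<^esub> = \<zero>\<^bsub>B\<^esub>" "\<zero>\<^bsub>B\<^esub> \<otimes>\<^bsub>R\<^esub> a = \<zero>\<^bsub>B\<^esub>" if "a \<in> carrier B" for a
  using wD(13)[OF that B.zero_closed, of 0] wD(12)[OF B.zero_closed that, of 0] wD(9)[OF that B.zero_closed] wD(9)[OF B.zero_closed that] by simp_all
 have w: "act M m (bw u \<otimes>\<^bsub>R\<^esub> b) = act M (act M m (bw u)) b" if m: "m \<in> carrier M" and b: "b \<in> carrier B" for m u b
  using b
 proof (induction rule: B_induct)
  case zero show ?case using m z zR(1) cl by simp
 next
  case (add b b') then show ?case using m cl by (simp add: wD(9,11) add_r)
 next
  case (smult c b) then show ?case using m cl by (simp add: wD(9,13) smult_r)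
 next
  case (bw v) show ?case using m by (simp add: wD(7) app smult_r)
 qed
 have mult: "act M m (a \<otimes>\<^bsub>R\<^esub> b) = act M (act M m a) b" if m: "m \<in> carrier M" and b: "b \<in> carrier B" and a: "a \<in> carrier B" for m a b
  using a
 proof (induction rule: B_induct)
  case zero show ?case using m b z zR(2) zl by simp
 next
  case (add a a') then show ?case using m b cl by (simp add: wD(9,10) add_r assms(4))
 next
  case (smult c a) then show ?case using m b cl by (simp add: wD(9,12) smult_r assms(6))
 qed (use w m b in simp)
 have pcr: "act M m b \<in> piece M (i + j)" if m: "m \<in> piece M i" and b: "b \<in> piece B j" for m b i j
  using b
 proof (induction rule: B_piece_induct)
  case zero show ?case using z M.pD(2) M.pD(5)[OF m] by simp
 next
  case (add a b) then show ?case using add_r M.pD(3) M.pD(5)[OF m] by simp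
 next
  case (smult c a) then show ?case using smult_r M.pD(4) M.pD(5)[OF m] by simp
 next
  case (bw v) then show ?case using pc[OF m, of v] by simp
 qed
 show ?thesis
  unfolding graded_module_def wD(1-6) bw_Nil[symmetric]
  using M cl add add_r smult smult_r Nil mult pcr by (simp add: gspace_iff)
qed

context gmod
begin

lemma sub_module_simps:
 "carrier (sub_module M N) = N" "add (sub_module M N) = add M" "zero (sub_module M N) = zero M"
 "module.smult (sub_module M N) = module.smult M" "act (sub_module M N) = act M"
 "piece (sub_module M N) n = piece M n Int N"
 by (simp_all add: sub_module_def)

lemma sub_module_kspace: "sub N ==> kspace (sub_module M N)"
 by (rule kspace_transfer[OF sub_kspace]) (simp_all add: sub_module_def)

lemma sub_of_sub_module:
 assumes "sub N"
 shows "submodule class_ring L (sub_module M N) \<longleftrightarrow> sub L & L <= N"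
proof -
 interpret N: kspace "sub_module M N" by (rule sub_module_kspace[OF assms])
 show ?thesis
 proof
  assume L: "submodule class_ring L (sub_module M N)"
  note L = N.subD[OF L, unfolded sub_module_simps]
  show "sub L & L <= N"
  proof
   show "sub L" by (rule subI) (use L subD(1)[OF assms] in auto)
  qed (rule L(1))
 next
  assume L: "sub L & L <= N"
  then have "sub L" ..
  note s = subD[OF this]
  show "submodule class_ring L (sub_module M N)"
   by (rule N.subI, unfold sub_module_simps) (use L s(2-4) in auto)
 qed
qed

lemma graded_submoduleD:
 assumes "graded_submodule R M N"
 shows "sub N" "m \<in> N ==> m \<cdot> i \<in> N" "m \<in> N ==> comp n m \<in> N" "m \<in> N ==> b \<in> carrier B ==> act M m b \<in> N"
  "right_submodule R M N"
proof -
 show r: "right_submodule R M N" using assms by (simp add: graded_submodule_def)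
 show "m \<in> N ==> b \<in> carrier B ==> act M m b \<in> N" by (rule right_submoduleD(2)[OF r])
 show "sub N" "m \<in> N ==> m \<cdot> i \<in> N" "m \<in> N ==> comp n m \<in> N"
  using assms unfolding graded_submodule_iff by auto
qed

lemma sub_module_gmod:
 assumes N: "graded_submodule R M N"
 shows "gmod \<alpha> \<beta> \<gamma> R r (sub_module M N)"
proof -
 note gs = graded_submoduleD[OF N]
 interpret N: kspace "sub_module M N" by (rule sub_module_kspace[OF gs(1)])
 have Nc: "x \<in> N ==> x \<in> carrier M" for x using subD(5)[OF gs(1)] .
 have "gspace (sub_module M N)"
 proof (rule gspaceI[of _ comp, OF N.kspace_axioms], unfold sub_module_simps sub_of_sub_module[OF gs(1)])
  show "sub (piece M n Int N) & piece M n Int N <= N" for n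
   by (auto intro!: subI simp: pD subD[OF gs(1)])
  show "!!v w. v \<in> N ==> w \<in> N ==> (!!n. comp n v = comp n w) ==> v = w" using eq_by_comps Nc by blast
  show "!!n m v. v \<in> piece M m Int N ==> comp n v = (if n = m then v else \<zero>\<^bsub>M\<^esub>)" using comp_homog by simp
 qed (use comp_bound comp_add Nc gs(3) comp_piece in auto)
 then have "graded_module R (sub_module M N)"
  by (rule graded_moduleI[OF wa], unfold sub_module_simps)
   (auto simp: Nc gs(4) act_add act_add_r act_smult act_smult_r act_bw intro: act_bw_piece)
 then show ?thesis using wa by (unfold_locales) auto
qed

text \<open>The finitely many pieces up to degree n1 lie in finite-dimensional pieces of M, so
  finite generating sets exist there; the later pieces follow by hypothesis. This criterion takes
  the place of a noetherian argument for the kernel.\<close>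

lemma fin_gen_sub:
 assumes fg: "finitely_generated R M" and K: "graded_submodule R M K"
  and gen: "!!n. n >= n1 ==> piece M (Suc n) Int K <= span (next_gens (piece M n Int K))"
 shows "finitely_generated R (sub_module M K)"
proof -
 note gs = graded_submoduleD[OF K]
 obtain U n0 where U: "!!n. finite (U n)" "!!n. U n <= piece M n" "!!n. piece M n = span (U n)"
  using fin_gen_pieces[OF fg] by metis
 have "EX T. finite T & T <= piece M n Int K & piece M n Int K = span T" for n
 proof (rule sub_fin_span[OF U(1)])
  show "U n <= carrier M" using U(2) pD(1) by blast
  show "sub (piece M n Int K)" by (auto intro!: subI simp: pD subD[OF gs(1)])
 qed (use U(3) in blast)
 then obtain T where T: "!!n. finite (T n)" "!!n. T n <= piece M n Int K" "!!n. piece M n Int K = span (T n)" by metis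
 have "generates R (sub_module M K) (\<Union>n\<le>n1. T n)"
  unfolding generates_def sub_module_simps
 proof (intro conjI allI impI)
  show "(\<Union>n\<le>n1. T n) <= K" using T(2) by blast
  fix L assume "right_submodule R (sub_module M K) L & (\<Union>n\<le>n1. T n) <= L"
  then have L: "sub L" "L <= K" "!!m i. m \<in> L ==> m \<cdot> i \<in> L" and TL: "!!n. n <= n1 ==> T n <= L"
   by (auto simp: right_submodule_def sub_module_simps sub_of_sub_module[OF gs(1)] word_algebraD(1)[OF wa])
  have pc: "piece M n Int K <= L" for n
  proof (induction n)
   case 0 then show ?case using span_least[OF TL L(1), of 0] T(3) by simp
  next
   case (Suc n)
   show ?case
   proof (cases "Suc n <= n1")
    case True then show ?thesis using span_least[OF TL L(1), of "Suc n"] T(3) by simp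
   next
    case False
    have "next_gens (piece M n Int K) <= L" using Suc L(3) by (auto simp: next_gens_def)
    then show ?thesis using span_least[OF _ L(1)] gen[of n] False by (meson not_less_eq_eq subset_trans nat_le_linear)
   qed
  qed
  have "K <= L"
  proof
   fix x assume x: "x \<in> K"
   have xc: "x \<in> carrier M" using subD(5)[OF gs(1) x] .
   show "x \<in> L" using comps_in[OF xc L(1)] pc gs(3)[OF x] comp_piece[OF xc] by blast
  qed
  then show "L = K" using L(2) by blast
 qed
 then show ?thesis unfolding finitely_generated_def using T(1) by blast
qed

text \<open>The pieces of a finitely generated module are finite dimensional, so for a graded
  submodule vanishing in large degrees already bounds the dimension.\<close>

lemma finite_subI:
 assumes fg: "finitely_generated R M" and K: "graded_submodule R M K"
  and n0: "!!n. n >= n0 ==> piece M n Int K <= {\<zero>\<^bsub>M\<^esub>}"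
 shows "finite_sub R M K"
proof -
 note gs = graded_submoduleD[OF K]
 obtain U n0' where U: "!!n. finite (U n)" "!!n. U n <= piece M n" "!!n. piece M n = span (U n)"
  using fin_gen_pieces[OF fg] by metis
 let ?U = "\<Union>n<n0. U n"
 have Uc: "?U <= carrier M" using U(2) pD(1) by blast
 have "K <= span ?U"
 proof
  fix x assume x: "x \<in> K"
  have xc: "x \<in> carrier M" using subD(5)[OF gs(1) x] .
  show "x \<in> span ?U"
  proof (rule comps_in[OF xc span_sub[OF Uc]])
   fix n
   show "comp n x \<in> span ?U"
   proof (cases "n < n0")
    case True
    then have "span (U n) <= span ?U" by (intro span_is_monotone) auto
    then show ?thesis using U(3) comp_piece[OF xc] by blast
   next
    case False
    then have "comp n x = \<zero>\<^bsub>M\<^esub>" using n0[of n] gs(3)[OF x] comp_piece[OF xc] by fastforce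
    then show ?thesis using subD(2)[OF span_sub[OF Uc]] by simp
   qed
  qed
 qed
 then obtain T where T: "finite T" "T <= K" "K = span T" using sub_fin_span[OF _ Uc gs(1)] U(1) by blast
 interpret K: kspace "sub_module M K" by (rule sub_module_kspace[OF gs(1)])
 have "Defs.fin_dim (sub_module M K)"
  unfolding K.fin_dim_iff sub_module_simps sub_of_sub_module[OF gs(1)]
 proof (intro exI[of _ T] conjI T(1,2) allI impI)
  show "K <= L" if "(sub L & L <= K) & T <= L" for L
   using that by (subst T(3)) (simp add: span_least)
 qed
 then show ?thesis using K by (simp add: finite_sub_def)
qed

lemma finite_subD:
 assumes "finite_sub R M K"
 shows "graded_submodule R M K" "EX n0. \<forall>n\<ge>n0. piece M n Int K <= {\<zero>\<^bsub>M\<^esub>}"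
proof -
 show K: "graded_submodule R M K" using assms by (simp add: finite_sub_def)
 note gs = graded_submoduleD[OF K]
 interpret K: kspace "sub_module M K" by (rule sub_module_kspace[OF gs(1)])
 have "Defs.fin_dim (sub_module M K)" using assms by (simp add: finite_sub_def)
 then obtain S where S: "finite S" "S <= K" "ALL L. (sub L & L <= K) & S <= L --> K <= L"
  unfolding K.fin_dim_iff sub_module_simps sub_of_sub_module[OF gs(1)] by blast
 have "S <= carrier M" using S(2) subD(1)[OF gs(1)] by (rule subset_trans)
 then obtain n0 where n0: "!!s n. s \<in> S ==> n >= n0 ==> comp n s = \<zero>\<^bsub>M\<^esub>"
  by (rule comp_bound_finite[OF S(1)]) blast
 let ?L = "{x \<in> K. \<forall>n\<ge>n0. comp n x = \<zero>\<^bsub>M\<^esub>}"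
 have "sub ?L" by (rule subI) (use subD[OF gs(1)] in \<open>auto simp: comp_add comp_smult\<close>)
 moreover have "S <= ?L" using S(2) n0 by blast
 ultimately have "K <= ?L" using S(3)[rule_format, of ?L] by simp
 then have KL: "comp n x = \<zero>\<^bsub>M\<^esub>" if "n >= n0" "x \<in> K" for n x using that by blast
 have "piece M n Int K <= {\<zero>\<^bsub>M\<^esub>}" if n: "n >= n0" for n
 proof
  fix x assume "x \<in> piece M n Int K"
  then show "x \<in> {\<zero>\<^bsub>M\<^esub>}" using KL[OF n, of x] comp_homog[of x n n] by simp
 qed
 then show "EX n0. \<forall>n\<ge>n0. piece M n Int K <= {\<zero>\<^bsub>M\<^esub>}" by blast
qed

end

section \<open>Quotients of graded modules\<close>

context gmod
begin

lemma abelian_subgroup_sub: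
 assumes "sub N"
 shows "abelian_subgroup N M"
proof (rule abelian_subgroupI3[OF additive_subgroup.intro M.abelian_group_axioms])
 show "subgroup N (add_monoid M)"
  using subD[OF assms] by (intro M.add.subgroupI) (simp_all flip: a_inv_def, blast+)
qed

context
 fixes N assumes N: "sub N"
begin

interpretation N: abelian_subgroup N M by (rule abelian_subgroup_sub[OF N])

abbreviation "coset \<equiv> a_r_coset M N"

lemma coset_eq: "x \<in> carrier M ==> y \<in> carrier M ==> coset x = coset y \<longleftrightarrow> x \<oplus>\<^bsub>M\<^esub> (- 1) \<odot>\<^bsub>M\<^esub> y \<in> N"
proof
 assume xy: "x \<in> carrier M" "y \<in> carrier M"
 show "coset x = coset y ==> x \<oplus>\<^bsub>M\<^esub> (- 1) \<odot>\<^bsub>M\<^esub> y \<in> N"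
 proof -
  assume "coset x = coset y"
  then have "x \<in> coset y" using N.a_rcos_self[OF xy(1)] by simp
  then obtain n where n: "n \<in> N" "x = n \<oplus>\<^bsub>M\<^esub> y" by (auto simp: a_r_coset_def')
  have "y \<oplus>\<^bsub>M\<^esub> (- 1) \<odot>\<^bsub>M\<^esub> y = \<zero>\<^bsub>M\<^esub>" using diff_zero xy by blast
  then show ?thesis using n xy subD(5)[OF N] by (simp add: M.a_assoc)
 qed
 assume *: "x \<oplus>\<^bsub>M\<^esub> (- 1) \<odot>\<^bsub>M\<^esub> y \<in> N"
 have "(- 1) \<odot>\<^bsub>M\<^esub> y \<oplus>\<^bsub>M\<^esub> y = \<zero>\<^bsub>M\<^esub>" using diff_zero[OF xy(2) xy(2)] xy M.a_comm by simp
 then have "x = (x \<oplus>\<^bsub>M\<^esub> (- 1) \<odot>\<^bsub>M\<^esub> y) \<oplus>\<^bsub>M\<^esub> y" using xy by (simp add: M.a_assoc)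
 then have "x \<in> coset y" using * by (auto simp: a_r_coset_def')
 then show "coset x = coset y" using N.a_repr_independence'[of x y] xy by simp
qed

lemma coset_self: "x \<in> carrier M ==> x \<in> coset x"
 by (rule N.a_rcos_self)

lemma mem_coset:
 assumes x: "x \<in> carrier M"
 shows "y \<in> coset x \<longleftrightarrow> y \<in> carrier M & coset y = coset x"
proof
 assume y: "y \<in> coset x"
 show "y \<in> carrier M & coset y = coset x"
  using N.a_repr_independence'[OF y x] N.a_elemrcos_carrier[OF x y] by simp
next
 assume "y \<in> carrier M & coset y = coset x"
 then show "y \<in> coset x" using coset_self[of y] by simp
qed

lemma coset_zero: "x \<in> N ==> coset x = N"
 by (rule N.a_rcos_const)

text \<open>The operations of \<open>quot_module\<close> are unions over a coset; an operation that
  respects congruence contributes the same coset each time.\<close>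

lemma coset_cong:
 assumes x: "x \<in> carrier M" and f: "!!z. z \<in> carrier M ==> coset z = coset x ==> coset (f z) = coset (f x)"
 shows "(\<Union>z\<in>coset x. coset (f z)) = coset (f x)"
proof -
 have "coset (f z) = coset (f x)" if "z \<in> coset x" for z using f mem_coset[OF x] that by blast
 then show ?thesis using coset_self[OF x] by blast
qed

lemma quot_carrier: "carrier (quot_module M N) = coset ` carrier M"
 and quot_zero: "zero (quot_module M N) = N"
 and quot_add: "x \<in> carrier M ==> y \<in> carrier M ==> coset x \<oplus>\<^bsub>quot_module M N\<^esub> coset y = coset (x \<oplus>\<^bsub>M\<^esub> y)"
 and quot_piece: "piece (quot_module M N) n = coset ` piece M n"
 by (auto simp: quot_module_def A_RCOSETS_def' N.a_rcos_sum)

lemma quot_smult: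
 assumes x: "x \<in> carrier M"
 shows "c \<odot>\<^bsub>quot_module M N\<^esub> coset x = coset (c \<odot>\<^bsub>M\<^esub> x)"
proof -
 have "coset (c \<odot>\<^bsub>M\<^esub> z) = coset (c \<odot>\<^bsub>M\<^esub> x)" if z: "z \<in> carrier M" "coset z = coset x" for z
 proof -
  have "c \<odot>\<^bsub>M\<^esub> (z \<oplus>\<^bsub>M\<^esub> (- 1) \<odot>\<^bsub>M\<^esub> x) = c \<odot>\<^bsub>M\<^esub> z \<oplus>\<^bsub>M\<^esub> (- 1) \<odot>\<^bsub>M\<^esub> (c \<odot>\<^bsub>M\<^esub> x)"
   using x z by (simp add: add_s flip: s_mult)
  moreover have "z \<oplus>\<^bsub>M\<^esub> (- 1) \<odot>\<^bsub>M\<^esub> x \<in> N" using coset_eq[OF z(1) x] z(2) by simp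
  ultimately show ?thesis using coset_eq[OF sc[OF z(1)] sc[OF x]] subD(4)[OF N] by metis
 qed
 then show ?thesis using coset_cong[OF x, of "%z. c \<odot>\<^bsub>M\<^esub> z"] by (simp add: quot_module_def)
qed

lemma quot_kspace: "kspace (quot_module M N)"
proof (rule kspaceI)
 show "abelian_group (quot_module M N)"
 proof (rule abelian_groupI)
  show "\<zero>\<^bsub>quot_module M N\<^esub> \<in> carrier (quot_module M N)"
   unfolding quot_carrier quot_zero using coset_zero[OF subD(2)[OF N]] by (metis M.zero_closed imageI)
  fix X assume "X \<in> carrier (quot_module M N)"
  then obtain x where x: "x \<in> carrier M" "X = coset x" unfolding quot_carrier by blast
  have N0: "coset \<zero>\<^bsub>M\<^esub> = N" by (rule coset_zero[OF subD(2)[OF N]])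
  show "\<zero>\<^bsub>quot_module M N\<^esub> \<oplus>\<^bsub>quot_module M N\<^esub> X = X"
   unfolding quot_zero x(2) using quot_add[of "\<zero>\<^bsub>M\<^esub>" x] x(1) N0 by simp
  show "\<exists>Y\<in>carrier (quot_module M N). Y \<oplus>\<^bsub>quot_module M N\<^esub> X = \<zero>\<^bsub>quot_module M N\<^esub>"
   unfolding quot_zero x(2) quot_carrier using quot_add[of "\<ominus>\<^bsub>M\<^esub> x" x] x(1) N0 by (auto simp: M.l_neg)
 qed (auto simp: quot_carrier quot_add M.a_ac)
qed (auto simp: quot_carrier quot_smult quot_add s_add add_s s_mult)

lemma quot_fin_dim:
 "Defs.fin_dim (quot_module M N) \<longleftrightarrow> (EX S. finite S & S <= carrier M & (ALL L. sub L & N <= L & S <= L --> carrier M <= L))"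
proof -
 interpret Q: kspace "quot_module M N" by (rule quot_kspace)
 have Nc: "N <= carrier M" using subD(1)[OF N] .
 have pre: "sub {x \<in> carrier M. coset x \<in> L} & N <= {x \<in> carrier M. coset x \<in> L}" if L: "submodule class_ring L (quot_module M N)" for L
 proof -
  note Q = Q.subD(2-4)[OF L]
  have "N \<in> L" using Q(1) by (simp add: quot_zero)
  then show ?thesis using Nc coset_zero Q(2,3) subD(2)[OF N]
   by (intro conjI subI) (auto simp: quot_add[symmetric] quot_smult[symmetric])
 qed
 have post: "submodule class_ring (coset ` L) (quot_module M N)" if L: "sub L" "N <= L" for L
 proof (rule Q.subI)
  show "\<zero>\<^bsub>quot_module M N\<^esub> \<in> coset ` L" unfolding quot_zero using coset_zero[OF subD(2)[OF N]] subD(2)[OF L(1)] by (metis imageI)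
 qed (use subD[OF L(1)] in \<open>auto simp: quot_carrier quot_add quot_smult\<close>)
 show ?thesis
  unfolding Q.fin_dim_iff
 proof safe
  fix S assume S: "finite S" "S <= carrier (quot_module M N)"
   and gen: "ALL L. submodule class_ring L (quot_module M N) & S <= L --> carrier (quot_module M N) <= L"
  obtain T where T: "T <= carrier M" "finite T" "S = coset ` T"
   using finite_subset_image[OF S(1), of coset "carrier M"] S(2) by (auto simp: quot_carrier)
  have "carrier M <= L" if L: "sub L" "N <= L" "T <= L" for L
  proof
   fix x assume x: "x \<in> carrier M"
   have "coset x \<in> coset ` L" using gen post[OF L(1,2)] L(3) T(3) x by (auto simp: quot_carrier)
   then obtain l where l: "l \<in> L" "coset x = coset l" by blast
   then have "x \<oplus>\<^bsub>M\<^esub> (- 1) \<odot>\<^bsub>M\<^esub> l \<in> L" using coset_eq[OF x] subD(5)[OF L(1)] L(2) by blast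
   then have "(x \<oplus>\<^bsub>M\<^esub> (- 1) \<odot>\<^bsub>M\<^esub> l) \<oplus>\<^bsub>M\<^esub> l \<in> L" using l subD(3)[OF L(1)] by blast
   moreover have "(- 1) \<odot>\<^bsub>M\<^esub> l \<oplus>\<^bsub>M\<^esub> l = \<zero>\<^bsub>M\<^esub>"
    using diff_zero[of l l] subD(5)[OF L(1) l(1)] M.a_comm by simp
   ultimately show "x \<in> L" using x subD(5)[OF L(1) l(1)] by (simp add: M.a_assoc)
  qed
  then show "EX S. finite S & S <= carrier M & (ALL L. sub L & N <= L & S <= L --> carrier M <= L)"
   using T(1,2) by (intro exI[of _ T]) simp
 next
  fix S assume S: "finite S" "S <= carrier M" and gen: "ALL L. sub L & N <= L & S <= L --> carrier M <= L"
  have "carrier (quot_module M N) <= L" if L: "submodule class_ring L (quot_module M N)" "coset ` S <= L" for L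
  proof -
   have "carrier M <= {x \<in> carrier M. coset x \<in> L}"
    using gen[rule_format, of "{x \<in> carrier M. coset x \<in> L}"] pre[OF L(1)] L(2) S(2) by blast
   then show ?thesis by (auto simp: quot_carrier)
  qed
  then show "EX S. finite S & S <= carrier (quot_module M N) &
    (ALL L. submodule class_ring L (quot_module M N) & S <= L --> carrier (quot_module M N) <= L)"
   using S by (intro exI[of _ "coset ` S"]) (auto simp: quot_carrier)
 qed
qed

lemma quot_act:
 assumes x: "x \<in> carrier M" and b: "b \<in> carrier B" and stable: "!!n. n \<in> N ==> act M n b \<in> N"
 shows "act (quot_module M N) (coset x) b = coset (act M x b)"
proof -
 have "coset (act M z b) = coset (act M x b)" if z: "z \<in> carrier M" "coset z = coset x" for z
 proof -
  have "act M (z \<oplus>\<^bsub>M\<^esub> (- 1) \<odot>\<^bsub>M\<^esub> x) b = act M z b \<oplus>\<^bsub>M\<^esub> (- 1) \<odot>\<^bsub>M\<^esub> act M x b"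
   using x z b by (simp add: act_add act_smult)
  moreover have "z \<oplus>\<^bsub>M\<^esub> (- 1) \<odot>\<^bsub>M\<^esub> x \<in> N" using coset_eq[OF z(1) x] z(2) by simp
  ultimately have "act M z b \<oplus>\<^bsub>M\<^esub> (- 1) \<odot>\<^bsub>M\<^esub> act M x b \<in> N" using stable by metis
  then show ?thesis using coset_eq x z b by simp
 qed
 then show ?thesis using coset_cong[OF x, of "%z. act M z b"] by (simp add: quot_module_def)
qed

end

text \<open>Finitely many representatives of the quotient have components in finitely many degrees
  only. With \<open>cofinite_subI\<close>, finite codimension becomes a condition on tails.\<close>

lemma cofinite_subD:
 assumes "cofinite_sub R M N"
 shows "graded_submodule R M N" "EX n0. \<forall>n\<ge>n0. piece M n <= N"
proof -
 show N: "graded_submodule R M N" using assms by (simp add: cofinite_sub_def)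
 note gs = graded_submoduleD[OF N]
 have "Defs.fin_dim (quot_module M N)" using assms by (simp add: cofinite_sub_def)
 then obtain S where S: "finite S" "S <= carrier M" "ALL L. sub L & N <= L & S <= L --> carrier M <= L"
  unfolding quot_fin_dim[OF gs(1)] by blast
 obtain n0 where n0: "!!s n. s \<in> S ==> n >= n0 ==> comp n s = \<zero>\<^bsub>M\<^esub>"
  by (rule comp_bound_finite[OF S(1,2)]) blast
 let ?L = "{x \<in> carrier M. \<forall>n\<ge>n0. comp n x \<in> N}"
 have "carrier M <= ?L"
 proof (rule S(3)[rule_format], intro conjI)
  show "sub ?L" by (rule subI) (use subD[OF gs(1)] in \<open>auto simp: comp_add comp_smult\<close>)
  show "N <= ?L" using gs(3) subD(5)[OF gs(1)] by blast
  show "S <= ?L" using S(2) n0 subD(2)[OF gs(1)] by auto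
 qed
 then have inN: "comp n x \<in> N" if "n >= n0" "x \<in> carrier M" for n x using that by blast
 have "piece M n <= N" if n: "n >= n0" for n
 proof
  fix x assume "x \<in> piece M n"
  then show "x \<in> N" using inN[OF n pD(5)] comp_homog[of x n n] by metis
 qed
 then show "EX n0. \<forall>n\<ge>n0. piece M n <= N" by blast
qed

lemma cofinite_subI:
 assumes fg: "finitely_generated R M" and N: "graded_submodule R M N" and n0: "!!n. n >= n0 ==> piece M n <= N"
 shows "cofinite_sub R M N"
proof -
 note gs = graded_submoduleD[OF N]
 obtain U n1 where U: "!!n. finite (U n)" "!!n. U n <= piece M n" "!!n. piece M n = span (U n)"
  using fin_gen_pieces[OF fg] by metis
 have "carrier M <= L" if L: "sub L" "N <= L" "(\<Union>n<n0. U n) <= L" for L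
 proof
  fix x assume x: "x \<in> carrier M"
  show "x \<in> L"
  proof (rule comps_in[OF x L(1)])
   fix n
   show "comp n x \<in> L"
   proof (cases "n < n0")
    case True
    then have "span (U n) <= L" using L by (intro span_least) auto
    then show ?thesis using U(3) comp_piece[OF x] by blast
   next
    case False
    then show ?thesis using n0[of n] comp_piece[OF x] L(2) by fastforce
   qed
  qed
 qed
 then have "Defs.fin_dim (quot_module M N)"
  unfolding quot_fin_dim[OF gs(1)] 
 proof (intro exI[of _ "\<Union>n<n0. U n"] conjI allI impI)
  show "finite (\<Union>n<n0. U n)" using U(1) by simp
  show "(\<Union>n<n0. U n) <= carrier M" using U(2) pD(1) by blast
 qed simp
 then show ?thesis using N by (simp add: cofinite_sub_def)
qed

end

section \<open>Row vectors over a graded module\<close>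

context sklyanin
begin

definition tm :: "'k => gen => gen => 'k elem_B => 'k elem_B" where
 "tm e i j b = GC b (kd i) \<oplus>\<^bsub>B\<^esub> e \<odot>\<^bsub>B\<^esub> GC b (kd j)"

lemma tm_closed [simp, intro]: "b \<in> carrier B ==> tm e i j b \<in> carrier B"
 by (simp add: tm_def del: kd.simps)

lemma tm_add: "a \<in> carrier B ==> b \<in> carrier B ==> tm e i j (a \<oplus>\<^bsub>B\<^esub> b) = tm e i j a \<oplus>\<^bsub>B\<^esub> tm e i j b"
 by (simp add: tm_def GC_add B.smult_r_distr B.a_ac del: kd.simps)

lemma tm_smult: "b \<in> carrier B ==> tm e i j (c \<odot>\<^bsub>B\<^esub> b) = c \<odot>\<^bsub>B\<^esub> tm e i j b"
 by (simp add: tm_def GC_smult B.smult_r_distr mult.commute del: kd.simps flip: B.smult_smult)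

lemma tm_bw: "i ~= j ==> tm e i j (bw v) = (if word_deg v = i then bw v else if word_deg v = j then e \<odot>\<^bsub>B\<^esub> bw v else \<zero>\<^bsub>B\<^esub>)"
 by (auto simp: tm_def GC_bw simp del: kd.simps)

lemma twist_matrix_tm:
 assumes "b \<in> carrier B"
 shows "twist_matrix \<alpha> \<beta> \<gamma> b = ((tm 1 X0 X1 b, tm (- 1) X2 X3 b), (tm 1 X2 X3 b, tm (- 1) X0 X1 b))"
 using assms by (simp add: twist_matrix_def tm_def Let_def B.smult_one B.minus_smult a_minus_def)

end

context gmod
begin

abbreviation "RM \<equiv> row_module \<alpha> \<beta> \<gamma> M"

lemma row_simps:
 "carrier RM = carrier M \<times> carrier M" "zero RM = (\<zero>\<^bsub>M\<^esub>, \<zero>\<^bsub>M\<^esub>)" "piece RM n = piece M n \<times> piece M n"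
 "(a, b) \<oplus>\<^bsub>RM\<^esub> (c, d) = (a \<oplus>\<^bsub>M\<^esub> c, b \<oplus>\<^bsub>M\<^esub> d)" "e \<odot>\<^bsub>RM\<^esub> (a, b) = (e \<odot>\<^bsub>M\<^esub> a, e \<odot>\<^bsub>M\<^esub> b)"
 by (simp_all add: row_module_def direct_sum_def)

lemma row_act:
 assumes "b \<in> carrier B"
 shows "act RM (m, m') b = (act M m (tm 1 X0 X1 b) \<oplus>\<^bsub>M\<^esub> act M m' (tm 1 X2 X3 b),
  act M m (tm (- 1) X2 X3 b) \<oplus>\<^bsub>M\<^esub> act M m' (tm (- 1) X0 X1 b))"
 using assms by (simp add: row_module_def twist_matrix_tm)

text \<open>The action on row vectors of the four scalar matrices in the embedding of the twist into
  the matrices over B. They form a projective representation of the Klein group with cocycle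
  \<open>mu\<close>.\<close>

fun rowP :: "gen => 'm \<times> 'm => 'm \<times> 'm" where
 "rowP X0 (a, b) = (a, b)" | "rowP X1 (a, b) = (a, (- 1) \<odot>\<^bsub>M\<^esub> b)"
| "rowP X2 (a, b) = (b, a)" | "rowP X3 (a, b) = (b, (- 1) \<odot>\<^bsub>M\<^esub> a)"

lemma row_act_bw:
 assumes "m \<in> carrier M" "m' \<in> carrier M"
 shows "act RM (m, m') (bw v) = rowP (word_deg v) (act M m (bw v), act M m' (bw v))"
 using assms by (cases "word_deg v") (simp_all add: row_act tm_bw act_smult_r)

lemma rowP_mult:
 assumes "a \<in> carrier M" "b \<in> carrier M"
 shows "rowP h (rowP g (a, b)) = mu g h \<odot>\<^bsub>RM\<^esub> rowP (g \<boxplus> h) (a, b)"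
 using assms by (cases g; cases h) (simp_all add: mu_eval row_simps flip: s_mult)

lemma rowP_act:
 assumes "a \<in> carrier M" "b \<in> carrier M" "rowP g (a, b) = (c, d)" "x \<in> carrier B"
 shows "(act M c x, act M d x) = rowP g (act M a x, act M b x)" "c \<in> carrier M" "d \<in> carrier M"
 using assms by (cases g; auto simp: act_smult)+

lemma rowP_smult:
 assumes "a \<in> carrier M" "b \<in> carrier M"
 shows "rowP g (e \<odot>\<^bsub>M\<^esub> a, e \<odot>\<^bsub>M\<^esub> b) = e \<odot>\<^bsub>RM\<^esub> rowP g (a, b)"
 using assms by (cases g) (simp_all add: row_simps mult.commute flip: s_mult)

lemma rowP_piece:
 assumes "a \<in> piece M n" "b \<in> piece M n"
 shows "rowP g (a, b) \<in> piece M n \<times> piece M n"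
 using assms pD(4) by (cases g) auto

lemma row_kspace: "kspace RM"
 by (rule kspace_transfer[of "direct_sum M M"])
  (simp_all add: kspace_def direct_sum_is_vs vectorspace_axioms row_module_def)

lemma row_gspace: "gspace RM"
proof -
 interpret K: kspace RM by (rule row_kspace)
 show ?thesis
 proof (rule gspaceI[of _ "%n (a, b). (comp n a, comp n b)", OF row_kspace], unfold row_simps)
  show "submodule class_ring (piece M n \<times> piece M n) RM" for n
   by (rule K.subI) (auto simp: row_simps pD)
  show "EX K. \<forall>n\<ge>K. (case v of (a, b) => (comp n a, comp n b)) = (\<zero>\<^bsub>M\<^esub>, \<zero>\<^bsub>M\<^esub>)" if "v \<in> carrier M \<times> carrier M" for v
  proof -
   obtain a b where v: "v = (a, b)" "a \<in> carrier M" "b \<in> carrier M"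
    using \<open>v \<in> carrier M \<times> carrier M\<close> by blast
   obtain K L where "\<forall>n\<ge>K. comp n a = \<zero>\<^bsub>M\<^esub>" "\<forall>n\<ge>L. comp n b = \<zero>\<^bsub>M\<^esub>" using comp_bound v by metis
   then show ?thesis using v by (intro exI[of _ "max K L"]) simp
  qed
  show "v = w" if "v \<in> carrier M \<times> carrier M" "w \<in> carrier M \<times> carrier M"
   "!!n. (case v of (a, b) => (comp n a, comp n b)) = (case w of (a, b) => (comp n a, comp n b))" for v w
   using that eq_by_comps[of "fst v" "fst w"] eq_by_comps[of "snd v" "snd w"]
   by (cases v; cases w) simp
 qed (auto simp: row_simps comp_piece comp_add comp_homog)
qed

text \<open>Row vectors change the factor r by \<open>mu\<close>. So they lead from B to the twist,
  and from the twist back to B, where the two factors \<open>mu\<close> cancel.\<close>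

lemma row_gmod:
 assumes S: "word_algebra S s" and s: "!!i j. s i j = mu i j * r i j"
 shows "gmod \<alpha> \<beta> \<gamma> S s RM"
proof -
 have "graded_module S RM"
 proof (rule graded_moduleI[OF S row_gspace], unfold row_simps(1-3))
  fix m assume "m \<in> carrier M \<times> carrier M"
  then obtain a b where m: "m = (a, b)" "a \<in> carrier M" "b \<in> carrier M" by blast
  show "act RM m (bw []) = m" using m by (simp add: row_act_bw)
  show "act RM m x \<in> carrier M \<times> carrier M" if "x \<in> carrier B" for x
   using m that by (simp add: row_act)
  show "act RM m (x \<oplus>\<^bsub>B\<^esub> y) = act RM m x \<oplus>\<^bsub>RM\<^esub> act RM m y" if "x \<in> carrier B" "y \<in> carrier B" for x y
   using m that by (simp add: row_act row_simps tm_add act_add_r M.a_ac)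
  show "act RM (c \<odot>\<^bsub>RM\<^esub> m) x = c \<odot>\<^bsub>RM\<^esub> act RM m x" if "x \<in> carrier B" for x c
   using m that by (simp add: row_act row_simps act_smult add_s)
  show "act RM m (c \<odot>\<^bsub>B\<^esub> x) = c \<odot>\<^bsub>RM\<^esub> act RM m x" if "x \<in> carrier B" for x c
   using m that by (simp add: row_act row_simps tm_smult act_smult_r add_s)
  show "act RM (m \<oplus>\<^bsub>RM\<^esub> m') x = act RM m x \<oplus>\<^bsub>RM\<^esub> act RM m' x" if "m' \<in> carrier M \<times> carrier M" "x \<in> carrier B" for m' x
   using m that by (cases m') (simp add: row_act row_simps act_add M.a_ac)
  fix u v
  obtain c d where cd: "rowP (word_deg u) (act M a (bw u), act M b (bw u)) = (c, d)" by (cases "rowP (word_deg u) (act M a (bw u), act M b (bw u))")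
  note c = rowP_act[OF act_closed[OF m(2) bw_carrier] act_closed[OF m(3) bw_carrier] cd bw_carrier]
  have "act RM (act RM m (bw u)) (bw v) = rowP (word_deg v) (act M c (bw v), act M d (bw v))"
   using m c(2,3) cd by (simp add: row_act_bw)
  also have "... = rowP (word_deg v) (rowP (word_deg u) (act M (act M a (bw u)) (bw v), act M (act M b (bw u)) (bw v)))"
   by (simp only: c(1))
  also have "... = mu (word_deg u) (word_deg v) \<odot>\<^bsub>RM\<^esub> rowP (word_deg u \<boxplus> word_deg v) (act M (act M a (bw u)) (bw v), act M (act M b (bw u)) (bw v))"
   using m by (intro rowP_mult) auto
  also have "... = mu (word_deg u) (word_deg v) \<odot>\<^bsub>RM\<^esub> (r (word_deg u) (word_deg v) \<odot>\<^bsub>RM\<^esub> act RM m (bw (u @ v)))"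
   using m by (simp add: act_bw rowP_smult row_act_bw word_deg_append)
  also have "... = s (word_deg u) (word_deg v) \<odot>\<^bsub>RM\<^esub> act RM m (bw (u @ v))"
   using kspace.s_mult[OF row_kspace, of "act RM m (bw (u @ v))"] m by (simp add: s row_simps(1) row_act)
  finally show "act RM (act RM m (bw u)) (bw v) = s (word_deg u) (word_deg v) \<odot>\<^bsub>RM\<^esub> act RM m (bw (u @ v))" .
 next
  fix m i w assume "m \<in> piece M i \<times> piece M i"
  then obtain a b where m: "m = (a, b)" "a \<in> piece M i" "b \<in> piece M i" by blast
  then show "act RM m (bw w) \<in> piece M (i + length w) \<times> piece M (i + length w)"
   using rowP_piece[OF act_bw_piece[OF m(2)] act_bw_piece[OF m(3)]] pD(5) by (simp add: row_act_bw)
 qed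
 then show ?thesis using S sklyanin_axioms by (simp add: gmod_def gmod_axioms_def)
qed

end

section \<open>Point modules\<close>

context sklyanin
begin

lemma pB_sum:
 assumes "finite S"
 shows "pB (%w. \<Sum>i\<in>S. c i * mono (f i) w) = finsum B (%i. c i \<odot>\<^bsub>B\<^esub> bw (f i)) S"
 using assms
proof (induction S)
 case empty show ?case using pB_zero by simp
next
 case (insert i S)
 have c: "(%w. c i * mono (f i) w) \<in> carrier FA" using finite_support_scale[OF finite_mono] by simp
 have "(%w. \<Sum>i\<in>S. c i * mono (f i) w) \<in> carrier FA" using \<open>finite S\<close>
  by (induction S) (auto intro!: finite_support_add finite_support_scale)
 then have "pB (%w. c i * mono (f i) w + (\<Sum>i\<in>S. c i * mono (f i) w)) = pB (%w. c i * mono (f i) w) \<oplus>\<^bsub>B\<^esub> pB (%w. \<Sum>i\<in>S. c i * mono (f i) w)"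
  using pB_facts(2)[OF c] by simp
 moreover have "pB (%w. c i * mono (f i) w) = c i \<odot>\<^bsub>B\<^esub> bw (f i)"
  using pB_facts(3)[OF mono_carrier, of "c i" "f i"] by (simp add: bw_def)
 ultimately show ?case using insert by simp
qed

lemma rel_in_B: "finsum B (%i. rel \<alpha> \<beta> \<gamma> h s i \<odot>\<^bsub>B\<^esub> bw [i, i \<boxplus> h]) UNIV = \<zero>\<^bsub>B\<^esub>"
proof -
 have "pB (re h s) = finsum B (%i. rel \<alpha> \<beta> \<gamma> h s i \<odot>\<^bsub>B\<^esub> bw [i, i \<boxplus> h]) UNIV"
  unfolding rel_elem_def[abs_def] by (rule pB_sum) simp
 then show ?thesis using pB_rel by simp
qed

lemma rel_words_in_B: "finsum B (%i. rel \<alpha> \<beta> \<gamma> h s i \<odot>\<^bsub>B\<^esub> bw (u @ i # (i \<boxplus> h) # v)) UNIV = \<zero>\<^bsub>B\<^esub>"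
proof -
 have "finsum B (%i. rel \<alpha> \<beta> \<gamma> h s i \<odot>\<^bsub>B\<^esub> bw (u @ i # (i \<boxplus> h) # v)) UNIV =
   finsum B (%i. (bw u \<otimes>\<^bsub>B\<^esub> (rel \<alpha> \<beta> \<gamma> h s i \<odot>\<^bsub>B\<^esub> bw [i, i \<boxplus> h])) \<otimes>\<^bsub>B\<^esub> bw v) UNIV"
  by (simp add: B.mult_smult B.smult_mult bw_mult)
 also have "... = (bw u \<otimes>\<^bsub>B\<^esub> finsum B (%i. rel \<alpha> \<beta> \<gamma> h s i \<odot>\<^bsub>B\<^esub> bw [i, i \<boxplus> h]) UNIV) \<otimes>\<^bsub>B\<^esub> bw v"
  by (simp add: B.finsum_ldistr B.finsum_rdistr)
 finally show ?thesis by (simp add: rel_in_B)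
qed

end

context sklyanin_curve
begin

definition bform :: "nat => (gen list => 'k) => 'k elem_B" where
 "bform n t = finsum B (%w. t w \<odot>\<^bsub>B\<^esub> bw w) (words n)"

text \<open>The algebra \<open>B\<close> embeds in the twisted ring of functions on \<open>E\<close>:
  a form vanishing on \<open>E\<close> is a combination of relations, by duality.\<close>

lemma bform_zero:
 assumes "!!p. p \<in> E ==> form n t p = 0"
 shows "bform n t = \<zero>\<^bsub>B\<^esub>"
proof (cases "n = 0")
 case True
 have "E ~= {}" using infinite_E by auto
 then obtain p where "p \<in> E" by blast
 moreover have "words 0 = {[]}" by (auto simp: words_def)
 ultimately show ?thesis using assms[of p] True by (simp add: bform_def form_def)
next
 case n: False
 \<comment> \<open>The coefficient vector of a relation placed between the words u and v. As q runs
   through \<open>S\<close>, these vectors span the degree-n part of the ideal of relations.\<close>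
 define a where "a q w = (case q of (u, h, s, v) => \<Sum>i\<in>UNIV. rel \<alpha> \<beta> \<gamma> h s i * mono (u @ i # (i \<boxplus> h) # v) w)" for q w
 define S where "S = {(u :: gen list, h :: gen, s :: bool, v :: gen list). length u + length v + 2 = n}"
 have "S <= (\<Union>j\<le>n. words j) \<times> UNIV \<times> UNIV \<times> (\<Union>j\<le>n. words j)" by (auto simp: S_def)
 then have fin: "finite S" by (rule finite_subset) simp
 have sum_mono: "(\<Sum>w\<in>words n. \<phi> w * mono x w) = \<phi> x" if "length x = n" for \<phi> :: "gen list => 'k" and x
  using that by (simp add: mono_def if_distrib[of "%z. _ * z"] cong: if_cong)
 have "EX c. \<forall>w\<in>words n. t w = (\<Sum>q\<in>S. c q * a q w)"
 proof (rule double_annihilator[OF fin finite_words])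
  fix \<phi> assume \<phi>: "!!q. q \<in> S ==> (\<Sum>w\<in>words n. \<phi> w * a q w) = 0"
  have "relation_free n \<phi>"
   unfolding relation_free_def
  proof (intro allI impI)
   fix u v :: "gen list" and h s assume len: "length u + length v + 2 = n"
   have "0 = (\<Sum>w\<in>words n. \<phi> w * a (u, h, s, v) w)" using \<phi> len by (simp add: S_def)
   also have "... = (\<Sum>i\<in>UNIV. \<Sum>w\<in>words n. rel \<alpha> \<beta> \<gamma> h s i * (\<phi> w * mono (u @ i # (i \<boxplus> h) # v) w))"
    unfolding a_def prod.case sum_distrib_left by (subst sum.swap) (simp add: mult_ac)
   also have "... = (\<Sum>i\<in>UNIV. rel \<alpha> \<beta> \<gamma> h s i * \<phi> (u @ i # (i \<boxplus> h) # v))"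
    using len by (simp add: sum_mono flip: sum_distrib_left)
   finally show "(\<Sum>i\<in>UNIV. rel \<alpha> \<beta> \<gamma> h s i * \<phi> (u @ i # (i \<boxplus> h) # v)) = 0" by simp
  qed
  \<comment> \<open>A relation-free functional is a combination of evaluations at 4n points of E,
    and t vanishes at each of them.\<close>
  moreover obtain P where P: "finite P" "P <= E" "card P = 4 * n" "indep n P"
   using indep_basis_avoiding[of "{}" n] n by auto
  ultimately obtain c where c: "!!w. length w = n ==> \<phi> w = (\<Sum>p\<in>P. c p * ev p w)"
   using indep_basis_spans[OF _ P] n by (metis One_nat_def Suc_leI neq0_conv)
  have "(\<Sum>w\<in>words n. \<phi> w * t w) = (\<Sum>w\<in>words n. \<Sum>p\<in>P. c p * (t w * ev p w))"
   by (rule sum.cong) (auto simp: c sum_distrib_left sum_distrib_right mult_ac)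
  also have "... = (\<Sum>p\<in>P. c p * form n t p)"
   by (subst sum.swap) (simp add: form_def sum_distrib_left)
  also have "... = 0" using assms P(2) by (intro sum.neutral) auto
  finally show "(\<Sum>w\<in>words n. \<phi> w * t w) = 0" .
 qed
 then obtain c where c: "!!w. length w = n ==> t w = (\<Sum>q\<in>S. c q * a q w)" by auto
 have pBt: "pB (%w. \<Sum>x\<in>words n. f x * mono x w) = bform n f" for f
  unfolding bform_def using pB_sum[OF finite_words, of f "%w. w" n] by simp
 have ac: "a q \<in> carrier FA" "pB (a q) = \<zero>\<^bsub>B\<^esub>" for q
 proof -
  obtain u h s v where q: "q = (u, h, s, v)" by (metis prod.exhaust)
  have "a q = (%w. \<Sum>i\<in>UNIV. rel \<alpha> \<beta> \<gamma> h s i * mono (u @ i # (i \<boxplus> h) # v) w)" by (simp add: a_def q fun_eq_iff)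
  then show "pB (a q) = \<zero>\<^bsub>B\<^esub>" using pB_sum[of UNIV "rel \<alpha> \<beta> \<gamma> h s" "%i. u @ i # (i \<boxplus> h) # v"] rel_words_in_B by simp
  show "a q \<in> carrier FA" by (auto simp: a_def[abs_def] q sum_gen intro!: finite_support_add finite_support_scale)
 qed
 have zero: "(%w. \<Sum>q\<in>T. c q * a q w) \<in> carrier FA & pB (%w. \<Sum>q\<in>T. c q * a q w) = \<zero>\<^bsub>B\<^esub>" if "finite T" for T
  using that
 proof (induction T)
  case empty show ?case using pB_zero by simp
 next
  case (insert q T)
  have sc: "(%w. c q * a q w) \<in> carrier FA" "pB (%w. c q * a q w) = \<zero>\<^bsub>B\<^esub>"
   using ac[of q] pB_facts(3)[OF ac(1), of "c q" q] finite_support_scale by auto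
  have "pB (%w. c q * a q w + (\<Sum>q\<in>T. c q * a q w)) = pB (%w. c q * a q w) \<oplus>\<^bsub>B\<^esub> pB (%w. \<Sum>q\<in>T. c q * a q w)"
   using pB_facts(2)[OF sc(1) conjunct1[OF insert.IH]] by simp
  then have "pB (%w. \<Sum>q\<in>insert q T. c q * a q w) = \<zero>\<^bsub>B\<^esub>" using insert sc(2) by simp
  moreover have "(%w. \<Sum>q\<in>insert q T. c q * a q w) \<in> carrier FA"
   using FA.add.m_closed[OF sc(1) conjunct1[OF insert.IH]] insert.hyps by simp
  ultimately show ?case by (rule conjI[rotated])
 qed
 have len: "a q w = 0" if "q \<in> S" "length w ~= n" for q w
  using that by (auto simp: a_def S_def mono_def intro!: sum.neutral)
 have "(%w. \<Sum>q\<in>S. c q * a q w) = (%w. \<Sum>x\<in>words n. t x * mono x w)"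
 proof
  fix w
  show "(\<Sum>q\<in>S. c q * a q w) = (\<Sum>x\<in>words n. t x * mono x w)"
  proof (cases "length w = n")
   case True
   then have "(\<Sum>x\<in>words n. t x * mono x w) = t w"
    by (simp add: mono_def if_distrib[of "%z. _ * z"] cong: if_cong)
   then show ?thesis using c[OF True] by simp
  next
   case False
   then have "(\<Sum>x\<in>words n. t x * mono x w) = 0" by (intro sum.neutral) (auto simp: mono_def)
   then show ?thesis using len False by simp
  qed
 qed
 then show ?thesis using zero[OF fin] pBt[of t] by simp
qed

end

lemma (in gmod) act_finsum:
 assumes "m \<in> carrier M" "finite S" "!!i. i \<in> S ==> f i \<in> carrier B"
 shows "act M m (finsum B f S) = finsum M (%i. act M m (f i)) S"
 using assms(2,3)
proof (induction S)
 case (insert i S)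
 then have "finsum B f S \<in> carrier B" by (intro B.finsum_closed) auto
 then show ?case using insert assms(1) by (simp add: act_add_r Pi_def)
qed (use assms(1) in simp)

lemma (in kspace) finsum_scalars:
 assumes "e \<in> carrier V" "finite S"
 shows "finsum V (%i. f i \<odot> e) S = (\<Sum>i\<in>S. f i) \<odot> e"
 using assms(2)
proof (induction S)
 case (insert i S)
 then show ?case using assms(1) by (simp add: s_add Pi_def)
qed (use assms(1) in simp)

lemma field_not_singleton: "(UNIV :: 'a::field set) ~= {0}"
proof
 assume "(UNIV :: 'a set) = {0}"
 then have "(1 :: 'a) \<in> {0}" by (metis UNIV_I)
 then show False by simp
qed

lemma (in kspace) dim_1_obtain:
 fixes N :: "'m set"
 assumes "sub N" "Defs.fin_dim (V\<lparr>carrier := N\<rparr>)" "dimension (V\<lparr>carrier := N\<rparr>) = 1"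
 obtains e where "e \<in> N" "e ~= \<zero>" "!!x. x \<in> N ==> EX c. x = c \<odot> e"
proof -
 interpret N: kspace "V\<lparr>carrier := N\<rparr>" by (rule sub_kspace[OF assms(1)])
 obtain b where b: "finite b" "N.basis b" using N.finite_basis_exists assms(2) by blast
 then have "card b = 1" using N.dim_basis assms(3) by simp
 then obtain e where e: "b = {e}" by (rule card_1_singletonE)
 have eN: "e \<in> N" using b(2) e by (simp add: N.basis_def)
 have "\<zero>\<^bsub>V\<lparr>carrier := N\<rparr>\<^esub> ~: b"
  by (rule N.zero_nin_lin_indpt) (use b(2) in \<open>simp_all add: N.basis_def class_ring_simps field_not_singleton\<close>)
 then have "e ~= \<zero>" using e by simp
 moreover have "EX c. x = c \<odot> e" if x: "x \<in> N" for x
 proof -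
  have "x \<in> N.span {e, e}" using b(2) e x by (simp add: N.basis_def)
  then obtain c d where "x = c \<odot> e \<oplus> d \<odot> e" using N.span_comb2[of e e x] eN by auto
  then show ?thesis using s_add[of e c d] eN subD(5)[OF assms(1)] by metis
 qed
 ultimately show ?thesis using that eN by blast
qed

lemma fps_geometric: "(1 / (1 - fps_X) :: rat fps) = Abs_fps (%n. 1)"
 using gp[of "fps_X :: rat fps"] by simp

lemma proj_point_scale:
 assumes c: "(c::'k::field) ~= 0"
 shows "proj_point (%i. c * y i) = proj_point y"
 unfolding proj_point_def
proof safe
 fix d :: 'k assume "d ~= 0"
 then show "EX e. (%i. d * (c * y i)) = (%i. e * y i) & e ~= 0" using c by (intro exI[of _ "d * c"]) (simp add: mult.assoc)
 show "EX e. (%i. d * y i) = (%i. e * (c * y i)) & e ~= 0" using c \<open>d ~= 0\<close> by (intro exI[of _ "d / c"]) simp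
qed

locale point_modules = sklyanin \<alpha> \<beta> \<gamma> for \<alpha> \<beta> \<gamma> :: "'k::alg_closed_field" +
 fixes Mp :: "'k point => ('k, 'n, 'k elem_B) graded_rmodule" and \<sigma> :: "'k point => 'k point"
 assumes pm: "!!p. p \<in> curve_E \<alpha> \<beta> \<gamma> ==> point_module_at \<alpha> \<beta> \<gamma> p (Mp p)"
  and sh: "shift_automorphism \<alpha> \<beta> \<gamma> Mp \<sigma>"
begin

abbreviation "E \<equiv> curve_E \<alpha> \<beta> \<gamma>"

definition Y :: "'k point => gen => 'k" where
 "Y p = (SOME y. y \<in> p & (\<exists>m0 \<in> piece (Mp p) 0 - {\<zero>\<^bsub>Mp p\<^esub>}. \<exists>m1 \<in> piece (Mp p) 1 - {\<zero>\<^bsub>Mp p\<^esub>}.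
    ALL i. act (Mp p) m0 (bw [i]) = y i \<odot>\<^bsub>Mp p\<^esub> m1))"

lemma Y:
 assumes "p \<in> E"
 shows "Y p \<in> p" "\<exists>m0 \<in> piece (Mp p) 0 - {\<zero>\<^bsub>Mp p\<^esub>}. \<exists>m1 \<in> piece (Mp p) 1 - {\<zero>\<^bsub>Mp p\<^esub>}.
    ALL i. act (Mp p) m0 (bw [i]) = Y p i \<odot>\<^bsub>Mp p\<^esub> m1"
proof -
 have "EX y. y \<in> p & (\<exists>m0 \<in> piece (Mp p) 0 - {\<zero>\<^bsub>Mp p\<^esub>}. \<exists>m1 \<in> piece (Mp p) 1 - {\<zero>\<^bsub>Mp p\<^esub>}.
    ALL i. act (Mp p) m0 (bw [i]) = y i \<odot>\<^bsub>Mp p\<^esub> m1)"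
  using pm[OF assms] unfolding point_module_at_def gen_B_bw by blast
 from someI_ex[OF this] show "Y p \<in> p" "\<exists>m0 \<in> piece (Mp p) 0 - {\<zero>\<^bsub>Mp p\<^esub>}. \<exists>m1 \<in> piece (Mp p) 1 - {\<zero>\<^bsub>Mp p\<^esub>}.
    ALL i. act (Mp p) m0 (bw [i]) = Y p i \<odot>\<^bsub>Mp p\<^esub> m1"
  unfolding Y_def by blast+
qed

lemma curve_points:
 assumes "p \<in> E"
 obtains y where "p = proj_point y" "EX i. y i ~= 0" "(y X0)\<^sup>2 + (y X1)\<^sup>2 + (y X2)\<^sup>2 + (y X3)\<^sup>2 = 0"
  "(y X3)\<^sup>2 + (1 - \<gamma>) / (1 + \<alpha>) * (y X1)\<^sup>2 + (1 + \<gamma>) / (1 - \<beta>) * (y X2)\<^sup>2 = 0"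
  "p = proj_point (Y p)" "EX c. c ~= 0 & Y p = (%i. c * y i)"
proof -
 obtain y where y: "p = proj_point y" "EX i. y i ~= 0" "(y X0)\<^sup>2 + (y X1)\<^sup>2 + (y X2)\<^sup>2 + (y X3)\<^sup>2 = 0"
  "(y X3)\<^sup>2 + (1 - \<gamma>) / (1 + \<alpha>) * (y X1)\<^sup>2 + (1 + \<gamma>) / (1 - \<beta>) * (y X2)\<^sup>2 = 0"
  using assms unfolding curve_E_def by blast
 obtain c where c: "c ~= 0" "Y p = (%i. c * y i)" using Y(1)[OF assms] unfolding y(1) proj_point_def by blast
 then have "proj_point (%i. c * y i) = proj_point y" by (intro proj_point_scale)
 then show ?thesis using that[OF y] y(1) c by auto
qed

lemma Y_facts:
 assumes "p \<in> E"
 shows "p = proj_point (Y p)" "EX i. Y p i ~= 0"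
 by (rule curve_points[OF assms], auto)+

lemma \<sigma>_in': "p \<in> E ==> \<sigma> p \<in> E"
 using sh by (auto simp: shift_automorphism_def bij_betw_def)

lemma \<sigma>_pow_in': "p \<in> E ==> (\<sigma> ^^ n) p \<in> E"
 by (induction n) (auto intro: \<sigma>_in')

lemma Mp_gmod: "p \<in> E ==> gmod \<alpha> \<beta> \<gamma> B (%_ _. 1) (Mp p)"
 using pm[of p] sklyanin_axioms word_algebra_B
 by (simp add: gmod_def gmod_axioms_def point_module_at_def point_module_def)

lemma Mp_piece:
 assumes p: "p \<in> E"
 obtains e where "e \<in> piece (Mp p) n" "e ~= \<zero>\<^bsub>Mp p\<^esub>" "!!x. x \<in> piece (Mp p) n ==> EX c. x = c \<odot>\<^bsub>Mp p\<^esub> e"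
proof -
 interpret gmod \<alpha> \<beta> \<gamma> B "%_ _. 1" "Mp p" by (rule Mp_gmod[OF p])
 have h: "has_hilbert_series (Mp p) (1 / (1 - fps_X))" using pm[OF p] by (simp add: point_module_at_def point_module_def)
 then have "fps_nth (Abs_fps (%n. of_nat (dimension (Mp p\<lparr>carrier := piece (Mp p) n\<rparr>)) :: rat)) n = 1"
  by (simp add: has_hilbert_series_def fps_geometric)
 then have "dimension (Mp p\<lparr>carrier := piece (Mp p) n\<rparr>) = 1" by simp
 moreover have "Defs.fin_dim (Mp p\<lparr>carrier := piece (Mp p) n\<rparr>)" using h by (simp add: has_hilbert_series_def)
 ultimately show ?thesis using dim_1_obtain[OF piece_sub, of n] that by blast
qed

text \<open>Degree 0 is the defining condition of the point module at p, rescaled. A higher degree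
  is carried down by the isomorphism of the truncated shift with the point module at
  \<sigma>(p).\<close>

lemma Mp_step:
 assumes "p \<in> E" "e \<in> piece (Mp p) n" "e ~= \<zero>\<^bsub>Mp p\<^esub>"
 shows "\<exists>e'\<in>piece (Mp p) (Suc n). e' ~= \<zero>\<^bsub>Mp p\<^esub> & (ALL i. act (Mp p) e (bw [i]) = Y ((\<sigma> ^^ n) p) i \<odot>\<^bsub>Mp p\<^esub> e')"
 using assms
proof (induction n arbitrary: p e)
 case 0
 interpret gmod \<alpha> \<beta> \<gamma> B "%_ _. 1" "Mp p" by (rule Mp_gmod[OF 0(1)])
 obtain m0 m1 where m: "m0 \<in> piece (Mp p) 0" "m0 ~= \<zero>\<^bsub>Mp p\<^esub>" "m1 \<in> piece (Mp p) 1" "m1 ~= \<zero>\<^bsub>Mp p\<^esub>"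
  "!!i. act (Mp p) m0 (bw [i]) = Y p i \<odot>\<^bsub>Mp p\<^esub> m1" using Y(2)[OF 0(1)] by blast
 obtain f where f: "f \<in> piece (Mp p) 0" "!!x. x \<in> piece (Mp p) 0 ==> EX c. x = c \<odot>\<^bsub>Mp p\<^esub> f" using Mp_piece[OF 0(1), of 0] by metis
 obtain c d where cd: "e = c \<odot>\<^bsub>Mp p\<^esub> f" "m0 = d \<odot>\<^bsub>Mp p\<^esub> f" using f(2)[OF 0(2)] f(2)[OF m(1)] by blast
 have fc: "f \<in> carrier (Mp p)" "m1 \<in> carrier (Mp p)" using f m pD by blast+
 have d: "d ~= 0" and c: "c ~= 0" using m(2) 0(3) cd fc by auto
 have e: "e = (c / d) \<odot>\<^bsub>Mp p\<^esub> m0" using cd fc d by (simp flip: s_mult)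
 show ?case
 proof (intro bexI conjI allI)
  show "(c / d) \<odot>\<^bsub>Mp p\<^esub> m1 \<in> piece (Mp p) (Suc 0)" using m(3) pD(4) by simp
  show "(c / d) \<odot>\<^bsub>Mp p\<^esub> m1 ~= \<zero>\<^bsub>Mp p\<^esub>" using s_eq_zero fc m(4) c d by simp
  show "act (Mp p) e (bw [i]) = Y ((\<sigma> ^^ 0) p) i \<odot>\<^bsub>Mp p\<^esub> ((c / d) \<odot>\<^bsub>Mp p\<^esub> m1)" for i
   using e m(1,5) pD(5) fc by (simp add: act_smult mult.commute flip: s_mult)
 qed
next
 case (Suc n)
 interpret M: gmod \<alpha> \<beta> \<gamma> B "%_ _. 1" "Mp p" by (rule Mp_gmod[OF Suc.prems(1)])
 have sp: "\<sigma> p \<in> E" by (rule \<sigma>_in'[OF Suc.prems(1)])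
 interpret N: gmod \<alpha> \<beta> \<gamma> B "%_ _. 1" "Mp (\<sigma> p)" by (rule Mp_gmod[OF sp])
 let ?T = "truncated_shift (Mp p)"
 obtain f where f: "f \<in> graded_hom B ?T (Mp (\<sigma> p))" "bij_betw f (carrier ?T) (carrier (Mp (\<sigma> p)))"
  using sh Suc.prems(1) unfolding shift_automorphism_def graded_isomorphic_def by blast
 have T: "carrier ?T = {m \<in> carrier (Mp p). M.comp 0 m = \<zero>\<^bsub>Mp p\<^esub>}" "piece ?T k = piece (Mp p) (Suc k)"
  "act ?T = act (Mp p)" "add ?T = add (Mp p)" "module.smult ?T = module.smult (Mp p)" for k
 proof -
  have "(EX c. homog_decomp (Mp p) c m & c 0 = \<zero>\<^bsub>Mp p\<^esub>) \<longleftrightarrow> M.comp 0 m = \<zero>\<^bsub>Mp p\<^esub>" if "m \<in> carrier (Mp p)" for m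
   using M.comp_decomp[OF that] M.comp_eq by metis
  then show "carrier ?T = {m \<in> carrier (Mp p). M.comp 0 m = \<zero>\<^bsub>Mp p\<^esub>}" by (auto simp: truncated_shift_def)
 qed (simp_all add: truncated_shift_def)
 have pT: "x \<in> carrier ?T" if "x \<in> piece (Mp p) (Suc k)" for x k
  using that M.comp_homog[OF that, of 0] M.pD(5) by (simp add: T(1))
 have zT: "\<zero>\<^bsub>Mp p\<^esub> \<in> carrier ?T" by (simp add: T(1))
 have fh: "f (c \<odot>\<^bsub>Mp p\<^esub> x) = c \<odot>\<^bsub>Mp (\<sigma> p)\<^esub> f x" "f (act (Mp p) x (bw [i])) = act (Mp (\<sigma> p)) (f x) (bw [i])"
  "f x \<in> carrier (Mp (\<sigma> p))" if "x \<in> carrier ?T" for x c i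
  using f(1) that by (auto simp: graded_hom_def LinearCombinations.module_hom_def T(3,5) class_ring_simps)
 have fp: "f x \<in> piece (Mp (\<sigma> p)) k" if "x \<in> piece (Mp p) (Suc k)" for x k
 proof -
  have "f ` piece ?T k <= piece (Mp (\<sigma> p)) k" using f(1) by (simp add: graded_hom_def)
  then show ?thesis using that by (auto simp: T(2))
 qed
 have inj: "x = y" if "x \<in> carrier ?T" "y \<in> carrier ?T" "f x = f y" for x y
  using f(2) that by (auto simp: bij_betw_def inj_on_def)
 have f0: "f \<zero>\<^bsub>Mp p\<^esub> = \<zero>\<^bsub>Mp (\<sigma> p)\<^esub>" using fh(1)[OF zT, of 0] fh(3)[OF zT] by simp
 note eT = pT[OF Suc.prems(2)]
 have "f e ~= \<zero>\<^bsub>Mp (\<sigma> p)\<^esub>" using inj[OF eT zT] f0 Suc.prems(3) by auto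
 from Suc.IH[OF sp fp[OF Suc.prems(2)] this]
 obtain e' where e': "e' \<in> piece (Mp (\<sigma> p)) (Suc n)" "e' ~= \<zero>\<^bsub>Mp (\<sigma> p)\<^esub>"
  "!!i. act (Mp (\<sigma> p)) (f e) (bw [i]) = Y ((\<sigma> ^^ n) (\<sigma> p)) i \<odot>\<^bsub>Mp (\<sigma> p)\<^esub> e'" by blast
 define y where "y = Y ((\<sigma> ^^ n) (\<sigma> p))"
 have ec: "e' \<in> carrier (Mp (\<sigma> p))" using e'(1) N.pD by blast
 obtain l where l: "y l ~= 0"
 proof -
  show ?thesis using that Y_facts(2)[OF \<sigma>_pow_in'[OF sp, of n]] by (auto simp: y_def)
 qed
 \<comment> \<open>The preimage of \<open>e'\<close> under f: since f commutes with the action, it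
   maps e x_l to y_l times \<open>e'\<close>, and y_l is nonzero.\<close>
 let ?e = "inverse (y l) \<odot>\<^bsub>Mp p\<^esub> act (Mp p) e (bw [l])"
 have ei: "act (Mp p) e (bw [i]) \<in> piece (Mp p) (Suc (Suc n))" for i by (rule M.actx_piece[OF Suc.prems(2)])
 then have ep: "?e \<in> piece (Mp p) (Suc (Suc n))" using M.pD(4) by blast
 have fe: "f ?e = e'"
  using fh(1)[OF pT[OF ei]] fh(2)[OF eT] e'(3)[of l] ec l by (simp add: y_def flip: N.s_mult)
 show ?case
 proof (intro bexI[of _ ?e] conjI allI ep)
  show "?e ~= \<zero>\<^bsub>Mp p\<^esub>" using fe e'(2) f0 by metis
  fix i
  have "f (act (Mp p) e (bw [i])) = f (y i \<odot>\<^bsub>Mp p\<^esub> ?e)"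
   using fh(2)[OF eT] fh(1)[OF pT[OF ep]] fe e'(3) by (simp add: y_def)
  then have "act (Mp p) e (bw [i]) = y i \<odot>\<^bsub>Mp p\<^esub> ?e"
   using inj pT[OF ei] pT[OF M.pD(4)[OF ep]] by blast
  then show "act (Mp p) e (bw [i]) = Y ((\<sigma> ^^ Suc n) p) i \<odot>\<^bsub>Mp p\<^esub> ?e" by (simp add: y_def funpow_swap1)
 qed
qed

lemma Mp_basis:
 assumes p: "p \<in> E"
 obtains e where "!!n. e n \<in> piece (Mp p) n" "!!n. e n ~= \<zero>\<^bsub>Mp p\<^esub>"
  "!!n x. x \<in> piece (Mp p) n ==> EX c. x = c \<odot>\<^bsub>Mp p\<^esub> e n"
  "!!n i. act (Mp p) (e n) (bw [i]) = Y ((\<sigma> ^^ n) p) i \<odot>\<^bsub>Mp p\<^esub> e (Suc n)"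
proof -
 interpret gmod \<alpha> \<beta> \<gamma> B "%_ _. 1" "Mp p" by (rule Mp_gmod[OF p])
 obtain e0 where e0: "e0 \<in> piece (Mp p) 0" "e0 ~= \<zero>\<^bsub>Mp p\<^esub>" using Mp_piece[OF p, of 0] by metis
 have "EX e. ALL n. (e n \<in> piece (Mp p) n & e n ~= \<zero>\<^bsub>Mp p\<^esub>) &
   (ALL i. act (Mp p) (e n) (bw [i]) = Y ((\<sigma> ^^ n) p) i \<odot>\<^bsub>Mp p\<^esub> e (Suc n))"
  by (rule dependent_nat_choice) (use e0 Mp_step[OF p] in blast)+
 then obtain e where e: "!!n. e n \<in> piece (Mp p) n" "!!n. e n ~= \<zero>\<^bsub>Mp p\<^esub>"
  "!!n i. act (Mp p) (e n) (bw [i]) = Y ((\<sigma> ^^ n) p) i \<odot>\<^bsub>Mp p\<^esub> e (Suc n)" by blast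
 have "EX c. x = c \<odot>\<^bsub>Mp p\<^esub> e n" if x: "x \<in> piece (Mp p) n" for x n
 proof -
  obtain f where f: "f \<in> piece (Mp p) n" "!!x. x \<in> piece (Mp p) n ==> EX c. x = c \<odot>\<^bsub>Mp p\<^esub> f" using Mp_piece[OF p, of n] by metis
  obtain c d where cd: "x = c \<odot>\<^bsub>Mp p\<^esub> f" "e n = d \<odot>\<^bsub>Mp p\<^esub> f" using f(2)[OF x] f(2)[OF e(1)] by metis
  have fc: "f \<in> carrier (Mp p)" using f pD by blast
  have "d ~= 0" using cd(2) e(2)[of n] fc by auto
  then have "x = (c / d) \<odot>\<^bsub>Mp p\<^esub> e n" using cd fc by (simp flip: s_mult)
  then show ?thesis by blast
 qed
 then show ?thesis using that e by blast
qed

text \<open>The module theory enters in \<open>shift\<close>: a quadratic relation applied to the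
  generator of M_p gives its bilinear value at (p, \<sigma>(p)) times a nonzero element of degree
  2.\<close>

lemma curve: "sklyanin_curve \<alpha> \<beta> \<gamma> E \<sigma> Y"
proof unfold_locales
 show "bij_betw \<sigma> E E" using sh by (simp add: shift_automorphism_def)
 fix p assume p: "p \<in> E"
 obtain y where y: "EX i. y i ~= 0" "(y X0)\<^sup>2 + (y X1)\<^sup>2 + (y X2)\<^sup>2 + (y X3)\<^sup>2 = 0"
  "(y X3)\<^sup>2 + (1 - \<gamma>) / (1 + \<alpha>) * (y X1)\<^sup>2 + (1 + \<gamma>) / (1 - \<beta>) * (y X2)\<^sup>2 = 0"
  and ex: "EX c. c ~= 0 & Y p = (%i. c * y i)" by (rule curve_points[OF p]) blast
 obtain c where c: "c ~= 0" "Y p = (%i. c * y i)" using ex by blast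
 show "EX i. Y p i ~= 0" using y c by auto
 have "(Y p X0)\<^sup>2 + (Y p X1)\<^sup>2 + (Y p X2)\<^sup>2 + (Y p X3)\<^sup>2 = c\<^sup>2 * ((y X0)\<^sup>2 + (y X1)\<^sup>2 + (y X2)\<^sup>2 + (y X3)\<^sup>2)"
  by (simp add: c power_mult_distrib distrib_left)
 then show "(Y p X0)\<^sup>2 + (Y p X1)\<^sup>2 + (Y p X2)\<^sup>2 + (Y p X3)\<^sup>2 = 0" using y by simp
 have "(Y p X3)\<^sup>2 + (1 - \<gamma>) / (1 + \<alpha>) * (Y p X1)\<^sup>2 + (1 + \<gamma>) / (1 - \<beta>) * (Y p X2)\<^sup>2 =
  c\<^sup>2 * ((y X3)\<^sup>2 + (1 - \<gamma>) / (1 + \<alpha>) * (y X1)\<^sup>2 + (1 + \<gamma>) / (1 - \<beta>) * (y X2)\<^sup>2)"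
  by (simp add: c power_mult_distrib distrib_left mult.left_commute)
 then show "(Y p X3)\<^sup>2 + (1 - \<gamma>) / (1 + \<alpha>) * (Y p X1)\<^sup>2 + (1 + \<gamma>) / (1 - \<beta>) * (Y p X2)\<^sup>2 = 0" using y by simp
 show "p = q" if q: "q \<in> E" and e: "!!i. Y q i = d * Y p i" for q d
 proof -
  have pp: "p = proj_point (Y p)" "q = proj_point (Y q)" using Y_facts p q by simp_all
  obtain i where "Y q i ~= 0" using Y_facts[OF q] by blast
  then have d: "d ~= 0" using e by auto
  have "Y q = (%i. d * Y p i)" using e by auto
  then have "proj_point (Y q) = proj_point (Y p)" using proj_point_scale[OF d] by simp
  then show ?thesis using pp by simp
 qed
 show "bilin \<alpha> \<beta> \<gamma> h s (Y p) (Y (\<sigma> p)) = 0" for h s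
 proof -
  interpret gmod \<alpha> \<beta> \<gamma> B "%_ _. 1" "Mp p" by (rule Mp_gmod[OF p])
  obtain e where e: "!!n. e n \<in> piece (Mp p) n" "!!n. e n ~= \<zero>\<^bsub>Mp p\<^esub>"
   "!!n i. act (Mp p) (e n) (bw [i]) = Y ((\<sigma> ^^ n) p) i \<odot>\<^bsub>Mp p\<^esub> e (Suc n)" using Mp_basis[OF p] by metis
  have ec: "e n \<in> carrier (Mp p)" for n using e(1) pD by blast
  have two: "act (Mp p) (e 0) (bw [i, j]) = (Y p i * Y (\<sigma> p) j) \<odot>\<^bsub>Mp p\<^esub> e 2" for i j
  proof -
   have "act (Mp p) (e 0) (bw [i, j]) = act (Mp p) (act (Mp p) (e 0) (bw [i])) (bw [j])" using act_bw[OF ec, of 0 "[i]" "[j]"] ec by simp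
   then show ?thesis using e(3)[of 0 i] e(3)[of 1 j] ec by (simp add: act_smult numeral_2_eq_2 flip: s_mult)
  qed
  have "\<zero>\<^bsub>Mp p\<^esub> = act (Mp p) (e 0) (finsum B (%i. rel \<alpha> \<beta> \<gamma> h s i \<odot>\<^bsub>B\<^esub> bw [i, i \<boxplus> h]) UNIV)"
   using ec by (simp add: rel_in_B)
  also have "... = finsum (Mp p) (%i. (rel \<alpha> \<beta> \<gamma> h s i * Y p i * Y (\<sigma> p) (i \<boxplus> h)) \<odot>\<^bsub>Mp p\<^esub> e 2) UNIV"
   using ec by (simp add: act_finsum act_smult_r two mult.assoc flip: s_mult)
  also have "... = bilin \<alpha> \<beta> \<gamma> h s (Y p) (Y (\<sigma> p)) \<odot>\<^bsub>Mp p\<^esub> e 2"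
   using ec by (simp add: finsum_scalars bilin_def)
  finally show ?thesis using s_eq_zero ec e(2) by metis
 qed
next
 fix y :: "gen => 'k" assume y: "EX i. y i ~= 0" "(y X0)\<^sup>2 + (y X1)\<^sup>2 + (y X2)\<^sup>2 + (y X3)\<^sup>2 = 0"
  "(y X3)\<^sup>2 + (1 - \<gamma>) / (1 + \<alpha>) * (y X1)\<^sup>2 + (1 + \<gamma>) / (1 - \<beta>) * (y X2)\<^sup>2 = 0"
 then have p: "proj_point y \<in> E" unfolding curve_E_def by blast
 show "\<exists>p\<in>E. EX c. c ~= 0 & (ALL i. Y p i = c * y i)"
  using Y(1)[OF p] p by (auto simp: proj_point_def intro!: bexI[of _ "proj_point y"])
qed

end

section \<open>The fat point modules\<close>

locale fat_point = point_modules \<alpha> \<beta> \<gamma> Mp \<sigma> for \<alpha> \<beta> \<gamma> :: "'k::alg_closed_field"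
  and Mp :: "'k point => ('k, 'n, 'k elem_B) graded_rmodule" and \<sigma> +
 fixes p :: "'k point" and e :: "nat => 'n"
 assumes p: "p \<in> E"
  and e_piece: "!!n. e n \<in> piece (Mp p) n" and e_nz: "!!n. e n ~= \<zero>\<^bsub>Mp p\<^esub>"
  and e_span: "!!n x. x \<in> piece (Mp p) n ==> EX c. x = c \<odot>\<^bsub>Mp p\<^esub> e n"
  and e_act: "!!n i. act (Mp p) (e n) (bw [i]) = Y ((\<sigma> ^^ n) p) i \<odot>\<^bsub>Mp p\<^esub> e (Suc n)"

lemma (in point_modules) fat_point_exists:
 assumes "p \<in> E"
 shows "EX e. fat_point \<alpha> \<beta> \<gamma> Mp \<sigma> p e"
 using Mp_basis[OF assms] assms point_modules_axioms unfolding fat_point_def fat_point_axioms_def by metis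

sublocale fat_point \<subseteq> Q: gmod \<alpha> \<beta> \<gamma> B "%_ _. 1" "Mp p"
 by (rule Mp_gmod[OF p])

sublocale fat_point \<subseteq> P: gmod \<alpha> \<beta> \<gamma> TW mu "row_module \<alpha> \<beta> \<gamma> (Mp p)"
 by (rule Q.row_gmod[OF word_algebra_TW]) simp

context fat_point
begin

abbreviation "P \<equiv> row_module \<alpha> \<beta> \<gamma> (Mp p)"
abbreviation "y n \<equiv> Y ((\<sigma> ^^ n) p)"

definition v :: "nat => 'k => 'k => 'n \<times> 'n" where
 "v n a b = (a \<odot>\<^bsub>Mp p\<^esub> e n, b \<odot>\<^bsub>Mp p\<^esub> e n)"

lemma ec [simp, intro]: "e n \<in> carrier (Mp p)"
 using e_piece Q.pD(5) by blast

lemma v_piece [simp, intro]: "v n a b \<in> piece P n"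
 using e_piece Q.pD(4) by (simp add: v_def Q.row_simps)

lemma v_carrier [simp, intro]: "v n a b \<in> carrier P"
 by (simp add: v_def Q.row_simps)

lemma piece_v: "x \<in> piece P n ==> EX a b. x = v n a b"
 using e_span unfolding v_def Q.row_simps by (metis mem_Sigma_iff prod.exhaust)

lemma v_add: "v n a b \<oplus>\<^bsub>P\<^esub> v n c d = v n (a + c) (b + d)"
 by (simp add: v_def Q.row_simps Q.s_add)

lemma v_smult: "c \<odot>\<^bsub>P\<^esub> v n a b = v n (c * a) (c * b)"
 by (simp add: v_def Q.row_simps Q.s_mult)

lemma v_zero: "v n a b = \<zero>\<^bsub>P\<^esub> \<longleftrightarrow> a = 0 & b = 0"
 using e_nz by (simp add: v_def Q.row_simps Q.s_eq_zero)

lemma v_inj: "v n a b = v n c d \<longleftrightarrow> a = c & b = d"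
proof -
 have "v n a b \<oplus>\<^bsub>P\<^esub> (- 1) \<odot>\<^bsub>P\<^esub> v n c d = v n (a - c) (b - d)" by (simp add: v_add v_smult)
 then show ?thesis using P.diff_zero[of "v n a b" "v n c d"] v_zero[of n "a - c" "b - d"] by auto
qed

lemma v_act: "act P (v n a b) (bw [i]) = (case i of
  X0 => v (Suc n) (y n X0 * a) (y n X0 * b) | X1 => v (Suc n) (y n X1 * a) (- (y n X1 * b))
 | X2 => v (Suc n) (y n X2 * b) (y n X2 * a) | X3 => v (Suc n) (y n X3 * b) (- (y n X3 * a)))"
 by (cases i) (simp_all add: v_def Q.row_act_bw Q.act_smult e_act mult_ac flip: Q.s_mult)

lemma one_zero: "i ~= j ==> y n i = 0 ==> y n j ~= 0"
proof -
 interpret C: sklyanin_curve \<alpha> \<beta> \<gamma> E \<sigma> Y by (rule curve)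
 show "i ~= j ==> y n i = 0 ==> y n j ~= 0" using C.one_zero[of "(\<sigma> ^^ n) p" i j] \<sigma>_pow_in'[OF p] by blast
qed

text \<open>Up to nonzero factors the four products are (a, b), (a, -b), (b, a), (b, -a), and at
  most one of them is lost to a vanishing coordinate. If a and b are nonzero, one of the pairs {(a,
  b), (a, -b)}, {(b, a), (b, -a)} survives and spans; if one of them is 0, one vector from each pair
  is enough.\<close>

lemma spread:
 assumes L: "P.sub L" and act: "!!i. act P (v n a b) (bw [i]) \<in> L" and ab: "a ~= 0 \<or> b ~= 0"
 shows "piece P (Suc n) <= L"
proof -
 define l where "l c d \<longleftrightarrow> v (Suc n) c d \<in> L" for c d
 have l_add: "l (c + c') (d + d')" if "l c d" "l c' d'" for c d c' d'
  using P.subD(3)[OF L] that unfolding l_def by (metis v_add)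
 have l_s: "l (k * c) (k * d)" if "l c d" for k c d
  using P.subD(4)[OF L] that unfolding l_def by (metis v_smult)
 have unit: "l c d" if "l (k * c) (k * d)" "k ~= 0" for k c d
  using l_s[OF that(1), of "inverse k"] that(2) by (simp flip: mult.assoc)
 have f0: "l a b" if "y n X0 ~= 0" using act[of X0] unit[OF _ that] by (simp add: v_act l_def)
 have f1: "l a (- b)" if "y n X1 ~= 0" using act[of X1] unit[of "y n X1" a "- b"] that by (simp add: v_act l_def)
 have f2: "l b a" if "y n X2 ~= 0" using act[of X2] unit[OF _ that] by (simp add: v_act l_def)
 have f3: "l b (- a)" if "y n X3 ~= 0" using act[of X3] unit[of "y n X3" b "- a"] that by (simp add: v_act l_def)
 have l1: "l 1 0" if "l c 0" "c ~= 0" for c using unit[of c 1 0] that by simp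
 have l2: "l 0 1" if "l 0 c" "c ~= 0" for c using unit[of c 0 1] that by simp
 have neg: "l (- c) (- d)" if "l c d" for c d using l_s[OF that, of "- 1"] by simp
 have pair: "l 1 0 & l 0 1" if "l c d" "l c (- d)" "c ~= 0" "d ~= 0" for c d
 proof -
  have "l (2 * c) 0" "l 0 (2 * d)" using l_add[OF that(1,2)] l_add[OF that(1) neg[OF that(2)]] by (simp_all flip: mult_2)
  then show ?thesis using l1[of "2 * c"] l2[of "2 * d"] that two by simp
 qed
 have "l 1 0 & l 0 1"
 proof (cases "a = 0 \<or> b = 0")
  case False
  then show ?thesis
   using pair[of a b] pair[of b a] f0 f1 f2 f3 one_zero[of X0 X2] one_zero[of X0 X3] one_zero[of X1 X2] one_zero[of X1 X3] by blast
 next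
  case True
  have 01: "y n X0 ~= 0 \<or> y n X1 ~= 0" and 23: "y n X2 ~= 0 \<or> y n X3 ~= 0" using one_zero by blast+
  show ?thesis
  proof (cases "b = 0")
   case b: True
   have "l a 0" using f0 f1 01 b by auto
   moreover have "l 0 a \<or> l 0 (- a)" using f2 f3 23 b by auto
   ultimately show ?thesis using l1[of a] l2[of a] l2[of "- a"] ab b by auto
  next
   case False
   then have a: "a = 0" using True by simp
   have "l b 0" using f2 f3 23 a by auto
   moreover have "l 0 b \<or> l 0 (- b)" using f0 f1 01 a by auto
   ultimately show ?thesis using l1[of b] l2[of b] l2[of "- b"] False by auto
  qed
 qed
 then have all: "l c d" for c d using l_add[OF l_s[of 1 0 c] l_s[of 0 1 d]] by simp
 show ?thesis
 proof
  fix x assume "x \<in> piece P (Suc n)"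
  then show "x \<in> L" using piece_v all unfolding l_def by blast
 qed
qed

lemma piece_spread:
 assumes L: "P.sub L" and act: "!!x i. x \<in> L ==> act P x (bw [i]) \<in> L" and x: "x \<in> L" "x \<in> piece P n" "x ~= \<zero>\<^bsub>P\<^esub>"
  and m: "m > n"
 shows "piece P m <= L"
 using m
proof (induction m)
 case (Suc m)
 show ?case
 proof (cases "m = n")
  case True
  obtain a b where ab: "x = v n a b" using piece_v[OF x(2)] by blast
  then show ?thesis using spread[OF L, of n a b] act[OF x(1)] x(3) v_zero True by auto
 next
  case False
  then have "v m 1 0 \<in> L" using Suc v_piece by fastforce
  then show ?thesis using spread[OF L, of m 1 0] act by auto
 qed
qed simp

lemma piece_0_generates: "P.sub L ==> (!!x i. x \<in> L ==> act P x (bw [i]) \<in> L) ==> piece P 0 <= L ==> L = carrier P"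
proof -
 assume L: "P.sub L" "!!x i. x \<in> L ==> act P x (bw [i]) \<in> L" "piece P 0 <= L"
 have "v 0 1 0 \<in> L" using L(3) v_piece by blast
 then have pc: "piece P n <= L" for n
  using piece_spread[OF L(1,2), of "v 0 1 0" 0 n] L(3) v_zero[of 0 1 0] by (cases "n = 0") auto
 have "x \<in> L" if "x \<in> carrier P" for x
  using P.comps_in[OF that L(1)] pc P.comp_piece[OF that] by blast
 then show "L = carrier P" using P.subD(1)[OF L(1)] by blast
qed

lemma generated_0: "generates TW P (piece P 0)"
 unfolding generates_def
proof (intro conjI allI impI)
 show "piece P 0 <= carrier P" by (rule P.pD(1))
 fix L assume "right_submodule TW P L & piece P 0 <= L"
 then show "L = carrier P" using piece_0_generates[of L] P.right_submoduleD bw_carrier by metis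
qed

lemma fin_gen: "finitely_generated TW P"
proof -
 have "generates TW P {v 0 1 0, v 0 0 1}"
  unfolding generates_def
 proof (intro conjI allI impI)
  show "{v 0 1 0, v 0 0 1} <= carrier P" by auto
  fix L assume L: "right_submodule TW P L & {v 0 1 0, v 0 0 1} <= L"
  note s = P.right_submoduleD[of L]
  have "piece P 0 <= L"
  proof
   fix x assume "x \<in> piece P 0"
   then obtain a b where x: "x = v 0 a b" using piece_v by blast
   then have "x = a \<odot>\<^bsub>P\<^esub> v 0 1 0 \<oplus>\<^bsub>P\<^esub> b \<odot>\<^bsub>P\<^esub> v 0 0 1" by (simp add: v_add v_smult)
   then show "x \<in> L" using L s P.subD(3,4) by auto
  qed
  then show "L = carrier P" using L generated_0 unfolding generates_def by blast
 qed
 then show ?thesis unfolding finitely_generated_def by (intro exI[of _ "{v 0 1 0, v 0 0 1}"]) simp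
qed

lemma fin_codim:
 assumes N: "graded_submodule TW P N" "N ~= {\<zero>\<^bsub>P\<^esub>}"
 shows "Defs.fin_dim (quot_module P N)"
proof -
 note gs = P.graded_submoduleD[OF N(1)]
 obtain x where x: "x \<in> N" "x ~= \<zero>\<^bsub>P\<^esub>" using N(2) P.subD(2)[OF gs(1)] by blast
 have xc: "x \<in> carrier P" using P.subD(5)[OF gs(1) x(1)] .
 obtain n where n: "P.comp n x ~= \<zero>\<^bsub>P\<^esub>" using P.eq_by_comps[OF xc, of "\<zero>\<^bsub>P\<^esub>"] x(2) by auto
 have "piece P m <= N" if "m >= Suc n" for m
  using piece_spread[OF gs(1,2) gs(3)[OF x(1)] P.comp_piece[OF xc] n, of m] that by simp
 then have "cofinite_sub TW P N" by (rule P.cofinite_subI[OF fin_gen N(1)])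
 then show ?thesis by (simp add: cofinite_sub_def)
qed

end

lemma (in kspace) dim_2:
 assumes ab: "a \<in> N" "b \<in> N" and N: "sub N" and span: "!!x. x \<in> N ==> EX c d. x = c \<odot> a \<oplus> d \<odot> b"
  and indep: "!!c d. c \<odot> a \<oplus> d \<odot> b = \<zero> ==> c = 0 & d = 0"
 shows "Defs.fin_dim (V\<lparr>carrier := N\<rparr>)" "dimension (V\<lparr>carrier := N\<rparr>) = 2"
proof -
 interpret N: kspace "V\<lparr>carrier := N\<rparr>" by (rule sub_kspace[OF N])
 have abc: "a \<in> carrier V" "b \<in> carrier V" using ab subD(5)[OF N] by auto
 have ne: "a ~= b" using indep[of 1 "- 1"] diff_zero[of a b] abc by auto
 have S: "{a, b} <= carrier (V\<lparr>carrier := N\<rparr>)" using ab by simp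
 have gen: "N.span {a, b} = carrier (V\<lparr>carrier := N\<rparr>)"
 proof
  show "N.span {a, b} <= carrier (V\<lparr>carrier := N\<rparr>)" by (rule N.span_is_subset2[OF S])
  note s = N.subD[OF N.span_sub[OF S]]
  have "a \<in> N.span {a, b}" "b \<in> N.span {a, b}" using N.in_own_span[OF S] by auto
  then show "carrier (V\<lparr>carrier := N\<rparr>) <= N.span {a, b}" using span s(3,4) by fastforce
 qed
 have li: "N.lin_indpt {a, b}"
 proof (rule N.finite_lin_indpt2)
  fix f assume "f \<in> {a, b} \<rightarrow> carrier class_ring" "N.lincomb f {a, b} = \<zero>\<^bsub>V\<lparr>carrier := N\<rparr>\<^esub>"
  then have "f a \<odot> a \<oplus> f b \<odot> b = \<zero>"
   using N.finsum_insert[of "{b}" a "%x. f x \<odot> x"] N.sc[of a "f a"] N.sc[of b "f b"] ab abc ne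
   by (simp add: N.lincomb_def)
  then show "\<forall>x\<in>{a, b}. f x = \<zero>\<^bsub>class_ring\<^esub>" using indep by (auto simp: class_ring_simps)
 qed (use S in auto)
 show "Defs.fin_dim (V\<lparr>carrier := N\<rparr>)" unfolding N.fin_dim_def using gen S by (intro exI[of _ "{a, b}"]) simp
 have "N.basis {a, b}" using li gen S by (simp add: N.basis_def)
 then show "dimension (V\<lparr>carrier := N\<rparr>) = 2" using N.dim_basis[of "{a, b}"] ne by simp
qed

context fat_point
begin

lemma hilbert: "has_hilbert_series P (of_nat 2 / (1 - fps_X))"
proof -
 have d: "Defs.fin_dim (P\<lparr>carrier := piece P n\<rparr>)" "dimension (P\<lparr>carrier := piece P n\<rparr>) = 2" for n
 proof -
  have s: "EX c d. x = c \<odot>\<^bsub>P\<^esub> v n 1 0 \<oplus>\<^bsub>P\<^esub> d \<odot>\<^bsub>P\<^esub> v n 0 1" if "x \<in> piece P n" for x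
   using piece_v[OF that] by (auto simp: v_add v_smult)
  have i: "c = 0 & d = 0" if "c \<odot>\<^bsub>P\<^esub> v n 1 0 \<oplus>\<^bsub>P\<^esub> d \<odot>\<^bsub>P\<^esub> v n 0 1 = \<zero>\<^bsub>P\<^esub>" for c d
   using that by (simp add: v_add v_smult v_zero)
  show "Defs.fin_dim (P\<lparr>carrier := piece P n\<rparr>)" "dimension (P\<lparr>carrier := piece P n\<rparr>) = 2"
   by (rule P.dim_2[OF v_piece v_piece P.piece_sub s i]; assumption)+
 qed
 have "(of_nat 2 / (1 - fps_X) :: rat fps) = of_nat 2 * (1 / (1 - fps_X))"
  by (simp add: fps_divide_unit)
 also have "... = 1 / (1 - fps_X) + 1 / (1 - fps_X)" unfolding of_nat_numeral by (rule mult_2)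
 also have "... = Abs_fps (%n. 2)" unfolding fps_geometric
  by (rule fps_ext) (simp only: fps_add_nth fps_nth_Abs_fps one_add_one)
 finally have h: "(of_nat 2 / (1 - fps_X) :: rat fps) = Abs_fps (%n. 2)" .
 show ?thesis unfolding has_hilbert_series_def h using d by simp
qed

lemma is_fat_point_module: "fat_point_module TW 2 P"
 unfolding fat_point_module_def using P.gm hilbert generated_0 fin_codim by blast

end

section \<open>Gelfand-Kirillov dimension\<close>

lemma (in kspace) dim_le_card:
 assumes U: "finite U" "U <= carrier V" and N: "sub N" "N <= span U"
 shows "Defs.fin_dim (V\<lparr>carrier := N\<rparr>)" "dimension (V\<lparr>carrier := N\<rparr>) <= card U"
proof -
 interpret N: kspace "V\<lparr>carrier := N\<rparr>" by (rule sub_kspace[OF N(1)])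
 have W: "sub (span U)" by (rule span_sub[OF U(2)])
 interpret W: kspace "V\<lparr>carrier := span U\<rparr>" by (rule sub_kspace[OF W])
 obtain T where T: "finite T" "T <= N" "N = span T" using sub_fin_span[OF U N] by blast
 have "N.span T = N" using span_li_not_depend(1)[OF T(2) N(1)] T(3) by simp
 then show fd: "Defs.fin_dim (V\<lparr>carrier := N\<rparr>)" unfolding N.fin_dim_def using T(1,2) by (intro exI[of _ T]) simp
 have UW: "U <= span U" by (rule in_own_span[OF U(2)])
 have gen: "W.span U = span U" by (rule span_li_not_depend(1)[OF UW W])
 obtain b where b: "finite b" "N.basis b" using N.finite_basis_exists fd by blast
 then have bN: "b <= N" and "N.lin_indpt b" by (simp_all add: N.basis_def)
 then have "W.lin_indpt b"
  using span_li_not_depend(2)[OF bN N(1)] span_li_not_depend(2)[OF subset_trans[OF bN N(2)] W] by simp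
 then have "card b <= card U"
  using W.li_smaller_than_gen[OF b(1) U(1)] bN N(2) UW gen by (simp add: subset_trans)
 then show "dimension (V\<lparr>carrier := N\<rparr>) <= card U" using N.dim_basis[OF b] by simp
qed

text \<open>A bound C n^k gives ln C / ln n + k for the quotient of logarithms, and the first term
  tends to 0.\<close>

lemma GKdim_upper:
 assumes "!!V F. finite V ==> V <= carrier R ==> finite F ==> F <= carrier M ==>
  \<exists>C\<ge>1. \<forall>n\<ge>1. real (dimension (M\<lparr>carrier := growth M V F n\<rparr>)) <= C * real n ^ k"
 shows "GKdim R M <= ereal (real k)"
 unfolding GKdim_def
proof (rule SUP_least, clarify)
 fix V F assume "finite V" "V <= carrier R" "finite F" "F <= carrier M"
 from assms[OF this] obtain C where C: "C >= 1"
  "!!n. n >= 1 ==> real (dimension (M\<lparr>carrier := growth M V F n\<rparr>)) <= C * real n ^ k" by blast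
 let ?d = "%n. real (dimension (M\<lparr>carrier := growth M V F n\<rparr>))"
 have le: "ln (?d n) / ln (real n) <= ln C / ln (real n) + real k" if n: "n >= 2" for n
 proof -
  have n0: "ln (real n) > 0" using n by simp
  have "ln (?d n) <= ln (C * real n ^ k)"
  proof (cases "?d n = 0")
   \<comment> \<open>Here \<open>ln 0 = 0\<close>, which stays below the bound because C is at least
     1.\<close>
   case True
   have "1 <= C * real n ^ k" using mult_mono[OF C(1), of 1 "real n ^ k"] C(1) n by simp
   then show ?thesis using True by simp
  next
   case False
   then have "0 < ?d n" by simp
   then show ?thesis using C(2)[of n] n by (subst ln_le_cancel_iff) auto
  qed
  also have "... = ln C + real k * ln (real n)" using C(1) n by (simp add: ln_mult ln_realpow)
  finally show ?thesis using n0 by (simp add: field_simps)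
 qed
 have "(%n. ln C / ln (real n) + real k) \<longlonglongrightarrow> 0 + real k"
 proof (intro tendsto_add tendsto_const)
  have "filterlim (%n. ln (real n)) at_top sequentially"
   by (rule filterlim_compose[OF ln_at_top filterlim_real_sequentially])
  then show "(%n. ln C / ln (real n)) \<longlonglongrightarrow> 0"
   by (intro tendsto_divide_0[OF tendsto_const] filterlim_at_top_imp_at_infinity)
 qed
 then have "limsup (%n. ereal (ln C / ln (real n) + real k)) = ereal (real k)"
  by (intro lim_imp_Limsup) auto
 moreover have "limsup (%n. ereal (ln (?d n) / ln (real n))) <= limsup (%n. ereal (ln C / ln (real n) + real k))"
  by (intro Limsup_mono eventually_mono[OF eventually_ge_at_top[of 2]]) (simp add: le)
 ultimately show "limsup (%n. ereal (ln (?d n) / ln (real n))) <= ereal (real k)" by simp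
qed

lemma GKdim_lower:
 assumes "finite V" "V <= carrier R" "\<one>\<^bsub>R\<^esub> \<in> V" "finite F" "F <= carrier M"
  and d: "!!n. dimension (M\<lparr>carrier := growth M V F n\<rparr>) >= n"
 shows "GKdim R M >= 1"
proof -
 let ?d = "%n. real (dimension (M\<lparr>carrier := growth M V F n\<rparr>))"
 have "1 <= ln (?d n) / ln (real n)" if "n >= 2" for n
  using d[of n] that by (simp add: le_divide_eq)
 then have "limsup (%n. 1 :: ereal) <= limsup (%n. ereal (ln (?d n) / ln (real n)))"
  by (intro Limsup_mono eventually_mono[OF eventually_ge_at_top[of 2]]) (simp add: one_ereal_def)
 then have "1 <= limsup (%n. ereal (ln (?d n) / ln (real n)))" by (simp add: Limsup_const)
 also have "... <= GKdim R M"
  unfolding GKdim_def by (rule SUP_upper2[of "(V, F)"]) (use assms in auto)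
 finally show ?thesis .
qed

section \<open>Degree bounds for growth\<close>

context gmod
begin

definition upto :: "nat => 'm set" where "upto k = {x \<in> carrier M. \<forall>j>k. comp j x = \<zero>\<^bsub>M\<^esub>}"

lemma upto_sub: "sub (upto k)"
 by (rule subI) (auto simp: upto_def comp_add comp_smult)

lemma upto_mono: "k <= l ==> upto k <= upto l"
 by (auto simp: upto_def)

lemma upto_actx:
 assumes "x \<in> upto k"
 shows "x \<cdot> i \<in> upto (Suc k)"
proof -
 have x: "x \<in> carrier M" "!!j. j > k ==> comp j x = \<zero>\<^bsub>M\<^esub>" using assms by (auto simp: upto_def)
 have "comp j (x \<cdot> i) = \<zero>\<^bsub>M\<^esub>" if "j > Suc k" for j
  using that comp_actx(1)[OF x(1), of "j - 1" i] x(2)[of "j - 1"] by simp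
 then show ?thesis using x(1) by (simp add: upto_def)
qed

lemma upto_bw: "x \<in> upto k ==> act M x (bw w) \<in> upto (k + length w)"
proof (induction w arbitrary: x k)
 case (Cons i w)
 have xc: "x \<in> carrier M" using Cons.prems by (simp add: upto_def)
 have "act M (x \<cdot> i) (bw w) \<in> upto (Suc k + length w)" using Cons upto_actx by blast
 then show ?case using act_bw_append[OF xc, of "[i]" w] subD(4)[OF upto_sub] by simp
qed (simp add: upto_def)

text \<open>An element of B is a combination of words of bounded length, so it raises degrees by a
  bounded amount, uniformly in x and k.\<close>

lemma upto_act:
 assumes "b \<in> carrier B"
 shows "EX D. ALL k x. x \<in> upto k --> act M x b \<in> upto (k + D)"
 using assms
proof (induction rule: B_induct)
 case zero
 show ?case using subD(2)[OF upto_sub] by (intro exI[of _ 0]) (auto simp: upto_def)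
next
 case (add a b)
 then obtain D D' where D: "!!k x. x \<in> upto k ==> act M x a \<in> upto (k + D)" "!!k x. x \<in> upto k ==> act M x b \<in> upto (k + D')" by blast
 have "act M x (a \<oplus>\<^bsub>B\<^esub> b) \<in> upto (k + max D D')" if x: "x \<in> upto k" for k x
 proof -
  have "act M x a \<in> upto (k + max D D')" "act M x b \<in> upto (k + max D D')"
   using D(1)[OF x] D(2)[OF x] upto_mono[of "k + D" "k + max D D'"] upto_mono[of "k + D'" "k + max D D'"] by auto
  then show ?thesis using act_add_r add.hyps x subD(3)[OF upto_sub] by (simp add: upto_def)
 qed
 then show ?case by blast
next
 case (smult c a)
 then obtain D where D: "!!k x. x \<in> upto k ==> act M x a \<in> upto (k + D)" by blast
 have "act M x (c \<odot>\<^bsub>B\<^esub> a) \<in> upto (k + D)" if x: "x \<in> upto k" for k x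
 proof -
  have "x \<in> carrier M" using x by (simp add: upto_def)
  then show ?thesis using act_smult_r smult.hyps subD(4)[OF upto_sub D[OF x]] by simp
 qed
 then show ?case by blast
next
 case (bw v) show ?case using upto_bw by blast
qed

lemma growth_sub:
 assumes "V <= carrier B" "F <= carrier M"
 shows "sub (growth M V F n)"
proof (induction n)
 case 0 show ?case using span_sub[OF assms(2)] by simp
next
 case (Suc n)
 have "{act M m v |m v. m \<in> growth M V F n & v \<in> V} <= carrier M"
  using subD(5)[OF Suc] assms(1) by auto
 then show ?case using span_sub by simp
qed

lemma growth_upto:
 assumes "finite V" "V <= carrier B" "finite F" "F <= carrier M"
 shows "EX k D. ALL n. growth M V F n <= upto (k + n * D)"
proof -
 obtain k where k: "!!s n. s \<in> F ==> n >= k ==> comp n s = \<zero>\<^bsub>M\<^esub>"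
  by (rule comp_bound_finite[OF assms(3,4)]) blast
 have "\<forall>b\<in>V. EX D. ALL k x. x \<in> upto k --> act M x b \<in> upto (k + D)" using upto_act assms(2) by blast
 then obtain f where f: "!!b k x. b \<in> V ==> x \<in> upto k ==> act M x b \<in> upto (k + f b)" by metis
 let ?D = "Max (f ` V)"
 have D: "act M x b \<in> upto (j + ?D)" if "b \<in> V" "x \<in> upto j" for b x j
  using f[OF that] upto_mono[of "j + f b" "j + ?D"] that(1) assms(1) by auto
 have "growth M V F n <= upto (k + n * ?D)" for n
 proof (induction n)
  case 0
  have "F <= upto k" using k assms(4) by (auto simp: upto_def)
  then show ?case using span_least upto_sub by simp
 next
  case (Suc n)
  have "{act M m v |m v. m \<in> growth M V F n & v \<in> V} <= upto (k + n * ?D + ?D)"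
   using Suc D by blast
  then show ?case using span_least[OF _ upto_sub] by (simp add: add.commute add.left_commute)
 qed
 then show ?thesis by blast
qed

end

context fat_point
begin

lemma upto_span: "P.upto k <= P.span ((%j. v j 1 0) ` {..k} Un (%j. v j 0 1) ` {..k})"
proof
 let ?U = "(%j. v j 1 0) ` {..k} Un (%j. v j 0 1) ` {..k}"
 have U: "?U <= carrier P" by auto
 note s = P.subD[OF P.span_sub[OF U]]
 fix x assume "x \<in> P.upto k"
 then have x: "x \<in> carrier P" "!!j. j > k ==> P.comp j x = \<zero>\<^bsub>P\<^esub>" by (auto simp: P.upto_def)
 show "x \<in> P.span ?U"
 proof (rule P.comps_in[OF x(1) P.span_sub[OF U]])
  fix n
  show "P.comp n x \<in> P.span ?U"
  proof (cases "n <= k")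
   case True
   obtain a b where "P.comp n x = v n a b" using piece_v[OF P.comp_piece[OF x(1)]] by blast
   also have "... = a \<odot>\<^bsub>P\<^esub> v n 1 0 \<oplus>\<^bsub>P\<^esub> b \<odot>\<^bsub>P\<^esub> v n 0 1" by (simp add: v_add v_smult)
   finally have eq: "P.comp n x = a \<odot>\<^bsub>P\<^esub> v n 1 0 \<oplus>\<^bsub>P\<^esub> b \<odot>\<^bsub>P\<^esub> v n 0 1" .
   have "v n 1 0 \<in> P.span ?U" "v n 0 1 \<in> P.span ?U" using P.in_own_span[OF U] True by auto
   then show ?thesis unfolding eq using s(3,4) by blast
  next
   case False
   then show ?thesis using x(2)[of n] s(2) by simp
  qed
 qed
qed

lemma GKdim_le: "GKdim TW P <= 1"
proof -
 have "GKdim TW P <= ereal (real 1)"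
 proof (rule GKdim_upper)
  fix V F assume V: "finite V" "V <= carrier TW" and F: "finite F" "F <= carrier P"
  have VB: "V <= carrier B" using V(2) by (simp add: TW_simps)
  obtain k D where kD: "!!n. growth P V F n <= P.upto (k + n * D)" using P.growth_upto[OF V(1) VB F] by blast
  have "real (dimension (P\<lparr>carrier := growth P V F n\<rparr>)) <= real (2 * (k + D + 1)) * real n ^ 1" if n: "n >= 1" for n
  proof -
   let ?k = "k + n * D"
   let ?U = "(%j. v j 1 0) ` {..?k} Un (%j. v j 0 1) ` {..?k}"
   have "dimension (P\<lparr>carrier := growth P V F n\<rparr>) <= card ?U"
    by (rule P.dim_le_card(2)[OF _ _ P.growth_sub[OF VB F(2)] subset_trans[OF kD upto_span]]) auto
   also have "... <= card ((%j. v j 1 0) ` {..?k}) + card ((%j. v j 0 1) ` {..?k})" by (rule card_Un_le)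
   also have "... <= card {..?k} + card {..?k}" by (intro add_mono card_image_le) auto
   also have "... = 2 * (k + n * D + 1)" by simp
   also have "... <= 2 * (k + D + 1) * n"
   proof -
    have "k + n * D + 1 <= k * n + n * D + n" using n by (intro add_mono) auto
    then show ?thesis by (simp add: algebra_simps)
   qed
   finally show ?thesis unfolding power_one_right of_nat_mult[symmetric] of_nat_le_iff .
  qed
  then show "\<exists>C\<ge>1. \<forall>n\<ge>1. real (dimension (P\<lparr>carrier := growth P V F n\<rparr>)) <= C * real n ^ 1"
   by (intro exI[of _ "real (2 * (k + D + 1))"]) auto
 qed
 then show ?thesis by (simp add: one_ereal_def)
qed

lemma comp_finsum:
 assumes "finite S" "!!i. i \<in> S ==> f i \<in> carrier P"
 shows "P.comp n (finsum P f S) = finsum P (%i. P.comp n (f i)) S"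
 using assms
proof (induction S)
 case (insert i S)
 then show ?case by (simp add: P.comp_add Pi_def P.M.finsum_closed)
qed simp

lemma dim_ge:
 assumes G: "P.sub G" "Defs.fin_dim (P\<lparr>carrier := G\<rparr>)" and v: "!!j. j < n ==> v j 1 0 \<in> G"
 shows "n <= dimension (P\<lparr>carrier := G\<rparr>)"
proof -
 interpret G: kspace "P\<lparr>carrier := G\<rparr>" by (rule P.sub_kspace[OF G(1)])
 let ?A = "(%j. v j 1 0) ` {..<n}"
 have inj: "inj_on (%j. v j 1 0) {..<n}"
 proof (rule inj_onI)
  fix i j assume "v i 1 0 = v j 1 0"
  then show "i = j" using P.comp_homog[OF v_piece, of i j 1 0] P.comp_homog[OF v_piece, of i i 1 0] v_zero[of i 1 0] by (auto split: if_splits)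
 qed
 have AG: "?A <= carrier (P\<lparr>carrier := G\<rparr>)" using v by auto
 have "G.lin_indpt ?A"
 proof (rule G.finite_lin_indpt2)
  fix f assume "f \<in> ?A \<rightarrow> carrier class_ring" and z: "G.lincomb f ?A = \<zero>\<^bsub>P\<lparr>carrier := G\<rparr>\<^esub>"
  have "P.lincomb f ?A = G.lincomb f ?A"
   by (rule P.lincomb_not_depend[OF _ _ G(1)]) (use AG in \<open>auto simp: class_ring_simps\<close>)
  then have "finsum P (%x. f x \<odot>\<^bsub>P\<^esub> x) ?A = \<zero>\<^bsub>P\<^esub>" using z by (simp add: P.lincomb_def)
  moreover have "finsum P (%x. f x \<odot>\<^bsub>P\<^esub> x) ?A = finsum P (%j. f (v j 1 0) \<odot>\<^bsub>P\<^esub> v j 1 0) {..<n}"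
   by (rule P.M.finsum_reindex[OF _ inj]) auto
  ultimately have z: "finsum P (%j. f (v j 1 0) \<odot>\<^bsub>P\<^esub> v j 1 0) {..<n} = \<zero>\<^bsub>P\<^esub>" by simp
  have "f (v i 1 0) = 0" if i: "i < n" for i
  proof -
   have "\<zero>\<^bsub>P\<^esub> = finsum P (%j. P.comp i (f (v j 1 0) \<odot>\<^bsub>P\<^esub> v j 1 0)) {..<n}"
    using arg_cong[OF z, of "P.comp i"] by (subst (asm) comp_finsum) auto
   also have "... = finsum P (%j. if i = j then f (v i 1 0) \<odot>\<^bsub>P\<^esub> v i 1 0 else \<zero>\<^bsub>P\<^esub>) {..<n}"
    by (rule P.M.finsum_cong') (auto simp: v_smult P.comp_homog[OF v_piece])
   also have "... = f (v i 1 0) \<odot>\<^bsub>P\<^esub> v i 1 0"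
    using i by (subst P.M.add.finprod_singleton) auto
   finally show ?thesis by (simp add: v_smult) (metis v_zero)
  qed
  then show "\<forall>x\<in>?A. f x = \<zero>\<^bsub>class_ring\<^esub>" by (auto simp: class_ring_simps)
 qed (use AG in auto)
 then have "card ?A <= G.dim" using G.li_le_dim(2)[OF G(2) AG] by simp
 then show ?thesis using card_image[OF inj] by simp
qed

lemma GKdim_ge: "GKdim TW P >= 1"
proof (rule GKdim_lower)
 \<comment> \<open>Including the unit makes the spaces increasing, so the n-th one contains all
   pieces up to degree n.\<close>
 let ?V = "insert (bw []) (range (%i. bw [i]))" and ?F = "{v 0 1 0, v 0 0 1}"
 show V: "finite ?V" "?V <= carrier TW" "\<one>\<^bsub>TW\<^esub> \<in> ?V" by (auto simp: TW_simps bw_Nil)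
 show F: "finite ?F" "?F <= carrier P" by auto
 have VB: "?V <= carrier B" by auto
 note G = P.growth_sub[OF VB F(2)]
 have acts: "{act P m w |m w. m \<in> growth P ?V ?F n & w \<in> ?V} <= growth P ?V ?F (Suc n)" for n
 proof -
  have "{act P m w |m w. m \<in> growth P ?V ?F n & w \<in> ?V} <= carrier P"
   using P.subD(5)[OF G] VB by auto
  from P.in_own_span[OF this] show ?thesis by simp
 qed
 have act: "act P m w \<in> growth P ?V ?F (Suc n)" if "m \<in> growth P ?V ?F n" "w \<in> ?V" for m w n
  using acts[of n] that by blast
 have "j <= n ==> piece P j <= growth P ?V ?F n" for j n
 proof (induction n arbitrary: j)
  case 0
  show ?case
  proof
   fix x assume "x \<in> piece P j"
   then obtain a b where x: "x = v 0 a b" using piece_v 0 by blast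
   have "v 0 1 0 \<in> growth P ?V ?F 0" "v 0 0 1 \<in> growth P ?V ?F 0" using P.in_own_span[OF F(2)] by auto
   moreover have "x = a \<odot>\<^bsub>P\<^esub> v 0 1 0 \<oplus>\<^bsub>P\<^esub> b \<odot>\<^bsub>P\<^esub> v 0 0 1" by (simp add: x v_add v_smult)
   ultimately show "x \<in> growth P ?V ?F 0" using P.subD(3,4)[OF G[of 0]] by blast
  qed
 next
  case (Suc n)
  show ?case
  proof (cases "j <= n")
   case True
   show ?thesis
   proof
    fix x assume "x \<in> piece P j"
    then have "x \<in> growth P ?V ?F n" "x \<in> carrier P" using Suc.IH[OF True] P.pD(5) by blast+
    then show "x \<in> growth P ?V ?F (Suc n)" using act[of x n "bw []"] P.act_Nil by simp
   qed
  next
   case False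
   then have j: "j = Suc n" using Suc.prems by simp
   have "v n 1 0 \<in> growth P ?V ?F n" using Suc.IH[of n] v_piece by blast
   then show ?thesis unfolding j using spread[OF G[of "Suc n"], of n 1 0] act by auto
  qed
 qed
 then have "v j 1 0 \<in> growth P ?V ?F n" if "j < n" for j n using that v_piece less_imp_le by blast
 moreover have "Defs.fin_dim (P\<lparr>carrier := growth P ?V ?F n\<rparr>)" for n
 proof -
  obtain k D where kD: "!!n. growth P ?V ?F n <= P.upto (k + n * D)" using P.growth_upto[OF V(1) VB F] by blast
  show ?thesis
   by (rule P.dim_le_card(1)[OF _ _ G subset_trans[OF kD upto_span]]) auto
 qed
 ultimately show "n <= dimension (P\<lparr>carrier := growth P ?V ?F n\<rparr>)" for n
  using dim_ge[OF G] by blast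
qed

lemma GKdim_quot:
 assumes N: "graded_submodule TW P N" "N ~= {\<zero>\<^bsub>P\<^esub>}"
 shows "GKdim TW (quot_module P N) < 1"
proof -
 note gs = P.graded_submoduleD[OF N(1)]
 interpret K: kspace "quot_module P N" by (rule P.quot_kspace[OF gs(1)])
 let ?Q = "quot_module P N"
 have "Defs.fin_dim ?Q" by (rule fin_codim[OF N])
 then obtain S where S: "finite S" "S <= carrier ?Q" "K.span S = carrier ?Q" unfolding K.fin_dim_def by blast
 have actc: "act ?Q X b \<in> carrier ?Q" if "X \<in> carrier ?Q" "b \<in> carrier B" for X b
  using that P.quot_act[OF gs(1) _ that(2)] gs(4) by (auto simp: P.quot_carrier[OF gs(1)])
 have "GKdim TW ?Q <= ereal (real 0)"
 proof (rule GKdim_upper)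
  fix V F assume V: "finite V" "V <= carrier TW" and F: "finite F" "F <= carrier ?Q"
  have G: "K.sub (growth ?Q V F n)" for n
  proof (induction n)
   case 0 show ?case using K.span_sub[OF F(2)] by simp
  next
   case (Suc n)
   have "{act ?Q m v |m v. m \<in> growth ?Q V F n & v \<in> V} <= carrier ?Q"
    using K.subD(5)[OF Suc] V(2) actc by (auto simp: TW_simps)
   then show ?case using K.span_sub by simp
  qed
  have "real (dimension (?Q\<lparr>carrier := growth ?Q V F n\<rparr>)) <= real (card S + 1) * real n ^ 0" for n
  proof -
   have "dimension (?Q\<lparr>carrier := growth ?Q V F n\<rparr>) <= card S"
    by (rule K.dim_le_card(2)[OF S(1,2) G]) (use K.subD(1)[OF G] S(3) in simp)
   then show ?thesis by simp
  qed
  then show "\<exists>C\<ge>1. \<forall>n\<ge>1. real (dimension (?Q\<lparr>carrier := growth ?Q V F n\<rparr>)) <= C * real n ^ 0"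
   by (intro exI[of _ "real (card S + 1)"]) auto
 qed
 also have "ereal (real 0) < 1" by (simp add: one_ereal_def)
 finally show ?thesis .
qed

lemma is_one_critical: "one_critical TW P"
 unfolding one_critical_def
 using P.gm fin_gen GKdim_le GKdim_ge GKdim_quot antisym by blast

end

section \<open>Functionals on modules over \<open>B\<close>\<close>

context sklyanin_curve
begin

text \<open>The graph of the isomorphism from the degree-n part of B to \<open>F n\<close>, as the
  joint image of the forms. By \<open>Z_zero\<close> the function determines the element of B, and
  no inverse has to be chosen.\<close>

definition Z :: "nat => ('k elem_B \<times> ('p => 'k)) set" where "Z n = range (%t. (bform n t, fn n t))"

lemma bform_pB: "bform n t = pB (%w. \<Sum>x\<in>words n. t x * mono x w)"
 unfolding bform_def using pB_sum[OF finite_words, of t "%w. w" n] by simp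

lemma Z_in: "(b, f) \<in> Z n ==> b \<in> carrier B" "(b, f) \<in> Z n ==> f \<in> F n"
 by (auto simp: Z_def bform_def intro!: B.finsum_closed)

lemma Z_ex: "f \<in> F n ==> EX b. (b, f) \<in> Z n"
 by (auto simp: Z_def F_def)

lemma Z_add: "(b, f) \<in> Z n ==> (b', f') \<in> Z n ==> (b \<oplus>\<^bsub>B\<^esub> b', %p. f p + f' p) \<in> Z n"
proof -
 have "bform n s \<oplus>\<^bsub>B\<^esub> bform n t = bform n (%w. s w + t w)" for s t
  unfolding bform_def by (subst B.finsum_addf[symmetric]) (auto simp: B.smult_l_distr)
 then show "(b, f) \<in> Z n ==> (b', f') \<in> Z n ==> (b \<oplus>\<^bsub>B\<^esub> b', %p. f p + f' p) \<in> Z n"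
  by (auto simp: Z_def fn_add fun_eq_iff image_iff)
qed

lemma Z_smult: "(b, f) \<in> Z n ==> (c \<odot>\<^bsub>B\<^esub> b, %p. c * f p) \<in> Z n"
proof -
 have "c \<odot>\<^bsub>B\<^esub> bform n t = bform n (%w. c * t w)" for t
  unfolding bform_def by (subst finsum_smult) (auto simp: B.smult_smult)
 then show "(b, f) \<in> Z n ==> (c \<odot>\<^bsub>B\<^esub> b, %p. c * f p) \<in> Z n"
  by (auto simp: Z_def fn_scale fun_eq_iff image_iff)
qed

lemma Z_zero: "(b, f) \<in> Z n ==> (!!p. p \<in> E ==> f p = 0) ==> b = \<zero>\<^bsub>B\<^esub>"
 using bform_zero unfolding Z_def by (force simp: fn_def)

lemma Z_one: "EX f. (bw [], f) \<in> Z 0"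
proof -
 have "words 0 = {[]}" by (auto simp: words_def)
 then have "bform 0 (%w. 1) = bw []" by (simp add: bform_def B.smult_one)
 then show ?thesis unfolding Z_def by (intro exI[of _ "fn 0 (%w. 1)"] image_eqI[of _ _ "%w. 1"]) auto
qed

lemma Z_mult:
 assumes "(b, f) \<in> Z n"
 shows "(b \<otimes>\<^bsub>B\<^esub> bw [i], tw n f (xx i)) \<in> Z (Suc n)"
proof -
 obtain t where t: "b = bform n t" "f = fn n t" using assms by (auto simp: Z_def)
 define s where "s u = (\<Sum>w\<in>words n. t w * mono (w @ [i]) u)" for u
 have mono: "(\<Sum>u\<in>words m. g u * mono x u) = (if length x = m then g x else 0)" for g :: "gen list => 'k" and x m
  by (simp add: mono_def if_distrib[of "%z. _ * z"] sum.delta' cong: if_cong)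
 have s: "(\<Sum>x\<in>words (Suc n). s x * mono x u) = s u" for u
 proof -
  have "(\<Sum>x\<in>words (Suc n). s x * mono x u) = (if length u = Suc n then s u else 0)"
   by (simp add: mono_def if_distrib[of "%z. _ * z"] cong: if_cong)
  then show ?thesis by (auto simp: s_def mono_def intro!: sum.neutral)
 qed
 have "b \<otimes>\<^bsub>B\<^esub> bw [i] = finsum B (%w. t w \<odot>\<^bsub>B\<^esub> bw (w @ [i])) (words n)"
  unfolding t bform_def by (subst B.finsum_ldistr) (auto simp: B.smult_mult bw_mult)
 also have "... = bform (Suc n) s"
  unfolding bform_pB s unfolding s_def by (rule pB_sum[symmetric]) simp
 finally have 1: "b \<otimes>\<^bsub>B\<^esub> bw [i] = bform (Suc n) s" .
 have "form (Suc n) s p = form n t p * Y ((\<sigma> ^^ n) p) i" for p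
 proof -
  have "form (Suc n) s p = (\<Sum>w\<in>words n. t w * (\<Sum>u\<in>words (Suc n). ev p u * mono (w @ [i]) u))"
   unfolding form_def s_def sum_distrib_left sum_distrib_right by (subst sum.swap) (simp add: mult_ac)
  also have "... = (\<Sum>w\<in>words n. t w * ev p (w @ [i]))" by (intro sum.cong) (auto simp: mono)
  finally show ?thesis by (simp add: form_def sum_distrib_right ev_append mult.assoc)
 qed
 then have "tw n f (xx i) = fn (Suc n) s" by (auto simp: t tw_def fn_def xx_apply fun_eq_iff)
 with 1 show ?thesis by (simp add: Z_def)
qed

end

text \<open>Passing to a tail puts all generators into the single degree n0; the functional is only
  wanted in large degrees.\<close>

locale test_module = sklyanin_curve \<alpha> \<beta> \<gamma> E \<sigma> Y + gmod \<alpha> \<beta> \<gamma> "alg_B \<alpha> \<beta> \<gamma>" "%_ _. 1" M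
 for \<alpha> \<beta> \<gamma> :: "'k::alg_closed_field" and E :: "'p set" and \<sigma> Y
  and M :: "('k, 'm, 'k elem_B) graded_rmodule" +
 fixes n0 :: nat and T :: "'m set"
 assumes T: "finite T" "T <= piece M n0" "piece M n0 <= span T"
  and gen: "!!n. n >= n0 ==> piece M (Suc n) <= span (next_gens (piece M n))"
  and inf: "!!k. \<exists>n\<ge>k. ~ piece M n <= {\<zero>\<^bsub>M\<^esub>}"
begin

definition gsub :: "'m set => 'm set" where "gsub W = \<Inter> {N. sub N & (\<forall>m\<in>N. ALL i. m \<cdot> i \<in> N) & W <= N}"

lemma gsub_least: "sub N ==> (!!m i. m \<in> N ==> m \<cdot> i \<in> N) ==> W <= N ==> gsub W <= N"
 unfolding gsub_def by blast

lemma gsub: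
 assumes "W <= carrier M"
 shows "sub (gsub W)" "m \<in> gsub W ==> m \<cdot> i \<in> gsub W" "W <= gsub W"
proof -
 have c: "gsub W <= carrier M" using gsub_least[OF sub_carrier, of W] assms by auto
 show "sub (gsub W)" using c by (rule subI) (auto simp: gsub_def subD)
qed (auto simp: gsub_def)

definition evfull :: "'m set => bool" where "evfull X \<longleftrightarrow> (EX k. \<forall>n\<ge>k. piece M n <= X)"

lemma not_evfull_empty: "~ evfull (gsub {})"
proof
 assume "evfull (gsub {})"
 moreover have "gsub {} <= {\<zero>\<^bsub>M\<^esub>}" by (rule gsub_least) (auto intro!: subI)
 ultimately show False using inf unfolding evfull_def by (metis subset_trans)
qed

lemma evfull_T: "evfull (gsub T)"
proof -
 have Tc: "T <= carrier M" using T(2) pD(1) by blast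
 note g = gsub[OF Tc]
 have "piece M n <= gsub T" if "n >= n0" for n
  using that
 proof (induction n rule: dec_induct)
  case base show ?case using T(3) span_least[OF g(3,1)] by (rule subset_trans)
 next
  case (step n)
  then have "next_gens (piece M n) <= gsub T" using g(2) by (auto simp: next_gens_def)
  then show ?case using gen[OF step.hyps(1)] span_least[OF _ g(1)] by blast
 qed
 then show ?thesis unfolding evfull_def by blast
qed

text \<open>Add the generators one at a time, and stop when the submodule first contains a tail.
  Modulo the submodule reached just before, the tail is cyclic and still not finite
  dimensional.\<close>

lemma critical_generator:
 obtains W v where "W <= piece M n0" "v \<in> piece M n0" "~ evfull (gsub W)" "evfull (gsub (insert v W))"
proof -
 have "EX W v. W <= S & v \<in> S & ~ evfull (gsub W) & evfull (gsub (insert v W))" if "finite S" "evfull (gsub S)" for S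
  using that
 proof (induction S)
  case (insert x S)
  then show ?case by (cases "evfull (gsub S)") blast+
 qed (simp add: not_evfull_empty)
 from this[OF T(1) evfull_T] obtain W v where "W <= T" "v \<in> T" "~ evfull (gsub W)" "evfull (gsub (insert v W))"
  by blast
 then show ?thesis using that[of W v] T(2) by blast
qed

text \<open>Modulo the submodule \<open>L\<close> generated by W, a tail of M is generated by v
  alone. The functions whose action on v ends in \<open>L\<close> form a proper right ideal, and the
  functional of \<open>point_functional\<close> for it descends to M.\<close>

lemma functional:
 obtains q k \<Lambda> where "q \<in> E"
  "!!n u u'. n >= k ==> u \<in> piece M n ==> u' \<in> piece M n ==> \<Lambda> n (u \<oplus>\<^bsub>M\<^esub> u') = \<Lambda> n u + (\<Lambda> n u' :: 'k)"
  "!!n u c. n >= k ==> u \<in> piece M n ==> \<Lambda> n (c \<odot>\<^bsub>M\<^esub> u) = c * \<Lambda> n u"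
  "!!n u i. n >= k ==> u \<in> piece M n ==> \<Lambda> (Suc n) (u \<cdot> i) = Y ((\<sigma> ^^ n) q) i * \<Lambda> n u"
  "!!n. n >= k ==> \<exists>u\<in>piece M n. \<Lambda> n u ~= 0"
proof -
 obtain W v where W: "W <= piece M n0" and v: "v \<in> piece M n0" and ev: "~ evfull (gsub W)" "evfull (gsub (insert v W))"
  by (rule critical_generator)
 have Wc: "W <= carrier M" and vc: "v \<in> carrier M" using W v pD by blast+
 define L where "L = gsub W"
 have L: "sub L" "!!m i. m \<in> L ==> m \<cdot> i \<in> L" "W <= L" using gsub[OF Wc] by (simp_all add: L_def)
 note sL = subD[OF L(1)]
 have Lcomp: "comp n x \<in> L" if "x \<in> L" for n x
 proof -
  have "gsub W <= {x \<in> L. ALL n. comp n x \<in> L}"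
  proof (rule gsub_least)
   show "sub {x \<in> L. ALL n. comp n x \<in> L}" by (rule subI) (use sL in \<open>auto simp: comp_add comp_smult\<close>)
   show "m \<cdot> i \<in> {x \<in> L. ALL n. comp n x \<in> L}" if m: "m \<in> {x \<in> L. ALL n. comp n x \<in> L}" for m i
   proof -
    have "comp n (m \<cdot> i) \<in> L" for n using comp_actx[of m] m L(2) sL(2,5) by (cases n) auto
    then show ?thesis using m L(2) by simp
   qed
   have "comp n x \<in> L" if "x \<in> W" for n x
    using comp_homog[of x n0 n] subsetD[OF W that] subsetD[OF L(3) that] sL(2) by simp
   then show "W <= {x \<in> L. ALL n. comp n x \<in> L}" using L(3) by blast
  qed
  then show ?thesis using that unfolding L_def by blast
 qed
 have Zv: "act M v b \<in> carrier M" if "(b, f) \<in> Z n" for b f n using vc Z_in(1)[OF that] by blast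
 have Zi: "act M v b \<cdot> i = act M v (b \<otimes>\<^bsub>B\<^esub> bw [i])" if "(b, f) \<in> Z n" for b f n i
  using act_mult[OF vc Z_in(1)[OF that] bw_carrier] by simp
 \<comment> \<open>x lies in L + v B_{n - n0}; the offset is the degree n0 of v.\<close>
 define D where "D n x \<longleftrightarrow> (\<exists>l\<in>L. EX b f. (b, f) \<in> Z (n - n0) & x = l \<oplus>\<^bsub>M\<^esub> act M v b)" for n x
 obtain g0 where g0: "(bw [], g0) \<in> Z 0" using Z_one by blast
 have Z0: "EX f. (\<zero>\<^bsub>B\<^esub>, f) \<in> Z n" for n
 proof -
  obtain b f where "(b, f) \<in> Z n" by (auto simp: Z_def)
  from Z_smult[OF this, of 0] show ?thesis using Z_in(1)[OF \<open>(b, f) \<in> Z n\<close>] by auto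
 qed
 have D: "D n x" if full: "x \<in> gsub (insert v W)" and n: "n >= n0" and x: "x \<in> piece M n" for n x
 proof -
  let ?G = "{x \<in> carrier M. ALL n. (n >= n0 --> D n (comp n x)) & (n < n0 --> comp n x = \<zero>\<^bsub>M\<^esub>)}"
  have D_L: "D n l" if "l \<in> L" for l n
   unfolding D_def using that Z0[of "n - n0"] sL(5)[OF that] vc by (intro bexI[OF _ that]) auto
  have D_add: "D n (x \<oplus>\<^bsub>M\<^esub> z)" if h: "D n x" "D n z" for n x z
  proof -
   obtain l b f l' b' f' where *: "l \<in> L" "(b, f) \<in> Z (n - n0)" "x = l \<oplus>\<^bsub>M\<^esub> act M v b" "l' \<in> L" "(b', f') \<in> Z (n - n0)" "z = l' \<oplus>\<^bsub>M\<^esub> act M v b'"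
    using h unfolding D_def by blast
   have "x \<oplus>\<^bsub>M\<^esub> z = (l \<oplus>\<^bsub>M\<^esub> l') \<oplus>\<^bsub>M\<^esub> act M v (b \<oplus>\<^bsub>B\<^esub> b')"
    using * sL(5) Z_in(1)[OF *(2)] Z_in(1)[OF *(5)] vc by (simp add: act_add_r M.a_ac)
   then show ?thesis unfolding D_def using Z_add[OF *(2,5)] sL(3)[OF *(1,4)] by blast
  qed
  have D_s: "D n (c \<odot>\<^bsub>M\<^esub> x)" if h: "D n x" for n x c
  proof -
   obtain l b f where *: "l \<in> L" "(b, f) \<in> Z (n - n0)" "x = l \<oplus>\<^bsub>M\<^esub> act M v b" using h unfolding D_def by blast
   have "c \<odot>\<^bsub>M\<^esub> x = c \<odot>\<^bsub>M\<^esub> l \<oplus>\<^bsub>M\<^esub> act M v (c \<odot>\<^bsub>B\<^esub> b)"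
    using * sL(5) Z_in(1)[OF *(2)] vc by (simp add: act_smult_r add_s)
   then show ?thesis unfolding D_def using Z_smult[OF *(2)] sL(4)[OF *(1)] by blast
  qed
  have D_x: "D (Suc n) (x \<cdot> i)" if h: "D n x" "n >= n0" for n x i
  proof -
   obtain l b f where *: "l \<in> L" "(b, f) \<in> Z (n - n0)" "x = l \<oplus>\<^bsub>M\<^esub> act M v b" using h unfolding D_def by blast
   have "x \<cdot> i = l \<cdot> i \<oplus>\<^bsub>M\<^esub> act M v (b \<otimes>\<^bsub>B\<^esub> bw [i])"
    using * sL(5)[OF *(1)] Zv[OF *(2)] Zi[OF *(2)] by (simp add: act_add)
   then show ?thesis unfolding D_def using Z_mult[OF *(2), of i] L(2)[OF *(1)] h(2) by (metis Suc_diff_le)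
  qed
  have "gsub (insert v W) <= ?G"
  proof (rule gsub_least)
   show "sub ?G" by (rule subI) (use D_L[OF sL(2)] D_add D_s in \<open>auto simp: comp_add comp_smult\<close>)
   show "m \<cdot> i \<in> ?G" if m: "m \<in> ?G" for m i
   proof -
    have "(n >= n0 --> D n (comp n (m \<cdot> i))) & (n < n0 --> comp n (m \<cdot> i) = \<zero>\<^bsub>M\<^esub>)" for n
    proof (cases n)
     case 0 then show ?thesis using comp_actx(2)[of m i] m D_L[OF sL(2)] by auto
    next
     case (Suc k)
     then show ?thesis using comp_actx(1)[of m k i] m D_x[of k "comp k m" i] D_L[OF sL(2), of n] by (cases "k >= n0") auto
    qed
    then show ?thesis using m by simp
   qed
   have "D n0 v" unfolding D_def using g0 vc sL(2) by (intro bexI[OF _ sL(2)]) auto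
   then have "v \<in> ?G" using vc comp_homog[OF v] D_L[OF sL(2)] by auto
   moreover have "w \<in> ?G" if "w \<in> W" for w
    using subsetD[OF Wc that] subsetD[OF W that] comp_homog[of w n0] D_L[OF subsetD[OF L(3) that]] D_L[OF sL(2)] by simp
   ultimately show "insert v W <= ?G" by blast
  qed
  then have "D n (comp n x)" using full n by blast
  then show ?thesis using comp_homog[OF x, of n] by simp
 qed
 obtain k where k: "!!n x. n >= k ==> x \<in> piece M n ==> x \<in> gsub (insert v W)" using ev(2) unfolding evfull_def by blast
 \<comment> \<open>The annihilator of v modulo \<open>L\<close>, carried from B to functions on E.
   If it were full in some degree, \<open>L\<close> would contain a tail of M, contrary to the
   choice of W.\<close>
 define I where "I n = {f. EX b. (b, f) \<in> Z n & act M v b \<in> L}" for n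
 have I: "right_ideal I"
  unfolding right_ideal_def subsp_def
 proof (intro allI conjI ballI)
  fix n
  obtain f where f: "(\<zero>\<^bsub>B\<^esub>, f) \<in> Z n" using Z0 by blast
  from Z_smult[OF this, of 0] show "(%p. 0) \<in> I n" unfolding I_def using vc sL(2) by auto
  show "I n <= F n" using Z_in(2) by (auto simp: I_def)
  show "(%p. f p + g p) \<in> I n" if f: "f \<in> I n" and g: "g \<in> I n" for f g
  proof -
   obtain b b' where "(b, f) \<in> Z n" "act M v b \<in> L" "(b', g) \<in> Z n" "act M v b' \<in> L" using f g by (auto simp: I_def)
   then show ?thesis unfolding I_def using Z_add sL(3) act_add_r[OF vc] Z_in(1) by (metis (mono_tags, lifting) mem_Collect_eq)
  qed
  show "(%p. c * f p) \<in> I n" if f: "f \<in> I n" for f c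
  proof -
   obtain b where "(b, f) \<in> Z n" "act M v b \<in> L" using f by (auto simp: I_def)
   then show ?thesis unfolding I_def using Z_smult sL(4) act_smult_r[OF vc] Z_in(1) by (metis (mono_tags, lifting) mem_Collect_eq)
  qed
  show "tw n f (xx i) \<in> I (Suc n)" if f: "f \<in> I n" for f i
  proof -
   obtain b where "(b, f) \<in> Z n" "act M v b \<in> L" using f by (auto simp: I_def)
   then show ?thesis unfolding I_def using Z_mult L(2) Zi by (metis (mono_tags, lifting) mem_Collect_eq)
  qed
 qed
 have ZI: "act M v b \<in> L" if h: "f \<in> I n" "(b, f) \<in> Z n" for b f n
 proof -
  obtain b' where b': "(b', f) \<in> Z n" "act M v b' \<in> L" using h(1) by (auto simp: I_def)
  have "b \<oplus>\<^bsub>B\<^esub> (- 1) \<odot>\<^bsub>B\<^esub> b' = \<zero>\<^bsub>B\<^esub>" by (rule Z_zero[OF Z_add[OF h(2) Z_smult[OF b'(1), of "- 1"]]]) simp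
  then have "act M v b \<oplus>\<^bsub>M\<^esub> (- 1) \<odot>\<^bsub>M\<^esub> act M v b' = \<zero>\<^bsub>M\<^esub>"
   using act_add_r[OF vc, of b "(- 1) \<odot>\<^bsub>B\<^esub> b'"] Z_in(1)[OF h(2)] Z_in(1)[OF b'(1)] vc by (simp add: act_smult_r)
  then show ?thesis using diff_zero Zv[OF h(2)] Zv[OF b'(1)] b'(2) by simp
 qed
 have "proper I"
  unfolding proper_def
 proof (intro allI notI)
  fix n assume full: "I n = F n"
  have "piece M m <= L" if m: "m >= max k (n0 + n)" for m
  proof
   fix x assume x: "x \<in> piece M m"
   have "D m x" using D[OF k[OF _ x] _ x] m by simp
   then obtain l b f where lb: "l \<in> L" "(b, f) \<in> Z (m - n0)" "x = l \<oplus>\<^bsub>M\<^esub> act M v b" unfolding D_def by blast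
   have "I (m - n0) = F (m - n0)" by (rule right_ideal_full[OF I full]) (use m in linarith)
   then show "x \<in> L" using ZI[OF _ lb(2)] Z_in(2)[OF lb(2)] lb sL(3) by simp
  qed
  then show False using ev(1) unfolding evfull_def L_def by blast
 qed
 then obtain p N \<Lambda> where p: "p \<in> E" and
  \<Lambda>: "!!n f g. n >= N ==> f \<in> F n ==> g \<in> F n ==> \<Lambda> n (%p. f p + g p) = \<Lambda> n f + (\<Lambda> n g :: 'k)"
  "!!n f c. n >= N ==> f \<in> F n ==> \<Lambda> n (%p. c * f p) = c * \<Lambda> n f"
  "!!n f. n >= N ==> f \<in> I n ==> \<Lambda> n f = 0"
  "!!n f i. n >= N ==> f \<in> F n ==> \<Lambda> (Suc n) (tw n f (xx i)) = Y ((\<sigma> ^^ n) p) i * \<Lambda> n f"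
  "!!n. n >= N ==> \<exists>f\<in>F n. \<Lambda> n f ~= 0"
  by (rule point_functional[OF I]) blast
 let ?k = "max k (n0 + N)"
 have nN: "N <= n - n0" if "n >= ?k" for n using that by (simp add: le_diff_conv2)
 \<comment> \<open>The graph of the functional on M: an element l + v b has the value of the
   functional at the function of b. It is single valued because that functional vanishes on
   \<open>I\<close>.\<close>
 define G where "G n u c \<longleftrightarrow> (\<exists>l\<in>L. EX b f. (b, f) \<in> Z (n - n0) & u = l \<oplus>\<^bsub>M\<^esub> act M v b & c = \<Lambda> (n - n0) f)" for n u c
 have G_ex: "EX c. G n u c" if "n >= ?k" "u \<in> piece M n" for n u
  using D[OF k[OF _ that(2)] _ that(2)] that unfolding D_def G_def by auto
 have G_add: "G n (u \<oplus>\<^bsub>M\<^esub> u') (c + c')" if n: "n >= ?k" and h: "G n u c" "G n u' c'" for n u u' c c'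
 proof -
  obtain l b f l' b' f' where *: "l \<in> L" "(b, f) \<in> Z (n - n0)" "u = l \<oplus>\<^bsub>M\<^esub> act M v b" "c = \<Lambda> (n - n0) f"
   "l' \<in> L" "(b', f') \<in> Z (n - n0)" "u' = l' \<oplus>\<^bsub>M\<^esub> act M v b'" "c' = \<Lambda> (n - n0) f'"
   using h unfolding G_def by blast
  have "u \<oplus>\<^bsub>M\<^esub> u' = (l \<oplus>\<^bsub>M\<^esub> l') \<oplus>\<^bsub>M\<^esub> act M v (b \<oplus>\<^bsub>B\<^esub> b')"
   using * sL(5) Z_in(1)[OF *(2)] Z_in(1)[OF *(6)] vc by (simp add: act_add_r M.a_ac)
  moreover have "c + c' = \<Lambda> (n - n0) (%p. f p + f' p)" using \<Lambda>(1)[OF nN[OF n] Z_in(2)[OF *(2)] Z_in(2)[OF *(6)]] *(4,8) by simp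
  ultimately show ?thesis unfolding G_def using Z_add[OF *(2,6)] sL(3)[OF *(1,5)] by blast
 qed
 have G_s: "G n (d \<odot>\<^bsub>M\<^esub> u) (d * c)" if n: "n >= ?k" and h: "G n u c" for n u c d
 proof -
  obtain l b f where *: "l \<in> L" "(b, f) \<in> Z (n - n0)" "u = l \<oplus>\<^bsub>M\<^esub> act M v b" "c = \<Lambda> (n - n0) f" using h unfolding G_def by blast
  have "d \<odot>\<^bsub>M\<^esub> u = d \<odot>\<^bsub>M\<^esub> l \<oplus>\<^bsub>M\<^esub> act M v (d \<odot>\<^bsub>B\<^esub> b)"
   using * sL(5) Z_in(1)[OF *(2)] vc by (simp add: act_smult_r add_s)
  moreover have "d * c = \<Lambda> (n - n0) (%p. d * f p)" using \<Lambda>(2)[OF nN[OF n] Z_in(2)[OF *(2)]] *(4) by simp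
  ultimately show ?thesis unfolding G_def using Z_smult[OF *(2)] sL(4)[OF *(1)] by blast
 qed
 have G_x: "G (Suc n) (u \<cdot> i) (Y ((\<sigma> ^^ (n - n0)) p) i * c)" if n: "n >= ?k" and h: "G n u c" for n u c i
 proof -
  obtain l b f where *: "l \<in> L" "(b, f) \<in> Z (n - n0)" "u = l \<oplus>\<^bsub>M\<^esub> act M v b" "c = \<Lambda> (n - n0) f" using h unfolding G_def by blast
  have S: "Suc n - n0 = Suc (n - n0)" using n by auto
  have "u \<cdot> i = l \<cdot> i \<oplus>\<^bsub>M\<^esub> act M v (b \<otimes>\<^bsub>B\<^esub> bw [i])"
   using * sL(5)[OF *(1)] Zv[OF *(2)] Zi[OF *(2)] by (simp add: act_add)
  moreover have "Y ((\<sigma> ^^ (n - n0)) p) i * c = \<Lambda> (Suc (n - n0)) (tw (n - n0) f (xx i))" using \<Lambda>(4)[OF nN[OF n] Z_in(2)[OF *(2)]] *(4) by simp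
  ultimately show ?thesis unfolding G_def S using Z_mult[OF *(2), of i] L(2)[OF *(1)] by blast
 qed
 have G_zero: "c = 0" if n: "n >= ?k" and h: "G n \<zero>\<^bsub>M\<^esub> c" for n c
 proof -
  obtain l b f where *: "l \<in> L" "(b, f) \<in> Z (n - n0)" "\<zero>\<^bsub>M\<^esub> = l \<oplus>\<^bsub>M\<^esub> act M v b" "c = \<Lambda> (n - n0) f" using h unfolding G_def by blast
  have "act M v b = \<ominus>\<^bsub>M\<^esub> l" using M.minus_equality[of "act M v b" l] M.a_comm *(3) sL(5)[OF *(1)] Zv[OF *(2)] by simp
  then have "f \<in> I (n - n0)" unfolding I_def using *(2) sL(6)[OF *(1)] by auto
  then show ?thesis using \<Lambda>(3)[OF nN[OF n]] *(4) by simp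
 qed
 have G_unique: "c = c'" if n: "n >= ?k" and u: "u \<in> piece M n" and G: "G n u c" "G n u c'" for n u c c'
 proof -
  have "u \<oplus>\<^bsub>M\<^esub> (- 1) \<odot>\<^bsub>M\<^esub> u = \<zero>\<^bsub>M\<^esub>" using diff_zero pD(5)[OF u] by simp
  then show ?thesis using G_zero[OF n] G_add[OF n G(1) G_s[OF n G(2), of "- 1"]] by fastforce
 qed
 define \<Lambda>' where "\<Lambda>' n u = (SOME c. G n u c)" for n u
 have G\<Lambda>: "G n u (\<Lambda>' n u)" if "n >= ?k" "u \<in> piece M n" for n u
  unfolding \<Lambda>'_def using someI_ex[OF G_ex[OF that]] .
 have \<Lambda>'_eq: "\<Lambda>' n u = c" if "n >= ?k" "u \<in> piece M n" "G n u c" for n u c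
  using G_unique G\<Lambda> that by blast
 \<comment> \<open>v sits in degree n0, so the orbit is started n0 steps before p in order to count
   degrees in M from 0.\<close>
 obtain q where q: "q \<in> E" "(\<sigma> ^^ n0) q = p" using \<sigma>_pow_surj[of n0] p by (metis imageE)
 have qn: "(\<sigma> ^^ n) q = (\<sigma> ^^ (n - n0)) p" if "n >= ?k" for n
 proof -
  have "n = (n - n0) + n0" using that by auto
  then have "(\<sigma> ^^ n) q = (\<sigma> ^^ (n - n0)) ((\<sigma> ^^ n0) q)" by (metis comp_apply funpow_add)
  then show ?thesis using q by simp
 qed
 show ?thesis
 proof (rule that[of q ?k \<Lambda>'])
  show "q \<in> E" by (rule q(1))
  fix n assume n: "n >= ?k"
  show "\<exists>u\<in>piece M n. \<Lambda>' n u ~= 0"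
  proof -
   obtain f where f: "f \<in> F (n - n0)" "\<Lambda> (n - n0) f ~= 0" using \<Lambda>(5)[OF nN[OF n]] by blast
   obtain b where b: "(b, f) \<in> Z (n - n0)" using Z_ex[OF f(1)] by blast
   then obtain t where t: "b = bform (n - n0) t" by (auto simp: Z_def)
   have "b \<in> piece B (n - n0)"
    unfolding t bform_pB pB_facts(7)
   proof (rule imageI)
    have len: "length w = n - n0" if nz: "(\<Sum>x\<in>words (n - n0). t x * mono x w) ~= 0" for w
    proof (rule ccontr)
     assume "length w ~= n - n0"
     then have "(\<Sum>x\<in>words (n - n0). t x * mono x w) = 0" by (intro sum.neutral) (auto simp: mono_def)
     then show False using nz by simp
    qed
    then have "finite {w. (\<Sum>x\<in>words (n - n0). t x * mono x w) ~= 0}"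
     by (intro finite_subset[OF _ finite_words[of "n - n0"]]) auto
    with len show "(%w. \<Sum>x\<in>words (n - n0). t x * mono x w) \<in> piece FA (n - n0)" by simp
   qed
   then have u: "act M v b \<in> piece M n" using act_piece[OF v, of b "n - n0"] n by auto
   have "G n (act M v b) (\<Lambda> (n - n0) f)" unfolding G_def using b sL(2) Zv[OF b] by (intro bexI[OF _ sL(2)] exI[of _ b] exI[of _ f]) auto
   from \<Lambda>'_eq[OF n u this] show ?thesis using f(2) by (intro bexI[OF _ u]) simp
  qed
  fix u assume u: "u \<in> piece M n"
  show "\<Lambda>' n (c \<odot>\<^bsub>M\<^esub> u) = c * \<Lambda>' n u" for c by (rule \<Lambda>'_eq[OF n pD(4)[OF u] G_s[OF n G\<Lambda>[OF n u]]])
  show "\<Lambda>' (Suc n) (u \<cdot> i) = Y ((\<sigma> ^^ n) q) i * \<Lambda>' n u" for i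
   using \<Lambda>'_eq[OF _ actx_piece[OF u] G_x[OF n G\<Lambda>[OF n u]], of i] n qn[OF n] by simp
  show "\<Lambda>' n (u \<oplus>\<^bsub>M\<^esub> u') = \<Lambda>' n u + \<Lambda>' n u'" if u': "u' \<in> piece M n" for u'
   by (rule \<Lambda>'_eq[OF n pD(3)[OF u u'] G_add[OF n G\<Lambda>[OF n u] G\<Lambda>[OF n u']]])
 qed
qed

end

section \<open>Irreducible objects of the quotient category\<close>

lemma set_add_iff: "x \<in> A <+>\<^bsub>M\<^esub> N \<longleftrightarrow> (\<exists>a\<in>A. \<exists>n\<in>N. x = a \<oplus>\<^bsub>M\<^esub> n)"
 by (auto simp: set_add_def')

lemma (in gspace) assemble:
 assumes d: "!!n. d n \<in> piece V n" and K: "!!n. n >= K ==> d n = \<zero>"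
 shows "\<exists>x\<in>carrier V. ALL n. comp n x = d n"
proof -
 have "homog_decomp V d (finsum V d {..<K})" by (rule homog_decompI[OF d]) (use K in \<open>auto simp: not_less\<close>)
 from comp_eq[OF this] homog_decompD(3)[OF this] show ?thesis by blast
qed

context gmod
begin

lemma sub_zero: "sub {\<zero>\<^bsub>M\<^esub>}" and graded_zero: "graded_submodule R M {\<zero>\<^bsub>M\<^esub>}"
proof -
 show s: "sub {\<zero>\<^bsub>M\<^esub>}" by (rule subI) auto
 then show "graded_submodule R M {\<zero>\<^bsub>M\<^esub>}" by (simp add: graded_submodule_iff)
qed

lemma coset_singleton: "x \<in> carrier M ==> a_r_coset M {\<zero>\<^bsub>M\<^esub>} x = {x}"
 by (simp add: a_r_coset_def')

text \<open>Morphisms of the quotient category take cosets as values. Modulo the zero submodule the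
  cosets are singletons, which accounts for the braces.\<close>

lemma quot_zero_hom:
 assumes "!!x. x \<in> carrier L ==> \<Phi> x \<in> carrier M" "!!x x'. x \<in> carrier L ==> x' \<in> carrier L ==> \<Phi> (x \<oplus>\<^bsub>L\<^esub> x') = \<Phi> x \<oplus>\<^bsub>M\<^esub> \<Phi> x'"
  "!!x c. x \<in> carrier L ==> \<Phi> (c \<odot>\<^bsub>L\<^esub> x) = c \<odot>\<^bsub>M\<^esub> \<Phi> x" "!!x b. x \<in> carrier L ==> b \<in> carrier B ==> \<Phi> (act L x b) = act M (\<Phi> x) b"
  "!!n x. x \<in> piece L n ==> \<Phi> x \<in> piece M n"
 shows "(%x. {\<Phi> x}) \<in> graded_hom R L (quot_module M {\<zero>\<^bsub>M\<^esub>})"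
proof -
 note q = quot_carrier[OF sub_zero] quot_add[OF sub_zero] quot_smult[OF sub_zero] quot_piece[OF sub_zero]
 have "{x} \<oplus>\<^bsub>quot_module M {\<zero>\<^bsub>M\<^esub>}\<^esub> {x'} = {x \<oplus>\<^bsub>M\<^esub> x'}" if "x \<in> carrier M" "x' \<in> carrier M" for x x'
  using q(2)[OF that] that by (simp add: coset_singleton)
 moreover have "c \<odot>\<^bsub>quot_module M {\<zero>\<^bsub>M\<^esub>}\<^esub> {x} = {c \<odot>\<^bsub>M\<^esub> x}" if "x \<in> carrier M" for x c
  using q(3)[OF that] that by (simp add: coset_singleton)
 moreover have "act (quot_module M {\<zero>\<^bsub>M\<^esub>}) {x} b = {act M x b}" if "x \<in> carrier M" "b \<in> carrier B" for x b
  using quot_act[OF sub_zero that] that by (simp add: coset_singleton)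
 moreover have "{x} \<in> carrier (quot_module M {\<zero>\<^bsub>M\<^esub>})" if "x \<in> carrier M" for x
  unfolding q(1) using coset_singleton that by (metis imageI)
 moreover have "{x} \<in> piece (quot_module M {\<zero>\<^bsub>M\<^esub>}) n" if "x \<in> piece M n" for x n
  unfolding q(4) using coset_singleton pD(5)[OF that] that by (metis imageI)
 ultimately show ?thesis
  using assms unfolding graded_hom_def LinearCombinations.module_hom_def word_algebraD(1)[OF wa] by auto
qed

lemma finite_sub_zero: "finitely_generated R M ==> finite_sub R M {\<zero>\<^bsub>M\<^esub>}"
 by (rule finite_subI[OF _ graded_zero]) auto

text \<open>If the identity and the zero map agree on a submodule of finite codimension modulo a
  finite-dimensional one, the first is contained in the second, and in large degrees nothing is
  left.\<close>

lemma qgr_is_zero_iff: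
 assumes "finitely_generated R M"
 shows "qgr_is_zero R M \<longleftrightarrow> (EX k. \<forall>n\<ge>k. piece M n <= {\<zero>\<^bsub>M\<^esub>})"
proof
 assume "qgr_is_zero R M"
 then obtain M' N' where *: "cofinite_sub R M M'" "finite_sub R M N'"
  "!!m. m \<in> M' ==> {m} <+>\<^bsub>M\<^esub> N' = {\<zero>\<^bsub>M\<^esub>} <+>\<^bsub>M\<^esub> N'"
  unfolding qgr_is_zero_def qgr_eq_def qgr_id_def qgr_zero_mor_def by auto
 note N = subD[OF graded_submoduleD(1)[OF finite_subD(1)[OF *(2)]]]
 have "m \<in> N'" if m: "m \<in> M'" for m
 proof -
  have "m \<in> carrier M" using subD(5)[OF graded_submoduleD(1)[OF cofinite_subD(1)[OF *(1)]] m] .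
  then have "m \<in> {m} <+>\<^bsub>M\<^esub> N'" using N(2) by (auto simp: set_add_iff intro: bexI[of _ "\<zero>\<^bsub>M\<^esub>"])
  then show ?thesis unfolding *(3)[OF m] using N(5) by (auto simp: set_add_iff)
 qed
 moreover obtain k1 k2 where "\<forall>n\<ge>k1. piece M n <= M'" "\<forall>n\<ge>k2. piece M n Int N' <= {\<zero>\<^bsub>M\<^esub>}"
  using cofinite_subD(2)[OF *(1)] finite_subD(2)[OF *(2)] by blast
 ultimately have "\<forall>n\<ge>max k1 k2. piece M n <= {\<zero>\<^bsub>M\<^esub>}" by fastforce
 then show "EX k. \<forall>n\<ge>k. piece M n <= {\<zero>\<^bsub>M\<^esub>}" by blast
next
 assume "EX k. \<forall>n\<ge>k. piece M n <= {\<zero>\<^bsub>M\<^esub>}"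
 then have "cofinite_sub R M {\<zero>\<^bsub>M\<^esub>}" using cofinite_subI[OF assms graded_zero] by blast
 then show "qgr_is_zero R M"
  unfolding qgr_is_zero_def qgr_eq_def qgr_id_def qgr_zero_mor_def prod.case
  by (intro exI[of _ "{\<zero>\<^bsub>M\<^esub>}"]) (simp add: finite_sub_zero[OF assms])
qed

text \<open>The inclusion of K is a monomorphism of the quotient category, so K is zero there or the
  inclusion is invertible, and an inverse forces K to contain a tail. K must be finitely generated
  in order to be a test object.\<close>

lemma irreducible_submodule:
 assumes irr: "qgr_irreducible R M" and K: "graded_submodule R M K" and fgK: "finitely_generated R (sub_module M K)"
 shows "(EX k. \<forall>n\<ge>k. piece M n Int K <= {\<zero>\<^bsub>M\<^esub>}) \<or> (EX k. \<forall>n\<ge>k. piece M n <= K)"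
proof -
 let ?K = "sub_module M K" and ?i = "(K, {\<zero>\<^bsub>M\<^esub>}, %m. {m})"
 have fg: "finitely_generated R M" using irr by (simp add: qgr_irreducible_def qgr_object_def)
 note gs = graded_submoduleD[OF K] and sK = subD[OF graded_submoduleD(1)[OF K]]
 interpret K: gmod \<alpha> \<beta> \<gamma> R r ?K by (rule sub_module_gmod[OF K])
 note ss = sub_module_simps[of K]
 have Kcomp: "K.comp n x = comp n x" if x: "x \<in> K" for x n
 proof -
  have 1: "K.sub {x \<in> K. ALL n. K.comp n x = comp n x}"
   using K.comp_add K.comp_smult comp_add comp_smult sK K.comp_zero
   by (intro K.subI) (auto simp: ss)
  have 2: "K.comp m x \<in> {x \<in> K. ALL n. K.comp n x = comp n x}" for m
  proof -
   have p: "K.comp m x \<in> piece ?K m" using K.comp_piece x by (simp add: ss)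
   then show ?thesis using K.comp_homog[OF p] comp_homog[of "K.comp m x" m] by (auto simp: ss)
  qed
  have "x \<in> {x \<in> K. ALL n. K.comp n x = comp n x}" by (rule K.comps_in[OF _ 1 2]) (simp add: ss x)
  then show ?thesis by blast
 qed
 have KK: "graded_submodule R ?K K"
  using gs(2) K.comp_closed sub_of_sub_module[OF gs(1)] gs(1) unfolding K.graded_submodule_iff by (simp add: ss)
 have "cofinite_sub R ?K K" by (rule K.cofinite_subI[OF fgK KK, of 0]) (simp add: ss)
 moreover have "sub_module ?K K = ?K" by (simp add: sub_module_def inf_assoc)
 moreover have "(%m. {m}) \<in> graded_hom R ?K (quot_module M {\<zero>\<^bsub>M\<^esub>})"
  by (rule quot_zero_hom) (use sK in \<open>auto simp: ss\<close>)
 ultimately have mor: "?i \<in> qgr_mor R ?K M" using finite_sub_zero[OF fg] by (simp add: qgr_mor_def)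
 have "qgr_eq R Z ?K g h"
  if g: "g \<in> qgr_mor R Z ?K" and h: "h \<in> qgr_mor R Z ?K" and eq: "qgr_eq R Z M (qgr_comp g ?i) (qgr_comp h ?i)"
  for Z :: "('k, 'm, 'k elem_B) graded_rmodule" and g h
 proof -
  \<comment> \<open>The values of g and h are nonempty cosets inside K, so composing with the
    inclusion, which intersects with K, does not change them.\<close>
  have cos: "f z <= K" "f z ~= {}" if f: "(Z1, N1, f) \<in> qgr_mor R Z ?K" and z: "z \<in> Z1" for Z1 N1 f z
  proof -
   have N1: "K.sub N1" using f by (auto simp: qgr_mor_def dest: K.finite_subD(1) K.graded_submoduleD(1))
   have "f z \<in> carrier (quot_module ?K N1)"
    using f z by (auto simp: qgr_mor_def graded_hom_def LinearCombinations.module_hom_def sub_module_def)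
   then obtain x where x: "x \<in> K" "f z = a_r_coset ?K N1 x" unfolding K.quot_carrier[OF N1] ss by blast
   show "f z <= K" using x K.mem_coset[OF N1, of x] by (auto simp: ss)
   show "f z ~= {}" using x K.coset_self[OF N1, of x] by (auto simp: ss)
  qed
  obtain Z1 N1 f1 Z2 N2 f2 where gh: "g = (Z1, N1, f1)" "h = (Z2, N2, f2)" by (metis prod.exhaust)
  obtain Z' N' where *: "cofinite_sub R Z Z'" "finite_sub R M N'" "N1 Int K Un N2 Int K <= N'"
   "\<forall>z\<in>Z'. (f1 z Int K) <+>\<^bsub>M\<^esub> N' = (f2 z Int K) <+>\<^bsub>M\<^esub> N'" and Z': "Z' <= {m \<in> Z1. f1 m Int K ~= {}} Int {m \<in> Z2. f2 m Int K ~= {}}"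
   using eq unfolding gh qgr_comp_def qgr_eq_def prod.case UN_singleton by blast
  have Z12: "Z' <= Z1 Int Z2" using Z' by blast
  have N12: "N1 <= K" "N2 <= K"
   using g h K.subD(1)[OF K.graded_submoduleD(1)[OF K.finite_subD(1)]] unfolding gh qgr_mor_def by (auto simp: ss)
  note N' = finite_subD[OF *(2)] and sN = subD[OF graded_submoduleD(1)[OF finite_subD(1)[OF *(2)]]]
  have "graded_submodule R ?K (N' Int K)"
   unfolding K.graded_submodule_iff
  proof (intro conjI ballI allI)
   show "K.sub (N' Int K)" by (rule K.subI) (use sN sK in \<open>auto simp: ss\<close>)
   show "act ?K m (bw [i]) \<in> N' Int K" if "m \<in> N' Int K" for m i
    using that gs(2) graded_submoduleD(2)[OF N'(1)] by (simp add: ss)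
   show "K.comp n m \<in> N' Int K" if "m \<in> N' Int K" for m n
    using that gs(3) graded_submoduleD(3)[OF N'(1)] Kcomp by simp
  qed
  moreover obtain n0 where "\<forall>n\<ge>n0. piece M n Int N' <= {\<zero>\<^bsub>M\<^esub>}" using N'(2) by blast
  ultimately have fs: "finite_sub R ?K (N' Int K)"
   by (intro K.finite_subI[OF fgK, of _ n0]) (auto simp: ss)
  \<comment> \<open>Elements of K that are congruent modulo N' differ by an element of N' that lies
    in K, so the congruence already holds modulo the intersection of N' with K.\<close>
  have half: "X <+>\<^bsub>?K\<^esub> (N' Int K) <= Y <+>\<^bsub>?K\<^esub> (N' Int K)"
   if "X <= K" "Y <= K" "X <+>\<^bsub>M\<^esub> N' = Y <+>\<^bsub>M\<^esub> N'" for X Y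
  proof
   fix x assume "x \<in> X <+>\<^bsub>?K\<^esub> (N' Int K)"
   then obtain a n where an: "a \<in> X" "n \<in> N'" "n \<in> K" "x = a \<oplus>\<^bsub>M\<^esub> n" by (auto simp: set_add_iff ss)
   then have "x \<in> X <+>\<^bsub>M\<^esub> N'" unfolding set_add_iff by blast
   then have "x \<in> Y <+>\<^bsub>M\<^esub> N'" unfolding that(3) .
   then obtain b n' where b: "b \<in> Y" "n' \<in> N'" "x = b \<oplus>\<^bsub>M\<^esub> n'" by (auto simp: set_add_iff)
   have K: "x \<in> K" "b \<in> K" using an(3,4) b(1) sK(3)[OF subsetD[OF that(1) an(1)]] subsetD[OF that(2)] by simp_all
   have "\<ominus>\<^bsub>M\<^esub> b \<oplus>\<^bsub>M\<^esub> x = n'" using b(3) sK(5)[OF K(2)] sN(5)[OF b(2)] by (simp add: M.r_neg1)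
   then have "n' \<in> K" using sK(3)[OF sK(6)[OF K(2)] K(1)] by simp
   then show "x \<in> Y <+>\<^bsub>?K\<^esub> (N' Int K)" unfolding set_add_iff ss using b by blast
  qed
  have "f1 z <+>\<^bsub>?K\<^esub> (N' Int K) = f2 z <+>\<^bsub>?K\<^esub> (N' Int K)" if z: "z \<in> Z'" for z
  proof -
   have c: "f1 z <= K" "f2 z <= K" using cos g h subsetD[OF Z12 z] unfolding gh by blast+
   then have "f1 z <+>\<^bsub>M\<^esub> N' = f2 z <+>\<^bsub>M\<^esub> N'" using bspec[OF *(4) z] by (simp add: Int_absorb2)
   then show ?thesis using half[OF c] half[OF c(2,1)] by blast
  qed
  moreover have "N1 Un N2 <= N' Int K" using *(3) N12 by blast
  ultimately show ?thesis unfolding gh qgr_eq_def prod.case using *(1) Z12 fs by (intro exI[of _ Z'] exI[of _ "N' Int K"]) simp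
 qed
 then have "qgr_mono R ?K M ?i" using mor by (simp add: qgr_mono_def)
 moreover have "qgr_object R ?K" using fgK K.gm by (simp add: qgr_object_def)
 ultimately consider "qgr_is_zero R ?K" | "qgr_iso R ?K M ?i" using irr unfolding qgr_irreducible_def by blast
 then show ?thesis
 proof cases
  case 1
  then show ?thesis unfolding K.qgr_is_zero_iff[OF fgK] by (simp add: ss)
 next
  case 2
  then obtain M1 N1 g where "(M1, N1, g) \<in> qgr_mor R M ?K" "qgr_eq R M M (qgr_comp (M1, N1, g) ?i) (qgr_id M)"
   unfolding qgr_iso_def by auto
  then obtain M' N' where *: "cofinite_sub R M M'" "finite_sub R M N'"
   "!!m. m \<in> M' ==> (g m Int K) <+>\<^bsub>M\<^esub> N' = {m} <+>\<^bsub>M\<^esub> N'"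
   unfolding qgr_comp_def qgr_eq_def qgr_id_def prod.case UN_singleton by auto
  note sN = subD[OF graded_submoduleD(1)[OF finite_subD(1)[OF *(2)]]]
  obtain k1 k2 where k: "\<forall>n\<ge>k1. piece M n <= M'" "\<forall>n\<ge>k2. piece M n Int N' <= {\<zero>\<^bsub>M\<^esub>}"
   using cofinite_subD(2)[OF *(1)] finite_subD(2)[OF *(2)] by blast
  \<comment> \<open>The inverse writes m as a + b with a in K and b in N'. As N' has nothing in
    degree n, m is the degree-n component of a.\<close>
  have "m \<in> K" if n: "n >= max k1 k2" and m: "m \<in> piece M n" for n m
  proof -
   have mc: "m \<in> carrier M" using pD(5)[OF m] .
   have "m \<in> {m} <+>\<^bsub>M\<^esub> N'" using mc sN(2) by (auto simp: set_add_iff intro: bexI[of _ "\<zero>\<^bsub>M\<^esub>"])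
   then have "m \<in> (g m Int K) <+>\<^bsub>M\<^esub> N'" using *(3) k(1) n m by auto
   then obtain a b where ab: "a \<in> K" "b \<in> N'" "m = a \<oplus>\<^bsub>M\<^esub> b" by (auto simp: set_add_iff)
   have "comp n b = \<zero>\<^bsub>M\<^esub>" using k(2) n graded_submoduleD(3)[OF finite_subD(1)[OF *(2)] ab(2)] comp_piece[OF sN(5)[OF ab(2)]] by fastforce
   then have "comp n m = comp n a" using comp_add[of a b n] ab sK(5) sN(5) by simp
   then show ?thesis using comp_homog[OF m, of n] gs(3)[OF ab(1), of n] by simp
  qed
  then show ?thesis by blast
 qed
qed

section \<open>Tails, and morphisms prescribed in large degrees\<close>

definition tail :: "nat => 'm set" where "tail k = {x \<in> carrier M. \<forall>n<k. comp n x = \<zero>\<^bsub>M\<^esub>}"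

lemma graded_tail: "graded_submodule R M (tail k)"
 unfolding graded_submodule_iff
proof (intro conjI ballI allI)
 show "sub (tail k)" by (rule subI) (auto simp: tail_def comp_add comp_smult)
 show "m \<cdot> i \<in> tail k" if m: "m \<in> tail k" for m i
 proof -
  have "comp n (m \<cdot> i) = \<zero>\<^bsub>M\<^esub>" if "n < k" for n
   using that m comp_actx[of m] by (cases n) (auto simp: tail_def)
  then show ?thesis using m by (simp add: tail_def)
 qed
 show "comp n m \<in> tail k" if "m \<in> tail k" for m n
  using that comp_homog[OF comp_piece[of m n]] by (auto simp: tail_def)
qed

lemma tail_piece: "n >= k ==> piece M n <= tail k"
 using comp_homog pD(5) by (auto simp: tail_def)

end

locale gmod_pair = gmod \<alpha> \<beta> \<gamma> R r M + N: gmod \<alpha> \<beta> \<gamma> R r N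
 for \<alpha> \<beta> \<gamma> :: "'k::alg_closed_field" and R r and M :: "('k, 'm, 'k elem_B) graded_rmodule"
  and N :: "('k, 'n, 'k elem_B) graded_rmodule"
begin

text \<open>Every element has finitely many nonzero components, so the maps on the pieces can be
  assembled; components below degree k are sent to 0. Compatibility with the generators extends to
  words and then to all of B.\<close>

lemma hom_of_pieces:
 assumes p: "!!n u. n >= k ==> u \<in> piece M n ==> \<phi> n u \<in> piece N n"
  and add: "!!n u u'. n >= k ==> u \<in> piece M n ==> u' \<in> piece M n ==> \<phi> n (u \<oplus>\<^bsub>M\<^esub> u') = \<phi> n u \<oplus>\<^bsub>N\<^esub> \<phi> n u'"
  and smult: "!!n u c. n >= k ==> u \<in> piece M n ==> \<phi> n (c \<odot>\<^bsub>M\<^esub> u) = c \<odot>\<^bsub>N\<^esub> \<phi> n u"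
  and act: "!!n u i. n >= k ==> u \<in> piece M n ==> \<phi> (Suc n) (act M u (bw [i])) = act N (\<phi> n u) (bw [i])"
 obtains \<Phi> where "(%x. {\<Phi> x}) \<in> graded_hom R (sub_module M (tail k)) (quot_module N {\<zero>\<^bsub>N\<^esub>})"
  "!!x. x \<in> tail k ==> \<Phi> x \<in> N.tail k"
  "!!x n. x \<in> tail k ==> n >= k ==> N.comp n (\<Phi> x) = \<phi> n (comp n x)"
proof -
 note t = graded_submoduleD[OF graded_tail[of k]]
 have p0: "\<phi> n \<zero>\<^bsub>M\<^esub> = \<zero>\<^bsub>N\<^esub>" if "n >= k" for n
  using smult[OF that pD(2), of 0] p[OF that pD(2)] N.pD(5) by simp
 have "\<exists>z\<in>carrier N. ALL n. N.comp n z = (if n >= k then \<phi> n (comp n x) else \<zero>\<^bsub>N\<^esub>)" if x: "x \<in> carrier M" for x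
 proof -
  obtain K where "\<forall>n\<ge>K. comp n x = \<zero>\<^bsub>M\<^esub>" using comp_bound[OF x] by blast
  then show ?thesis
   by (intro N.assemble[of _ K]) (use p p0 comp_piece[OF x] N.pD(2) in auto)
 qed
 then obtain \<Phi> where \<Phi>: "!!x. x \<in> carrier M ==> \<Phi> x \<in> carrier N"
  "!!x n. x \<in> carrier M ==> N.comp n (\<Phi> x) = (if n >= k then \<phi> n (comp n x) else \<zero>\<^bsub>N\<^esub>)" by metis
 have \<Phi>_add: "\<Phi> (x \<oplus>\<^bsub>M\<^esub> x') = \<Phi> x \<oplus>\<^bsub>N\<^esub> \<Phi> x'" if "x \<in> carrier M" "x' \<in> carrier M" for x x'
  by (rule N.eq_by_comps) (use that \<Phi> add comp_piece in \<open>auto simp: comp_add N.comp_add\<close>)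
 have \<Phi>_s: "\<Phi> (c \<odot>\<^bsub>M\<^esub> x) = c \<odot>\<^bsub>N\<^esub> \<Phi> x" if "x \<in> carrier M" for x c
  by (rule N.eq_by_comps) (use that \<Phi> smult comp_piece in \<open>auto simp: comp_smult N.comp_smult\<close>)
 have \<Phi>_x: "\<Phi> (act M x (bw [i])) = act N (\<Phi> x) (bw [i])" if x: "x \<in> tail k" for x i
 proof (rule N.eq_by_comps)
  have xc: "x \<in> carrier M" using x by (simp add: tail_def)
  show "\<Phi> (act M x (bw [i])) \<in> carrier N" "act N (\<Phi> x) (bw [i]) \<in> carrier N" using xc \<Phi>(1) by auto
  show "N.comp n (\<Phi> (act M x (bw [i]))) = N.comp n (act N (\<Phi> x) (bw [i]))" for n
  proof (cases n)
   case 0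
   then show ?thesis using \<Phi>(2)[of "act M x (bw [i])" 0] xc comp_actx(2)[OF xc] N.comp_actx(2)[OF \<Phi>(1)[OF xc]] p0 by simp
  next
   case (Suc j)
   show ?thesis
   proof (cases "j >= k")
    case True
    then show ?thesis using Suc xc act[OF True comp_piece[OF xc]] \<Phi> comp_actx(1)[OF xc] N.comp_actx(1)[OF \<Phi>(1)[OF xc]] by simp
   next
    case False
    then have "comp j x = \<zero>\<^bsub>M\<^esub>" using x by (simp add: tail_def)
    then show ?thesis using Suc xc \<Phi> p0 comp_actx(1)[OF xc] N.comp_actx(1)[OF \<Phi>(1)[OF xc]] False by simp
   qed
  qed
 qed
 have \<Phi>_w: "\<Phi> (act M x (bw w)) = act N (\<Phi> x) (bw w)" if "x \<in> tail k" for x w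
  using that
 proof (induction w arbitrary: x)
  case (Cons i w)
  have xc: "x \<in> carrier M" and xi: "act M x (bw [i]) \<in> tail k" using subD(5)[OF t(1)] t(2) Cons.prems by auto
  have "\<Phi> (act M (act M x (bw [i])) (bw w)) = act N (act N (\<Phi> x) (bw [i])) (bw w)"
   using Cons.IH[OF xi] \<Phi>_x[OF Cons.prems] by simp
  then show ?case
   using act_bw_append[OF xc, of "[i]" w] N.act_bw_append[OF \<Phi>(1)[OF xc], of "[i]" w] \<Phi>_s xc by simp
 qed (use \<Phi>(1) subD(5)[OF t(1)] in simp)
 have \<Phi>_act: "\<Phi> (act M x b) = act N (\<Phi> x) b" if x: "x \<in> tail k" and b: "b \<in> carrier B" for x b
 proof -
  have xc: "x \<in> carrier M" using x by (simp add: tail_def)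
  have \<Phi>0: "\<Phi> \<zero>\<^bsub>M\<^esub> = \<zero>\<^bsub>N\<^esub>" using \<Phi>_s[of "\<zero>\<^bsub>M\<^esub>" 0] \<Phi>(1)[of "\<zero>\<^bsub>M\<^esub>"] by simp
  show ?thesis using b
   by (induction rule: B_induct) (use xc x \<Phi> \<Phi>0 \<Phi>_w in \<open>simp_all add: act_add_r N.act_add_r act_smult_r N.act_smult_r \<Phi>_add \<Phi>_s\<close>)
 qed
 show ?thesis
 proof (rule that[of \<Phi>])
  show "\<Phi> x \<in> N.tail k" if "x \<in> tail k" for x using that \<Phi> by (simp add: tail_def N.tail_def)
  show "N.comp n (\<Phi> x) = \<phi> n (comp n x)" if "x \<in> tail k" "n >= k" for x n using that \<Phi> by (simp add: tail_def)
  show "(%x. {\<Phi> x}) \<in> graded_hom R (sub_module M (tail k)) (quot_module N {\<zero>\<^bsub>N\<^esub>})"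
  proof (rule N.quot_zero_hom, unfold sub_module_simps)
   fix n x assume x: "x \<in> piece M n Int tail k"
   have xc: "x \<in> carrier M" using x by (simp add: tail_def)
   have "\<Phi> x = N.comp n (\<Phi> x)"
   proof (rule N.eq_by_comps)
    show "N.comp m (\<Phi> x) = N.comp m (N.comp n (\<Phi> x))" for m
     using comp_homog[of x n m] x \<Phi>(2)[OF xc, of m] N.comp_homog[OF N.comp_piece[OF \<Phi>(1)[OF xc]], of m n] p0[of m] by auto
   qed (use \<Phi>(1)[OF xc] in auto)
   then show "\<Phi> x \<in> piece N n" using N.comp_piece[OF \<Phi>(1)[OF xc], of n] by simp
  qed (use \<Phi> \<Phi>_add \<Phi>_s \<Phi>_act in \<open>auto simp: tail_def\<close>)
 qed
qed

end

lemma (in gmod) qgr_comp_tails: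
 assumes fg: "finitely_generated R M" and inv: "!!x. x \<in> tail k ==> \<Phi> x \<in> T & \<Psi> (\<Phi> x) = x" and z: "\<Phi> \<zero>\<^bsub>M\<^esub> = z"
 shows "qgr_eq R M M (qgr_comp (tail k, {z}, %x. {\<Phi> x}) (T, {\<zero>\<^bsub>M\<^esub>}, %x. {\<Psi> x})) (qgr_id M)"
proof -
 have c: "cofinite_sub R M (tail k)" by (rule cofinite_subI[OF fg graded_tail tail_piece])
 have z0: "\<zero>\<^bsub>M\<^esub> \<in> tail k" by (simp add: tail_def)
 have 1: "tail k <= {m \<in> tail k. {\<Phi> m} Int T ~= {}} Int carrier M" using inv by (auto simp: tail_def)
 have 2: "(\<Union>n\<in>{z} Int T. {\<Psi> n}) Un {\<zero>\<^bsub>M\<^esub>} <= {\<zero>\<^bsub>M\<^esub>}" using inv[OF z0] z by auto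
 have 3: "\<forall>m\<in>tail k. (\<Union>n\<in>{\<Phi> m} Int T. {\<Psi> n}) <+>\<^bsub>M\<^esub> {\<zero>\<^bsub>M\<^esub>} = {m} <+>\<^bsub>M\<^esub> {\<zero>\<^bsub>M\<^esub>}"
 proof
  fix m assume "m \<in> tail k"
  then have "(\<Union>n\<in>{\<Phi> m} Int T. {\<Psi> n}) = {m}" using inv[of m] by auto
  then show "(\<Union>n\<in>{\<Phi> m} Int T. {\<Psi> n}) <+>\<^bsub>M\<^esub> {\<zero>\<^bsub>M\<^esub>} = {m} <+>\<^bsub>M\<^esub> {\<zero>\<^bsub>M\<^esub>}" by simp
 qed
 show ?thesis
  unfolding qgr_comp_def qgr_eq_def qgr_id_def prod.case using c 1 finite_sub_zero[OF fg] 2 3 by blast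
qed

lemma (in gmod_pair) qgr_isomorphic_tails:
 assumes fg: "finitely_generated R M" "finitely_generated R N"
  and p: "!!n. n >= k ==> bij_betw (\<phi> n) (piece M n) (piece N n)"
  and add: "!!n u u'. n >= k ==> u \<in> piece M n ==> u' \<in> piece M n ==> \<phi> n (u \<oplus>\<^bsub>M\<^esub> u') = \<phi> n u \<oplus>\<^bsub>N\<^esub> \<phi> n u'"
  and smult: "!!n u c. n >= k ==> u \<in> piece M n ==> \<phi> n (c \<odot>\<^bsub>M\<^esub> u) = c \<odot>\<^bsub>N\<^esub> \<phi> n u"
  and act: "!!n u i. n >= k ==> u \<in> piece M n ==> \<phi> (Suc n) (act M u (bw [i])) = act N (\<phi> n u) (bw [i])"
 shows "qgr_isomorphic R M N"
proof -
 interpret NM: gmod_pair \<alpha> \<beta> \<gamma> R r N M by unfold_locales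
 define \<psi> where "\<psi> n = the_inv_into (piece M n) (\<phi> n)" for n
 have \<phi>: "\<phi> n u \<in> piece N n" "\<psi> n (\<phi> n u) = u" if "n >= k" "u \<in> piece M n" for n u
  using p[OF that(1)] that(2) by (auto simp: \<psi>_def bij_betw_def the_inv_into_f_f)
 have \<psi>: "\<psi> n w \<in> piece M n" "\<phi> n (\<psi> n w) = w" if "n >= k" "w \<in> piece N n" for n w
  using p[OF that(1)] that(2) the_inv_into_into[of "\<phi> n" "piece M n" w "piece M n"] f_the_inv_into_f[of "\<phi> n" "piece M n" w]
  by (simp_all add: \<psi>_def bij_betw_def)
 obtain \<Phi> where \<Phi>: "(%x. {\<Phi> x}) \<in> graded_hom R (sub_module M (tail k)) (quot_module N {\<zero>\<^bsub>N\<^esub>})"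
  "!!x. x \<in> tail k ==> \<Phi> x \<in> N.tail k" "!!x n. x \<in> tail k ==> n >= k ==> N.comp n (\<Phi> x) = \<phi> n (comp n x)"
  by (rule hom_of_pieces[of k \<phi>]) (use \<phi> add smult act in auto)
 obtain \<Psi> where \<Psi>: "(%x. {\<Psi> x}) \<in> graded_hom R (sub_module N (N.tail k)) (quot_module M {\<zero>\<^bsub>M\<^esub>})"
  "!!x. x \<in> N.tail k ==> \<Psi> x \<in> tail k" "!!x n. x \<in> N.tail k ==> n >= k ==> comp n (\<Psi> x) = \<psi> n (N.comp n x)"
 proof (rule NM.hom_of_pieces[of k \<psi>])
  fix n assume n: "n >= k"
  fix w assume w: "w \<in> piece N n"
  show "\<psi> n w \<in> piece M n" by (rule \<psi>(1)[OF n w])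
  show "\<psi> n (w \<oplus>\<^bsub>N\<^esub> w') = \<psi> n w \<oplus>\<^bsub>M\<^esub> \<psi> n w'" if w': "w' \<in> piece N n" for w'
   using \<phi>(2)[OF n pD(3)[OF \<psi>(1)[OF n w] \<psi>(1)[OF n w']]] add n \<psi> w w' by simp
  show "\<psi> n (c \<odot>\<^bsub>N\<^esub> w) = c \<odot>\<^bsub>M\<^esub> \<psi> n w" for c
   using \<phi>(2)[OF n pD(4)[OF \<psi>(1)[OF n w]]] smult n \<psi> w by simp
  show "\<psi> (Suc n) (act N w (bw [i])) = act M (\<psi> n w) (bw [i])" for i
   using \<phi>(2)[OF _ actx_piece[OF \<psi>(1)[OF n w]], of i] act n \<psi> w by simp
 qed blast
 have inv: "\<Psi> (\<Phi> x) = x" if x: "x \<in> tail k" for x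
 proof (rule eq_by_comps)
  have "x \<in> carrier M" "\<Psi> (\<Phi> x) \<in> tail k" using x \<Phi>(2) \<Psi>(2) by (auto simp: tail_def)
  then show "\<Psi> (\<Phi> x) \<in> carrier M" "x \<in> carrier M" "comp n (\<Psi> (\<Phi> x)) = comp n x" for n
   using x \<Phi>(2,3)[OF x] \<Psi>(3)[OF \<Phi>(2)[OF x], of n] \<phi>(2)[OF _ comp_piece, of n x] by (cases "n >= k"; auto simp: tail_def)+
 qed
 have inv': "\<Phi> (\<Psi> x) = x" if x: "x \<in> N.tail k" for x
 proof (rule N.eq_by_comps)
  have "x \<in> carrier N" "\<Phi> (\<Psi> x) \<in> N.tail k" using x \<Phi>(2) \<Psi>(2) by (auto simp: N.tail_def)
  then show "\<Phi> (\<Psi> x) \<in> carrier N" "x \<in> carrier N" "N.comp n (\<Phi> (\<Psi> x)) = N.comp n x" for n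
   using x \<Psi>(2,3)[OF x] \<Phi>(3)[OF \<Psi>(2)[OF x], of n] \<psi>(2)[OF _ N.comp_piece, of n x] by (cases "n >= k"; auto simp: N.tail_def)+
 qed
 have z: "\<zero>\<^bsub>M\<^esub> \<in> tail k" "\<zero>\<^bsub>N\<^esub> \<in> N.tail k" by (simp_all add: tail_def N.tail_def)
 have \<Phi>0: "\<Phi> \<zero>\<^bsub>M\<^esub> = \<zero>\<^bsub>N\<^esub>"
 proof (rule N.eq_by_comps)
  show "N.comp n (\<Phi> \<zero>\<^bsub>M\<^esub>) = N.comp n \<zero>\<^bsub>N\<^esub>" for n
   using \<Phi>(2,3)[OF z(1)] smult[OF _ pD(2), of n 0] \<phi>(1)[OF _ pD(2), of n] N.pD(5) by (cases "n >= k") (auto simp: N.tail_def)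
 qed (use \<Phi>(2)[OF z(1)] in \<open>auto simp: N.tail_def\<close>)
 then have \<Psi>0: "\<Psi> \<zero>\<^bsub>N\<^esub> = \<zero>\<^bsub>M\<^esub>" using inv[OF z(1)] by simp
 have c: "cofinite_sub R M (tail k)" "cofinite_sub R N (N.tail k)"
  by (rule cofinite_subI[OF fg(1) graded_tail tail_piece], assumption) (rule N.cofinite_subI[OF fg(2) N.graded_tail N.tail_piece], assumption)
 have "(tail k, {\<zero>\<^bsub>N\<^esub>}, %x. {\<Phi> x}) \<in> qgr_mor R M N" "(N.tail k, {\<zero>\<^bsub>M\<^esub>}, %x. {\<Psi> x}) \<in> qgr_mor R N M"
  using \<Phi>(1) \<Psi>(1) c finite_sub_zero[OF fg(1)] N.finite_sub_zero[OF fg(2)] by (auto simp: qgr_mor_def)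
 moreover have "qgr_eq R M M (qgr_comp (tail k, {\<zero>\<^bsub>N\<^esub>}, %x. {\<Phi> x}) (N.tail k, {\<zero>\<^bsub>M\<^esub>}, %x. {\<Psi> x})) (qgr_id M)"
  by (rule qgr_comp_tails[where \<Phi> = \<Phi>, OF fg(1) _ \<Phi>0]) (use \<Phi>(2) inv in auto)
 moreover have "qgr_eq R N N (qgr_comp (N.tail k, {\<zero>\<^bsub>M\<^esub>}, %x. {\<Psi> x}) (tail k, {\<zero>\<^bsub>N\<^esub>}, %x. {\<Phi> x})) (qgr_id N)"
  by (rule N.qgr_comp_tails[where \<Phi> = \<Psi>, OF fg(2) _ \<Psi>0]) (use \<Psi>(2) inv' in auto)
 ultimately show ?thesis
  unfolding qgr_isomorphic_def qgr_iso_def qgr_object_def using fg gm N.gm by blast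
qed

context point_modules
begin

lemma irreducible_isomorphic:
 fixes M :: "('k, 'm, 'k elem_B) graded_rmodule"
 assumes irr: "qgr_irreducible TW M"
 shows "\<exists>p\<in>E. qgr_isomorphic TW M (row_module \<alpha> \<beta> \<gamma> (Mp p))"
proof -
 have obj: "graded_module TW M" and fg: "finitely_generated TW M" and nz: "~ qgr_is_zero TW M"
  using irr by (simp_all add: qgr_irreducible_def qgr_object_def)
 interpret M: gmod \<alpha> \<beta> \<gamma> TW mu M
  using sklyanin_axioms word_algebra_TW obj by (simp add: gmod_def gmod_axioms_def)
 interpret N: gmod \<alpha> \<beta> \<gamma> B "%_ _. 1" "row_module \<alpha> \<beta> \<gamma> M"
  by (rule M.row_gmod[OF word_algebra_B]) simp
 interpret C: sklyanin_curve \<alpha> \<beta> \<gamma> E \<sigma> Y by (rule curve)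
 let ?N = "row_module \<alpha> \<beta> \<gamma> M"
 obtain U n0 where U: "!!n. finite (U n)" "!!n. U n <= piece M n" "!!n. piece M n = M.span (U n)"
  "!!n. n >= n0 ==> piece M (Suc n) = M.span (M.next_gens (U n))" by (rule M.fin_gen_pieces[OF fg]) blast
 have Uc: "U n <= carrier M" for n using U(2) M.pD(1) by blast
 let ?o = "\<zero>\<^bsub>M\<^esub>"
 note row = M.row_simps
 have row_x: "act ?N (u, u') (bw [i]) = M.rowP i (act M u (bw [i]), act M u' (bw [i]))" if "u \<in> carrier M" "u' \<in> carrier M" for u u' i
  using M.row_act_bw[OF that, of "[i]"] by simp
 \<comment> \<open>To span all row vectors over the span of \<open>W\<close> it is enough to have
   (w, 0) and (0, w) for w in \<open>W\<close>.\<close>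
 have parts: "(a, b) \<in> N.span X" if X: "X <= carrier ?N" and W: "W <= carrier M" "!!w. w \<in> W ==> (w, ?o) \<in> N.span X & (?o, w) \<in> N.span X"
  and ab: "a \<in> M.span W" "b \<in> M.span W" for X W a b
 proof -
  note s = N.subD[OF N.span_sub[OF X]]
  let ?S = "{w \<in> carrier M. (w, ?o) \<in> N.span X & (?o, w) \<in> N.span X}"
  have "M.sub ?S"
  proof (rule M.subI)
   fix x y c assume x: "x \<in> ?S"
   show "c \<odot>\<^bsub>M\<^esub> x \<in> ?S"
    using x s(4)[of "(x, ?o)" c] s(4)[of "(?o, x)" c] by (simp add: row)
   assume y: "y \<in> ?S"
   show "x \<oplus>\<^bsub>M\<^esub> y \<in> ?S"
    using x y s(3)[of "(x, ?o)" "(y, ?o)"] s(3)[of "(?o, x)" "(?o, y)"] by (simp add: row)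
  qed (use s(2) row in auto)
  then have "M.span W <= ?S"
   by (rule M.span_least[rotated]) (use W in blast)
  then have "(a, ?o) \<in> N.span X" "(?o, b) \<in> N.span X" "a \<in> carrier M" "b \<in> carrier M" using ab by blast+
  then show ?thesis using s(3)[of "(a, ?o)" "(?o, b)"] by (simp add: row)
 qed
 let ?T = "(%u. (u, ?o)) ` U n0 Un (%u. (?o, u)) ` U n0"
 have "test_module \<alpha> \<beta> \<gamma> E \<sigma> Y ?N n0 ?T"
 proof (intro test_module.intro test_module_axioms.intro C.sklyanin_curve_axioms N.gmod_axioms)
  show "finite ?T" using U(1) by simp
  show "?T <= piece ?N n0" using U(2)[of n0] M.pD(2) by (auto simp: row)
  have Tc: "?T <= carrier ?N" using Uc by (auto simp: row)
  show "piece ?N n0 <= N.span ?T"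
  proof
   fix x assume "x \<in> piece ?N n0"
   then obtain a b where "x = (a, b)" "a \<in> M.span (U n0)" "b \<in> M.span (U n0)" using U(3)[of n0] by (auto simp: row)
   then show "x \<in> N.span ?T" using parts[OF Tc Uc[of n0]] N.in_own_span[OF Tc] by blast
  qed
  show "piece ?N (Suc n) <= N.span (N.next_gens (piece ?N n))" if n: "n >= n0" for n
  proof
   let ?X = "N.next_gens (piece ?N n)"
   have Xc: "?X <= carrier ?N" using N.next_gens_piece[of "piece ?N n" n] N.pD(1) by blast
   note s = N.subD(4)[OF N.span_sub[OF Xc]]
   have Wc: "M.next_gens (U n) <= carrier M" using M.next_gens_piece[OF U(2)] M.pD(1) by blast
   have W: "(w, ?o) \<in> N.span ?X & (?o, w) \<in> N.span ?X" if "w \<in> M.next_gens (U n)" for w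
   proof -
    obtain u i where u: "u \<in> piece M n" "w = act M u (bw [i])" using \<open>w \<in> M.next_gens (U n)\<close> U(2) by (auto simp: M.next_gens_def)
    have uc: "u \<in> carrier M" using M.pD(5)[OF u(1)] .
    have "act ?N x (bw [i]) \<in> ?X" if "x \<in> piece ?N n" for x using that by (auto simp: N.next_gens_def)
    then have "M.rowP i (w, ?o) \<in> N.span ?X" "M.rowP i (?o, w) \<in> N.span ?X"
     using row_x[of u "?o" i] row_x[of "?o" u i] uc u M.pD(2)[of n] N.in_own_span[OF Xc] by (force simp: row)+
    \<comment> \<open>\<open>rowP\<close> permutes the two slots up to sign, so the two vectors just
      found are (w, 0) and (0, w) up to order and sign.\<close>
    then show ?thesis using uc u(2) s[of _ "- 1"] by (cases i) (force simp: row simp flip: M.s_mult)+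
   qed
   fix x assume "x \<in> piece ?N (Suc n)"
   then obtain a b where "x = (a, b)" "a \<in> M.span (M.next_gens (U n))" "b \<in> M.span (M.next_gens (U n))" using U(4)[OF n] by (auto simp: row)
   then show "x \<in> N.span ?X" using parts[OF Xc Wc W] by blast
  qed
  show "\<exists>n\<ge>k. ~ piece ?N n <= {\<zero>\<^bsub>?N\<^esub>}" for k
   using nz M.pD(2) unfolding M.qgr_is_zero_iff[OF fg] by (fastforce simp: row)
 qed
 then interpret T: test_module \<alpha> \<beta> \<gamma> E \<sigma> Y ?N n0 ?T .
 obtain q k \<Lambda> where q: "q \<in> E" and \<Lambda>:
  "!!n u u'. n >= k ==> u \<in> piece ?N n ==> u' \<in> piece ?N n ==> \<Lambda> n (u \<oplus>\<^bsub>?N\<^esub> u') = \<Lambda> n u + \<Lambda> n u'"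
  "!!n u c. n >= k ==> u \<in> piece ?N n ==> \<Lambda> n (c \<odot>\<^bsub>?N\<^esub> u) = c * \<Lambda> n u"
  "!!n u i. n >= k ==> u \<in> piece ?N n ==> \<Lambda> (Suc n) (act ?N u (bw [i])) = Y ((\<sigma> ^^ n) q) i * \<Lambda> n u"
  "!!n. n >= k ==> \<exists>u\<in>piece ?N n. \<Lambda> n u ~= 0" by (rule T.functional) blast
 obtain e where "fat_point \<alpha> \<beta> \<gamma> Mp \<sigma> q e" using fat_point_exists[OF q] by blast
 then interpret FP: fat_point \<alpha> \<beta> \<gamma> Mp \<sigma> q e .
 let ?P = "row_module \<alpha> \<beta> \<gamma> (Mp q)" and ?y = "%n. Y ((\<sigma> ^^ n) q)"
 \<comment> \<open>\<Lambda> restricted to the two slots gives the two coordinates of the image in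
   the fat point module of q. The way the matrices mix the slots matches \<open>v_act\<close>, which
   makes the map linear over the twist.\<close>
 define a b where "a n u = \<Lambda> n (u, ?o)" and "b n u = \<Lambda> n (?o, u)" for n u
 define \<phi> where "\<phi> n u = FP.v n (a n u) (b n u)" for n u
 have ab_add: "a n (u \<oplus>\<^bsub>M\<^esub> u') = a n u + a n u'" "b n (u \<oplus>\<^bsub>M\<^esub> u') = b n u + b n u'" if "n >= k" "u \<in> piece M n" "u' \<in> piece M n" for n u u'
  using \<Lambda>(1)[OF that(1), of "(u, ?o)" "(u', ?o)"] \<Lambda>(1)[OF that(1), of "(?o, u)" "(?o, u')"] that M.pD(2)
  by (simp_all add: a_def b_def row)
 have ab_s: "a n (c \<odot>\<^bsub>M\<^esub> u) = c * a n u" "b n (c \<odot>\<^bsub>M\<^esub> u) = c * b n u" if "n >= k" "u \<in> piece M n" for n u c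
  using \<Lambda>(2)[OF that(1), of "(u, ?o)" c] \<Lambda>(2)[OF that(1), of "(?o, u)" c] that M.pD(2)
  by (simp_all add: a_def b_def row)
 have ab_x: "a (Suc n) (act M u (bw [i])) = ?y n i * (if i = X0 \<or> i = X1 then a n u else b n u)"
  "b (Suc n) (act M u (bw [i])) = (if i = X1 \<or> i = X3 then - 1 else 1) * (?y n i * (if i = X0 \<or> i = X1 then b n u else a n u))"
  if n: "n >= k" and u: "u \<in> piece M n" for n u i
 proof -
  have uc: "u \<in> carrier M" using M.pD(5)[OF u] .
  have neg: "\<Lambda> (Suc n) (?o, act M u (bw [i])) = - \<Lambda> (Suc n) (?o, (- 1) \<odot>\<^bsub>M\<^esub> act M u (bw [i]))"
   using ab_s(2)[OF le_SucI[OF n] M.actx_piece[OF u], of "- 1" i] by (simp add: b_def)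
  show "a (Suc n) (act M u (bw [i])) = ?y n i * (if i = X0 \<or> i = X1 then a n u else b n u)"
   using \<Lambda>(3)[OF n, of "(u, ?o)" i] \<Lambda>(3)[OF n, of "(?o, u)" i] u uc M.pD(2) row_x[of u "?o" i] row_x[of "?o" u i]
   by (cases i) (simp_all add: row a_def b_def)
  show "b (Suc n) (act M u (bw [i])) = (if i = X1 \<or> i = X3 then - 1 else 1) * (?y n i * (if i = X0 \<or> i = X1 then b n u else a n u))"
   using \<Lambda>(3)[OF n, of "(u, ?o)" i] \<Lambda>(3)[OF n, of "(?o, u)" i] u uc M.pD(2) row_x[of u "?o" i] row_x[of "?o" u i] neg
   by (cases i) (simp_all add: row a_def b_def)
 qed
 have \<phi>_add: "\<phi> n (u \<oplus>\<^bsub>M\<^esub> u') = \<phi> n u \<oplus>\<^bsub>?P\<^esub> \<phi> n u'" if "n >= k" "u \<in> piece M n" "u' \<in> piece M n" for n u u'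
  using ab_add[OF that] by (simp add: \<phi>_def FP.v_add)
 have \<phi>_s: "\<phi> n (c \<odot>\<^bsub>M\<^esub> u) = c \<odot>\<^bsub>?P\<^esub> \<phi> n u" if "n >= k" "u \<in> piece M n" for n u c
  using ab_s[OF that] by (simp add: \<phi>_def FP.v_smult)
 have \<phi>_x: "\<phi> (Suc n) (act M u (bw [i])) = act ?P (\<phi> n u) (bw [i])" if "n >= k" "u \<in> piece M n" for n u i
  using ab_x[OF that, of i] by (cases i) (simp_all add: \<phi>_def FP.v_act)
 have \<phi>_zero: "\<phi> n u = \<zero>\<^bsub>?P\<^esub> \<longleftrightarrow> a n u = 0 & b n u = 0" for n u by (simp add: \<phi>_def FP.v_zero)
 have \<phi>0: "\<phi> n ?o = \<zero>\<^bsub>?P\<^esub>" if "n >= k" for n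
  using \<phi>_s[OF that M.pD(2), of 0] by (simp add: \<phi>_def FP.v_smult FP.v_zero)
 have \<phi>_nz: "\<exists>u\<in>piece M n. \<phi> n u ~= \<zero>\<^bsub>?P\<^esub>" if n: "n >= k" for n
 proof -
  obtain u u' where u: "u \<in> piece M n" "u' \<in> piece M n" "\<Lambda> n (u, u') ~= 0" using \<Lambda>(4)[OF n] by (auto simp: row)
  have "\<Lambda> n (u, u') = a n u + b n u'"
   using \<Lambda>(1)[OF n, of "(u, ?o)" "(?o, u')"] u M.pD(2,5) by (simp add: row a_def b_def)
  then have "a n u ~= 0 \<or> b n u' ~= 0" using u(3) by auto
  then show ?thesis using u \<phi>_zero by blast
 qed
 \<comment> \<open>The image contains all products with the generators of a nonzero vector one
   degree lower, hence by \<open>spread\<close> the whole piece. Surjectivity therefore starts one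
   degree after k.\<close>
 have surj: "\<exists>u\<in>piece M n. \<phi> n u = x" if n: "n >= Suc k" and x: "x \<in> piece ?P n" for n x
 proof -
  obtain m where m: "n = Suc m" "m >= k" using n by (metis Suc_le_D Suc_le_mono)
  obtain u0 where u0: "u0 \<in> piece M m" "a m u0 ~= 0 \<or> b m u0 ~= 0" using \<phi>_nz[OF m(2)] \<phi>_zero by blast
  have nk: "n >= k" using n by simp
  have "FP.P.sub (\<phi> n ` piece M n)"
  proof (rule FP.P.subI)
   show "\<phi> n ` piece M n <= carrier ?P" unfolding \<phi>_def using FP.v_carrier by blast
   show "\<zero>\<^bsub>?P\<^esub> \<in> \<phi> n ` piece M n" using \<phi>0[OF nk] M.pD(2) by (metis imageI)
   fix x x' c assume "x \<in> \<phi> n ` piece M n"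
   then obtain u where u: "x = \<phi> n u" "u \<in> piece M n" by blast
   show "c \<odot>\<^bsub>?P\<^esub> x \<in> \<phi> n ` piece M n" unfolding u(1) \<phi>_s[OF nk u(2), symmetric] by (rule imageI[OF M.pD(4)[OF u(2)]])
   assume "x' \<in> \<phi> n ` piece M n"
   then obtain u' where u': "x' = \<phi> n u'" "u' \<in> piece M n" by blast
   show "x \<oplus>\<^bsub>?P\<^esub> x' \<in> \<phi> n ` piece M n"
    unfolding u(1) u'(1) \<phi>_add[OF nk u(2) u'(2), symmetric] by (rule imageI[OF M.pD(3)[OF u(2) u'(2)]])
  qed
  then have "piece ?P (Suc m) <= \<phi> n ` piece M n"
  proof (rule FP.spread[OF _ _ u0(2)])
   show "act ?P (FP.v m (a m u0) (b m u0)) (bw [i]) \<in> \<phi> n ` piece M n" for i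
    unfolding \<phi>_def[symmetric] \<phi>_x[OF m(2) u0(1), symmetric] m(1) by (rule imageI[OF M.actx_piece[OF u0(1)]])
  qed
  then show ?thesis using x m(1) by blast
 qed
 let ?k = "Suc k"
 \<comment> \<open>The kernel of the map, cut off below the degree from which the map is known to be
   onto.\<close>
 define K where "K = {u \<in> carrier M. ALL n. (n < ?k --> M.comp n u = ?o) & (n >= ?k --> \<phi> n (M.comp n u) = \<zero>\<^bsub>?P\<^esub>)}"
 have K: "graded_submodule TW M K"
  unfolding M.graded_submodule_iff
 proof (intro conjI ballI allI)
  show "M.sub K"
   by (rule M.subI) (auto simp: K_def \<phi>0 \<phi>_add \<phi>_s M.comp_add M.comp_smult M.comp_piece)
  show "act M u (bw [i]) \<in> K" if u: "u \<in> K" for u i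
  proof -
   have uc: "u \<in> carrier M" using u by (simp add: K_def)
   have "(n < ?k --> M.comp n (act M u (bw [i])) = ?o) & (n >= ?k --> \<phi> n (M.comp n (act M u (bw [i]))) = \<zero>\<^bsub>?P\<^esub>)" for n
   proof (cases n)
    case (Suc j)
    then show ?thesis using u M.comp_actx(1)[OF uc, of j i] \<phi>_x[OF _ M.comp_piece[OF uc], of j i] \<phi>0[of n]
     by (cases "j < ?k") (auto simp: K_def)
   qed (use M.comp_actx(2)[OF uc] in simp)
   then show ?thesis using uc by (simp add: K_def)
  qed
  show "M.comp n u \<in> K" if "u \<in> K" for u n
   using that M.comp_homog[OF M.comp_piece[of u n]] \<phi>0 by (auto simp: K_def)
 qed
 have pK: "u \<in> piece M n Int K \<longleftrightarrow> u \<in> piece M n & \<phi> n u = \<zero>\<^bsub>?P\<^esub>" if n: "n >= ?k" for n u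
  using n M.comp_homog[of u n] \<phi>0 M.pD(5)[of u n] by (auto simp: K_def)
 \<comment> \<open>An element of the kernel is a sum of u_j x_j. The tuple u is corrected by a tuple
   t with the same images and with vanishing sum of t_j x_j, so that the differences u_j - t_j lie
   in the kernel. The bound on n leaves a degree l = n - 1 in which the map is already onto.\<close>
 have gen: "piece M (Suc n) Int K <= M.span (M.next_gens (piece M n Int K))" if n: "n >= max (Suc ?k) n0" for n
 proof
  obtain l where l: "n = Suc l" "l >= ?k" using n by (metis Suc_le_D Suc_le_mono max.bounded_iff)
  have nk: "n >= k" "n >= ?k" "l >= k" using l by simp_all
  define X where "X t = act M (t X0) (bw [X0]) \<oplus>\<^bsub>M\<^esub> act M (t X1) (bw [X1]) \<oplus>\<^bsub>M\<^esub> act M (t X2) (bw [X2]) \<oplus>\<^bsub>M\<^esub> act M (t X3) (bw [X3])" for t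
  let ?G = "M.next_gens (piece M n Int K)"
  have Gc: "?G <= carrier M" using M.next_gens_piece[of "piece M n Int K" n] M.pD(1) by blast
  note sG = M.subD[OF M.span_sub[OF Gc]]
  have X_add: "X (%j. t j \<oplus>\<^bsub>M\<^esub> c \<odot>\<^bsub>M\<^esub> t' j) = X t \<oplus>\<^bsub>M\<^esub> c \<odot>\<^bsub>M\<^esub> X t'" if "!!j. t j \<in> carrier M" "!!j. t' j \<in> carrier M" for t t' c
   using that by (simp add: X_def M.act_add M.act_smult M.add_s M.M.a_ac)
  obtain w where w: "!!\<epsilon>. w \<epsilon> \<in> piece M l" "\<phi> l (w False) = FP.v l 1 0" "\<phi> l (w True) = FP.v l 0 1"
  proof -
   obtain w0 w1 where "w0 \<in> piece M l" "\<phi> l w0 = FP.v l 1 0" "w1 \<in> piece M l" "\<phi> l w1 = FP.v l 0 1"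
    using surj[OF l(2) FP.v_piece] by metis
   then show ?thesis using that[of "%\<epsilon>. if \<epsilon> then w1 else w0"] by simp
  qed
  have wc: "w \<epsilon> \<in> carrier M" for \<epsilon> using w(1) M.pD(5) by blast
  have wab: "a l (w False) = 1" "b l (w False) = 0" "a l (w True) = 0" "b l (w True) = 1"
   using w(2,3) by (simp_all add: \<phi>_def FP.v_inj)
  \<comment> \<open>The syzygies at hand: the relation (h, s) applied to w and split after its first
    letter. The sign \<open>mu\<close> converts the product of two letters in B into their
    successive action over the twist.\<close>
  define \<rho> where "\<rho> r j = (case r of (h, s, \<epsilon>) => (rel \<alpha> \<beta> \<gamma> h s (j \<boxplus> h) * mu (j \<boxplus> h) j) \<odot>\<^bsub>M\<^esub> act M (w \<epsilon>) (bw [j \<boxplus> h]))" for r j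
  have \<rho>p: "\<rho> r j \<in> piece M n" for r j
   using M.pD(4)[OF M.actx_piece[OF w(1)]] l(1) by (simp add: \<rho>_def split: prod.split)
  have \<rho>X: "X (\<rho> r) = ?o" for r
  proof -
   obtain h s \<epsilon> where r: "r = (h, s, \<epsilon>)" by (metis prod.exhaust)
   have "?o = act M (w \<epsilon>) (finsum B (%i. rel \<alpha> \<beta> \<gamma> h s i \<odot>\<^bsub>B\<^esub> bw [i, i \<boxplus> h]) UNIV)"
    using wc by (simp add: rel_in_B)
   also have "... = X (\<rho> r)"
    using wc M.act_bw_append[OF wc, of \<epsilon> "[_]" "[_]"]
    by (cases h) (simp_all add: finsum_gen X_def r \<rho>_def M.act_add_r M.act_smult_r M.act_smult M.s_mult M.M.a_ac)
   finally show ?thesis by simp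
  qed
  fix m assume m: "m \<in> piece M (Suc n) Int K"
  obtain u where u: "!!j. u j \<in> piece M n" "m = X u"
  proof -
   let ?S = "{X u |u. ALL j. u j \<in> piece M n}"
   have Xc: "X t \<in> carrier M" if "!!j. t j \<in> carrier M" for t using that by (simp add: X_def)
   have Uc': "M.next_gens (U n) <= carrier M" using M.next_gens_piece[OF U(2)] M.pD(1) by blast
   have "M.sub ?S"
   proof (rule M.subI)
    show "?S <= carrier M" using Xc M.pD(5) by blast
    have "X (%_. ?o) = ?o" by (simp add: X_def)
    then show "?o \<in> ?S" using M.pD(2)[of n] by (intro CollectI exI[of _ "%_. ?o"]) simp
    fix x y c assume "x \<in> ?S"
    then obtain u where u: "x = X u" "!!j. u j \<in> piece M n" by blast
    have uc: "u j \<in> carrier M" for j using M.pD(5)[OF u(2)] .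
    have "c \<odot>\<^bsub>M\<^esub> x = X (%j. c \<odot>\<^bsub>M\<^esub> u j)" using uc by (simp add: u(1) X_def M.act_smult M.add_s)
    then show "c \<odot>\<^bsub>M\<^esub> x \<in> ?S" using M.pD(4)[OF u(2)] by blast
    assume "y \<in> ?S"
    then obtain u' where u': "y = X u'" "!!j. u' j \<in> piece M n" by blast
    have "x \<oplus>\<^bsub>M\<^esub> y = X (%j. u j \<oplus>\<^bsub>M\<^esub> 1 \<odot>\<^bsub>M\<^esub> u' j)"
     using X_add[of u u' 1] uc M.pD(5)[OF u'(2)] u(1) u'(1) by (simp add: X_def)
    then show "x \<oplus>\<^bsub>M\<^esub> y \<in> ?S" using M.pD(3)[OF u(2) M.pD(4)[OF u'(2)]] by blast
   qed
   moreover have "M.next_gens (U n) <= ?S"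
   proof
    fix x assume "x \<in> M.next_gens (U n)"
    then obtain v i where v: "v \<in> piece M n" "x = act M v (bw [i])" using U(2) by (auto simp: M.next_gens_def)
    then have "x = X (%j. if j = i then v else ?o)" using M.pD(5)[OF v(1)] by (cases i) (simp_all add: X_def)
    then show "x \<in> ?S" using v(1) M.pD(2) by (intro CollectI exI[of _ "%j. if j = i then v else ?o"]) auto
   qed
   ultimately have "piece M (Suc n) <= ?S"
    using M.span_least U(4)[of n] n by simp
   then show ?thesis using m that by blast
  qed
  have uc: "u j \<in> carrier M" for j using M.pD(5)[OF u(1)] .
  have m0: "a (Suc n) m = 0" "b (Suc n) m = 0" using m pK[of "Suc n" m] nk \<phi>_zero by auto
  have Sn: "Suc n >= k" using nk by simp
  note up = M.actx_piece[OF u(1)]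
  let ?z = "?y n"
  have ca: "?z X0 * a n (u X0) + ?z X1 * a n (u X1) + ?z X2 * b n (u X2) + ?z X3 * b n (u X3) = 0"
   using m0(1) M.pD(3)[OF up up] M.pD(3)[OF M.pD(3)[OF up up] up] up
   by (simp add: u(2) X_def ab_add(1)[OF Sn] ab_x(1)[OF nk(1) u(1)])
  have cb: "?z X0 * b n (u X0) - ?z X1 * b n (u X1) + ?z X2 * a n (u X2) - ?z X3 * a n (u X3) = 0"
   using m0(2) M.pD(3)[OF up up] M.pD(3)[OF M.pD(3)[OF up up] up] up
   by (simp add: u(2) X_def ab_add(2)[OF Sn] ab_x(2)[OF nk(1) u(1)])
  define co where "co t x = (case x of (j, d) => if d then b n (t j) else a n (t j))" for t :: "gen => 'm" and x
  have sum_gb: "(\<Sum>x\<in>UNIV. f x) = (\<Sum>j\<in>UNIV. f (j, False) + f (j, True))" for f :: "gen \<times> bool => 'k"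
   unfolding UNIV_Times_UNIV[symmetric] sum.cartesian_product' UNIV_bool by (simp add: add.commute)
  \<comment> \<open>The images of u, as a vector in eight coordinates, must be a combination of
    those of the syzygies. By \<open>double_annihilator\<close> it suffices that every functional
    killing all syzygies kills it too.\<close>
  have "EX c. \<forall>x\<in>UNIV. co u x = (\<Sum>r\<in>UNIV. c r * co (\<rho> r) x)"
  proof (rule double_annihilator)
   fix \<psi> assume \<psi>: "!!r. r \<in> UNIV ==> (\<Sum>x\<in>UNIV. \<psi> x * co (\<rho> r) x) = 0"
   \<comment> \<open>Regrouped according to which slot each generator feeds, with the signs of
     \<open>rowP\<close>, the eight coordinates of the functional become two vectors. Testing on the
     two lifts w of a basis shows that each satisfies all bilinear relations against the point in
     degree l.\<close>
   define z0 z1 where "z0 j = (if j = X0 \<or> j = X1 then \<psi> (j, False) else \<psi> (j, True))"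
    and "z1 j = (if j = X0 then \<psi> (j, True) else if j = X1 then - \<psi> (j, True) else if j = X2 then \<psi> (j, False) else - \<psi> (j, False))" for j
   define W where "W \<epsilon> i d = (if d then b n (act M (w \<epsilon>) (bw [i])) else a n (act M (w \<epsilon>) (bw [i])))" for \<epsilon> i d
   have r\<rho>: "co (\<rho> (h, s, \<epsilon>)) (j, d) = rel \<alpha> \<beta> \<gamma> h s (j \<boxplus> h) * mu (j \<boxplus> h) j * W \<epsilon> (j \<boxplus> h) d" for h s \<epsilon> j d
    using ab_s[OF nk(1)] M.actx_piece[OF w(1)] l(1) by (simp add: co_def \<rho>_def W_def mult.assoc)
   have W: "W \<epsilon> i d = ?y l i * (if d then (if i = X1 \<or> i = X3 then - 1 else 1) * (if (i = X0 \<or> i = X1) = \<epsilon> then 1 else 0)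
     else (if (i = X0 \<or> i = X1) = \<epsilon> then 0 else 1))" for \<epsilon> i d
    using ab_x[OF nk(3) w(1), of \<epsilon> i] wab l(1) by (cases \<epsilon>) (auto simp: W_def)
   have "bilin \<alpha> \<beta> \<gamma> h s (?y l) z0 = 0 & bilin \<alpha> \<beta> \<gamma> h s (?y l) z1 = 0" for h s
    using \<psi>[of "(h, s, False)"] \<psi>[of "(h, s, True)"]
    by (cases h) (simp_all add: bilin_def sum_gb sum_gen r\<rho> W mu_eval z0_def z1_def algebra_simps del: rel.simps)
   then obtain c0 c1 where c: "!!j. z0 j = c0 * ?y n j" "!!j. z1 j = c1 * ?y n j"
    using C.bil_unique[OF \<sigma>_pow_in'[OF q, of l], of z0] C.bil_unique[OF \<sigma>_pow_in'[OF q, of l], of z1] unfolding l(1) funpow.simps comp_apply by metis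
   have p: "\<psi> (X0, False) = c0 * ?z X0" "\<psi> (X1, False) = c0 * ?z X1" "\<psi> (X2, True) = c0 * ?z X2" "\<psi> (X3, True) = c0 * ?z X3"
    "\<psi> (X0, True) = c1 * ?z X0" "\<psi> (X1, True) = - (c1 * ?z X1)" "\<psi> (X2, False) = c1 * ?z X2" "\<psi> (X3, False) = - (c1 * ?z X3)"
    using c(1)[of X0] c(1)[of X1] c(1)[of X2] c(1)[of X3] c(2)[of X0] c(2)[of X2]
     arg_cong[OF c(2)[of X1], of uminus] arg_cong[OF c(2)[of X3], of uminus]
    by (simp_all add: z0_def z1_def)
   \<comment> \<open>By uniqueness both vectors are multiples of the next point, so the functional
     is a combination of the two equations \<open>ca\<close> and \<open>cb\<close> that say that the
     image of m is zero.\<close>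
   have "(\<Sum>x\<in>UNIV. \<psi> x * co u x) = c0 * (?z X0 * a n (u X0) + ?z X1 * a n (u X1) + ?z X2 * b n (u X2) + ?z X3 * b n (u X3))
     + c1 * (?z X0 * b n (u X0) - ?z X1 * b n (u X1) + ?z X2 * a n (u X2) - ?z X3 * a n (u X3))"
    by (simp add: sum_gb sum_gen co_def p algebra_simps)
   then show "(\<Sum>x\<in>UNIV. \<psi> x * co u x) = 0" unfolding ca cb by simp
  qed simp_all
  then obtain c where c: "!!x. co u x = (\<Sum>r\<in>UNIV. c r * co (\<rho> r) x)" by blast
  \<comment> \<open>The combination of images is lifted to the same combination of the syzygies
    themselves, one summand at a time.\<close>
  have "EX t. (ALL j. t j \<in> piece M n) & X t = ?o & (ALL x. co t x = (\<Sum>r\<in>Q. c r * co (\<rho> r) x))" if "finite Q" for Q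
   using that
  proof (induction Q)
   case empty
   have "a n ?o = 0" "b n ?o = 0" using \<phi>0[OF nk(1)] \<phi>_zero by auto
   then show ?case using M.pD(2) by (intro exI[of _ "%_. ?o"]) (auto simp: X_def co_def)
  next
   case (insert r Q)
   then obtain t where t: "!!j. t j \<in> piece M n" "X t = ?o" "!!x. co t x = (\<Sum>r\<in>Q. c r * co (\<rho> r) x)" by blast
   have "X (%j. t j \<oplus>\<^bsub>M\<^esub> c r \<odot>\<^bsub>M\<^esub> \<rho> r j) = ?o"
    using X_add[of t "\<rho> r" "c r"] M.pD(5)[OF t(1)] M.pD(5)[OF \<rho>p] t(2) \<rho>X by simp
   moreover have "co (%j. t j \<oplus>\<^bsub>M\<^esub> c r \<odot>\<^bsub>M\<^esub> \<rho> r j) x = co t x + c r * co (\<rho> r) x" for x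
    by (cases x) (simp add: co_def ab_add[OF nk(1) t(1) M.pD(4)[OF \<rho>p]] ab_s[OF nk(1) \<rho>p])
   ultimately show ?case using M.pD(3)[OF t(1) M.pD(4)[OF \<rho>p]] insert.hyps t(3)
    by (intro exI[of _ "%j. t j \<oplus>\<^bsub>M\<^esub> c r \<odot>\<^bsub>M\<^esub> \<rho> r j"]) (simp add: add.commute)
  qed
  from this[of UNIV] obtain t where t: "!!j. t j \<in> piece M n" "X t = ?o" "!!x. co t x = co u x" unfolding c by auto
  have tc: "t j \<in> carrier M" for j using M.pD(5)[OF t(1)] .
  \<comment> \<open>Its entries have image zero, and it still represents m because the sum of t_j
    x_j is zero.\<close>
  let ?u = "%j. u j \<oplus>\<^bsub>M\<^esub> (- 1) \<odot>\<^bsub>M\<^esub> t j"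
  have u0: "a n (?u j) = 0 & b n (?u j) = 0" for j
   using t(3)[of "(j, False)"] t(3)[of "(j, True)"] ab_add[OF nk(1) u(1) M.pD(4)[OF t(1)]] ab_s[OF nk(1) t(1)] by (simp_all add: co_def)
  have "?u j \<in> piece M n Int K" for j
   unfolding pK[OF nk(2)] \<phi>_zero using u0[of j] M.pD(3)[OF u(1) M.pD(4)[OF t(1)]] by (rule conjI[rotated])
  then have "act M (?u j) (bw [j]) \<in> ?G" for j
   unfolding M.next_gens_def by (intro image_eqI[of _ _ "(?u j, j)"] SigmaI UNIV_I) (simp only: prod.case)
  then have "act M (?u j) (bw [j]) \<in> M.span ?G" for j using M.in_own_span[OF Gc] by (rule set_mp[rotated])
  then have "X ?u \<in> M.span ?G" unfolding X_def by (intro sG(3))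
  moreover have "X ?u = m" using X_add[of u t "- 1"] uc tc t(2) u(2) M.pD(5)[OF IntD1[OF m]] by simp
  ultimately show "m \<in> M.span ?G" by simp
 qed
 have "finitely_generated TW (sub_module M K)" by (rule M.fin_gen_sub[OF fg K gen])
 note M.irreducible_submodule[OF irr K this]
 moreover have "~ (EX k. \<forall>n\<ge>k. piece M n <= K)"
 proof
  assume "EX k. \<forall>n\<ge>k. piece M n <= K"
  then obtain k'' where "!!n. n >= k'' ==> piece M n <= K" by blast
  from this[of "max k'' ?k"] have "\<phi> (max k'' ?k) u = \<zero>\<^bsub>?P\<^esub>" if "u \<in> piece M (max k'' ?k)" for u
   using pK[of "max k'' ?k" u] that by auto
  then show False using \<phi>_nz[of "max k'' ?k"] by (auto simp: le_max_iff_disj)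
 qed
 ultimately obtain k' where k': "!!n. n >= k' ==> piece M n Int K <= {?o}" by blast
 interpret PR: gmod_pair \<alpha> \<beta> \<gamma> TW mu M ?P by unfold_locales
 have "qgr_isomorphic TW M ?P"
 proof (rule PR.qgr_isomorphic_tails[OF fg FP.fin_gen, of "max k' ?k" \<phi>])
  fix n assume n: "n >= max k' ?k"
  have nk: "n >= k" "n >= ?k" using n by simp_all
  show "bij_betw (\<phi> n) (piece M n) (piece ?P n)"
  proof (rule bij_betw_imageI)
   show "inj_on (\<phi> n) (piece M n)"
   proof (rule inj_onI)
    fix u u' assume u: "u \<in> piece M n" "u' \<in> piece M n" "\<phi> n u = \<phi> n u'"
    have d: "u \<oplus>\<^bsub>M\<^esub> (- 1) \<odot>\<^bsub>M\<^esub> u' \<in> piece M n" using M.pD(3)[OF u(1) M.pD(4)[OF u(2)]] .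
    have "\<phi> n (u \<oplus>\<^bsub>M\<^esub> (- 1) \<odot>\<^bsub>M\<^esub> u') = \<phi> n u \<oplus>\<^bsub>?P\<^esub> (- 1) \<odot>\<^bsub>?P\<^esub> \<phi> n u'"
     using \<phi>_add[OF nk(1) u(1) M.pD(4)[OF u(2)]] \<phi>_s[OF nk(1) u(2)] by simp
    also have "... = \<zero>\<^bsub>?P\<^esub>" using FP.P.diff_zero u(3) FP.v_carrier by (simp add: \<phi>_def)
    finally have "u \<oplus>\<^bsub>M\<^esub> (- 1) \<odot>\<^bsub>M\<^esub> u' = ?o" using pK[OF nk(2)] d k'[of n] n by auto
    then show "u = u'" using M.diff_zero M.pD(5)[OF u(1)] M.pD(5)[OF u(2)] by simp
   qed
   show "\<phi> n ` piece M n = piece ?P n" 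
   proof
    show "\<phi> n ` piece M n <= piece ?P n" unfolding \<phi>_def using FP.v_piece by blast
    show "piece ?P n <= \<phi> n ` piece M n"
    proof
     fix x assume "x \<in> piece ?P n"
     from surj[OF nk(2) this] show "x \<in> \<phi> n ` piece M n" by auto
    qed
   qed
  qed
  fix u assume u: "u \<in> piece M n"
  show "\<phi> n (u \<oplus>\<^bsub>M\<^esub> u') = \<phi> n u \<oplus>\<^bsub>?P\<^esub> \<phi> n u'" if "u' \<in> piece M n" for u' by (rule \<phi>_add[OF nk(1) u that])
  show "\<phi> n (c \<odot>\<^bsub>M\<^esub> u) = c \<odot>\<^bsub>?P\<^esub> \<phi> n u" for c by (rule \<phi>_s[OF nk(1) u])
  show "\<phi> (Suc n) (act M u (bw [i])) = act ?P (\<phi> n u) (bw [i])" for i by (rule \<phi>_x[OF nk(1) u])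
 qed
 then show ?thesis using q by blast
qed

end

theorem proposition5p3p24:
  fixes \<alpha> \<beta> \<gamma> :: "'k :: alg_closed_field"
    and Mp :: "'k point \<Rightarrow> ('k, 'n, 'k elem_B) graded_rmodule"
    and \<sigma> :: "'k point \<Rightarrow> 'k point"
  assumes "CHAR('k) \<noteq> 2"
    and "sklyanin_parameters \<alpha> \<beta> \<gamma>"
    and "\<forall>p \<in> curve_E \<alpha> \<beta> \<gamma>. point_module_at \<alpha> \<beta> \<gamma> p (Mp p)"
    and "shift_automorphism \<alpha> \<beta> \<gamma> Mp \<sigma>"
    and "infinite_order_on (curve_E \<alpha> \<beta> \<gamma>) \<sigma>"
  shows "(\<forall>M :: ('k, 'm, 'k elem_B) graded_rmodule.
            qgr_irreducible (alg_twist \<alpha> \<beta> \<gamma>) M \<longrightarrow>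
            (\<exists>p \<in> curve_E \<alpha> \<beta> \<gamma>.
               qgr_isomorphic (alg_twist \<alpha> \<beta> \<gamma>) M (row_module \<alpha> \<beta> \<gamma> (Mp p)))) \<and>
         (\<forall>p \<in> curve_E \<alpha> \<beta> \<gamma>.
            one_critical (alg_twist \<alpha> \<beta> \<gamma>) (row_module \<alpha> \<beta> \<gamma> (Mp p)) \<and>
            fat_point_module (alg_twist \<alpha> \<beta> \<gamma>) 2 (row_module \<alpha> \<beta> \<gamma> (Mp p)))"
proof -
  have "(2::'k) \<noteq> 0"
  proof
    assume "(2::'k) = 0"
    then have "CHAR('k) dvd 2" using of_nat_eq_0_iff_char_dvd[where 'a = 'k, of 2] by simp
    then have "CHAR('k) = 1" using assms(1) dvd_imp_le[of "CHAR('k)" 2] by (cases "CHAR('k) = 0"; cases "CHAR('k) = 1") auto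
    then show False using of_nat_CHAR[where 'a = 'k] by simp
  qed
  then interpret point_modules \<alpha> \<beta> \<gamma> Mp \<sigma> using assms by unfold_locales blast+
  have "one_critical TW (row_module \<alpha> \<beta> \<gamma> (Mp p)) \<and> fat_point_module TW 2 (row_module \<alpha> \<beta> \<gamma> (Mp p))" if p: "p \<in> E" for p
  proof -
    obtain e where "fat_point \<alpha> \<beta> \<gamma> Mp \<sigma> p e" using fat_point_exists[OF p] by blast
    then interpret fat_point \<alpha> \<beta> \<gamma> Mp \<sigma> p e .
    show ?thesis using is_one_critical is_fat_point_module by blast
  qed
  then show ?thesis using irreducible_isomorphic by blast
qed

end
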